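(* Let $\mathbf{k}$ be an algebraically closed field, let $k\ge1$ and $n\geq 2k-1$, and let $\mathcal{E}=\mathcal{E}^k_{n-k}$ be the Schwarzenberger bundle on $\mathbf{P}^k$. Then $H^0(\mathbf{P}^k,\mathrm{Sym}^k(\mathcal{E}) \otimes \mathcal{O}_{\mathbf{P}^k}(-n+2k-2))$ is one-dimensional over $\mathbf{k}$.
   Context: $U$ is a $2$-dimensional $\mathbf{k}$-vector space, identified with its dual via a volume form; $\mathrm{D}^k$ is the $k$-th divided power (symmetric tensors). $\mathbf{P}^k=\mathrm{Proj}(\mathrm{Sym}(\mathrm{D}^kU))$ (points: nonzero $g\in\mathrm{Sym}^kU$ up to scaling), with tautological inclusion $\mathcal{O}_{\mathbf{P}^k}(-1)\to\mathrm{Sym}^kU\otimes\mathcal{O}_{\mathbf{P}^k}$. The Schwarzenberger bundle $\mathcal{E}=\mathcal{E}^k_{n-k}$ is the rank $k$ bundle on $\mathbf{P}^k$ defined by $$0\to\mathrm{Sym}^{n-k}U\otimes\mathcal{O}_{\mathbf{P}^k}(-1)\to\mathrm{Sym}^nU\otimes\mathcal{O}_{\mathbf{P}^k}\to\mathcal{E}\to0,$$ the first map being the tautological inclusion followed by multiplication $\mathrm{Sym}^{n-k}U\otimes\mathrm{Sym}^kU\to\mathrm{Sym}^nU$. *)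

theory Defs
  imports "HOL-Library.Poly_Mapping" "HOL-Algebra.Module" "HOL-Algebra.AbelCoset"
    "HOL-Algebra.Ideal" "HOL-Combinatorics.Permutations"
    "HOL-Computational_Algebra.Fraction_Field" "Jordan_Normal_Form.VS_Connect"
begin

section \<open>Modules: quotients, symmetric powers, tensor products\<close>

text \<open>The fields \<open>mult\<close> and \<open>one\<close> of a record of type \<open>module\<close> play no role and are left
  undefined.\<close>

definition quotient_module :: "('r, 'm) module \<Rightarrow> 'm set \<Rightarrow> ('r, 'm set) module" where
  "quotient_module M N =
     \<lparr>carrier = a_rcosets\<^bsub>M\<^esub> N, monoid.mult = undefined, one = undefined,
      zero = N, add = set_add M,
      smult = (\<lambda>r X. \<Union>x\<in>X. a_r_coset M N (r \<odot>\<^bsub>M\<^esub> x))\<rparr>"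

definition free_module :: "'r ring \<Rightarrow> 'x set \<Rightarrow> ('r, 'x \<Rightarrow> 'r) module" where
  "free_module R X =
     \<lparr>carrier = {c \<in> X \<rightarrow>\<^sub>E carrier R. finite {x \<in> X. c x \<noteq> \<zero>\<^bsub>R\<^esub>}},
      monoid.mult = undefined, one = undefined,
      zero = (\<lambda>x\<in>X. \<zero>\<^bsub>R\<^esub>), add = (\<lambda>c d. \<lambda>x\<in>X. c x \<oplus>\<^bsub>R\<^esub> d x),
      smult = (\<lambda>r c. \<lambda>x\<in>X. r \<otimes>\<^bsub>R\<^esub> c x)\<rparr>"

definition free_gen :: "'r ring \<Rightarrow> 'x set \<Rightarrow> 'x \<Rightarrow> 'x \<Rightarrow> 'r" where
  "free_gen R X x = (\<lambda>y\<in>X. if y = x then \<one>\<^bsub>R\<^esub> else \<zero>\<^bsub>R\<^esub>)"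

text \<open>The \<open>k\<close>-th symmetric power of \<open>M\<close> over \<open>R\<close> is the degree \<open>k\<close> part of the quotient of the
  tensor algebra by the ideal generated by all \<open>x \<otimes> y - y \<otimes> x\<close>. It is presented by the
  \<open>k\<close>-tuples of elements of \<open>M\<close>, subject to multilinearity and symmetry; no division by
  \<open>k!\<close> occurs, so the characteristic is arbitrary.\<close>

definition tuples :: "nat \<Rightarrow> ('r, 'm) module \<Rightarrow> (nat \<Rightarrow> 'm) set" where
  "tuples k M = {..<k} \<rightarrow>\<^sub>E carrier M"

definition sym_relations ::
  "'r ring \<Rightarrow> nat \<Rightarrow> ('r, 'm) module \<Rightarrow> ((nat \<Rightarrow> 'm) \<Rightarrow> 'r) set" where
  "sym_relations R k M =
    (let F = free_module R (tuples k M); g = free_gen R (tuples k M) in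
      {g (x(i := a \<oplus>\<^bsub>M\<^esub> b)) \<ominus>\<^bsub>F\<^esub> (g (x(i := a)) \<oplus>\<^bsub>F\<^esub> g (x(i := b))) | x i a b.
         x \<in> tuples k M \<and> i < k \<and> a \<in> carrier M \<and> b \<in> carrier M} \<union>
      {g (x(i := r \<odot>\<^bsub>M\<^esub> a)) \<ominus>\<^bsub>F\<^esub> (r \<odot>\<^bsub>F\<^esub> g (x(i := a))) | x i r a.
         x \<in> tuples k M \<and> i < k \<and> r \<in> carrier R \<and> a \<in> carrier M} \<union>
      {g (x \<circ> \<sigma>) \<ominus>\<^bsub>F\<^esub> g x | x \<sigma>. x \<in> tuples k M \<and> \<sigma> permutes {..<k}})"

definition sym_kernel ::
  "'r ring \<Rightarrow> nat \<Rightarrow> ('r, 'm) module \<Rightarrow> ((nat \<Rightarrow> 'm) \<Rightarrow> 'r) set" where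
  "sym_kernel R k M =
     LinearCombinations.module.span R (free_module R (tuples k M)) (sym_relations R k M)"

definition sym_module ::
  "'r ring \<Rightarrow> nat \<Rightarrow> ('r, 'm) module \<Rightarrow> ('r, ((nat \<Rightarrow> 'm) \<Rightarrow> 'r) set) module" where
  "sym_module R k M = quotient_module (free_module R (tuples k M)) (sym_kernel R k M)"

definition sym_prod ::
  "'r ring \<Rightarrow> nat \<Rightarrow> ('r, 'm) module \<Rightarrow> (nat \<Rightarrow> 'm) \<Rightarrow> ((nat \<Rightarrow> 'm) \<Rightarrow> 'r) set" where
  "sym_prod R k M x =
     a_r_coset (free_module R (tuples k M)) (sym_kernel R k M) (free_gen R (tuples k M) x)"

definition tensor_relations ::
  "'r ring \<Rightarrow> ('r, 'm) module \<Rightarrow> ('r, 'n) module \<Rightarrow> ('m \<times> 'n \<Rightarrow> 'r) set" where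
  "tensor_relations R M N =
    (let X = carrier M \<times> carrier N; F = free_module R X; g = free_gen R X in
      {g (a \<oplus>\<^bsub>M\<^esub> a', b) \<ominus>\<^bsub>F\<^esub> (g (a, b) \<oplus>\<^bsub>F\<^esub> g (a', b)) | a a' b.
         a \<in> carrier M \<and> a' \<in> carrier M \<and> b \<in> carrier N} \<union>
      {g (a, b \<oplus>\<^bsub>N\<^esub> b') \<ominus>\<^bsub>F\<^esub> (g (a, b) \<oplus>\<^bsub>F\<^esub> g (a, b')) | a b b'.
         a \<in> carrier M \<and> b \<in> carrier N \<and> b' \<in> carrier N} \<union>
      {g (r \<odot>\<^bsub>M\<^esub> a, b) \<ominus>\<^bsub>F\<^esub> (r \<odot>\<^bsub>F\<^esub> g (a, b)) | r a b.
         r \<in> carrier R \<and> a \<in> carrier M \<and> b \<in> carrier N} \<union>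
      {g (a, r \<odot>\<^bsub>N\<^esub> b) \<ominus>\<^bsub>F\<^esub> (r \<odot>\<^bsub>F\<^esub> g (a, b)) | r a b.
         r \<in> carrier R \<and> a \<in> carrier M \<and> b \<in> carrier N})"

definition tensor_kernel ::
  "'r ring \<Rightarrow> ('r, 'm) module \<Rightarrow> ('r, 'n) module \<Rightarrow> ('m \<times> 'n \<Rightarrow> 'r) set" where
  "tensor_kernel R M N =
     LinearCombinations.module.span R (free_module R (carrier M \<times> carrier N))
       (tensor_relations R M N)"

definition tensor_module ::
  "'r ring \<Rightarrow> ('r, 'm) module \<Rightarrow> ('r, 'n) module \<Rightarrow> ('r, ('m \<times> 'n \<Rightarrow> 'r) set) module" where
  "tensor_module R M N =
     quotient_module (free_module R (carrier M \<times> carrier N)) (tensor_kernel R M N)"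

definition tensor_prod ::
  "'r ring \<Rightarrow> ('r, 'm) module \<Rightarrow> ('r, 'n) module \<Rightarrow> 'm \<Rightarrow> 'n \<Rightarrow> ('m \<times> 'n \<Rightarrow> 'r) set" where
  "tensor_prod R M N a b =
     a_r_coset (free_module R (carrier M \<times> carrier N)) (tensor_kernel R M N)
       (free_gen R (carrier M \<times> carrier N) (a, b))"


section \<open>Sheaves of modules\<close>

text \<open>Sheaves are given by their stalks together with, for every open set \<open>V\<close>, the sections over
  \<open>V\<close>. A section is identified with the function sending a point of \<open>V\<close> to its germ there
  (extended by \<open>undefined\<close> outside \<open>V\<close>); restriction of sections is restriction of functions.\<close>

record ('p, 'r) ringed_space =
  opens :: "'p set set"
  ring_stalk :: "'p \<Rightarrow> 'r ring"
  ring_sections :: "'p set \<Rightarrow> ('p \<Rightarrow> 'r) set"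

record ('p, 'r, 'm) module_sheaf =
  stalk :: "'p \<Rightarrow> ('r, 'm) module"
  sections :: "'p set \<Rightarrow> ('p \<Rightarrow> 'm) set"

text \<open>Sheafification: given the stalks of a presheaf and, for every open \<open>W\<close>, the set \<open>pre W\<close> of
  functions \<open>q \<mapsto> t\<^sub>q\<close> arising from the sections \<open>t\<close> of the presheaf over \<open>W\<close>, a section of the
  associated sheaf is a family of germs that locally comes from the presheaf.\<close>

definition sheafify ::
  "'p set set \<Rightarrow> ('p \<Rightarrow> ('r, 'm) module) \<Rightarrow> ('p set \<Rightarrow> ('p \<Rightarrow> 'm) set) \<Rightarrow>
     ('p, 'r, 'm) module_sheaf" where
  "sheafify Op st pre =
     \<lparr>stalk = st,
      sections = (\<lambda>V. {s \<in> (\<Pi>\<^sub>E p\<in>V. carrier (st p)).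
        \<forall>p\<in>V. \<exists>W\<in>Op. p \<in> W \<and> W \<subseteq> V \<and> (\<exists>t\<in>pre W. \<forall>q\<in>W. s q = t q)})\<rparr>"

text \<open>Cokernel of a morphism \<open>G \<rightarrow> F\<close> given by its maps \<open>\<phi> p\<close> on stalks; the stalks of the
  cokernel are the cokernels of these maps.\<close>

definition cokernel_sheaf ::
  "'p set set \<Rightarrow> ('p, 'r, 'l) module_sheaf \<Rightarrow> ('p, 'r, 'm) module_sheaf \<Rightarrow> ('p \<Rightarrow> 'l \<Rightarrow> 'm) \<Rightarrow>
     ('p, 'r, 'm set) module_sheaf" where
  "cokernel_sheaf Op G F \<phi> =
     (let im = (\<lambda>p. \<phi> p ` carrier (stalk G p)) in
      sheafify Op (\<lambda>p. quotient_module (stalk F p) (im p))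
        (\<lambda>W. {(\<lambda>q. a_r_coset (stalk F q) (im q) (t q)) | t. t \<in> sections F W}))"

text \<open>The next two are the sheaves associated to \<open>W \<mapsto> Sym\<^sup>k (F W)\<close> and \<open>W \<mapsto> F W \<otimes> G W\<close>, taken
  over the ring of sections over \<open>W\<close>; forming \<open>Sym\<^sup>k\<close> and \<open>\<otimes>\<close> commutes with passing to stalks.\<close>

definition sym_sheaf ::
  "('p, 'r) ringed_space \<Rightarrow> nat \<Rightarrow> ('p, 'r, 'm) module_sheaf \<Rightarrow>
     ('p, 'r, ((nat \<Rightarrow> 'm) \<Rightarrow> 'r) set) module_sheaf" where
  "sym_sheaf X k F =
     (let st = (\<lambda>p. sym_module (ring_stalk X p) k (stalk F p)) in
      sheafify (opens X) st
        (\<lambda>W. {(\<lambda>q. \<Oplus>\<^bsub>st q\<^esub>j\<in>{..<N}. r j q \<odot>\<^bsub>st q\<^esub>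
                   sym_prod (ring_stalk X q) k (stalk F q) (\<lambda>i\<in>{..<k}. e j i q)) | (N::nat) r e.
              \<forall>j<N. r j \<in> ring_sections X W \<and> (\<forall>i<k. e j i \<in> sections F W)}))"

definition tensor_sheaf ::
  "('p, 'r) ringed_space \<Rightarrow> ('p, 'r, 'm) module_sheaf \<Rightarrow> ('p, 'r, 'n) module_sheaf \<Rightarrow>
     ('p, 'r, ('m \<times> 'n \<Rightarrow> 'r) set) module_sheaf" where
  "tensor_sheaf X F G =
     (let st = (\<lambda>p. tensor_module (ring_stalk X p) (stalk F p) (stalk G p)) in
      sheafify (opens X) st
        (\<lambda>W. {(\<lambda>q. \<Oplus>\<^bsub>st q\<^esub>j\<in>{..<N}.
                   tensor_prod (ring_stalk X q) (stalk F q) (stalk G q) (e j q) (l j q)) | (N::nat) e l.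
              \<forall>j<N. e j \<in> sections F W \<and> l j \<in> sections G W}))"

text \<open>Global sections as a module over a base ring mapping by \<open>\<iota>\<close> to all the local rings.\<close>

definition H0 ::
  "('p, 'r) ringed_space \<Rightarrow> ('a \<Rightarrow> 'r) \<Rightarrow> ('p, 'r, 'm) module_sheaf \<Rightarrow> ('a, 'p \<Rightarrow> 'm) module" where
  "H0 X \<iota> F =
     (let P = \<Union>(opens X) in
      \<lparr>carrier = sections F P, monoid.mult = undefined, one = undefined,
       zero = (\<lambda>p\<in>P. \<zero>\<^bsub>stalk F p\<^esub>), add = (\<lambda>s t. \<lambda>p\<in>P. s p \<oplus>\<^bsub>stalk F p\<^esub> t p),
       smult = (\<lambda>c s. \<lambda>p\<in>P. \<iota> c \<odot>\<^bsub>stalk F p\<^esub> s p)\<rparr>)"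


section \<open>Projective space as Proj of a polynomial ring\<close>

text \<open>\<open>mpoly_ring k\<close> is the ring of polynomials in \<open>z\<^sub>0, \<dots>, z\<^sub>k\<close>.
  For \<open>U\<close> with basis \<open>x, y\<close> it is \<open>Sym(D\<^sup>k U)\<close>, where \<open>D\<^sup>k U\<close> is the dual of \<open>Sym\<^sup>k U\<close>
  and \<open>z\<^sub>j\<close> is the coordinate of \<open>x\<^sup>k\<^sup>-\<^sup>j y\<^sup>j\<close>.\<close>

type_synonym 'a mpoly = "(nat \<Rightarrow>\<^sub>0 nat) \<Rightarrow>\<^sub>0 'a"

definition mpoly_carrier :: "nat \<Rightarrow> 'a::field mpoly set" where
  "mpoly_carrier k = {f. \<forall>m \<in> Poly_Mapping.keys f. Poly_Mapping.keys m \<subseteq> {..k}}"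

definition mpoly_ring :: "nat \<Rightarrow> 'a::field mpoly ring" where
  "mpoly_ring k =
     \<lparr>carrier = mpoly_carrier k, monoid.mult = (*), one = 1, zero = 0, add = (+)\<rparr>"

definition mvar :: "nat \<Rightarrow> 'a::field mpoly" where
  "mvar i = Poly_Mapping.single (Poly_Mapping.single i 1) 1"

definition homogeneous :: "nat \<Rightarrow> nat \<Rightarrow> 'a::field mpoly set" where
  "homogeneous k d = {f \<in> mpoly_carrier k. \<forall>m \<in> Poly_Mapping.keys f.
     (\<Sum>i\<in>Poly_Mapping.keys m. Poly_Mapping.lookup m i) = d}"

definition proj_points :: "nat \<Rightarrow> 'a::field mpoly set set" where
  "proj_points k =
     {p. primeideal p (mpoly_ring k) \<and>
         p = genideal (mpoly_ring k) (p \<inter> (\<Union>d. homogeneous k d)) \<and>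
         \<not> mvar ` {..k} \<subseteq> p}"

definition proj_opens :: "nat \<Rightarrow> 'a::field mpoly set set set" where
  "proj_opens k = {{p \<in> proj_points k. \<not> T \<subseteq> p} | T. T \<subseteq> (\<Union>d. homogeneous k d)}"

text \<open>The stalk at \<open>p\<close> of \<open>\<O>(d)\<close>: fractions of degree \<open>d\<close> with homogeneous denominator
  outside \<open>p\<close>.\<close>

definition twist_stalk :: "nat \<Rightarrow> int \<Rightarrow> 'a::field mpoly set \<Rightarrow> 'a mpoly fract set" where
  "twist_stalk k d p =
     {Fract a f | a f e e'. f \<in> homogeneous k e \<and> f \<notin> p \<and> a \<in> homogeneous k e' \<and>
        int e' = int e + d}"

definition twist ::
  "nat \<Rightarrow> int \<Rightarrow> ('a::field mpoly set, 'a mpoly fract, 'a mpoly fract) module_sheaf" where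
  "twist k d =
     sheafify (proj_opens k)
       (\<lambda>p. \<lparr>carrier = twist_stalk k d p, monoid.mult = undefined, one = undefined,
             zero = 0, add = (+), smult = (*)\<rparr>)
       (\<lambda>W. {(\<lambda>q. Fract a f) | a f e e'. f \<in> homogeneous k e \<and> (\<forall>q\<in>W. f \<notin> q) \<and>
               a \<in> homogeneous k e' \<and> int e' = int e + d})"

definition proj_space :: "nat \<Rightarrow> ('a::field mpoly set, 'a mpoly fract) ringed_space" where
  "proj_space k =
     \<lparr>opens = proj_opens k,
      ring_stalk = (\<lambda>p. \<lparr>carrier = twist_stalk k 0 p, monoid.mult = (*), one = 1,
                          zero = 0, add = (+)\<rparr>),
      ring_sections = sections (twist k 0)\<rparr>"

definition const_fract :: "'a::field \<Rightarrow> 'a mpoly fract" where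
  "const_fract c = Fract (Poly_Mapping.single 0 c) 1"


section \<open>Schwarzenberger bundles\<close>

text \<open>\<open>Sym\<^sup>m U \<otimes> \<O>(d)\<close>: the binary form with coefficient \<open>c\<^sub>i\<close> at \<open>x\<^sup>m\<^sup>-\<^sup>i y\<^sup>i\<close> is encoded by the
  univariate polynomial with coefficients \<open>c\<^sub>i\<close>, of degree at most \<open>m\<close>. Multiplication of binary
  forms is then multiplication of polynomials.\<close>

definition form_sheaf ::
  "nat \<Rightarrow> nat \<Rightarrow> int \<Rightarrow> ('a::field mpoly set, 'a mpoly fract, 'a mpoly fract poly) module_sheaf"
  where
  "form_sheaf k m d =
     (let st = (\<lambda>p. \<lparr>carrier = {P. degree P \<le> m \<and> (\<forall>i. coeff P i \<in> twist_stalk k d p)},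
                     monoid.mult = undefined, one = undefined,
                     zero = 0, add = (+), smult = Polynomial.smult\<rparr>) in
      \<lparr>stalk = st,
       sections = (\<lambda>V. {s \<in> (\<Pi>\<^sub>E p\<in>V. carrier (st p)).
         \<forall>i. (\<lambda>p\<in>V. coeff (s p) i) \<in> sections (twist k d) V})\<rparr>)"

text \<open>The tautological form \<open>\<Sum>\<^sub>j z\<^sub>j x\<^sup>k\<^sup>-\<^sup>j y\<^sup>j\<close>; multiplication by it is the tautological
  inclusion followed by the multiplication of forms.\<close>

definition tautological_form :: "nat \<Rightarrow> 'a::field mpoly fract poly" where
  "tautological_form k = (\<Sum>j\<le>k. monom (Fract (mvar j) 1) j)"

text \<open>The bundle \<open>\<E>\<^sup>k\<^sub>m\<close>, the cokernel of \<open>Sym\<^sup>m U \<otimes> \<O>(-1) \<rightarrow> Sym\<^sup>m\<^sup>+\<^sup>k U \<otimes> \<O>\<close>.\<close>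

definition schwarzenberger ::
  "nat \<Rightarrow> nat \<Rightarrow> ('a::field mpoly set, 'a mpoly fract, 'a mpoly fract poly set) module_sheaf" where
  "schwarzenberger k m =
     cokernel_sheaf (proj_opens k) (form_sheaf k m (-1)) (form_sheaf k (m + k) 0)
       (\<lambda>p P. tautological_form k * P)"

end

theory Submission
  imports Defs "Jordan_Normal_Form.Determinant"
begin

text \<open>Put \<open>N = n - 2k + 2\<close>. A global section is read as a function \<open>\<Phi>(g, \<phi>)\<close> of a form \<open>g\<close> of degree
  \<open>k\<close> and a functional \<open>\<phi>\<close> on \<open>Sym\<^sup>n U\<close> that annihilates the multiples of \<open>g\<close>; it has degree \<open>-N\<close>
  in \<open>g\<close> and \<open>k\<close> in \<open>\<phi>\<close>. If \<open>g\<close> has distinct roots \<open>t\<^sub>l\<close>, then \<open>\<phi>\<close> is a combination of the evaluations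
  at the \<open>t\<^sub>l\<close>, with weights \<open>c\<^sub>l\<close>. When \<open>c\<^sub>l = 0\<close>, the root \<open>t\<^sub>l\<close> can move over all of \<open>\<P>\<^sup>1\<close> with \<open>\<phi>\<close>
  fixed, and \<open>-N < 0\<close> forces \<open>\<Phi> = 0\<close>; hence \<open>\<Phi> = c\<^sub>0 \<dots> c\<^sub>k\<^sub>-\<^sub>1 f(t)\<close>. In each single root, \<open>f\<close> is a
  polynomial of degree at most \<open>2k - 2\<close> with a double zero at each of the other \<open>k - 1\<close> roots, so a
  section that vanishes at one such \<open>t\<close> is zero. A nonzero section is the Hankel determinant with
  entries \<open>\<phi>((x - \<alpha>)\<^sup>N x\<^sup>i\<^sup>+\<^sup>j)\<close>, \<open>i, j < k\<close>, divided by \<open>g(\<alpha>)\<^sup>N\<close>; up to sign its value is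
  \<open>\<Prod>c\<^sub>l \<Prod>(t\<^sub>i - t\<^sub>j)\<^sup>2\<close>, independent of \<open>\<alpha>\<close>.\<close>

text \<open>The obstacle is that a section is a family of germs at all homogeneous primes, whereas
  \<Phi> lives at closed points and is understood only at forms with distinct roots. The bridge is a
  frame with constant coefficients: where the form does not vanish at \<alpha>, the classes of
  \<open>(x - \<alpha>)^(n-k+1) x^i\<close> with i < k generate the bundle, so a section is locally
  a combination of words of length k in k letters. This shape shows both degrees of \<Phi> and its
  regularity along curves, and a nonzero coefficient can be detected at some form with distinct
  roots. The characteristic being arbitrary, words are kept as they are; their coefficients are not
  unique, and only the sums over words with the same letters matter.

  The bound 2k - 2 is n - N: when a root goes to infinity, its weight contributes degree n and the
  scaling of the form takes N away. The double zeros exhaust this bound exactly, so one more zero is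
  decisive. The same identity N + (2k - 2) = n makes the Hankel entries fit into degree n.\<close>

section \<open>Polynomials over an infinite field\<close>

lemma infinite_UNIV_alg_closed: "infinite (UNIV :: 'a::alg_closed_field set)"
proof
  assume fin: "finite (UNIV :: 'a set)"
  \<comment> \<open>Euclid's argument: over a finite field this polynomial takes the value 1
    everywhere, yet its degree is positive.\<close>
  let ?p = "(\<Prod>a\<in>(UNIV::'a set). [:- a, 1:]) + 1"
  have nz: "(\<Prod>a\<in>(UNIV::'a set). [:- a, 1:]) \<noteq> 0"
    using fin by (auto simp: prod_zero_iff)
  have "degree (\<Prod>a\<in>(UNIV::'a set). [:- a, 1:]) = card (UNIV :: 'a set)"
    using fin by (subst degree_prod_eq_sum_degree) auto
  moreover have "card (UNIV :: 'a set) > 0" using fin by (simp add: card_gt_0_iff)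
  ultimately have "degree ?p > 0" by (subst degree_add_eq_left) auto
  then obtain x where "poly ?p x = 0" using alg_closed_imp_poly_has_root by blast
  moreover have "poly (\<Prod>a\<in>(UNIV::'a set). [:- a, 1:]) x = 0"
    using fin by (auto simp: poly_prod)
  ultimately show False by simp
qed

text \<open>The device for clearing denominators: an identity derived away from finitely many
  parameters, where the derivation would divide by zero, extends across them.\<close>

lemma poly_eqI_cofinite:
  fixes p q :: "'a::alg_closed_field poly"
  assumes "finite A" "\<And>x. x \<notin> A \<Longrightarrow> poly p x = poly q x"
  shows "p = q"
proof (rule ccontr)
  assume "p \<noteq> q"
  then have "finite {x. poly (p - q) x = 0}" by (intro poly_roots_finite) auto
  moreover have "UNIV - A \<subseteq> {x. poly (p - q) x = 0}" using assms(2) by auto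
  ultimately have "finite (UNIV - A)" by (rule rev_finite_subset)
  then show False using assms(1) infinite_UNIV_alg_closed[where 'a='a] by simp
qed

section \<open>Evaluation of polynomials\<close>

text \<open>The values lie in any commutative monoid, not only in the field:
  \<open>meval_curve\<close> substitutes polynomials in one variable.\<close>

definition mon_val :: "(nat \<Rightarrow> 'a::comm_monoid_mult) \<Rightarrow> (nat \<Rightarrow>\<^sub>0 nat) \<Rightarrow> 'a" where
  "mon_val g m = (\<Prod>i\<in>Poly_Mapping.keys m. g i ^ Poly_Mapping.lookup m i)"

definition meval :: "(nat \<Rightarrow> 'a::field) \<Rightarrow> 'a mpoly \<Rightarrow> 'a" where
  "meval g f = (\<Sum>m\<in>Poly_Mapping.keys f. Poly_Mapping.lookup f m * mon_val g m)"

lemma mon_val_superset: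
  assumes "finite A" "Poly_Mapping.keys m \<subseteq> A"
  shows "mon_val g m = (\<Prod>i\<in>A. g i ^ Poly_Mapping.lookup m i)"
  unfolding mon_val_def using assms
  by (intro prod.mono_neutral_left) (auto simp: in_keys_iff)

lemma mon_val_add: "mon_val g (m + m') = mon_val g m * mon_val g m'"
proof -
  let ?A = "Poly_Mapping.keys m \<union> Poly_Mapping.keys m'"
  have "Poly_Mapping.keys (m + m') \<subseteq> ?A" by (rule Poly_Mapping.keys_add)
  then show ?thesis
    by (simp add: mon_val_superset[of ?A] lookup_add power_add prod.distrib)
qed

lemma mon_val_zero [simp]: "mon_val g 0 = 1"
  by (simp add: mon_val_def)

lemma mon_val_single [simp]: "mon_val g (Poly_Mapping.single i e) = g i ^ e"
  by (cases "e = 0") (auto simp: mon_val_def)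

lemma mon_val_sum: "mon_val g (\<Sum>x\<in>A. f x) = (\<Prod>x\<in>A. mon_val g (f x))"
  by (induction A rule: infinite_finite_induct) (auto simp: mon_val_add)

lemma meval_superset:
  assumes "finite A" "Poly_Mapping.keys f \<subseteq> A"
  shows "meval g f = (\<Sum>m\<in>A. Poly_Mapping.lookup f m * mon_val g m)"
  unfolding meval_def using assms
  by (intro sum.mono_neutral_left) (auto simp: in_keys_iff)

lemma meval_zero [simp]: "meval g 0 = 0"
  by (simp add: meval_def)

lemma meval_single [simp]: "meval g (Poly_Mapping.single m c) = c * mon_val g m"
  by (cases "c = 0") (auto simp: meval_def)

lemma meval_one [simp]: "meval g 1 = 1"
  using meval_single[of g 0 1] by simp

lemma meval_mvar [simp]: "meval g (mvar i) = g i"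
  by (simp add: mvar_def)

lemma meval_add: "meval g (f + h) = meval g f + meval g h"
proof -
  let ?A = "Poly_Mapping.keys f \<union> Poly_Mapping.keys h"
  have "Poly_Mapping.keys (f + h) \<subseteq> ?A" by (rule Poly_Mapping.keys_add)
  then show ?thesis
    by (simp add: meval_superset[of ?A] lookup_add distrib_right sum.distrib)
qed

lemma meval_sum: "meval g (\<Sum>x\<in>A. f x) = (\<Sum>x\<in>A. meval g (f x))"
  by (induction A rule: infinite_finite_induct) (auto simp: meval_add)

lemma mpoly_sum_single:
  "f = (\<Sum>m\<in>Poly_Mapping.keys f. Poly_Mapping.single m (Poly_Mapping.lookup f m))"
proof (rule poly_mapping_eqI)
  fix m
  show "Poly_Mapping.lookup f m = Poly_Mapping.lookup
    (\<Sum>m\<in>Poly_Mapping.keys f. Poly_Mapping.single m (Poly_Mapping.lookup f m)) m"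
    by (simp add: lookup_sum lookup_single when_def sum.delta' in_keys_iff)
qed

lemma meval_mult: "meval g (f * h) = meval g f * meval g h"
proof -
  let ?s = "\<lambda>f m. Poly_Mapping.single m (Poly_Mapping.lookup f m)"
  have "f * h = (\<Sum>m\<in>Poly_Mapping.keys f. ?s f m) * (\<Sum>m\<in>Poly_Mapping.keys h. ?s h m)"
    by (simp flip: mpoly_sum_single)
  also have "\<dots> = (\<Sum>m\<in>Poly_Mapping.keys f. \<Sum>m'\<in>Poly_Mapping.keys h. ?s f m * ?s h m')"
    by (rule sum_product)
  finally show ?thesis
    unfolding meval_def[of g f] meval_def[of g h]
    by (simp add: meval_sum sum_product mult_single mon_val_add mult_ac)
qed

lemma meval_power: "meval g (f ^ n) = meval g f ^ n"
  by (induction n) (auto simp: meval_mult)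

lemma meval_uminus: "meval g (- f) = - meval g f"
  using meval_add[of g f "- f"] by (simp add: eq_neg_iff_add_eq_0 add.commute)

text \<open>Reduction modulo \<open>B\<close> reads off the lowest digit, and the quotient has the
  remaining ones. This separates the exponents produced by the substitution below.\<close>

lemma digits_unique:
  fixes a b :: "nat \<Rightarrow> nat"
  assumes "\<And>i. i < M \<Longrightarrow> a i < B" "\<And>i. i < M \<Longrightarrow> b i < B"
    and "(\<Sum>i<M. a i * B ^ i) = (\<Sum>i<M. b i * B ^ i)" and "i < M"
  shows "a i = b i"
  using assms
proof (induction M arbitrary: a b i)
  case (Suc M)
  have shift: "(\<Sum>i<Suc M. c i * B ^ i) = c 0 + B * (\<Sum>i<M. c (Suc i) * B ^ i)" for c :: "nat \<Rightarrow> nat"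
    by (subst sum.lessThan_Suc_shift) (simp add: sum_distrib_left mult_ac)
  have eq: "a 0 + B * (\<Sum>i<M. a (Suc i) * B ^ i) = b 0 + B * (\<Sum>i<M. b (Suc i) * B ^ i)"
    using Suc.prems(3) unfolding shift .
  have lt: "a 0 < B" "b 0 < B" using Suc.prems by auto
  have "a 0 = (a 0 + B * (\<Sum>i<M. a (Suc i) * B ^ i)) mod B" using lt by simp
  also have "\<dots> = b 0" unfolding eq using lt by simp
  finally have a0: "a 0 = b 0" .
  have "(\<Sum>i<M. a (Suc i) * B ^ i) = (\<Sum>i<M. b (Suc i) * B ^ i)" using eq lt a0 by simp
  then have "j < M \<Longrightarrow> a (Suc j) = b (Suc j)" for j
    using Suc.IH[of "\<lambda>i. a (Suc i)" "\<lambda>i. b (Suc i)" j] Suc.prems(1,2) by simp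
  then show ?case using a0 Suc.prems(4) by (cases i) auto
qed simp

text \<open>Kronecker substitution \<open>z\<^sub>i \<mapsto> T\<^bsup>B^i\<^esup>\<close> with \<open>B\<close> above all exponents separates monomials.\<close>

lemma meval_eq_0_imp_eq_0:
  fixes f :: "'a::alg_closed_field mpoly"
  assumes "\<And>g. meval g f = 0"
  shows "f = 0"
proof -
  have fin: "finite (\<Union>m\<in>Poly_Mapping.keys f. Poly_Mapping.keys m)" by simp
  then obtain M where M: "(\<Union>m\<in>Poly_Mapping.keys f. Poly_Mapping.keys m) \<subseteq> {..<M}"
    by (metis finite_nat_iff_bounded)
  have "finite (\<Union>m\<in>Poly_Mapping.keys f. Poly_Mapping.lookup m ` {..<M})" by simp
  then obtain B where B: "(\<Union>m\<in>Poly_Mapping.keys f. Poly_Mapping.lookup m ` {..<M}) \<subseteq> {..<B}"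
    by (metis finite_nat_iff_bounded)
  \<comment> \<open>The power of T that the monomial becomes; \<open>M\<close> exceeds all variables
    and \<open>B\<close> all exponents that occur in \<open>f\<close>.\<close>
  define w where "w m = (\<Sum>i<M. Poly_Mapping.lookup m i * B ^ i)" for m :: "nat \<Rightarrow>\<^sub>0 nat"
  have inj: "m = m'" if "m \<in> Poly_Mapping.keys f" "m' \<in> Poly_Mapping.keys f" "w m = w m'" for m m'
  proof (rule poly_mapping_eqI)
    fix i
    show "Poly_Mapping.lookup m i = Poly_Mapping.lookup m' i"
    proof (cases "i < M")
      case True
      show ?thesis
        using that B True unfolding w_def
        by (intro digits_unique[of M "Poly_Mapping.lookup m" B "Poly_Mapping.lookup m'" i]) auto
    next
      case False
      then have "i \<notin> Poly_Mapping.keys m" "i \<notin> Poly_Mapping.keys m'" using M that by auto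
      then show ?thesis by (simp add: in_keys_iff)
    qed
  qed
  define P where "P = (\<Sum>m\<in>Poly_Mapping.keys f. monom (Poly_Mapping.lookup f m) (w m))"
  have "poly P T = 0" for T
  proof -
    have "mon_val (\<lambda>i. T ^ (B ^ i)) m = T ^ w m" if "m \<in> Poly_Mapping.keys f" for m
    proof -
      have "mon_val (\<lambda>i. T ^ (B ^ i)) m = (\<Prod>i<M. (T ^ (B ^ i)) ^ Poly_Mapping.lookup m i)"
        using M that by (intro mon_val_superset) auto
      also have "\<dots> = T ^ w m" by (simp add: w_def power_sum mult.commute flip: power_mult)
      finally show ?thesis .
    qed
    then have "poly P T = meval (\<lambda>i. T ^ (B ^ i)) f"
      by (simp add: P_def poly_sum poly_monom meval_def)
    then show ?thesis using assms by simp
  qed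
  then have P0: "P = 0" using poly_eqI_cofinite[of "{}" P 0] by simp
  show ?thesis
  proof (rule ccontr)
    assume "f \<noteq> 0"
    then obtain m where m: "m \<in> Poly_Mapping.keys f" by fastforce
    have "coeff P (w m) = (\<Sum>m'\<in>Poly_Mapping.keys f. if m' = m then Poly_Mapping.lookup f m' else 0)"
      unfolding P_def coeff_sum using inj m by (intro sum.cong) auto
    also have "\<dots> = Poly_Mapping.lookup f m" using m by simp
    finally show False using P0 m by (simp add: in_keys_iff)
  qed
qed

lemma meval_cong:
  assumes "f \<in> mpoly_carrier k" "\<And>i. i \<le> k \<Longrightarrow> g i = g' i"
  shows "meval g f = meval g' f"
  unfolding meval_def mon_val_def
proof (intro sum.cong refl arg_cong2[where f="(*)"] prod.cong)
  fix m i assume "m \<in> Poly_Mapping.keys f" "i \<in> Poly_Mapping.keys m"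
  then have "i \<le> k" using assms(1) by (auto simp: mpoly_carrier_def)
  then show "g i ^ Poly_Mapping.lookup m i = g' i ^ Poly_Mapping.lookup m i" using assms(2) by simp
qed

lemma meval_homogeneous:
  assumes "f \<in> homogeneous k e"
  shows "meval (\<lambda>i. c * g i) f = c ^ e * meval g f"
proof -
  have "mon_val (\<lambda>i. c * g i) m = c ^ e * mon_val g m" if "m \<in> Poly_Mapping.keys f" for m
    using that assms by (simp add: mon_val_def power_mult_distrib prod.distrib homogeneous_def flip: power_sum)
  then show ?thesis unfolding meval_def sum_distrib_left by (intro sum.cong) auto
qed

text \<open>Restriction to a parametrised curve is again \<open>mon_val\<close>, now with
  polynomials as values. The curves used below let one root of a form move.\<close>

lemma meval_curve:
  fixes G :: "nat \<Rightarrow> 'a::field poly"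
  shows "\<exists>r. \<forall>T. poly r T = meval (\<lambda>j. poly (G j) T) f"
  by (rule exI[of _ "\<Sum>m\<in>Poly_Mapping.keys f. Polynomial.smult (Poly_Mapping.lookup f m) (mon_val G m)"])
    (simp add: meval_def mon_val_def poly_sum poly_prod)

section \<open>Functions of a binary form and an apolar functional\<close>

text \<open>With \<open>\<phi> m\<close> the value on the monomial of index \<open>m\<close>, the
  sum is the value of \<phi> on the product of \<open>g\<close> and the monomial of index
  \<open>r\<close>. So \<phi> kills the multiples of \<open>g\<close> in degree \<open>n\<close>,
  which makes it a functional on the fibre of the bundle at \<open>g\<close>.\<close>

definition apolar :: "nat \<Rightarrow> nat \<Rightarrow> (nat \<Rightarrow> 'a::field) \<Rightarrow> (nat \<Rightarrow> 'a) \<Rightarrow> bool" where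
  "apolar k n g \<phi> \<longleftrightarrow> (\<forall>r\<le>n - k. (\<Sum>j\<le>k. g j * \<phi> (r + j)) = 0)"

definition nonzero_form :: "nat \<Rightarrow> (nat \<Rightarrow> 'a::zero) \<Rightarrow> bool" where
  "nonzero_form k g \<longleftrightarrow> (\<exists>j\<le>k. g j \<noteq> 0)"

definition root_form :: "nat \<Rightarrow> (nat \<Rightarrow> 'a::field) \<Rightarrow> nat \<Rightarrow> 'a" where
  "root_form k t = coeff (\<Prod>i<k. [:- t i, 1:])"

definition root_functional :: "nat \<Rightarrow> (nat \<Rightarrow> 'a::field) \<Rightarrow> (nat \<Rightarrow> 'a) \<Rightarrow> nat \<Rightarrow> 'a" where
  "root_functional k t c = (\<lambda>m. \<Sum>l<k. c l * t l ^ m)"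

lemma poly_bounded_sum:
  fixes p :: "'a::comm_semiring_1 poly"
  assumes "degree p \<le> k"
  shows "poly p x = (\<Sum>j\<le>k. coeff p j * x ^ j)"
  unfolding poly_altdef using assms
  by (intro sum.mono_neutral_left) (auto simp: coeff_eq_0)

lemma nonzero_form_coeff:
  assumes "degree p \<le> k" "p \<noteq> 0"
  shows "nonzero_form k (coeff p)"
  unfolding nonzero_form_def using assms by (intro exI[of _ "degree p"]) simp

text \<open>Evaluation at a root of \<open>p\<close> kills each multiple of \<open>p\<close>. The
  nodes may omit some of the roots, so a functional that gives one root no weight is covered
  too.\<close>

lemma apolar_sum_powers:
  fixes p :: "'a::field poly"
  assumes "degree p \<le> k" "\<And>l. l \<in> A \<Longrightarrow> poly p (x l) = 0"
  shows "apolar k n (coeff p) (\<lambda>m. \<Sum>l\<in>A. c l * x l ^ m)"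
  unfolding apolar_def
proof (intro allI impI)
  fix r
  have "(\<Sum>j\<le>k. coeff p j * (\<Sum>l\<in>A. c l * x l ^ (r + j)))
      = (\<Sum>l\<in>A. \<Sum>j\<le>k. coeff p j * (c l * x l ^ (r + j)))"
    by (simp add: sum_distrib_left sum.swap[of _ A])
  also have "\<dots> = (\<Sum>l\<in>A. c l * x l ^ r * poly p (x l))"
    by (simp add: poly_bounded_sum[OF assms(1)] sum_distrib_left power_add mult_ac)
  also have "\<dots> = 0" using assms(2) by simp
  finally show "(\<Sum>j\<le>k. coeff p j * (\<Sum>l\<in>A. c l * x l ^ (r + j))) = 0" .
qed

text \<open>Apolarity is a system of equations polynomial in the parameter. Weights that have a pole
  at an exceptional parameter can therefore be treated away from it.\<close>

lemma apolar_curve_closed: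
  fixes G P :: "nat \<Rightarrow> 'a::alg_closed_field poly"
  assumes "finite A" "\<And>T. T \<notin> A \<Longrightarrow> apolar k n (\<lambda>j. poly (G j) T) (\<lambda>m. poly (P m) T)"
  shows "apolar k n (\<lambda>j. poly (G j) T) (\<lambda>m. poly (P m) T)"
  unfolding apolar_def
proof (intro allI impI)
  fix r assume r: "r \<le> n - k"
  have "(\<Sum>j\<le>k. G j * P (r + j)) = 0"
    using assms r by (intro poly_eqI_cofinite[of A]) (auto simp: poly_sum apolar_def)
  then have "poly (\<Sum>j\<le>k. G j * P (r + j)) T = 0" by simp
  then show "(\<Sum>j\<le>k. poly (G j) T * poly (P (r + j)) T) = 0" by (simp add: poly_sum)
qed

section \<open>Polynomials near infinity and moving roots\<close>

text \<open>In the coordinate at infinity \<open>p\<close> has a pole of order at most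
  \<open>e\<close>. Were the degree larger, the reversed polynomial would be divisible by T, but its
  constant term is the leading coefficient of \<open>p\<close>.\<close>

lemma poly_degree_from_infinity:
  fixes p q :: "'a::alg_closed_field poly"
  assumes "\<And>T. T \<noteq> 0 \<Longrightarrow> poly p (1 / T) * T ^ e = poly q T"
  shows "degree p \<le> e"
proof (rule ccontr)
  assume *: "\<not> degree p \<le> e"
  have "reflect_poly p = monom 1 (degree p - e) * q"
  proof (rule poly_eqI_cofinite[of "{0}"])
    fix T :: 'a assume "T \<notin> {0}"
    then have T: "T \<noteq> 0" by simp
    have "poly (reflect_poly p) T = T ^ (degree p - e) * (poly p (1 / T) * T ^ e)"
      using T * by (simp add: poly_reflect_poly_nz inverse_eq_divide flip: power_add)
    then show "poly (reflect_poly p) T = poly (monom 1 (degree p - e) * q) T"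
      using assms[OF T] by (simp add: poly_monom)
  qed simp
  then have "coeff (reflect_poly p) 0 = 0" using * by (simp add: coeff_mult)
  then show False using * by auto
qed

text \<open>A function regular on the affine line with a zero at infinity: the line bundle of degree
  \<open>- N\<close> on the projective line has no nonzero section.\<close>

lemma poly_zero_from_infinity:
  fixes p q :: "'a::alg_closed_field poly"
  assumes "\<And>T. T \<noteq> 0 \<Longrightarrow> poly p (1 / T) = poly q T * T ^ N" "N \<ge> 1"
  shows "p = 0"
proof -
  have "reflect_poly p = monom 1 (degree p + N) * q"
  proof (rule poly_eqI_cofinite[of "{0}"])
    fix T :: 'a assume "T \<notin> {0}"
    then have T: "T \<noteq> 0" by simp
    have "poly (reflect_poly p) T = T ^ degree p * poly p (1 / T)"
      using T by (simp add: poly_reflect_poly_nz inverse_eq_divide)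
    then show "poly (reflect_poly p) T = poly (monom 1 (degree p + N) * q) T"
      using assms(1)[OF T] by (simp add: poly_monom power_add)
  qed simp
  then have "coeff (reflect_poly p) 0 = 0" using assms(2) by (simp add: coeff_mult)
  then show ?thesis by simp
qed

text \<open>The coefficients are linear in the root T, with \<open>pCons 0 h\<close> as
  multiplication by the variable. In this form a moving root is a polynomial curve of forms.\<close>

lemma coeff_moving_root: "coeff ([:- T, 1:] * h) = (\<lambda>j. poly [:coeff (pCons 0 h) j, - coeff h j:] T)"
  for h :: "'a::field poly"
  by (auto simp: fun_eq_iff)

text \<open>The other chart of the line of roots: for T \<noteq> 0 the root is \<open>1 / T\<close>,
  and at T = 0 it has gone to infinity, leaving \<open>h\<close> itself as a form whose top
  coefficient vanishes.\<close>

lemma coeff_moving_root_at_infinity: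
  "coeff ([:1, - T:] * h) = (\<lambda>j. poly [:coeff h j, - coeff (pCons 0 h) j:] T)"
  for h :: "'a::field poly"
proof
  fix j
  show "coeff ([:1, - T:] * h) j = poly [:coeff h j, - coeff (pCons 0 h) j:] T"
    by (cases j) (auto simp: algebra_simps)
qed

lemma coeff_at_infinity_scaled:
  fixes T :: "'a::field"
  assumes "T \<noteq> 0"
  shows "coeff ([:1, - T:] * h) = (\<lambda>j. - T * coeff ([:- (1 / T), 1:] * h) j)"
proof -
  have "[:1, - T:] = Polynomial.smult (- T) [:- (1 / T), 1:]" using assms by simp
  then show ?thesis by (intro ext) (simp only: mult_smult_left coeff_smult)
qed

text \<open>As \<open>a\<close> is not a root of \<open>p\<close>, the whole order of
  \<open>r\<close> at \<open>a\<close> comes from the cofactor of \<open>p\<close>.\<close>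

lemma dvd_times_linear_power:
  fixes p r :: "'a::field poly"
  assumes "p dvd r" "[:- a, 1:] ^ m dvd r" "poly p a \<noteq> 0"
  shows "p * [:- a, 1:] ^ m dvd r"
proof -
  obtain q where q: "r = p * q" using assms(1) by (auto simp: dvd_def)
  have "[:- a, 1:] ^ m dvd q"
  proof (cases "r = 0")
    case False
    then have "order a r = order a p + order a q" unfolding q by (rule order_mult)
    moreover have "order a p = 0" using assms(3) by (simp add: order_root)
    ultimately show ?thesis using assms(2) False by (simp add: order_divides)
  next
    case True
    then show ?thesis using q assms(3) by auto
  qed
  then show ?thesis unfolding q by (rule mult_dvd_mono[OF dvd_refl])
qed

section \<open>Forms and functionals given by roots and weights\<close>

definition other_roots :: "nat \<Rightarrow> nat \<Rightarrow> (nat \<Rightarrow> 'a::field) \<Rightarrow> 'a poly" where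
  "other_roots k l t = (\<Prod>i\<in>{..<k} - {l}. [:- t i, 1:])"

lemma root_form_upd:
  assumes "l < k"
  shows "root_form k (t(l := T)) = coeff ([:- T, 1:] * other_roots k l t)"
proof -
  have "(\<Prod>i<k. [:- (t(l := T)) i, 1:]) = [:- T, 1:] * (\<Prod>i\<in>{..<k} - {l}. [:- (t(l := T)) i, 1:])"
    using assms by (subst prod.remove[of _ l]) auto
  also have "(\<Prod>i\<in>{..<k} - {l}. [:- (t(l := T)) i, 1:]) = other_roots k l t"
    unfolding other_roots_def by (intro prod.cong) auto
  finally show ?thesis unfolding root_form_def by simp
qed

lemma root_functional_upd:
  assumes "l < k"
  shows "root_functional k (t(l := T)) c =
    (\<lambda>m. c l * T ^ m + (\<Sum>i\<in>{..<k} - {l}. c i * t i ^ m))"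
proof
  fix m
  have "(\<Sum>i<k. c i * (t(l := T)) i ^ m) =
      c l * T ^ m + (\<Sum>i\<in>{..<k} - {l}. c i * (t(l := T)) i ^ m)"
    using assms by (subst sum.remove[of _ l]) auto
  also have "(\<Sum>i\<in>{..<k} - {l}. c i * (t(l := T)) i ^ m) = (\<Sum>i\<in>{..<k} - {l}. c i * t i ^ m)"
    by (intro sum.cong) auto
  finally show "root_functional k (t(l := T)) c m =
    c l * T ^ m + (\<Sum>i\<in>{..<k} - {l}. c i * t i ^ m)" unfolding root_functional_def .
qed

lemma other_roots_props:
  assumes "l < k"
  shows "other_roots k l t \<noteq> 0" "degree (other_roots k l t) = k - 1"
    "i < k \<Longrightarrow> i \<noteq> l \<Longrightarrow> poly (other_roots k l t) (t i) = 0"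
  unfolding other_roots_def using assms
  by (auto simp: prod_zero_iff poly_prod degree_prod_eq_sum_degree)

lemma root_form_apolar: "apolar k n (root_form k t) (root_functional k t c)"
  and root_form_nonzero: "nonzero_form k (root_form k t)"
proof -
  let ?p = "\<Prod>i<k. [:- t i, 1:]"
  have nz: "?p \<noteq> 0" by (auto simp: prod_zero_iff)
  have deg: "degree ?p \<le> k" by (simp add: degree_prod_eq_sum_degree)
  show "nonzero_form k (root_form k t)" unfolding root_form_def using deg nz by (rule nonzero_form_coeff)
  show "apolar k n (root_form k t) (root_functional k t c)"
    unfolding root_form_def root_functional_def using deg
    by (intro apolar_sum_powers) (auto simp: poly_prod)
qed

text \<open>The properties of \<Phi> from which uniqueness follows, stated without sheaves.
  \<open>truncate\<close>: only the monomials of degree \<open>n\<close> count.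
  \<open>regular\<close>: form and functional may move together along a polynomial curve, which may
  pass through forms with a root at infinity. \<open>scale\<close>: degree \<open>- N\<close> in the
  form. \<open>form\<close>: degree \<open>k\<close> in the functional, with one term for each word
  of indices rather than for each monomial.\<close>

locale apolar_function =
  fixes k n N :: nat and \<Phi> :: "(nat \<Rightarrow> 'a::alg_closed_field) \<Rightarrow> (nat \<Rightarrow> 'a) \<Rightarrow> 'a"
  assumes nk: "n + 2 = N + 2 * k" and N1: "N \<ge> 1" and k1: "k \<ge> 1"
    and truncate: "(\<And>m. m \<le> n \<Longrightarrow> \<phi> m = \<phi>' m) \<Longrightarrow> \<Phi> g \<phi> = \<Phi> g \<phi>'"
    and regular: "(\<And>T. nonzero_form k (\<lambda>j. poly (G j) T)) \<Longrightarrow>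
      (\<And>T. apolar k n (\<lambda>j. poly (G j) T) (\<lambda>m. poly (P m) T)) \<Longrightarrow>
      \<exists>r. \<forall>T. \<Phi> (\<lambda>j. poly (G j) T) (\<lambda>m. poly (P m) T) = poly r T"
    and scale: "c \<noteq> 0 \<Longrightarrow> nonzero_form k g \<Longrightarrow> apolar k n g \<phi> \<Longrightarrow>
      \<Phi> (\<lambda>j. c * g j) \<phi> * c ^ N = \<Phi> g \<phi>"
    and form: "nonzero_form k g \<Longrightarrow> (\<And>l. l < k \<Longrightarrow> apolar k n g (\<psi> l)) \<Longrightarrow>
      \<exists>C. \<forall>c. \<Phi> g (\<lambda>m. \<Sum>l<k. c l * \<psi> l m) =
        (\<Sum>\<pi>\<in>{..<k} \<rightarrow>\<^sub>E {..<k}. C \<pi> * (\<Prod>i<k. c (\<pi> i)))"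
begin

lemma vanishes_if_weight_zero:
  assumes l: "l < k" and c: "c l = 0"
  shows "\<Phi> (root_form k t) (root_functional k t c) = 0"
proof -
  define h where "h = other_roots k l t"
  define R where "R = (\<lambda>m. \<Sum>i\<in>{..<k} - {l}. c i * t i ^ m)"
  have h: "h \<noteq> 0" "degree h = k - 1" "\<And>i. i < k \<Longrightarrow> i \<noteq> l \<Longrightarrow> poly h (t i) = 0"
    using other_roots_props[OF l] by (auto simp: h_def)
  have nzdeg: "nonzero_form k (coeff (q * h))" "apolar k n (coeff (q * h)) R"
    if "q \<noteq> 0" "degree q \<le> 1" for q
  proof -
    have "degree (q * h) \<le> k" using h that k1 by (simp add: degree_mult_eq)
    then show "nonzero_form k (coeff (q * h))" "apolar k n (coeff (q * h)) R"
      using that h(1,3) unfolding R_def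
      by (intro nonzero_form_coeff apolar_sum_powers; simp)+
  qed
  have "\<exists>r. \<forall>T. \<Phi> (\<lambda>j. poly [:coeff (pCons 0 h) j, - coeff h j:] T) (\<lambda>m. poly [:R m:] T) = poly r T"
  proof (rule regular)
    fix T
    show "nonzero_form k (\<lambda>j. poly [:coeff (pCons 0 h) j, - coeff h j:] T)"
      using nzdeg(1)[of "[:-T,1:]"] unfolding coeff_moving_root by simp
    show "apolar k n (\<lambda>j. poly [:coeff (pCons 0 h) j, - coeff h j:] T) (\<lambda>m. poly [:R m:] T)"
      using nzdeg(2)[of "[:-T,1:]"] unfolding coeff_moving_root by simp
  qed
  then obtain r where r: "\<And>T. \<Phi> (coeff ([:-T, 1:] * h)) R = poly r T"
    unfolding coeff_moving_root by auto
  have "\<exists>r. \<forall>T. \<Phi> (\<lambda>j. poly [:coeff h j, - coeff (pCons 0 h) j:] T) (\<lambda>m. poly [:R m:] T) = poly r T"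
  proof (rule regular)
    fix T
    show "nonzero_form k (\<lambda>j. poly [:coeff h j, - coeff (pCons 0 h) j:] T)"
      using nzdeg(1)[of "[:1,-T:]"] unfolding coeff_moving_root_at_infinity by simp
    show "apolar k n (\<lambda>j. poly [:coeff h j, - coeff (pCons 0 h) j:] T) (\<lambda>m. poly [:R m:] T)"
      using nzdeg(2)[of "[:1,-T:]"] unfolding coeff_moving_root_at_infinity by simp
  qed
  then obtain r' where r': "\<And>T. \<Phi> (coeff ([:1, -T:] * h)) R = poly r' T"
    unfolding coeff_moving_root_at_infinity by auto
  \<comment> \<open>The two charts differ by the factor \<open>- T\<close> on the form, so
    \<open>scale\<close> turns regularity at infinity into a zero of order \<open>N\<close>
    there.\<close>
  have "r = 0"
  proof (rule poly_zero_from_infinity[of _ "Polynomial.smult ((-1)^N) r'"])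
    fix T :: 'a assume T: "T \<noteq> 0"
    have "\<Phi> (coeff ([:1, -T:] * h)) R * (-T) ^ N = \<Phi> (coeff ([:-(1/T), 1:] * h)) R"
      unfolding coeff_at_infinity_scaled[OF T]
      by (rule scale) (use T nzdeg[of "[:-(1/T), 1:]"] in \<open>simp_all del: mult_pCons_left\<close>)
    then show "poly r (1 / T) = poly (Polynomial.smult ((-1)^N) r') T * T ^ N"
      unfolding r r' by (simp add: power_minus[of T] mult_ac)
  qed (rule N1)
  then have "\<Phi> (coeff ([:-t l, 1:] * h)) R = 0" using r by simp
  moreover have "root_form k t = coeff ([:-t l, 1:] * h)"
    using root_form_upd[OF l, of t "t l"] unfolding h_def by simp
  moreover have "root_functional k t c = R"
    using root_functional_upd[OF l, of t "t l" c] c unfolding R_def by simp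
  ultimately show ?thesis by simp
qed

text \<open>As the function of the weights \<open>c\<close> vanishes whenever some \<open>c\<^sub>l\<close> does, only the
  monomials containing every \<open>c\<^sub>l\<close> contribute; having degree \<open>k\<close>, they are all
  \<open>c\<^sub>0 \<dots> c\<^sub>k\<^sub>-\<^sub>1\<close>.\<close>

lemma weights_factor:
  "\<Phi> (root_form k t) (root_functional k t c) =
    (\<Prod>l<k. c l) * \<Phi> (root_form k t) (root_functional k t (\<lambda>_. 1))"
proof -
  let ?E = "{..<k} \<rightarrow>\<^sub>E {..<k}"
  have "apolar k n (root_form k t) (\<lambda>m. t l ^ m)" if "l < k" for l
    using that apolar_sum_powers[of "\<Prod>i<k. [:- t i, 1:]" k "{l}" t n "\<lambda>_. 1"]
    by (auto simp: root_form_def poly_prod degree_prod_eq_sum_degree)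
  then obtain C where C: "\<And>c. \<Phi> (root_form k t) (root_functional k t c) =
      (\<Sum>\<pi>\<in>?E. C \<pi> * (\<Prod>i<k. c (\<pi> i)))"
    using form[OF root_form_nonzero[of k t], of "\<lambda>l m. t l ^ m"] unfolding root_functional_def by blast
  have finE: "finite ?E" by (intro finite_PiE) auto
  \<comment> \<open>The indices are forced one by one: setting \<open>c l\<close> to 0 kills the
    words that contain \<open>l\<close> and makes \<Phi> vanish, so subtracting the two expansions
    leaves just the words that contain \<open>l\<close>.\<close>
  have part: "\<Phi> (root_form k t) (root_functional k t c) =
      (\<Sum>\<pi>\<in>{\<pi>\<in>?E. S \<subseteq> \<pi> ` {..<k}}. C \<pi> * (\<Prod>i<k. c (\<pi> i)))"
    if "finite S" "S \<subseteq> {..<k}" for S c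
    using that
  proof (induction S arbitrary: c)
    case empty
    then show ?case using C by simp
  next
    case (insert l S)
    let ?A = "{\<pi>\<in>?E. S \<subseteq> \<pi> ` {..<k}}"
    let ?c = "c(l := 0)"
    have 1: "(\<Sum>\<pi>\<in>?A. C \<pi> * (\<Prod>i<k. ?c (\<pi> i))) = 0"
      using insert vanishes_if_weight_zero[of l ?c t] by simp
    have 2: "(\<Prod>i<k. ?c (\<pi> i)) = (if l \<in> \<pi> ` {..<k} then 0 else (\<Prod>i<k. c (\<pi> i)))" for \<pi>
      by (auto intro!: prod.cong simp: prod_zero_iff)
    have "(\<Sum>\<pi>\<in>?A. C \<pi> * (\<Prod>i<k. c (\<pi> i))) =
        (\<Sum>\<pi>\<in>?A. C \<pi> * (\<Prod>i<k. c (\<pi> i))) - (\<Sum>\<pi>\<in>?A. C \<pi> * (\<Prod>i<k. ?c (\<pi> i)))"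
      by (simp only: 1 diff_0_right)
    also have "\<dots> = (\<Sum>\<pi>\<in>?A. if l \<in> \<pi> ` {..<k} then C \<pi> * (\<Prod>i<k. c (\<pi> i)) else 0)"
      unfolding 2 sum_subtractf[symmetric] by (intro sum.cong) auto
    also have "\<dots> = (\<Sum>\<pi>\<in>{\<pi>\<in>?A. l \<in> \<pi> ` {..<k}}. C \<pi> * (\<Prod>i<k. c (\<pi> i)))"
      using finE by (intro sum.inter_filter[symmetric]) auto
    also have "{\<pi>\<in>?A. l \<in> \<pi> ` {..<k}} = {\<pi>\<in>?E. insert l S \<subseteq> \<pi> ` {..<k}}" by auto
    finally show ?case using insert by simp
  qed
  let ?B = "{\<pi>\<in>?E. {..<k} \<subseteq> \<pi> ` {..<k}}"
  have "(\<Prod>i<k. c (\<pi> i)) = (\<Prod>l<k. c l)" if "\<pi> \<in> ?B" for \<pi> c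
  proof -
    have "\<pi> ` {..<k} = {..<k}" using that by auto
    then have "bij_betw \<pi> {..<k} {..<k}"
      by (simp add: bij_betw_def eq_card_imp_inj_on)
    then show ?thesis by (rule prod.reindex_bij_betw)
  qed
  then have "(\<Sum>\<pi>\<in>?B. C \<pi> * (\<Prod>i<k. c (\<pi> i))) = (\<Prod>l<k. c l) * sum C ?B" for c
    unfolding sum_distrib_left by (intro sum.cong) (auto simp: mult_ac)
  then have "\<Phi> (root_form k t) (root_functional k t c) = (\<Prod>l<k. c l) * sum C ?B" for c
    using part[of "{..<k}" c] by simp
  then show ?thesis by simp
qed

text \<open>Near \<open>T = t\<^sub>j\<close> the functional with weights \<open>1/(T - t\<^sub>j)\<close> at \<open>T\<close> and
  \<open>-1/(T - t\<^sub>j)\<close> at \<open>t\<^sub>j\<close> extends across \<open>T = t\<^sub>j\<close>; the product of the weights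
  produces the double zero.\<close>

lemma double_zero:
  assumes l: "l < k" and j: "j < k" "j \<noteq> l"
    and r: "\<And>T. \<Phi> (root_form k (t(l := T))) (root_functional k (t(l := T)) (\<lambda>_. 1)) = poly r T"
  shows "[:- t j, 1:] ^ 2 dvd r"
proof -
  define h where "h = other_roots k l t"
  have h: "h \<noteq> 0" "degree h = k - 1"
    using other_roots_props[OF l] by (auto simp: h_def)
  \<comment> \<open>The first sum is the divided difference
    \<open>(T^m - t_j^m) / (T - t_j)\<close>, written as a polynomial in T; the constant is the
    contribution of the other roots with weight 1.\<close>
  define Q where "Q m = (\<Sum>i<m. monom (t j ^ (m - Suc i)) i)
      + [:\<Sum>i\<in>{..<k} - {l} - {j}. t i ^ m:]" for m
  define c where "c T = (\<lambda>_. 1)(l := 1 / (T - t j), j := - 1 / (T - t j))" for T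
  have Q: "(\<lambda>m. poly (Q m) T) = root_functional k (t(l := T)) (c T)" if "T \<noteq> t j" for T
  proof
    fix m
    have "poly (\<Sum>i<m. monom (t j ^ (m - Suc i)) i) T = (T ^ m - t j ^ m) / (T - t j)"
      using that power_diff_sumr2[of T m "t j"] by (simp add: poly_sum poly_monom)
    moreover have "root_functional k (t(l := T)) (c T) m =
        c T l * T ^ m + (c T j * t j ^ m + (\<Sum>i\<in>{..<k} - {l} - {j}. c T i * t i ^ m))"
      unfolding root_functional_upd[OF l] using j by (subst sum.remove[of _ j]) auto
    moreover have "(\<Sum>i\<in>{..<k} - {l} - {j}. c T i * t i ^ m) = (\<Sum>i\<in>{..<k} - {l} - {j}. t i ^ m)"
      by (intro sum.cong) (auto simp: c_def)
    ultimately show "poly (Q m) T = root_functional k (t(l := T)) (c T) m"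
      using j by (simp add: Q_def c_def diff_divide_distrib)
  qed
  define G where "G = (\<lambda>i. [:coeff (pCons 0 h) i, - coeff h i:])"
  have G: "root_form k (t(l := T)) = (\<lambda>i. poly (G i) T)" for T
    unfolding G_def root_form_upd[OF l] h_def[symmetric] coeff_moving_root ..
  have "\<exists>q. \<forall>T. \<Phi> (\<lambda>i. poly (G i) T) (\<lambda>m. poly (Q m) T) = poly q T"
  proof (rule regular)
    fix T
    show "nonzero_form k (\<lambda>i. poly (G i) T)"
      unfolding G[symmetric] by (rule root_form_nonzero)
    \<comment> \<open>At T = \<open>t j\<close> the weights have a pole; apolarity there follows
      from the neighbouring parameters.\<close>
    show "apolar k n (\<lambda>i. poly (G i) T) (\<lambda>m. poly (Q m) T)"
    proof (rule apolar_curve_closed[of "{t j}"])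
      fix T assume "T \<notin> {t j}"
      then show "apolar k n (\<lambda>i. poly (G i) T) (\<lambda>m. poly (Q m) T)"
        using Q[of T] root_form_apolar[of k n "t(l := T)" "c T"] unfolding G[symmetric] by simp
    qed simp
  qed
  then obtain q where q: "\<And>T. \<Phi> (root_form k (t(l := T))) (\<lambda>m. poly (Q m) T) = poly q T"
    unfolding G by blast
  have "r = [:- t j, 1:] ^ 2 * (- q)"
  proof (rule poly_eqI_cofinite[of "{t j}"])
    fix T assume "T \<notin> {t j}"
    then have T: "T \<noteq> t j" by simp
    have "(\<Prod>i<k. c T i) = c T l * (c T j * (\<Prod>i\<in>{..<k} - {l} - {j}. c T i))"
      using l j by (subst prod.remove[of _ l], simp, simp, subst prod.remove[of _ j]) auto
    also have "(\<Prod>i\<in>{..<k} - {l} - {j}. c T i) = 1"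
      by (intro prod.neutral) (auto simp: c_def)
    finally have "(\<Prod>i<k. c T i) = - 1 / (T - t j) ^ 2"
      using j by (simp add: c_def power2_eq_square)
    then have "poly q T = - 1 / (T - t j) ^ 2 * poly r T"
      using weights_factor[of "t(l := T)" "c T"] by (simp add: r Q[OF T, symmetric] q)
    then show "poly r T = poly ([:- t j, 1:] ^ 2 * (- q)) T"
      using T by (simp add: field_simps)
  qed simp
  then show ?thesis by simp
qed

text \<open>The degree bound is found at infinity, where the root is \<open>1 / T\<close>. Giving it
  the weight \<open>T ^ n\<close> makes its contributions \<open>T ^ (n - m)\<close> polynomial. The
  product of the weights is then \<open>T ^ n\<close>, while \<open>scale\<close> costs
  \<open>T ^ N\<close>; so \<open>r\<close> has a pole of order at most n - N = 2k - 2.\<close>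

lemma moving_root_poly:
  assumes l: "l < k"
  obtains r where
    "\<And>T. \<Phi> (root_form k (t(l := T))) (root_functional k (t(l := T)) (\<lambda>_. 1)) = poly r T"
    "degree r \<le> 2 * k - 2"
proof -
  define h where "h = other_roots k l t"
  have h: "h \<noteq> 0" "degree h = k - 1" "\<And>i. i < k \<Longrightarrow> i \<noteq> l \<Longrightarrow> poly h (t i) = 0"
    using other_roots_props[OF l] by (auto simp: h_def)
  define R where "R m = (\<Sum>i\<in>{..<k} - {l}. t i ^ m)" for m
  define G where "G = (\<lambda>i. [:coeff (pCons 0 h) i, - coeff h i:])"
  have G: "root_form k (t(l := T)) = (\<lambda>i. poly (G i) T)" for T
    unfolding G_def root_form_upd[OF l] h_def[symmetric] coeff_moving_root ..
  define P where "P m = monom 1 m + [:R m:]" for m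
  have P: "root_functional k (t(l := T)) (\<lambda>_. 1) = (\<lambda>m. poly (P m) T)" for T
    unfolding root_functional_upd[OF l] P_def R_def by (simp add: poly_monom)
  have "\<exists>r. \<forall>T. \<Phi> (\<lambda>i. poly (G i) T) (\<lambda>m. poly (P m) T) = poly r T"
    by (rule regular) (simp_all only: G[symmetric] P[symmetric] root_form_nonzero root_form_apolar)
  then obtain r where r: "\<And>T. \<Phi> (root_form k (t(l := T))) (root_functional k (t(l := T)) (\<lambda>_. 1)) = poly r T"
    unfolding G P by blast
  define G' where "G' = (\<lambda>i. [:coeff h i, - coeff (pCons 0 h) i:])"
  have G': "coeff ([:1, -T:] * h) = (\<lambda>i. poly (G' i) T)" for T
    unfolding G'_def coeff_moving_root_at_infinity ..
  have G'_scaled: "(\<lambda>i. poly (G' i) T) = (\<lambda>j. - T * root_form k (t(l := 1 / T)) j)" if "T \<noteq> 0" for T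
    unfolding G'[symmetric] root_form_upd[OF l] h_def[symmetric] coeff_at_infinity_scaled[OF that] ..
  \<comment> \<open>Above index \<open>n\<close> the exponent \<open>n - m\<close> loses its meaning
    over the naturals; \<open>truncate\<close> permits the value 0 there.\<close>
  define P' where "P' m = (if m \<le> n then monom 1 (n - m) + [:R m:] else 0)" for m
  let ?w = "\<lambda>T. (\<lambda>_. 1)(l := T ^ n)"
  have P': "poly (P' m) T = root_functional k (t(l := 1 / T)) (?w T) m" if "T \<noteq> 0" "m \<le> n" for T m
  proof -
    have "(\<Sum>i\<in>{..<k} - {l}. ?w T i * t i ^ m) = R m"
      unfolding R_def by (intro sum.cong) auto
    moreover have "T ^ (n - m) = T ^ n * (1 / T) ^ m"
      using that by (simp add: power_diff power_one_over field_simps)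
    ultimately show ?thesis
      using that unfolding root_functional_upd[OF l] by (simp add: P'_def poly_monom)
  qed
  \<comment> \<open>Agreement up to index \<open>n\<close> suffices, because \<open>u + j\<close> is
    at most \<open>(n - k) + k\<close>.\<close>
  have ap: "apolar k n (\<lambda>i. c * root_form k t' i) \<phi>"
    if "\<And>m. m \<le> n \<Longrightarrow> \<phi> m = root_functional k t' w m" for c t' w \<phi>
    unfolding apolar_def
  proof (intro allI impI)
    fix u assume u: "u \<le> n - k"
    have nk': "k \<le> n" using nk N1 k1 by linarith
    have "(\<Sum>j\<le>k. c * root_form k t' j * \<phi> (u + j))
        = (\<Sum>j\<le>k. c * (root_form k t' j * root_functional k t' w (u + j)))"
      using that u nk' by (intro sum.cong) (auto simp: mult_ac)
    also have "\<dots> = 0"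
      using root_form_apolar[of k n t' w] u unfolding apolar_def by (simp flip: sum_distrib_left)
    finally show "(\<Sum>j\<le>k. c * root_form k t' j * \<phi> (u + j)) = 0" .
  qed
  have "\<exists>r'. \<forall>T. \<Phi> (\<lambda>i. poly (G' i) T) (\<lambda>m. poly (P' m) T) = poly r' T"
  proof (rule regular)
    fix T :: 'a
    have "degree [:1, -T:] \<le> 1" by simp
    then have "degree ([:1, -T:] * h) \<le> k" "[:1, -T:] * h \<noteq> 0"
      using h k1 degree_mult_le[of "[:1, -T:]" h] by (linarith, simp only: mult_eq_0_iff pCons_eq_0_iff, simp)
    then show "nonzero_form k (\<lambda>i. poly (G' i) T)"
      unfolding G'[symmetric] by (rule nonzero_form_coeff)
    show "apolar k n (\<lambda>i. poly (G' i) T) (\<lambda>m. poly (P' m) T)"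
    proof (rule apolar_curve_closed[of "{0}"])
      fix T :: 'a assume "T \<notin> {0}"
      then have "T \<noteq> 0" by simp
      then show "apolar k n (\<lambda>i. poly (G' i) T) (\<lambda>m. poly (P' m) T)"
        unfolding G'_scaled[OF \<open>T \<noteq> 0\<close>] using P' by (intro ap)
    qed simp
  qed
  then obtain r' where r': "\<And>T. \<Phi> (\<lambda>i. poly (G' i) T) (\<lambda>m. poly (P' m) T) = poly r' T"
    by blast
  have "degree r \<le> n - N"
  proof (rule poly_degree_from_infinity[of _ _ "Polynomial.smult ((-1)^N) r'"])
    fix T :: 'a assume T: "T \<noteq> 0"
    have w: "(\<Prod>i<k. ?w T i) = T ^ n"
      using l by (subst prod.remove[of _ l]) auto
    have nN: "n - N + N = n" using nk k1 by linarith
    have "poly r' T * (- T) ^ N = \<Phi> (root_form k (t(l := 1 / T))) (\<lambda>m. poly (P' m) T)"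
      unfolding r'[symmetric] G'_scaled[OF T]
      using T ap[of "\<lambda>m. poly (P' m) T" "t(l := 1 / T)" "?w T" 1] P'[OF T]
      by (intro scale root_form_nonzero) auto
    also have "\<dots> = \<Phi> (root_form k (t(l := 1 / T))) (root_functional k (t(l := 1 / T)) (?w T))"
      using P'[OF T] by (intro truncate)
    also have "\<dots> = T ^ n * poly r (1 / T)"
      unfolding weights_factor[of _ "?w T"] w r ..
    finally have "T ^ N * (poly r (1 / T) * T ^ (n - N)) = T ^ N * ((-1) ^ N * poly r' T)"
      using nN by (simp add: power_minus[of T] mult_ac flip: power_add)
    then show "poly r (1 / T) * T ^ (n - N) = poly (Polynomial.smult ((-1) ^ N) r') T"
      using T by simp
  qed
  moreover have "n - N \<le> 2 * k - 2" using nk by linarith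
  ultimately show thesis using r that by simp
qed

text \<open>As a polynomial in root number \<open>l\<close>, \<Phi> has degree at most 2k - 2 and
  already 2(k - 1) zeros, two at each of the other roots. A zero at \<open>t l\<close> is one too
  many, so \<Phi> vanishes wherever this root is placed.\<close>

lemma zero_moves:
  assumes l: "l < k" and inj: "inj_on t {..<k}"
    and zero: "\<Phi> (root_form k t) (root_functional k t (\<lambda>_. 1)) = 0"
  shows "\<Phi> (root_form k (t(l := T))) (root_functional k (t(l := T)) (\<lambda>_. 1)) = 0"
proof -
  obtain r where r: "\<And>T. \<Phi> (root_form k (t(l := T))) (root_functional k (t(l := T)) (\<lambda>_. 1)) = poly r T"
    and deg: "degree r \<le> 2 * k - 2"
    by (rule moving_root_poly[OF l, of t]) blast
  have 2: "(\<Prod>j\<in>A. [:- t j, 1:] ^ 2) dvd r" if "A \<subseteq> {..<k} - {l}" for A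
  proof -
    have "finite A" using that finite_subset by blast
    then show ?thesis using that
    proof (induction A)
      case (insert a A)
      have "[:- t a, 1:] ^ 2 dvd r"
        using insert r by (intro double_zero[OF l, of a t]) auto
      moreover have "poly (\<Prod>j\<in>A. [:- t j, 1:] ^ 2) (t a) \<noteq> 0"
        using insert inj by (auto simp: poly_prod prod_zero_iff inj_on_def)
      moreover have "(\<Prod>j\<in>A. [:- t j, 1:] ^ 2) dvd r" using insert by auto
      ultimately have "(\<Prod>j\<in>A. [:- t j, 1:] ^ 2) * [:- t a, 1:] ^ 2 dvd r"
        by (intro dvd_times_linear_power)
      then show ?case using insert by (simp add: mult.commute del: mult_pCons_left)
    qed simp
  qed
  let ?q = "\<Prod>j\<in>{..<k} - {l}. [:- t j, 1:] ^ 2"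
  have "poly r (t l) = 0" using zero r[of "t l"] by simp
  then have "[:- t l, 1:] ^ 1 dvd r" by (simp add: poly_eq_0_iff_dvd)
  moreover have "poly ?q (t l) \<noteq> 0"
    using l inj by (auto simp: poly_prod prod_zero_iff inj_on_def)
  ultimately have dvd: "?q * [:- t l, 1:] ^ 1 dvd r"
    using 2[of "{..<k} - {l}"] by (intro dvd_times_linear_power) auto
  have nz: "?q \<noteq> 0" by (auto simp: prod_zero_iff)
  have "degree ?q = 2 * (k - 1)"
    using l by (subst degree_prod_eq_sum_degree) (auto simp: degree_power_eq)
  then have "degree (?q * [:- t l, 1:] ^ 1) = 2 * k - 1"
    using nz k1 by (subst degree_mult_eq) auto
  then have "\<not> degree (?q * [:- t l, 1:] ^ 1) \<le> degree r" using deg k1 by linarith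
  then have "r = 0" using dvd dvd_imp_degree_le by blast
  then show ?thesis using r by simp
qed

text \<open>The roots are exchanged one at a time. Disjointness keeps every mixed tuple injective,
  as \<open>zero_moves\<close> requires.\<close>

lemma zero_moves_disjoint:
  assumes t: "inj_on t {..<k}" and t': "inj_on t' {..<k}" and disj: "t ` {..<k} \<inter> t' ` {..<k} = {}"
    and zero: "\<Phi> (root_form k t) (root_functional k t (\<lambda>_. 1)) = 0"
  shows "\<Phi> (root_form k t') (root_functional k t' (\<lambda>_. 1)) = 0"
proof -
  define s where "s j = (\<lambda>i. if i < j then t' i else t i)" for j :: nat
  have s: "s (Suc j) = (s j)(j := t' j)" for j by (auto simp: s_def fun_eq_iff)
  have ne: "t x \<noteq> t' y" if "x < k" "y < k" for x y
    using disj that by (metis disjoint_iff image_eqI lessThan_iff)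
  have inj: "inj_on (s j) {..<k}" for j
  proof (rule inj_onI)
    fix x y assume xy: "x \<in> {..<k}" "y \<in> {..<k}" "s j x = s j y"
    show "x = y"
    proof (cases "x < j \<longleftrightarrow> y < j")
      case True
      then show ?thesis using xy t t' by (auto simp: s_def inj_on_def split: if_splits)
    next
      case False
      then show ?thesis using xy ne[of x y] ne[of y x] by (auto simp: s_def split: if_splits)
    qed
  qed
  have "\<Phi> (root_form k (s j)) (root_functional k (s j) (\<lambda>_. 1)) = 0" if "j \<le> k" for j
    using that
  proof (induction j)
    case 0
    then show ?case using zero by (simp add: s_def)
  next
    case (Suc j)
    then show ?case unfolding s by (intro zero_moves inj) auto
  qed
  from this[of k] have "\<Phi> (root_form k (s k)) (root_functional k (s k) (\<lambda>_. 1)) = 0" by simp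
  moreover have "root_form k (s k) = root_form k t'" "root_functional k (s k) = root_functional k t'"
    by (auto simp: root_form_def root_functional_def s_def fun_eq_iff)
  ultimately show ?thesis by simp
qed

text \<open>The two root sets may overlap; a third one, disjoint from both, links them and exists
  because the field is infinite. The weights enter only through the factor in
  \<open>weights_factor\<close>.\<close>

lemma vanishes_everywhere:
  assumes t: "inj_on t {..<k}" and zero: "\<Phi> (root_form k t) (root_functional k t (\<lambda>_. 1)) = 0"
    and t': "inj_on t' {..<k}"
  shows "\<Phi> (root_form k t') (root_functional k t' c) = 0"
proof -
  have "infinite (UNIV - (t ` {..<k} \<union> t' ` {..<k}))"
    by (rule Diff_infinite_finite[OF _ infinite_UNIV_alg_closed]) auto
  then obtain B where B: "B \<subseteq> UNIV - (t ` {..<k} \<union> t' ` {..<k})" "finite B" "card B = k"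
    using infinite_arbitrarily_large[of _ k] by metis
  then obtain u where "bij_betw u {..<k} B"
    using ex_bij_betw_nat_finite[of B] by (auto simp: atLeast0LessThan)
  then have u: "inj_on u {..<k}" "u ` {..<k} = B" by (auto simp: bij_betw_def)
  have "\<Phi> (root_form k u) (root_functional k u (\<lambda>_. 1)) = 0"
    using B u by (intro zero_moves_disjoint[OF t u(1) _ zero]) auto
  then have "\<Phi> (root_form k t') (root_functional k t' (\<lambda>_. 1)) = 0"
    using B u by (intro zero_moves_disjoint[OF u(1) t']) auto
  then show ?thesis using weights_factor[of t' c] by simp
qed

end

section \<open>Quotients, symmetric powers and tensor products of modules\<close>

lemma submodule_abelian_subgroup:
  fixes R :: "'r ring" and M :: "('r, 'm) module"
  assumes "Module.module R M" "LinearCombinations.submodule R N M"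
  shows "abelian_subgroup N M"
proof -
  interpret M: Module.module R M by fact
  interpret N: LinearCombinations.submodule R N M by fact
  have inv: "\<ominus>\<^bsub>M\<^esub> x \<in> N" if "x \<in> N" for x
  proof -
    have x: "x \<in> carrier M" using that N.subset by blast
    have "(\<ominus>\<^bsub>R\<^esub> \<one>\<^bsub>R\<^esub>) \<odot>\<^bsub>M\<^esub> x \<in> N" using that by simp
    then show ?thesis using x M.smult_l_minus[of "\<one>\<^bsub>R\<^esub>" x] by simp
  qed
  have "additive_subgroup N M"
    using N.subset inv by (intro additive_subgroup.intro subgroup.intro) (auto simp: a_inv_def)
  then show ?thesis using M.abelian_group_axioms by (rule abelian_subgroupI3)
qed

locale module_quotient = Module.module R M for R :: "'r ring" (structure) and M :: "('r, 'm) module" (structure) +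
  fixes N :: "'m set"
  assumes sub: "LinearCombinations.submodule R N M"
begin

sublocale N: abelian_subgroup N M
  using module_axioms sub by (rule submodule_abelian_subgroup)

abbreviation "cl x \<equiv> a_r_coset M N x"

lemma cl_eq_zero: "x \<in> N \<Longrightarrow> cl x = N"
  using N.a_rcos_const by simp

lemma cl_eqI:
  assumes "x \<in> carrier M" "y \<in> carrier M" "x \<ominus>\<^bsub>M\<^esub> y \<in> N"
  shows "cl x = cl y"
proof -
  have "x = (x \<ominus>\<^bsub>M\<^esub> y) \<oplus>\<^bsub>M\<^esub> y"
    using assms by (simp add: M.minus_eq M.a_assoc M.l_neg)
  then have "x \<in> cl y" using assms(3) by (auto simp: a_r_coset_def')
  then show ?thesis using assms M.a_repr_independence[OF _ _ N.a_subgroup, of x y] by simp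
qed

lemma cl_add:
  assumes "x \<in> carrier M" "y \<in> carrier M"
  shows "set_add M (cl x) (cl y) = cl (x \<oplus>\<^bsub>M\<^esub> y)"
  using assms by (rule N.a_rcos_sum)

lemma cl_smult:
  assumes r: "r \<in> carrier R" and x: "x \<in> carrier M"
  shows "(\<Union>y\<in>cl x. cl (r \<odot>\<^bsub>M\<^esub> y)) = cl (r \<odot>\<^bsub>M\<^esub> x)"
proof -
  have "cl (r \<odot>\<^bsub>M\<^esub> y) = cl (r \<odot>\<^bsub>M\<^esub> x)" if y: "y \<in> cl x" for y
  proof -
    obtain z where z: "z \<in> N" "y = z \<oplus>\<^bsub>M\<^esub> x" using y by (auto simp: a_r_coset_def')
    then have zc: "z \<in> carrier M" using N.a_subset by blast
    have "r \<odot>\<^bsub>M\<^esub> y \<ominus>\<^bsub>M\<^esub> r \<odot>\<^bsub>M\<^esub> x = r \<odot>\<^bsub>M\<^esub> z"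
      using r x zc z by (simp add: smult_r_distr M.minus_eq M.a_assoc M.r_neg)
    then show ?thesis
      using r x zc z submodule.smult_closed[OF sub, of r z] by (intro cl_eqI) auto
  qed
  moreover have "x \<in> cl x" using N.a_rcos_self[OF x] .
  ultimately show ?thesis by blast
qed

abbreviation "Q \<equiv> quotient_module M N"

lemma quotient_carrier: "carrier Q = cl ` carrier M"
  by (auto simp: quotient_module_def A_RCOSETS_def')

lemma quotient_cl [simp]: "x \<in> carrier M \<Longrightarrow> cl x \<in> carrier Q"
  by (simp add: quotient_carrier)

lemma quotient_zero: "\<zero>\<^bsub>Q\<^esub> = cl \<zero>\<^bsub>M\<^esub>"
  using cl_eq_zero[OF N.zero_closed] by (simp add: quotient_module_def)

lemma quotient_add:
  "x \<in> carrier M \<Longrightarrow> y \<in> carrier M \<Longrightarrow> cl x \<oplus>\<^bsub>Q\<^esub> cl y = cl (x \<oplus>\<^bsub>M\<^esub> y)"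
  using cl_add by (simp add: quotient_module_def)

lemma quotient_smult:
  "r \<in> carrier R \<Longrightarrow> x \<in> carrier M \<Longrightarrow> r \<odot>\<^bsub>Q\<^esub> cl x = cl (r \<odot>\<^bsub>M\<^esub> x)"
  using cl_smult by (simp add: quotient_module_def)

lemma quotient_is_module: "Module.module R Q"
proof (rule moduleI)
  show "cring R" by (rule R.is_cring)
  show "abelian_group Q"
  proof (rule abelian_groupI)
    fix X assume "X \<in> carrier Q"
    then obtain x where "x \<in> carrier M" "X = cl x" by (auto simp: quotient_carrier)
    then show "\<exists>y\<in>carrier Q. y \<oplus>\<^bsub>Q\<^esub> X = \<zero>\<^bsub>Q\<^esub>"
      by (intro bexI[of _ "cl (\<ominus>\<^bsub>M\<^esub> x)"]) (auto simp: quotient_add quotient_zero M.l_neg)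
  qed (auto simp: quotient_carrier quotient_add quotient_zero M.a_ac)
qed (auto simp: quotient_carrier quotient_add quotient_smult smult_l_distr smult_r_distr smult_assoc1)

lemma quotient_finsum:
  assumes "finite A" "v \<in> A \<rightarrow> carrier M"
  shows "finsum Q (\<lambda>a. cl (v a)) A = cl (finsum M v A)"
proof -
  interpret Q: Module.module R Q by (rule quotient_is_module)
  show ?thesis using assms
  proof (induction A)
    case (insert a A)
    have 1: "v a \<in> carrier M" "v \<in> A \<rightarrow> carrier M" using insert by auto
    have 2: "(\<lambda>a. cl (v a)) \<in> A \<rightarrow> carrier Q" using 1 by (auto simp: Pi_iff)
    show ?case using insert 1 2 by (simp add: M.finsum_insert Q.finsum_insert quotient_add)
  qed (simp add: quotient_zero)
qed

end

section \<open>Maps to the field along an evaluation\<close>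

text \<open>The way to extract a number from an element of a stalk: \<open>ev\<close> will be the
  evaluation of the local ring at a closed point, and \<open>f\<close> is linear over it.\<close>

definition semilinear ::
  "'r ring \<Rightarrow> ('r \<Rightarrow> 'a::field) \<Rightarrow> ('r, 'm) module \<Rightarrow> ('m \<Rightarrow> 'a) \<Rightarrow> bool" where
  "semilinear R ev M f \<longleftrightarrow>
     (\<forall>x\<in>carrier M. \<forall>y\<in>carrier M. f (x \<oplus>\<^bsub>M\<^esub> y) = f x + f y) \<and>
     (\<forall>r\<in>carrier R. \<forall>x\<in>carrier M. f (r \<odot>\<^bsub>M\<^esub> x) = ev r * f x)"

lemma semilinear_add:
  "semilinear R ev M f \<Longrightarrow> x \<in> carrier M \<Longrightarrow> y \<in> carrier M \<Longrightarrow> f (x \<oplus>\<^bsub>M\<^esub> y) = f x + f y"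
  by (simp add: semilinear_def)

lemma semilinear_smult:
  "semilinear R ev M f \<Longrightarrow> r \<in> carrier R \<Longrightarrow> x \<in> carrier M \<Longrightarrow> f (r \<odot>\<^bsub>M\<^esub> x) = ev r * f x"
  by (simp add: semilinear_def)

lemma semilinear_zero:
  assumes "semilinear R ev M f" "abelian_group M"
  shows "f \<zero>\<^bsub>M\<^esub> = 0"
proof -
  interpret abelian_group M by fact
  show ?thesis using semilinear_add[OF assms(1), of "\<zero>\<^bsub>M\<^esub>" "\<zero>\<^bsub>M\<^esub>"]
    by (metis add_cancel_right_right l_zero zero_closed)
qed

lemma semilinear_minus:
  assumes "semilinear R ev M f" "abelian_group M" "x \<in> carrier M" "y \<in> carrier M"
  shows "f (x \<ominus>\<^bsub>M\<^esub> y) = f x - f y"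
proof -
  interpret abelian_group M by fact
  have "f (x \<ominus>\<^bsub>M\<^esub> y) + f y = f ((x \<ominus>\<^bsub>M\<^esub> y) \<oplus>\<^bsub>M\<^esub> y)"
    using assms by (intro semilinear_add[OF assms(1), symmetric]) auto
  also have "(x \<ominus>\<^bsub>M\<^esub> y) \<oplus>\<^bsub>M\<^esub> y = x"
    using assms by (simp add: minus_eq a_assoc l_neg)
  finally show ?thesis by (simp add: eq_diff_eq)
qed

lemma semilinear_finsum:
  assumes "semilinear R ev M f" "abelian_group M" "finite A" "v \<in> A \<rightarrow> carrier M"
  shows "f (finsum M v A) = (\<Sum>a\<in>A. f (v a))"
proof -
  interpret abelian_group M by fact
  show ?thesis using assms(3,4)
  proof (induction A)
    case (insert a A)
    then have "v a \<in> carrier M" "v \<in> A \<rightarrow> carrier M" by auto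
    then show ?case using insert by (simp add: finsum_insert semilinear_add[OF assms(1)] finsum_closed)
  qed (simp add: semilinear_zero[OF assms(1,2)])
qed

text \<open>The value is read off an arbitrary element of the coset; representatives differ by
  elements of \<open>N\<close>, on which \<open>f\<close> vanishes.\<close>

lemma (in module_quotient) semilinear_quotient:
  assumes f: "semilinear R ev M f" and zero: "\<And>x. x \<in> N \<Longrightarrow> f x = 0"
  shows "\<exists>F. semilinear R ev Q F \<and> (\<forall>x\<in>carrier M. F (cl x) = f x)"
proof -
  define F where "F X = f (SOME x. x \<in> X)" for X
  have F: "F (cl x) = f x" if x: "x \<in> carrier M" for x
  proof -
    have "(SOME y. y \<in> cl x) \<in> cl x" using N.a_rcos_self[OF x] by (rule someI)
    then obtain z where z: "z \<in> N" "(SOME y. y \<in> cl x) = z \<oplus>\<^bsub>M\<^esub> x" by (auto simp: a_r_coset_def')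
    then have "z \<in> carrier M" using N.a_subset by blast
    then show ?thesis using z x zero by (simp add: F_def semilinear_add[OF f])
  qed
  then have "semilinear R ev Q F"
    using f by (auto simp: semilinear_def quotient_carrier quotient_add quotient_smult)
  then show ?thesis using F by blast
qed

text \<open>The zeros of \<open>f\<close> form a submodule, which contains the span once it contains
  the generators.\<close>

lemma semilinear_span_zero:
  assumes f: "semilinear R ev M f" and M: "Module.module R M" and G: "G \<subseteq> carrier M"
    and zero: "\<And>x. x \<in> G \<Longrightarrow> f x = 0" and x: "x \<in> LinearCombinations.module.span R M G"
  shows "f x = 0"
proof -
  interpret M: Module.module R M by fact
  have f0: "f \<zero>\<^bsub>M\<^esub> = 0" by (rule semilinear_zero[OF f M.abelian_group_axioms])
  have "submodule R {x\<in>carrier M. f x = 0} M"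
    using M f0 by (auto simp: submodule_def semilinear_add[OF f] semilinear_smult[OF f])
  moreover have "G \<subseteq> {x\<in>carrier M. f x = 0}" using G zero by auto
  ultimately have "M.span G \<subseteq> {x\<in>carrier M. f x = 0}" by (intro M.span_is_subset)
  then show ?thesis using x by auto
qed

section \<open>Free modules\<close>

lemma free_module_simps:
  "zero (free_module R X) = (\<lambda>x\<in>X. \<zero>\<^bsub>R\<^esub>)"
  "add (free_module R X) c d = (\<lambda>x\<in>X. c x \<oplus>\<^bsub>R\<^esub> d x)"
  "smult (free_module R X) r c = (\<lambda>x\<in>X. r \<otimes>\<^bsub>R\<^esub> c x)"
  "c \<in> carrier (free_module R X) \<longleftrightarrow> c \<in> X \<rightarrow>\<^sub>E carrier R \<and> finite {x \<in> X. c x \<noteq> \<zero>\<^bsub>R\<^esub>}"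
  by (auto simp: free_module_def)

lemma free_module_is_module:
  fixes R :: "'r ring" (structure)
  assumes "cring R"
  shows "Module.module R (free_module R X)"
proof -
  interpret cring R by fact
  let ?F = "free_module R X"
  have val: "c x \<in> carrier R" if "c \<in> X \<rightarrow>\<^sub>E carrier R" "x \<in> X" for c x using that by auto
  have ext: "(\<lambda>x\<in>X. c x) = c" if "c \<in> X \<rightarrow>\<^sub>E carrier R" for c using that by auto
  have add: "c \<oplus>\<^bsub>?F\<^esub> d \<in> carrier ?F" if "c \<in> carrier ?F" "d \<in> carrier ?F" for c d
  proof -
    have "{x\<in>X. c x \<oplus> d x \<noteq> \<zero>} \<subseteq> {x\<in>X. c x \<noteq> \<zero>} \<union> {x\<in>X. d x \<noteq> \<zero>}" by auto
    then have "finite {x\<in>X. c x \<oplus> d x \<noteq> \<zero>}"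
      using that by (auto simp: free_module_simps intro: finite_subset)
    then show ?thesis using that by (auto simp: free_module_simps val cong: conj_cong)
  qed
  have smult: "r \<odot>\<^bsub>?F\<^esub> c \<in> carrier ?F" if "r \<in> carrier R" "c \<in> carrier ?F" for r c
  proof -
    have "{x\<in>X. r \<otimes> c x \<noteq> \<zero>} \<subseteq> {x\<in>X. c x \<noteq> \<zero>}" using that by auto
    then have "finite {x\<in>X. r \<otimes> c x \<noteq> \<zero>}"
      using that by (auto simp: free_module_simps intro: finite_subset)
    then show ?thesis using that by (auto simp: free_module_simps val cong: conj_cong)
  qed
  show ?thesis
  proof (rule moduleI)
    show "abelian_group ?F"
    proof (rule abelian_groupI)
      fix c assume c: "c \<in> carrier ?F"
      have "(\<ominus> \<one>) \<odot>\<^bsub>?F\<^esub> c \<oplus>\<^bsub>?F\<^esub> c = \<zero>\<^bsub>?F\<^esub>"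
        using c by (auto simp: free_module_simps val l_minus l_neg intro!: restrict_ext)
      then show "\<exists>y\<in>carrier ?F. y \<oplus>\<^bsub>?F\<^esub> c = \<zero>\<^bsub>?F\<^esub>"
        using smult[of "\<ominus> \<one>" c] c by blast
    next
      fix c assume "c \<in> carrier ?F"
      then show "\<zero>\<^bsub>?F\<^esub> \<oplus>\<^bsub>?F\<^esub> c = c"
        by (subst (2) ext[of c, symmetric]) (auto simp: free_module_simps val intro!: restrict_ext)
    next
      show "\<zero>\<^bsub>?F\<^esub> \<in> carrier ?F" by (auto simp: free_module_simps cong: conj_cong)
    qed (auto simp: add, auto simp: free_module_simps val a_ac intro!: restrict_ext)
  next
    fix c assume "c \<in> carrier ?F"
    then show "\<one> \<odot>\<^bsub>?F\<^esub> c = c"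
      by (subst (2) ext[of c, symmetric]) (auto simp: free_module_simps val intro!: restrict_ext)
  qed (auto simp: smult is_cring, auto simp: free_module_simps val l_distr r_distr m_assoc intro!: restrict_ext)
qed

lemma free_gen_carrier:
  assumes "cring R" "x \<in> X"
  shows "free_gen R X x \<in> carrier (free_module R X)"
proof -
  interpret cring R by fact
  have "{y\<in>X. free_gen R X x y \<noteq> \<zero>\<^bsub>R\<^esub>} \<subseteq> {x}" by (auto simp: free_gen_def)
  then have "finite {y\<in>X. free_gen R X x y \<noteq> \<zero>\<^bsub>R\<^esub>}" by (rule finite_subset) simp
  then show ?thesis by (auto simp: free_module_simps free_gen_def)
qed

definition eval_hom :: "'r ring \<Rightarrow> ('r \<Rightarrow> 'a::field) \<Rightarrow> bool" where
  "eval_hom R ev \<longleftrightarrow> ev \<one>\<^bsub>R\<^esub> = 1 \<and>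
     (\<forall>x\<in>carrier R. \<forall>y\<in>carrier R. ev (x \<oplus>\<^bsub>R\<^esub> y) = ev x + ev y \<and> ev (x \<otimes>\<^bsub>R\<^esub> y) = ev x * ev y)"

text \<open>Universal property of the free module along \<open>ev\<close>. Since \<open>ev\<close>
  sends zero to zero, the defining sum can be taken over any finite set that contains the support,
  which gives additivity.\<close>

lemma semilinear_free:
  fixes f :: "'x \<Rightarrow> 'a::field" and R :: "'r ring" (structure)
  assumes R: "cring R" and ev: "eval_hom R ev"
  shows "\<exists>F. semilinear R ev (free_module R X) F \<and> (\<forall>x\<in>X. F (free_gen R X x) = f x)"
proof -
  interpret cring R by fact
  let ?M = "free_module R X"
  have ev0: "ev \<zero> = 0" using ev zero_closed by (metis add_cancel_right_right eval_hom_def l_zero)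
  define F where "F c = (\<Sum>x\<in>{x\<in>X. c x \<noteq> \<zero>}. ev (c x) * f x)" for c
  have F: "F c = (\<Sum>x\<in>A. ev (c x) * f x)" if "finite A" "A \<subseteq> X" "{x\<in>X. c x \<noteq> \<zero>} \<subseteq> A" for c A
    unfolding F_def using that ev0 by (intro sum.mono_neutral_left) auto
  have "semilinear R ev ?M F"
    unfolding semilinear_def
  proof (intro conjI ballI)
    fix c d assume cd: "c \<in> carrier ?M" "d \<in> carrier ?M"
    let ?A = "{x\<in>X. c x \<noteq> \<zero>} \<union> {x\<in>X. d x \<noteq> \<zero>}"
    have fin: "finite ?A" and val: "\<And>x. x \<in> X \<Longrightarrow> c x \<in> carrier R" "\<And>x. x \<in> X \<Longrightarrow> d x \<in> carrier R"
      using cd by (auto simp: free_module_simps)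
    have "F (c \<oplus>\<^bsub>?M\<^esub> d) = (\<Sum>x\<in>?A. ev (c x \<oplus> d x) * f x)"
      using fin by (subst F[of ?A]) (auto simp: free_module_simps intro!: sum.cong)
    also have "\<dots> = (\<Sum>x\<in>?A. ev (c x) * f x + ev (d x) * f x)"
      using ev val by (intro sum.cong) (auto simp: eval_hom_def distrib_right)
    also have "\<dots> = F c + F d"
      using fin by (simp add: F[of ?A] sum.distrib)
    finally show "F (c \<oplus>\<^bsub>?M\<^esub> d) = F c + F d" .
  next
    fix r c assume rc: "r \<in> carrier R" "c \<in> carrier ?M"
    let ?A = "{x\<in>X. c x \<noteq> \<zero>}"
    have fin: "finite ?A" and val: "\<And>x. x \<in> X \<Longrightarrow> c x \<in> carrier R"
      using rc by (auto simp: free_module_simps)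
    have "F (r \<odot>\<^bsub>?M\<^esub> c) = (\<Sum>x\<in>?A. ev (r \<otimes> c x) * f x)"
      using fin rc by (subst F[of ?A]) (auto simp: free_module_simps intro!: sum.cong)
    also have "\<dots> = (\<Sum>x\<in>?A. ev r * (ev (c x) * f x))"
      using ev val rc by (intro sum.cong) (auto simp: eval_hom_def)
    also have "\<dots> = ev r * F c" by (simp add: F_def sum_distrib_left)
    finally show "F (r \<odot>\<^bsub>?M\<^esub> c) = ev r * F c" .
  qed
  moreover have "F (free_gen R X x) = f x" if "x \<in> X" for x
    using that ev by (subst F[of "{x}"]) (auto simp: free_gen_def eval_hom_def)
  ultimately show ?thesis by blast
qed

section \<open>Symmetric powers\<close>

lemma tuples_upd:
  "x \<in> tuples k M \<Longrightarrow> i < k \<Longrightarrow> a \<in> carrier M \<Longrightarrow> x(i := a) \<in> tuples k M"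
  by (auto simp: tuples_def PiE_iff extensional_def)

lemma tuples_comp:
  "x \<in> tuples k M \<Longrightarrow> \<sigma> permutes {..<k} \<Longrightarrow> x \<circ> \<sigma> \<in> tuples k M"
  by (auto simp: tuples_def PiE_iff extensional_def permutes_in_image permutes_not_in)
    (metis lessThan_iff permutes_in_image)

locale sym_power = Module.module R M for R :: "'r ring" (structure) and M :: "('r, 'm) module" (structure) +
  fixes k :: nat
begin

abbreviation "F \<equiv> free_module R (tuples k M)"
abbreviation "g \<equiv> free_gen R (tuples k M)"
abbreviation "S \<equiv> sym_module R k M"
abbreviation "sp \<equiv> sym_prod R k M"

lemma F_module: "Module.module R F"
  by (rule free_module_is_module) (rule R.is_cring)

interpretation F: Module.module R F by (rule F_module)

lemma g_closed [simp]: "x \<in> tuples k M \<Longrightarrow> g x \<in> carrier F"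
  by (rule free_gen_carrier[OF R.is_cring])

lemma relations_closed: "sym_relations R k M \<subseteq> carrier F"
  unfolding sym_relations_def Let_def
  by (auto intro!: F.minus_closed F.a_closed F.smult_closed g_closed tuples_upd tuples_comp
      M.a_closed smult_closed)

lemma quotient: "module_quotient R F (sym_kernel R k M)"
  using F_module relations_closed F.span_is_submodule[of "sym_relations R k M"]
  by (simp add: module_quotient_def module_quotient_axioms_def sym_kernel_def)

interpretation Q: module_quotient R F "sym_kernel R k M" by (rule quotient)

lemma sp_eq: "sp x = Q.cl (g x)"
  by (simp add: sym_prod_def)

lemma sym_is_module: "Module.module R S"
  using Q.quotient_is_module by (simp add: sym_module_def)

lemma sp_closed: "x \<in> tuples k M \<Longrightarrow> sp x \<in> carrier S"
  using Q.quotient_cl[of "g x"] by (simp add: sym_module_def sp_eq)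

lemma relation_in_kernel: "r \<in> sym_relations R k M \<Longrightarrow> r \<in> sym_kernel R k M"
  unfolding sym_kernel_def using F.in_own_span[OF relations_closed] by blast

lemma sp_add:
  assumes "x \<in> tuples k M" "i < k" "a \<in> carrier M" "b \<in> carrier M"
  shows "sp (x(i := a \<oplus>\<^bsub>M\<^esub> b)) = sp (x(i := a)) \<oplus>\<^bsub>S\<^esub> sp (x(i := b))"
proof -
  have "g (x(i := a \<oplus>\<^bsub>M\<^esub> b)) \<ominus>\<^bsub>F\<^esub> (g (x(i := a)) \<oplus>\<^bsub>F\<^esub> g (x(i := b))) \<in> sym_kernel R k M"
    using assms by (intro relation_in_kernel) (auto simp: sym_relations_def Let_def)
  then have "sp (x(i := a \<oplus>\<^bsub>M\<^esub> b)) = Q.cl (g (x(i := a)) \<oplus>\<^bsub>F\<^esub> g (x(i := b)))"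
    unfolding sp_eq using assms by (intro Q.cl_eqI) (auto simp: tuples_upd)
  also have "\<dots> = sp (x(i := a)) \<oplus>\<^bsub>S\<^esub> sp (x(i := b))"
    using assms by (simp add: sp_eq sym_module_def Q.quotient_add tuples_upd)
  finally show ?thesis .
qed

lemma sp_smult:
  assumes "x \<in> tuples k M" "i < k" "r \<in> carrier R" "a \<in> carrier M"
  shows "sp (x(i := r \<odot>\<^bsub>M\<^esub> a)) = r \<odot>\<^bsub>S\<^esub> sp (x(i := a))"
proof -
  have "g (x(i := r \<odot>\<^bsub>M\<^esub> a)) \<ominus>\<^bsub>F\<^esub> (r \<odot>\<^bsub>F\<^esub> g (x(i := a))) \<in> sym_kernel R k M"
    using assms by (intro relation_in_kernel) (auto simp: sym_relations_def Let_def)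
  then have "sp (x(i := r \<odot>\<^bsub>M\<^esub> a)) = Q.cl (r \<odot>\<^bsub>F\<^esub> g (x(i := a)))"
    unfolding sp_eq using assms by (intro Q.cl_eqI) (auto simp: tuples_upd)
  also have "\<dots> = r \<odot>\<^bsub>S\<^esub> sp (x(i := a))"
    using assms by (simp add: sp_eq sym_module_def Q.quotient_smult tuples_upd)
  finally show ?thesis .
qed

lemma sp_permute:
  assumes "x \<in> tuples k M" "\<sigma> permutes {..<k}"
  shows "sp (x \<circ> \<sigma>) = sp x"
proof -
  have "g (x \<circ> \<sigma>) \<ominus>\<^bsub>F\<^esub> g x \<in> sym_kernel R k M"
    using assms by (intro relation_in_kernel) (auto simp: sym_relations_def Let_def)
  then show ?thesis
    unfolding sp_eq using assms by (intro Q.cl_eqI) (auto simp: tuples_comp)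
qed

text \<open>Multilinearity in one slot. Applied slot after slot, it turns a product of sections into
  a combination of products of frame elements.\<close>

lemma sp_finsum:
  assumes x: "x \<in> tuples k M" "i < k" and A: "finite A"
    and w: "w \<in> A \<rightarrow> carrier R" and v: "v \<in> A \<rightarrow> carrier M"
  shows "sp (x(i := \<Oplus>\<^bsub>M\<^esub>a\<in>A. w a \<odot>\<^bsub>M\<^esub> v a)) = (\<Oplus>\<^bsub>S\<^esub>a\<in>A. w a \<odot>\<^bsub>S\<^esub> sp (x(i := v a)))"
proof -
  interpret S: Module.module R S by (rule sym_is_module)
  show ?thesis using A w v
  proof (induction A)
    case empty
    \<comment> \<open>Zero is written as a multiple by the scalar zero, since the relations speak of
      sums and multiples only.\<close>
    have "sp (x(i := \<zero>\<^bsub>M\<^esub>)) = sp (x(i := \<zero> \<odot>\<^bsub>M\<^esub> \<zero>\<^bsub>M\<^esub>))" by simp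
    also have "\<dots> = \<zero>\<^bsub>S\<^esub>"
      using x sp_closed[OF tuples_upd[OF x M.zero_closed]] by (subst sp_smult) auto
    finally show ?case unfolding M.finsum_empty S.finsum_empty .
  next
    case (insert a A)
    have wv: "w a \<in> carrier R" "v a \<in> carrier M" "w \<in> A \<rightarrow> carrier R" "v \<in> A \<rightarrow> carrier M"
      using insert.prems by auto
    have m: "w a \<odot>\<^bsub>M\<^esub> v a \<in> carrier M" "(\<lambda>a. w a \<odot>\<^bsub>M\<^esub> v a) \<in> A \<rightarrow> carrier M"
      using wv by (auto simp: Pi_iff)
    have s: "w a \<odot>\<^bsub>S\<^esub> sp (x(i := v a)) \<in> carrier S"
        "(\<lambda>a. w a \<odot>\<^bsub>S\<^esub> sp (x(i := v a))) \<in> A \<rightarrow> carrier S"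
      using wv x by (auto simp: Pi_iff intro!: S.smult_closed sp_closed tuples_upd)
    have "sp (x(i := \<Oplus>\<^bsub>M\<^esub>a\<in>insert a A. w a \<odot>\<^bsub>M\<^esub> v a)) =
        sp (x(i := w a \<odot>\<^bsub>M\<^esub> v a \<oplus>\<^bsub>M\<^esub> (\<Oplus>\<^bsub>M\<^esub>a\<in>A. w a \<odot>\<^bsub>M\<^esub> v a)))"
      using insert.hyps m by (simp add: M.finsum_insert)
    also have "\<dots> = w a \<odot>\<^bsub>S\<^esub> sp (x(i := v a)) \<oplus>\<^bsub>S\<^esub> (\<Oplus>\<^bsub>S\<^esub>a\<in>A. w a \<odot>\<^bsub>S\<^esub> sp (x(i := v a)))"
      unfolding insert.IH[OF wv(3,4), symmetric] sp_smult[OF x wv(1,2), symmetric]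
      using x m wv by (intro sp_add M.finsum_closed)
    also have "\<dots> = (\<Oplus>\<^bsub>S\<^esub>a\<in>insert a A. w a \<odot>\<^bsub>S\<^esub> sp (x(i := v a)))"
      using insert.hyps s by (simp add: S.finsum_insert)
    finally show ?case .
  qed
qed

text \<open>The product of the values of \<open>f\<close> over the slots is multilinear and
  symmetric, hence kills the relations. For a functional \<open>f\<close> on a fibre,
  \<open>h\<close> evaluates the symmetric power as polynomials of degree \<open>k\<close>, in any
  characteristic.\<close>

lemma semilinear_sym:
  fixes f :: "'m \<Rightarrow> 'a::field"
  assumes f: "semilinear R ev M f" and ev: "eval_hom R ev"
  shows "\<exists>h. semilinear R ev S h \<and> (\<forall>x\<in>tuples k M. h (sp x) = (\<Prod>i<k. f (x i)))"
proof -
  obtain h where h: "semilinear R ev F h" and gen: "\<And>x. x \<in> tuples k M \<Longrightarrow> h (g x) = (\<Prod>i<k. f (x i))"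
    using semilinear_free[OF R.is_cring ev, of "tuples k M" "\<lambda>x. \<Prod>i<k. f (x i)"] by blast
  have upd: "(\<Prod>j<k. f ((x(i := a)) j)) = f a * (\<Prod>j\<in>{..<k} - {i}. f (x j))" if "i < k" for x i a
  proof -
    have "(\<Prod>j<k. f ((x(i := a)) j)) = f a * (\<Prod>j\<in>{..<k} - {i}. f ((x(i := a)) j))"
      using that by (subst prod.remove[of _ i]) auto
    also have "(\<Prod>j\<in>{..<k} - {i}. f ((x(i := a)) j)) = (\<Prod>j\<in>{..<k} - {i}. f (x j))"
      by (intro prod.cong) auto
    finally show ?thesis .
  qed
  have perm_prod: "(\<Prod>i<k. f ((x \<circ> \<sigma>) i)) = (\<Prod>i<k. f (x i))" if "\<sigma> permutes {..<k}" for x \<sigma>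
    using prod.permute[OF that, of "\<lambda>i. f (x i)"] by (simp add: o_def)
  note hm = semilinear_minus[OF h F.abelian_group_axioms] semilinear_add[OF h] semilinear_smult[OF h]
  have rel: "h r = 0" if r: "r \<in> sym_relations R k M" for r
  proof -
    consider (add) x i a b where "x \<in> tuples k M" "i < k" "a \<in> carrier M" "b \<in> carrier M"
        "r = g (x(i := a \<oplus>\<^bsub>M\<^esub> b)) \<ominus>\<^bsub>F\<^esub> (g (x(i := a)) \<oplus>\<^bsub>F\<^esub> g (x(i := b)))"
      | (smult) x i c a where "x \<in> tuples k M" "i < k" "c \<in> carrier R" "a \<in> carrier M"
        "r = g (x(i := c \<odot>\<^bsub>M\<^esub> a)) \<ominus>\<^bsub>F\<^esub> (c \<odot>\<^bsub>F\<^esub> g (x(i := a)))"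
      | (perm) x \<sigma> where "x \<in> tuples k M" "\<sigma> permutes {..<k}" "r = g (x \<circ> \<sigma>) \<ominus>\<^bsub>F\<^esub> g x"
      using r unfolding sym_relations_def Let_def by blast
    then show ?thesis
    proof cases
      case add
      note t = tuples_upd[OF add(1,2)]
      have t3: "x(i := a \<oplus>\<^bsub>M\<^esub> b) \<in> tuples k M" "x(i := a) \<in> tuples k M" "x(i := b) \<in> tuples k M"
        using add t by auto
      note val = t3[THEN gen, unfolded upd[OF add(2)]]
      have "h r = h (g (x(i := a \<oplus>\<^bsub>M\<^esub> b))) - (h (g (x(i := a))) + h (g (x(i := b))))"
        unfolding add(5) using t3 by (subst hm(1), simp, simp, subst hm(2)) auto
      then show ?thesis
        unfolding val semilinear_add[OF f add(3,4)] by (simp add: distrib_right)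
    next
      case smult
      have t2: "x(i := c \<odot>\<^bsub>M\<^esub> a) \<in> tuples k M" "x(i := a) \<in> tuples k M"
        using smult by (auto intro!: tuples_upd)
      note val = t2[THEN gen, unfolded upd[OF smult(2)]]
      have "h r = h (g (x(i := c \<odot>\<^bsub>M\<^esub> a))) - ev c * h (g (x(i := a)))"
        unfolding smult(5) using t2 smult(3) by (subst hm(1), simp, simp, subst hm(3)) auto
      then show ?thesis
        unfolding val semilinear_smult[OF f smult(3,4)] by simp
    next
      case perm
      then have t2: "x \<circ> \<sigma> \<in> tuples k M" "x \<in> tuples k M" by (auto intro: tuples_comp)
      have "h r = h (g (x \<circ> \<sigma>)) - h (g x)"
        unfolding perm(3) using t2 by (intro hm(1)) auto
      also have "\<dots> = (\<Prod>i<k. f ((x \<circ> \<sigma>) i)) - (\<Prod>i<k. f (x i))"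
        unfolding t2[THEN gen] ..
      finally show ?thesis unfolding perm_prod[OF perm(2)] by simp
    qed
  qed
  have "h x = 0" if "x \<in> sym_kernel R k M" for x
    using semilinear_span_zero[OF h F_module relations_closed rel] that by (simp add: sym_kernel_def)
  then obtain H where "semilinear R ev S H" "\<forall>x\<in>carrier F. H (Q.cl x) = h x"
    using Q.semilinear_quotient[OF h] unfolding sym_module_def by blast
  then show ?thesis using gen by (auto simp: sp_eq)
qed

end

section \<open>Tensor products\<close>

locale tensor_product =
  M: Module.module R M + N: Module.module R N
  for R :: "'r ring" (structure) and M :: "('r, 'm) module" and N :: "('r, 'n) module"
begin

abbreviation "F \<equiv> free_module R (carrier M \<times> carrier N)"
abbreviation "g \<equiv> free_gen R (carrier M \<times> carrier N)"
abbreviation "T \<equiv> tensor_module R M N"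
abbreviation "tp \<equiv> tensor_prod R M N"

lemma F_module: "Module.module R F"
  by (rule free_module_is_module) (rule M.R.is_cring)

interpretation F: Module.module R F by (rule F_module)

lemma g_closed [simp]: "a \<in> carrier M \<Longrightarrow> b \<in> carrier N \<Longrightarrow> g (a, b) \<in> carrier F"
  by (rule free_gen_carrier[OF M.R.is_cring]) auto

lemma relations_closed: "tensor_relations R M N \<subseteq> carrier F"
  unfolding tensor_relations_def Let_def
  by (auto intro!: F.minus_closed F.a_closed F.smult_closed)

lemma quotient: "module_quotient R F (tensor_kernel R M N)"
  using F_module relations_closed F.span_is_submodule[of "tensor_relations R M N"]
  by (simp add: module_quotient_def module_quotient_axioms_def tensor_kernel_def)

interpretation Q: module_quotient R F "tensor_kernel R M N" by (rule quotient)

lemma tp_eq: "tp a b = Q.cl (g (a, b))"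
  by (simp add: tensor_prod_def)

lemma tensor_is_module: "Module.module R T"
  using Q.quotient_is_module by (simp add: tensor_module_def)

lemma tp_closed: "a \<in> carrier M \<Longrightarrow> b \<in> carrier N \<Longrightarrow> tp a b \<in> carrier T"
  using Q.quotient_cl[of "g (a, b)"] by (simp add: tensor_module_def tp_eq)

lemma relation_in_kernel: "r \<in> tensor_relations R M N \<Longrightarrow> r \<in> tensor_kernel R M N"
  unfolding tensor_kernel_def using F.in_own_span[OF relations_closed] by blast

lemma tp_add_left:
  assumes "a \<in> carrier M" "a' \<in> carrier M" "b \<in> carrier N"
  shows "tp (a \<oplus>\<^bsub>M\<^esub> a') b = tp a b \<oplus>\<^bsub>T\<^esub> tp a' b"
proof -
  have "g (a \<oplus>\<^bsub>M\<^esub> a', b) \<ominus>\<^bsub>F\<^esub> (g (a, b) \<oplus>\<^bsub>F\<^esub> g (a', b)) \<in> tensor_kernel R M N"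
    using assms by (intro relation_in_kernel) (auto simp: tensor_relations_def Let_def)
  then have "tp (a \<oplus>\<^bsub>M\<^esub> a') b = Q.cl (g (a, b) \<oplus>\<^bsub>F\<^esub> g (a', b))"
    unfolding tp_eq using assms by (intro Q.cl_eqI) auto
  then show ?thesis using assms by (simp add: tp_eq tensor_module_def Q.quotient_add)
qed

lemma tp_smult_left:
  assumes "r \<in> carrier R" "a \<in> carrier M" "b \<in> carrier N"
  shows "tp (r \<odot>\<^bsub>M\<^esub> a) b = r \<odot>\<^bsub>T\<^esub> tp a b"
proof -
  have "g (r \<odot>\<^bsub>M\<^esub> a, b) \<ominus>\<^bsub>F\<^esub> (r \<odot>\<^bsub>F\<^esub> g (a, b)) \<in> tensor_kernel R M N"
    using assms by (intro relation_in_kernel) (auto simp: tensor_relations_def Let_def)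
  then have "tp (r \<odot>\<^bsub>M\<^esub> a) b = Q.cl (r \<odot>\<^bsub>F\<^esub> g (a, b))"
    unfolding tp_eq using assms by (intro Q.cl_eqI) auto
  then show ?thesis using assms by (simp add: tp_eq tensor_module_def Q.quotient_smult)
qed

lemma tp_smult_right:
  assumes "r \<in> carrier R" "a \<in> carrier M" "b \<in> carrier N"
  shows "tp a (r \<odot>\<^bsub>N\<^esub> b) = r \<odot>\<^bsub>T\<^esub> tp a b"
proof -
  have "g (a, r \<odot>\<^bsub>N\<^esub> b) \<ominus>\<^bsub>F\<^esub> (r \<odot>\<^bsub>F\<^esub> g (a, b)) \<in> tensor_kernel R M N"
    using assms by (intro relation_in_kernel) (auto simp: tensor_relations_def Let_def)
  then have "tp a (r \<odot>\<^bsub>N\<^esub> b) = Q.cl (r \<odot>\<^bsub>F\<^esub> g (a, b))"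
    unfolding tp_eq using assms by (intro Q.cl_eqI) auto
  then show ?thesis using assms by (simp add: tp_eq tensor_module_def Q.quotient_smult)
qed

lemma tp_finsum_left:
  assumes "finite A" "v \<in> A \<rightarrow> carrier M" "b \<in> carrier N"
  shows "tp (finsum M v A) b = (\<Oplus>\<^bsub>T\<^esub>a\<in>A. tp (v a) b)"
proof -
  interpret T: Module.module R T by (rule tensor_is_module)
  show ?thesis using assms
  proof (induction A)
    case empty
    have "tp \<zero>\<^bsub>M\<^esub> b = tp (\<zero>\<^bsub>R\<^esub> \<odot>\<^bsub>M\<^esub> \<zero>\<^bsub>M\<^esub>) b" by simp
    also have "\<dots> = \<zero>\<^bsub>T\<^esub>"
      using empty tp_closed by (subst tp_smult_left) auto
    finally show ?case by simp
  next
    case (insert a A)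
    have 1: "v a \<in> carrier M" "v \<in> A \<rightarrow> carrier M" using insert.prems by auto
    have 2: "(\<lambda>a. tp (v a) b) \<in> A \<rightarrow> carrier T" "tp (v a) b \<in> carrier T"
      using 1 insert.prems by (auto simp: Pi_iff intro!: tp_closed)
    show ?case
      using insert 1 2 by (simp add: M.finsum_insert T.finsum_insert tp_add_left M.finsum_closed)
  qed
qed

text \<open>The product of the two values is bilinear along \<open>ev\<close>, so the four families
  of relations are killed.\<close>

lemma semilinear_tensor:
  fixes f :: "'m \<Rightarrow> 'a::field"
  assumes f: "semilinear R ev M f" and f': "semilinear R ev N f'" and ev: "eval_hom R ev"
  shows "\<exists>h. semilinear R ev T h \<and> (\<forall>a\<in>carrier M. \<forall>b\<in>carrier N. h (tp a b) = f a * f' b)"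
proof -
  obtain h where h: "semilinear R ev F h"
    and gen: "\<And>a b. a \<in> carrier M \<Longrightarrow> b \<in> carrier N \<Longrightarrow> h (g (a, b)) = f a * f' b"
    using semilinear_free[OF M.R.is_cring ev, of "carrier M \<times> carrier N" "\<lambda>(a, b). f a * f' b"] by auto
  note hm = semilinear_minus[OF h F.abelian_group_axioms] semilinear_add[OF h] semilinear_smult[OF h]
  have rel: "h r = 0" if r: "r \<in> tensor_relations R M N" for r
    using r unfolding tensor_relations_def Let_def
    by (auto simp: hm gen semilinear_add[OF f] semilinear_smult[OF f]
        semilinear_add[OF f'] semilinear_smult[OF f'] algebra_simps)
  have "h x = 0" if "x \<in> tensor_kernel R M N" for x
    using semilinear_span_zero[OF h F_module relations_closed rel] that by (simp add: tensor_kernel_def)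
  then obtain H where "semilinear R ev T H" "\<forall>x\<in>carrier F. H (Q.cl x) = h x"
    using Q.semilinear_quotient[OF h] unfolding tensor_module_def by blast
  then show ?thesis using gen by (auto simp: tp_eq)
qed

end

section \<open>Homogeneous fractions and points\<close>

definition mdeg :: "(nat \<Rightarrow>\<^sub>0 nat) \<Rightarrow> nat" where
  "mdeg m = (\<Sum>i\<in>Poly_Mapping.keys m. Poly_Mapping.lookup m i)"

lemma mdeg_superset:
  "finite A \<Longrightarrow> Poly_Mapping.keys m \<subseteq> A \<Longrightarrow> mdeg m = (\<Sum>i\<in>A. Poly_Mapping.lookup m i)"
  unfolding mdeg_def by (intro sum.mono_neutral_left) (auto simp: in_keys_iff)

lemma mdeg_add: "mdeg (m + m') = mdeg m + mdeg m'"
proof -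
  let ?A = "Poly_Mapping.keys m \<union> Poly_Mapping.keys m'"
  have "Poly_Mapping.keys (m + m') \<subseteq> ?A" by (rule Poly_Mapping.keys_add)
  then show ?thesis by (simp add: mdeg_superset[of ?A] lookup_add sum.distrib)
qed

lemma homogeneous_iff:
  "f \<in> homogeneous k d \<longleftrightarrow> f \<in> mpoly_carrier k \<and> (\<forall>m\<in>Poly_Mapping.keys f. mdeg m = d)"
  by (auto simp: homogeneous_def mdeg_def)

lemma mpoly_carrier_zero [simp]: "0 \<in> mpoly_carrier k"
  and mpoly_carrier_const [simp]: "Poly_Mapping.single 0 c \<in> mpoly_carrier k"
  and mpoly_carrier_mvar [simp]: "i \<le> k \<Longrightarrow> mvar i \<in> mpoly_carrier k"
  by (auto simp: mpoly_carrier_def mvar_def)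

lemma mpoly_carrier_one [simp]: "1 \<in> mpoly_carrier k"
  using mpoly_carrier_const[of 1 k] by simp

lemma mpoly_carrier_add: "f \<in> mpoly_carrier k \<Longrightarrow> h \<in> mpoly_carrier k \<Longrightarrow> f + h \<in> mpoly_carrier k"
  using Poly_Mapping.keys_add[of f h] by (auto simp: mpoly_carrier_def)

lemma mpoly_carrier_mult:
  assumes "f \<in> mpoly_carrier k" "h \<in> mpoly_carrier k"
  shows "f * h \<in> mpoly_carrier k"
  unfolding mpoly_carrier_def
proof safe
  fix m i assume m: "m \<in> Poly_Mapping.keys (f * h)" and i: "i \<in> Poly_Mapping.keys m"
  obtain a b where "m = a + b" "a \<in> Poly_Mapping.keys f" "b \<in> Poly_Mapping.keys h"
    using m Poly_Mapping.keys_mult[of f h] by blast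
  then show "i \<le> k" using i assms Poly_Mapping.keys_add[of a b] unfolding mpoly_carrier_def by blast
qed

lemma mpoly_carrier_uminus: "f \<in> mpoly_carrier k \<Longrightarrow> - f \<in> mpoly_carrier k"
  by (auto simp: mpoly_carrier_def in_keys_iff)

lemma homogeneous_carrier: "f \<in> homogeneous k d \<Longrightarrow> f \<in> mpoly_carrier k"
  by (simp add: homogeneous_iff)

lemma homogeneous_zero [simp]: "0 \<in> homogeneous k d"
  and homogeneous_const [simp]: "Poly_Mapping.single 0 c \<in> homogeneous k 0"
  and homogeneous_mvar [simp]: "i \<le> k \<Longrightarrow> mvar i \<in> homogeneous k (Suc 0)"
  by (auto simp: homogeneous_iff mpoly_carrier_def mvar_def mdeg_def)

lemma homogeneous_one [simp]: "1 \<in> homogeneous k 0"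
  using homogeneous_const[of 1 k] by simp

lemma homogeneous_add:
  "f \<in> homogeneous k d \<Longrightarrow> h \<in> homogeneous k d \<Longrightarrow> f + h \<in> homogeneous k d"
  using Poly_Mapping.keys_add[of f h] by (auto simp: homogeneous_iff mpoly_carrier_add)

lemma homogeneous_uminus: "f \<in> homogeneous k d \<Longrightarrow> - f \<in> homogeneous k d"
  by (auto simp: homogeneous_iff mpoly_carrier_uminus in_keys_iff)

lemma homogeneous_sum:
  "(\<And>x. x \<in> A \<Longrightarrow> f x \<in> homogeneous k d) \<Longrightarrow> (\<Sum>x\<in>A. f x) \<in> homogeneous k d"
  by (induction A rule: infinite_finite_induct) (auto intro: homogeneous_add)

lemma homogeneous_mult:
  assumes "f \<in> homogeneous k d" "h \<in> homogeneous k d'"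
  shows "f * h \<in> homogeneous k (d + d')"
  using assms Poly_Mapping.keys_mult[of f h]
  by (auto simp: homogeneous_iff mpoly_carrier_mult mdeg_add subset_iff)

lemma homogeneous_power: "f \<in> homogeneous k d \<Longrightarrow> f ^ j \<in> homogeneous k (j * d)"
  by (induction j) (auto intro: homogeneous_mult)

section \<open>The polynomial ring and its homogeneous primes\<close>

lemma mpoly_ring_cring: "cring (mpoly_ring k :: 'a::field mpoly ring)"
proof (rule cringI)
  show "abelian_group (mpoly_ring k :: 'a mpoly ring)"
  proof (rule abelian_groupI)
    fix x :: "'a mpoly" assume "x \<in> carrier (mpoly_ring k)"
    then show "\<exists>y\<in>carrier (mpoly_ring k). y \<oplus>\<^bsub>mpoly_ring k\<^esub> x = \<zero>\<^bsub>mpoly_ring k\<^esub>"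
      by (intro bexI[of _ "- x"]) (auto simp: mpoly_ring_def mpoly_carrier_uminus)
  qed (auto simp: mpoly_ring_def mpoly_carrier_add add_ac)
  show "comm_monoid (mpoly_ring k :: 'a mpoly ring)"
    by (rule comm_monoidI) (auto simp: mpoly_ring_def mpoly_carrier_mult mult_ac)
qed (auto simp: mpoly_ring_def distrib_right)

lemma mpoly_ring_simps [simp]:
  "carrier (mpoly_ring k) = mpoly_carrier k" "\<zero>\<^bsub>mpoly_ring k\<^esub> = 0" "\<one>\<^bsub>mpoly_ring k\<^esub> = 1"
  "x \<oplus>\<^bsub>mpoly_ring k\<^esub> y = x + y" "x \<otimes>\<^bsub>mpoly_ring k\<^esub> y = x * y"
  by (simp_all add: mpoly_ring_def)

lemma proj_pointD:
  assumes "p \<in> proj_points k"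
  shows "p \<subseteq> mpoly_carrier k" "0 \<in> p" "1 \<notin> p"
    "a \<in> p \<Longrightarrow> b \<in> p \<Longrightarrow> a + b \<in> p"
    "a \<in> p \<Longrightarrow> c \<in> mpoly_carrier k \<Longrightarrow> c * a \<in> p"
    "c \<in> mpoly_carrier k \<Longrightarrow> c' \<in> mpoly_carrier k \<Longrightarrow> c * c' \<in> p \<Longrightarrow> c \<in> p \<or> c' \<in> p"
proof -
  interpret primeideal p "mpoly_ring k" using assms by (simp add: proj_points_def)
  show "p \<subseteq> mpoly_carrier k" using a_subset by simp
  show "0 \<in> p" using additive_subgroup.zero_closed[OF additive_subgroup_axioms] by simp
  show "1 \<notin> p" using I_notcarr one_imp_carrier by auto
  show "a \<in> p \<Longrightarrow> b \<in> p \<Longrightarrow> a + b \<in> p" using additive_subgroup.a_closed[OF additive_subgroup_axioms, of a b] by simp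
  show "a \<in> p \<Longrightarrow> c \<in> mpoly_carrier k \<Longrightarrow> c * a \<in> p" using I_l_closed[of a c] by simp
  show "c \<in> mpoly_carrier k \<Longrightarrow> c' \<in> mpoly_carrier k \<Longrightarrow> c * c' \<in> p \<Longrightarrow> c \<in> p \<or> c' \<in> p"
    using I_prime[of c c'] by simp
qed

lemma proj_point_sum:
  assumes "p \<in> proj_points k" "\<And>x. x \<in> A \<Longrightarrow> f x \<in> p"
  shows "(\<Sum>x\<in>A. f x) \<in> p"
  using assms(2) by (induction A rule: infinite_finite_induct) (auto intro: proj_pointD[OF assms(1)])

text \<open>The predicate \<open>P\<close> on denominators covers both the stalks of \<open>\<O>(d)\<close> and its sections over
  basic open sets.\<close>

definition fracs :: "nat \<Rightarrow> ('a::field mpoly \<Rightarrow> bool) \<Rightarrow> int \<Rightarrow> 'a mpoly fract set" where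
  "fracs k P d = {Fract a f | a f e e'. f \<in> homogeneous k e \<and> P f \<and> a \<in> homogeneous k e' \<and>
     int e' = int e + d}"

lemma twist_stalk_eq: "twist_stalk k d p = fracs k (\<lambda>f. f \<notin> p) d"
  by (auto simp: twist_stalk_def fracs_def)

lemma fracsI:
  "f \<in> homogeneous k e \<Longrightarrow> P f \<Longrightarrow> a \<in> homogeneous k e' \<Longrightarrow> int e' = int e + d \<Longrightarrow>
    Fract a f \<in> fracs k P d"
  by (auto simp: fracs_def)

lemma fracs_mono: "(\<And>f. P f \<Longrightarrow> P' f) \<Longrightarrow> fracs k P d \<subseteq> fracs k P' d"
  unfolding fracs_def by blast

section \<open>Rings and modules of homogeneous fractions\<close>

text \<open>What the denominators at a point and those on a set of points have in common. The linear
  form is there for negative degrees: in \<open>fracs k P d\<close> with \<open>d\<close> negative,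
  even 0 needs a denominator of degree at least \<open>- d\<close>, and a power of the linear form
  provides it.\<close>

locale denominators =
  fixes k :: nat and P :: "'a::field mpoly \<Rightarrow> bool"
  assumes one: "P 1"
    and mult: "f \<in> mpoly_carrier k \<Longrightarrow> h \<in> mpoly_carrier k \<Longrightarrow> P f \<Longrightarrow> P h \<Longrightarrow> P (f * h)"
    and nonzero: "P f \<Longrightarrow> f \<noteq> 0"
    and linear: "\<exists>h\<in>homogeneous k 1. P h"
begin

lemma power: "h \<in> mpoly_carrier k \<Longrightarrow> P h \<Longrightarrow> h ^ j \<in> mpoly_carrier k \<and> P (h ^ j)"
  by (induction j) (auto simp: one mult mpoly_carrier_mult)

lemma fracs_const [simp]: "const_fract c \<in> fracs k P 0"
  unfolding const_fract_def by (rule fracsI[of _ _ 0 _ _ 0]) (auto simp: one)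

lemma const_fract_0_1: "const_fract (0::'a) = 0" "const_fract (1::'a) = 1"
  by (simp_all add: const_fract_def Zero_fract_def One_fract_def)

lemma fracs_one [simp]: "1 \<in> fracs k P 0"
  using fracs_const[of 1] by (simp add: const_fract_0_1)

lemma fracs_mult:
  assumes "x \<in> fracs k P d" "y \<in> fracs k P d'"
  shows "x * y \<in> fracs k P (d + d')"
proof -
  obtain a f e e' where x: "x = Fract a f" "f \<in> homogeneous k e" "P f" "a \<in> homogeneous k e'" "int e' = int e + d"
    using assms(1) by (auto simp: fracs_def)
  obtain b h u u' where y: "y = Fract b h" "h \<in> homogeneous k u" "P h" "b \<in> homogeneous k u'" "int u' = int u + d'"
    using assms(2) by (auto simp: fracs_def)
  have "Fract (a * b) (f * h) \<in> fracs k P (d + d')"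
    using x y by (intro fracsI[OF homogeneous_mult _ homogeneous_mult] mult homogeneous_carrier) auto
  then show ?thesis using x y by simp
qed

lemma fracs_zero [simp]: "0 \<in> fracs k P d"
proof (cases "d \<ge> 0")
  case True
  then have "Fract 0 1 \<in> fracs k P d" by (intro fracsI[of _ _ 0 _ _ "nat d"]) (auto simp: one)
  then show ?thesis by (simp add: Zero_fract_def)
next
  case False
  obtain h where h: "h \<in> homogeneous k 1" "P h" using linear by blast
  then have "Fract 0 (h ^ nat (- d)) \<in> fracs k P d"
    using False power[of h "nat (- d)"] homogeneous_carrier[OF h(1)]
    by (intro fracsI[OF homogeneous_power[OF h(1)], of _ _ _ 0]) auto
  then show ?thesis by (simp add: fract_collapse)
qed

lemma fracs_add:
  assumes "x \<in> fracs k P d" "y \<in> fracs k P d"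
  shows "x + y \<in> fracs k P d"
proof -
  obtain a f e e' where x: "x = Fract a f" "f \<in> homogeneous k e" "P f" "a \<in> homogeneous k e'" "int e' = int e + d"
    using assms(1) by (auto simp: fracs_def)
  obtain b h u u' where y: "y = Fract b h" "h \<in> homogeneous k u" "P h" "b \<in> homogeneous k u'" "int u' = int u + d"
    using assms(2) by (auto simp: fracs_def)
  have e: "e' + u = e + u'" using x(5) y(5) by linarith
  have "a * h + f * b \<in> homogeneous k (e' + u)"
    using x y homogeneous_mult[of a k e' h u] homogeneous_mult[of f k e b u'] e
    by (auto intro: homogeneous_add)
  then have "Fract (a * h + f * b) (f * h) \<in> fracs k P d"
    using x y by (intro fracsI[OF homogeneous_mult]) (auto intro!: mult homogeneous_carrier)
  then show ?thesis using x y nonzero by (simp add: mult.commute)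
qed

lemma fracs_uminus: "x \<in> fracs k P d \<Longrightarrow> - x \<in> fracs k P d"
  using homogeneous_uminus unfolding fracs_def by fastforce

lemma fracs_sum: "(\<And>i. i \<in> A \<Longrightarrow> f i \<in> fracs k P d) \<Longrightarrow> sum f A \<in> fracs k P d"
  by (induction A rule: infinite_finite_induct) (auto intro: fracs_add)

lemma fracs_linear_power:
  assumes "h \<in> homogeneous k 1" "P h"
  shows "Fract 1 (h ^ j) \<in> fracs k P (- int j)" "Fract (h ^ j) 1 \<in> fracs k P (int j)"
  using power[OF homogeneous_carrier[OF assms(1)] assms(2), of j] homogeneous_power[OF assms(1), of j]
  by (auto intro!: fracsI[of "h ^ j" k j _ 1 0] fracsI[of 1 k 0 _ "h ^ j" j] simp: one)

end

definition frac_ring :: "nat \<Rightarrow> ('a::field mpoly \<Rightarrow> bool) \<Rightarrow> 'a mpoly fract ring" where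
  "frac_ring k P =
    \<lparr>carrier = fracs k P 0, monoid.mult = (*), one = 1, zero = 0, add = (+)\<rparr>"

definition frac_module ::
  "nat \<Rightarrow> ('a::field mpoly \<Rightarrow> bool) \<Rightarrow> int \<Rightarrow> ('a mpoly fract, 'a mpoly fract) module" where
  "frac_module k P d =
    \<lparr>carrier = fracs k P d, monoid.mult = undefined, one = undefined, zero = 0, add = (+), smult = (*)\<rparr>"

definition frac_poly_module ::
  "nat \<Rightarrow> ('a::field mpoly \<Rightarrow> bool) \<Rightarrow> nat \<Rightarrow> int \<Rightarrow> ('a mpoly fract, 'a mpoly fract poly) module" where
  "frac_poly_module k P m d =
    \<lparr>carrier = {p. degree p \<le> m \<and> (\<forall>i. coeff p i \<in> fracs k P d)}, monoid.mult = undefined,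
   one = undefined, zero = 0, add = (+), smult = Polynomial.smult\<rparr>"

context denominators
begin

lemma frac_ring_cring: "cring (frac_ring k P)"
proof (rule cringI)
  show "abelian_group (frac_ring k P)"
  proof (rule abelian_groupI)
    fix x assume "x \<in> carrier (frac_ring k P)"
    then show "\<exists>y\<in>carrier (frac_ring k P). y \<oplus>\<^bsub>frac_ring k P\<^esub> x = \<zero>\<^bsub>frac_ring k P\<^esub>"
      by (intro bexI[of _ "- x"]) (auto simp: frac_ring_def fracs_uminus)
  qed (auto simp: frac_ring_def fracs_add add_ac)
  show "comm_monoid (frac_ring k P)"
    using fracs_mult[of _ 0 _ 0] by (intro comm_monoidI) (auto simp: frac_ring_def mult_ac)
qed (auto simp: frac_ring_def distrib_right)

lemma frac_module_is_module: "Module.module (frac_ring k P) (frac_module k P d)"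
proof (rule moduleI)
  show "abelian_group (frac_module k P d)"
  proof (rule abelian_groupI)
    fix x assume "x \<in> carrier (frac_module k P d)"
    then show "\<exists>y\<in>carrier (frac_module k P d). y \<oplus>\<^bsub>frac_module k P d\<^esub> x = \<zero>\<^bsub>frac_module k P d\<^esub>"
      by (intro bexI[of _ "- x"]) (auto simp: frac_module_def fracs_uminus)
  qed (auto simp: frac_module_def fracs_add add_ac)
qed (use fracs_mult[of _ 0 _ d] in
    \<open>auto simp: frac_ring_cring, auto simp: frac_ring_def frac_module_def algebra_simps\<close>)

lemma frac_poly_module_is_module: "Module.module (frac_ring k P) (frac_poly_module k P m d)"
proof (rule moduleI)
  show "abelian_group (frac_poly_module k P m d)"
  proof (rule abelian_groupI)
    fix x assume "x \<in> carrier (frac_poly_module k P m d)"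
    then show "\<exists>y\<in>carrier (frac_poly_module k P m d).
        y \<oplus>\<^bsub>frac_poly_module k P m d\<^esub> x = \<zero>\<^bsub>frac_poly_module k P m d\<^esub>"
      by (intro bexI[of _ "- x"]) (auto simp: frac_poly_module_def fracs_uminus)
  qed (auto simp: frac_poly_module_def fracs_add add_ac degree_add_le)
qed (use fracs_mult[of _ 0 _ d] in
    \<open>auto simp: frac_ring_cring, auto simp: frac_ring_def frac_poly_module_def algebra_simps smult_add_left
      smult_add_right intro: order_trans[OF degree_smult_le]\<close>)

end

section \<open>Evaluation of fractions\<close>

definition fev :: "(nat \<Rightarrow> 'a::field) \<Rightarrow> 'a mpoly fract \<Rightarrow> 'a" where
  "fev g x = (THE v. \<exists>a f. x = Fract a f \<and> meval g f \<noteq> 0 \<and> v = meval g a / meval g f)"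

text \<open>Two representations of a fraction cross-multiply to an identity of polynomials, which
  evaluation respects; so the value does not depend on the representation.\<close>

lemma fev_Fract:
  assumes "meval g f \<noteq> 0"
  shows "fev g (Fract a f) = meval g a / meval g f"
  unfolding fev_def
proof (rule the_equality)
  show "\<exists>a' f'. Fract a f = Fract a' f' \<and> meval g f' \<noteq> 0 \<and>
      meval g a / meval g f = meval g a' / meval g f'"
    using assms by blast
next
  fix v assume "\<exists>a' f'. Fract a f = Fract a' f' \<and> meval g f' \<noteq> 0 \<and> v = meval g a' / meval g f'"
  then obtain a' f' where *: "Fract a f = Fract a' f'" "meval g f' \<noteq> 0" "v = meval g a' / meval g f'"
    by blast
  have "f \<noteq> 0" "f' \<noteq> 0" using assms *(2) by auto
  then have "meval g (a * f') = meval g (a' * f)" using *(1) by (simp add: eq_fract)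
  then show "v = meval g a / meval g f"
    using assms * by (simp add: meval_mult frac_eq_eq)
qed

lemma fev_const_fract [simp]: "fev g (const_fract c) = c"
  unfolding const_fract_def by (subst fev_Fract) auto

text \<open>The local ring of affine space at \<open>g\<close>, with no condition of homogeneity. It
  contains the stalks of all twists at the point \<open>pt k g\<close>, so evaluation can be handled
  without regard to degrees.\<close>

definition regular_at :: "(nat \<Rightarrow> 'a::field) \<Rightarrow> 'a mpoly fract set" where
  "regular_at g = {Fract a f | a f. meval g f \<noteq> 0}"

lemma fev_add: "x \<in> regular_at g \<Longrightarrow> y \<in> regular_at g \<Longrightarrow> fev g (x + y) = fev g x + fev g y"
  and regular_add: "x \<in> regular_at g \<Longrightarrow> y \<in> regular_at g \<Longrightarrow> x + y \<in> regular_at g"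
  and fev_mult: "x \<in> regular_at g \<Longrightarrow> y \<in> regular_at g \<Longrightarrow> fev g (x * y) = fev g x * fev g y"
  and regular_mult: "x \<in> regular_at g \<Longrightarrow> y \<in> regular_at g \<Longrightarrow> x * y \<in> regular_at g"
proof -
  assume "x \<in> regular_at g" "y \<in> regular_at g"
  then obtain a f b h where *: "x = Fract a f" "meval g f \<noteq> 0" "y = Fract b h" "meval g h \<noteq> 0"
    by (auto simp: regular_at_def)
  then have nz: "f \<noteq> 0" "h \<noteq> 0" by auto
  have s: "x + y = Fract (a * h + b * f) (f * h)" "x * y = Fract (a * b) (f * h)"
    using * nz by simp_all
  have fh: "meval g (f * h) \<noteq> 0" using * by (simp add: meval_mult)
  show "x + y \<in> regular_at g" "x * y \<in> regular_at g" using s fh by (auto simp: regular_at_def)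
  show "fev g (x + y) = fev g x + fev g y" "fev g (x * y) = fev g x * fev g y"
    unfolding s fev_Fract[OF fh] using * by (simp_all add: fev_Fract meval_add meval_mult field_simps)
qed

lemma regular_const [simp]: "const_fract c \<in> regular_at g"
  unfolding regular_at_def const_fract_def by (intro CollectI exI[of _ "Poly_Mapping.single 0 c"] exI[of _ 1] conjI) auto

lemma regular_0_1 [simp]: "0 \<in> regular_at g" "1 \<in> regular_at g"
  using regular_const[of 0 g] regular_const[of 1 g]
  by (simp_all add: const_fract_def Zero_fract_def[symmetric] One_fract_def[symmetric])

lemma fev_0_1 [simp]: "fev g 0 = 0" "fev g 1 = 1"
  using fev_const_fract[of g 0] fev_const_fract[of g 1]
  by (simp_all add: const_fract_def Zero_fract_def[symmetric] One_fract_def[symmetric])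

lemma fev_sum: "(\<And>x. x \<in> A \<Longrightarrow> f x \<in> regular_at g) \<Longrightarrow>
  sum f A \<in> regular_at g \<and> fev g (sum f A) = (\<Sum>x\<in>A. fev g (f x))"
  by (induction A rule: infinite_finite_induct) (auto simp: fev_add regular_add)

section \<open>Closed points\<close>

text \<open>Vanishing on the whole line spanned by \<open>g\<close> makes this ideal homogeneous
  over an infinite field; vanishing at \<open>g\<close> alone would not. For homogeneous polynomials
  the two conditions agree.\<close>

definition pt :: "nat \<Rightarrow> (nat \<Rightarrow> 'a::field) \<Rightarrow> 'a mpoly set" where
  "pt k g = {f \<in> mpoly_carrier k. \<forall>c. meval (\<lambda>i. c * g i) f = 0}"

lemma homogeneous_in_pt: "f \<in> homogeneous k e \<Longrightarrow> f \<in> pt k g \<longleftrightarrow> meval g f = 0"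
  using meval_homogeneous[of f k e 1 g] meval_homogeneous[of f k e _ g]
  by (auto simp: pt_def homogeneous_carrier)

definition hcomp :: "nat \<Rightarrow> 'a::field mpoly \<Rightarrow> 'a mpoly" where
  "hcomp d f = (\<Sum>m\<in>{m\<in>Poly_Mapping.keys f. mdeg m = d}. Poly_Mapping.single m (Poly_Mapping.lookup f m))"

lemma hcomp_homogeneous:
  assumes "f \<in> mpoly_carrier k"
  shows "hcomp d f \<in> homogeneous k d"
  unfolding hcomp_def
  using assms by (intro homogeneous_sum) (auto simp: homogeneous_iff mpoly_carrier_def)

lemma sum_hcomp: "f = (\<Sum>d\<in>mdeg ` Poly_Mapping.keys f. hcomp d f)"
proof -
  have "(\<Sum>d\<in>mdeg ` Poly_Mapping.keys f. hcomp d f) =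
      (\<Sum>m\<in>Poly_Mapping.keys f. Poly_Mapping.single m (Poly_Mapping.lookup f m))"
    unfolding hcomp_def by (rule sum.image_gen[symmetric]) simp
  then show ?thesis using mpoly_sum_single[of f] by simp
qed

lemma meval_line: "\<exists>r. \<forall>c. poly r c = meval (\<lambda>i. c * g i) f"
  using meval_curve[of "\<lambda>i. [:0, g i:]" f] by simp

text \<open>Along the line through \<open>g\<close> the polynomial \<open>f\<close> becomes a
  polynomial in \<open>c\<close> whose coefficients are the values of the homogeneous components. It
  is identically zero, so each of these values is.\<close>

lemma hcomp_in_pt:
  fixes g :: "nat \<Rightarrow> 'a::alg_closed_field"
  assumes f: "f \<in> pt k g"
  shows "hcomp d f \<in> pt k g"
proof -
  have fc: "f \<in> mpoly_carrier k" using f by (simp add: pt_def)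
  let ?D = "mdeg ` Poly_Mapping.keys f"
  let ?r = "\<Sum>d\<in>?D. monom (meval g (hcomp d f)) d"
  have "poly ?r c = 0" for c
  proof -
    have "poly ?r c = meval (\<lambda>i. c * g i) (\<Sum>d\<in>?D. hcomp d f)"
      by (simp add: poly_sum poly_monom meval_sum meval_homogeneous[OF hcomp_homogeneous[OF fc]] mult.commute)
    also have "\<dots> = 0" using f by (simp add: sum_hcomp[symmetric] pt_def)
    finally show ?thesis .
  qed
  then have r0: "?r = 0" using poly_eqI_cofinite[of "{}" ?r 0] by simp
  have "meval g (hcomp d f) = 0"
  proof (cases "d \<in> ?D")
    case True
    have "coeff ?r d = meval g (hcomp d f)" using True by (simp add: coeff_sum sum.delta')
    then show ?thesis using r0 by simp
  next
    case False
    then have e: "{m \<in> Poly_Mapping.keys f. mdeg m = d} = {}" by auto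
    show ?thesis unfolding hcomp_def e by simp
  qed
  then show ?thesis using homogeneous_in_pt[OF hcomp_homogeneous[OF fc]] by blast
qed

lemma pt_in_proj_points:
  fixes g :: "nat \<Rightarrow> 'a::alg_closed_field"
  assumes g: "nonzero_form k g"
  shows "pt k g \<in> proj_points k"
proof -
  interpret R: cring "mpoly_ring k :: 'a mpoly ring" by (rule mpoly_ring_cring)
  have subgroup: "subgroup (pt k g) (add_monoid (mpoly_ring k))"
  proof (rule R.add.subgroupI)
    fix a :: "'a mpoly" assume a: "a \<in> pt k g"
    then have ac: "a \<in> mpoly_carrier k" by (simp add: pt_def)
    have "\<ominus>\<^bsub>mpoly_ring k\<^esub> a = - a"
      using ac mpoly_carrier_uminus[OF ac] by (intro R.minus_equality) auto
    then show "\<ominus>\<^bsub>mpoly_ring k\<^esub> a \<in> pt k g"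
      using a by (auto simp: pt_def mpoly_carrier_uminus meval_uminus)
  next
    have "(0 :: 'a mpoly) \<in> pt k g" by (simp add: pt_def)
    then show "pt k g \<noteq> {}" by blast
  qed (auto simp: pt_def mpoly_carrier_add meval_add)
  have ideal: "ideal (pt k g) (mpoly_ring k)"
    by (rule idealI[OF R.ring_axioms subgroup]) (auto simp: pt_def mpoly_carrier_mult meval_mult)
  have "primeideal (pt k g) (mpoly_ring k)"
  proof (intro primeidealI[OF ideal mpoly_ring_cring])
    have "(1 :: 'a mpoly) \<notin> pt k g" by (simp add: pt_def)
    then show "carrier (mpoly_ring k) \<noteq> pt k g" using mpoly_carrier_one[of k] by auto
  next
    fix a b :: "'a mpoly"
    assume ab: "a \<in> carrier (mpoly_ring k)" "b \<in> carrier (mpoly_ring k)"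
      "a \<otimes>\<^bsub>mpoly_ring k\<^esub> b \<in> pt k g"
    obtain r where r: "\<And>c. poly r c = meval (\<lambda>i. c * g i) a" using meval_line by blast
    obtain s where s: "\<And>c. poly s c = meval (\<lambda>i. c * g i) b" using meval_line by blast
    \<comment> \<open>Primality: restricted to the line, the factors are polynomials in one
      variable, where there are no zero divisors.\<close>
    have "r * s = 0" using ab by (intro poly_eqI_cofinite[of "{}"]) (auto simp: r s pt_def meval_mult)
    then have "r = 0 \<or> s = 0" by simp
    then show "a \<in> pt k g \<or> b \<in> pt k g" using ab r s by (auto simp: pt_def)
  qed
  moreover have "pt k g = genideal (mpoly_ring k) (pt k g \<inter> (\<Union>d. homogeneous k d))"
  proof
    have sc: "pt k g \<inter> (\<Union>d. homogeneous k d) \<subseteq> carrier (mpoly_ring k)" by (auto simp: pt_def)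
    have gi: "ideal (genideal (mpoly_ring k) (pt k g \<inter> (\<Union>d. homogeneous k d))) (mpoly_ring k)"
      and sub: "pt k g \<inter> (\<Union>d. homogeneous k d) \<subseteq> genideal (mpoly_ring k) (pt k g \<inter> (\<Union>d. homogeneous k d))"
      by (rule R.genideal_ideal[OF sc], rule R.genideal_self[OF sc])
    interpret I: ideal "genideal (mpoly_ring k) (pt k g \<inter> (\<Union>d. homogeneous k d))" "mpoly_ring k" by (rule gi)
    show "pt k g \<subseteq> genideal (mpoly_ring k) (pt k g \<inter> (\<Union>d. homogeneous k d))"
    proof
      fix f assume f: "f \<in> pt k g"
      then have fc: "f \<in> mpoly_carrier k" by (simp add: pt_def)
      have "(\<Sum>d\<in>A. hcomp d f) \<in> genideal (mpoly_ring k) (pt k g \<inter> (\<Union>d. homogeneous k d))" for A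
      proof (induction A rule: infinite_finite_induct)
        case (insert d A)
        have "hcomp d f \<in> genideal (mpoly_ring k) (pt k g \<inter> (\<Union>d. homogeneous k d))"
          using hcomp_in_pt[OF f] hcomp_homogeneous[OF fc] sub by blast
        then show ?case
          using insert additive_subgroup.a_closed[OF I.additive_subgroup_axioms] by fastforce
      qed (use additive_subgroup.zero_closed[OF I.additive_subgroup_axioms] in auto)
      then show "f \<in> genideal (mpoly_ring k) (pt k g \<inter> (\<Union>d. homogeneous k d))"
        using sum_hcomp[of f] by metis
    qed
    show "genideal (mpoly_ring k) (pt k g \<inter> (\<Union>d. homogeneous k d)) \<subseteq> pt k g"
      by (rule R.genideal_minimal[OF ideal]) auto
  qed
  moreover have "\<not> mvar ` {..k} \<subseteq> pt k g"
  proof -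
    obtain j where "j \<le> k" "g j \<noteq> 0" using g by (auto simp: nonzero_form_def)
    then show ?thesis using homogeneous_in_pt[OF homogeneous_mvar, of j k g] by auto
  qed
  ultimately show ?thesis by (simp add: proj_points_def)
qed

section \<open>Linear forms not vanishing at a point\<close>

text \<open>The numbers \<open>L l j\<close> are the coefficients of the Lagrange polynomials at the
  nodes, in other words the entries of the inverse Vandermonde matrix.\<close>

lemma lagrange_coefficients:
  fixes t :: "nat \<Rightarrow> 'a::field"
  assumes inj: "inj_on t {..<k}"
  shows "\<exists>L. \<forall>j<k. \<forall>m<k. (\<Sum>l<k. L l j * t l ^ m) = (if j = m then 1 else 0)"
proof -
  define w where "w l = (\<Prod>i\<in>{..<k} - {l}. t l - t i)" for l
  define \<Lambda> where "\<Lambda> l = Polynomial.smult (inverse (w l)) (other_roots k l t)" for l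
  have w: "w l \<noteq> 0" if "l < k" for l
    using inj that by (auto simp: w_def prod_zero_iff inj_on_def)
  have deg: "degree (\<Lambda> l) < k" if "l < k" for l
    using other_roots_props(2)[OF that, of t] that unfolding \<Lambda>_def
    by (intro le_less_trans[OF degree_smult_le]) auto
  have val: "poly (\<Lambda> l) (t i) = (if i = l then 1 else 0)" if "l < k" "i < k" for l i
    using w[OF that(1)] other_roots_props(3)[OF that(1), of i t] that
    by (auto simp: \<Lambda>_def other_roots_def poly_prod w_def)
  have id: "(\<Sum>l<k. Polynomial.smult (t l ^ m) (\<Lambda> l)) = monom 1 m" if m: "m < k" for m
  proof (rule poly_eqI_degree[of "t ` {..<k}"])
    fix x assume "x \<in> t ` {..<k}"
    then obtain i where i: "i < k" "x = t i" by auto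
    have "poly (\<Sum>l<k. Polynomial.smult (t l ^ m) (\<Lambda> l)) x = (\<Sum>l<k. if l = i then t l ^ m else 0)"
      unfolding poly_sum using i val by (intro sum.cong) auto
    then show "poly (\<Sum>l<k. Polynomial.smult (t l ^ m) (\<Lambda> l)) x = poly (monom 1 m) x"
      using i by (simp add: poly_monom)
  next
    have c: "card (t ` {..<k}) = k" using inj by (simp add: card_image)
    show "degree (\<Sum>l<k. Polynomial.smult (t l ^ m) (\<Lambda> l)) < card (t ` {..<k})"
      unfolding c using deg m
      by (intro degree_sum_less) (auto intro: le_less_trans[OF degree_smult_le])
    show "degree (monom (1::'a) m) < card (t ` {..<k})"
      unfolding c using m by (simp add: degree_monom_eq)
  qed
  have "(\<Sum>l<k. coeff (\<Lambda> l) j * t l ^ m) = (if j = m then 1 else 0)" if "m < k" for j m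
    using arg_cong[OF id[OF that], of "\<lambda>p. coeff p j"] by (auto simp: coeff_sum mult.commute)
  then show ?thesis by (intro exI[of _ "\<lambda>l. coeff (\<Lambda> l)"]) auto
qed

lemma inj_exists: "\<exists>t :: nat \<Rightarrow> 'a::alg_closed_field. inj_on t {..<k}"
proof -
  obtain B :: "'a set" where "finite B" "card B = k"
    using infinite_arbitrarily_large[OF infinite_UNIV_alg_closed, of k] by metis
  then show ?thesis
    using ex_bij_betw_nat_finite[of B] by (auto simp: atLeast0LessThan bij_betw_def)
qed

text \<open>\<open>ell k \<alpha>\<close> is the value at \<open>\<alpha>\<close> of the tautological form.\<close>

definition ell :: "nat \<Rightarrow> 'a::field \<Rightarrow> 'a mpoly" where
  "ell k \<alpha> = (\<Sum>j\<le>k. Poly_Mapping.single 0 (\<alpha> ^ j) * mvar j)"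

lemma ell_homogeneous: "ell k \<alpha> \<in> homogeneous k 1"
  unfolding ell_def
proof (rule homogeneous_sum)
  fix j assume "j \<in> {..k}"
  then show "Poly_Mapping.single 0 (\<alpha> ^ j) * mvar j \<in> homogeneous k 1"
    using homogeneous_mult[OF homogeneous_const[of "\<alpha> ^ j" k] homogeneous_mvar[of j k]] by simp
qed

lemma meval_ell: "meval g (ell k \<alpha>) = (\<Sum>j\<le>k. \<alpha> ^ j * g j)"
  by (simp add: ell_def meval_sum meval_mult)

lemma single_0_sum: "Poly_Mapping.single 0 (sum f A) = (\<Sum>x\<in>A. Poly_Mapping.single 0 (f x))"
  by (induction A rule: infinite_finite_induct) (auto simp: single_add)

text \<open>The values of the tautological form at k + 1 distinct \<alpha> determine its
  coefficients by the inverse Vandermonde matrix. If all these values lay in \<open>p\<close>, so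
  would all variables. Hence the open sets where some \<open>ell k \<alpha>\<close> is invertible
  cover the whole of Proj, not only its closed points.\<close>

lemma ell_avoids:
  fixes p :: "'a::alg_closed_field mpoly set"
  assumes p: "p \<in> proj_points k"
  shows "\<exists>\<alpha>. ell k \<alpha> \<notin> p"
proof (rule ccontr)
  assume *: "\<not> ?thesis"
  obtain t :: "nat \<Rightarrow> 'a" where "inj_on t {..<Suc k}" using inj_exists[of "Suc k"] by (elim exE)
  from lagrange_coefficients[OF this] obtain L where
    "\<forall>j<Suc k. \<forall>m<Suc k. (\<Sum>l<Suc k. L l j * t l ^ m) = (if j = m then 1 else 0)"
    by (elim exE)
  then have L: "(\<Sum>l<Suc k. L l j * t l ^ m) = (if j = m then 1 else 0)" if "j \<le> k" "m \<le> k" for j m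
    using that unfolding less_Suc_eq_le by blast
  have "mvar j \<in> p" if j: "j \<le> k" for j
  proof -
    have "(\<Sum>l<Suc k. Poly_Mapping.single 0 (L l j) * ell k (t l)) =
        (\<Sum>l<Suc k. \<Sum>m\<le>k. Poly_Mapping.single 0 (L l j * t l ^ m) * mvar m)"
      unfolding ell_def sum_distrib_left
      by (intro sum.cong refl) (simp only: mult.assoc[symmetric] mult_single add_0)
    also have "\<dots> = (\<Sum>m\<le>k. Poly_Mapping.single 0 (\<Sum>l<Suc k. L l j * t l ^ m) * mvar m)"
      unfolding single_0_sum sum_distrib_right by (rule sum.swap)
    also have "\<dots> = (\<Sum>m\<le>k. if m = j then mvar m else 0)"
      by (intro sum.cong refl, subst L[OF j]) auto
    also have "\<dots> = mvar j" using j by simp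
    finally have "mvar j = (\<Sum>l<Suc k. Poly_Mapping.single 0 (L l j) * ell k (t l))" ..
    moreover have "\<dots> \<in> p"
      using * by (intro proj_point_sum[OF p] proj_pointD(5)[OF p]) auto
    ultimately show ?thesis by simp
  qed
  then show False using p by (auto simp: proj_points_def)
qed

text \<open>The forms with \<open>k\<close> distinct finite roots are dense: split a general form and move its
  roots apart one at a time.\<close>

lemma meval_root_form_nonzero:
  fixes f :: "'a::alg_closed_field mpoly"
  assumes f: "f \<in> homogeneous k e" "f \<noteq> 0"
  shows "\<exists>t. inj_on t {..<k} \<and> meval (root_form k t) f \<noteq> 0"
proof -
  have "(mvar k :: 'a mpoly) \<noteq> 0"
  proof
    assume "(mvar k :: 'a mpoly) = 0"
    then have "Poly_Mapping.lookup (mvar k :: 'a mpoly) (Poly_Mapping.single k 1) = 0" by simp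
    then show False unfolding mvar_def lookup_single_eq by simp
  qed
  \<comment> \<open>The additional factor forces a nonzero top coefficient, so that all
    \<open>k\<close> roots of the form are finite.\<close>
  then have "f * mvar k \<noteq> 0" using f by simp
  then obtain g where "meval g (f * mvar k) \<noteq> 0" using meval_eq_0_imp_eq_0 by blast
  then have g: "meval g f \<noteq> 0" "g k \<noteq> 0" by (auto simp: meval_mult)
  define q where "q = (\<Sum>j\<le>k. monom (g j) j)"
  have coeff_q: "coeff q j = (if j \<le> k then g j else 0)" for j
    by (simp add: q_def coeff_sum sum.delta')
  have deg_q: "degree q = k"
    using g coeff_q by (intro antisym degree_le le_degree) auto
  have "q \<noteq> 0" using g coeff_q[of k] by auto
  then obtain A where A: "size A = degree q" "q = Polynomial.smult (lead_coeff q) (\<Prod>x\<in>#A. [:-x, 1:])"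
    using alg_closed_imp_factorization by blast
  obtain xs where xs: "mset xs = A" using ex_mset by blast
  define t where "t = (\<lambda>i. xs ! i)"
  have len: "length xs = k" using A xs deg_q by auto
  have "(\<Prod>x\<in>#A. [:-x, 1:]) = prod_list (map (\<lambda>x. [:-x, 1:]) xs)"
    unfolding xs[symmetric] by (simp flip: prod_mset_prod_list mset_map)
  also have "\<dots> = (\<Prod>i<k. [:- t i, 1:])"
    by (simp add: prod.list_conv_set_nth len t_def atLeast0LessThan)
  finally have q: "q = Polynomial.smult (g k) (\<Prod>i<k. [:- t i, 1:])"
    using A deg_q coeff_q[of k] by simp
  have "meval (root_form k t) f \<noteq> 0"
  proof
    assume "meval (root_form k t) f = 0"
    then have "meval (\<lambda>j. g k * root_form k t j) f = 0" using meval_homogeneous[OF f(1)] by simp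
    moreover have "meval (\<lambda>j. g k * root_form k t j) f = meval g f"
    proof (rule meval_cong[OF homogeneous_carrier[OF f(1)]])
      fix i assume "i \<le> k"
      have "g k * root_form k t i = coeff q i" by (subst q) (simp add: root_form_def)
      then show "g k * root_form k t i = g i" using coeff_q \<open>i \<le> k\<close> by simp
    qed
    ultimately show False using g by simp
  qed
  then have "\<exists>t. inj_on t {..<j} \<and> meval (root_form k t) f \<noteq> 0" if "j \<le> k" for j
    using that
  proof (induction j)
    case 0
    then show ?case by auto
  next
    case (Suc j)
    then obtain t where t: "inj_on t {..<j}" "meval (root_form k t) f \<noteq> 0" by auto
    have jk: "j < k" using Suc by simp
    have G: "root_form k (t(j := T)) =
        (\<lambda>i. poly [:coeff (pCons 0 (other_roots k j t)) i, - coeff (other_roots k j t) i:] T)" for T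
      unfolding root_form_upd[OF jk] coeff_moving_root ..
    obtain r where r: "\<And>T. poly r T = meval (root_form k (t(j := T))) f"
      unfolding G
      using meval_curve[of "\<lambda>i. [:coeff (pCons 0 (other_roots k j t)) i, - coeff (other_roots k j t) i:]" f]
      by blast
    have "poly r (t j) \<noteq> 0" unfolding r using t by simp
    then have "r \<noteq> 0" by auto
    then have "finite ({T. poly r T = 0} \<union> t ` {..<j})" by (simp add: poly_roots_finite)
    then obtain T where T: "T \<notin> {T. poly r T = 0} \<union> t ` {..<j}"
      using ex_new_if_finite[OF infinite_UNIV_alg_closed] by blast
    have "inj_on (t(j := T)) {..<Suc j}"
      using t(1) T by (auto simp: inj_on_def less_Suc_eq)
    moreover have "meval (root_form k (t(j := T))) f \<noteq> 0" unfolding r[symmetric] using T by simp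
    ultimately show ?case by blast
  qed
  then show ?thesis by blast
qed

section \<open>Stalks\<close>

definition basic :: "nat \<Rightarrow> 'a::field mpoly \<Rightarrow> 'a mpoly set set" where
  "basic k b = {p \<in> proj_points k. b \<notin> p}"

abbreviation "nonvan p \<equiv> (\<lambda>f. f \<notin> p)"
abbreviation "nonvan_on V \<equiv> (\<lambda>f. \<forall>q\<in>V. f \<notin> q)"

lemma denominators_basic:
  assumes "V \<subseteq> proj_points k" "p \<in> V" "\<forall>q\<in>V. ell k \<alpha> \<notin> q"
  shows "denominators k (nonvan_on V)"
proof
  show "nonvan_on V 1" using assms proj_pointD(3) by blast
  show "nonvan_on V (f * h)"
    if "f \<in> mpoly_carrier k" "h \<in> mpoly_carrier k" "nonvan_on V f" "nonvan_on V h" for f h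
    using that assms proj_pointD(6)[of _ k f h] by blast
  show "f \<noteq> 0" if "nonvan_on V f" for f
    using that assms proj_pointD(2) by blast
  show "\<exists>h\<in>homogeneous k 1. nonvan_on V h" using assms ell_homogeneous by blast
qed

lemma denominators_point:
  fixes p :: "'a::alg_closed_field mpoly set"
  assumes "p \<in> proj_points k"
  shows "denominators k (nonvan p)"
proof -
  obtain \<alpha> where "ell k \<alpha> \<notin> p" using ell_avoids[OF assms] by blast
  then have "denominators k (nonvan_on {p})" using assms by (intro denominators_basic) auto
  then show ?thesis by simp
qed

definition "taut_image k n P =
  (*) (tautological_form k) ` carrier (frac_poly_module k P (n - k) (- 1))"

abbreviation "form_stalk k n p \<equiv> frac_poly_module k (nonvan p) n 0"
abbreviation "ring_st k p \<equiv> frac_ring k (nonvan p)"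
abbreviation "bundle_stalk k n p \<equiv> quotient_module (form_stalk k n p) (taut_image k n (nonvan p))"
abbreviation "line_stalk k d p \<equiv> frac_module k (nonvan p) d"
abbreviation "sym_stalk k n p \<equiv> sym_module (ring_st k p) k (bundle_stalk k n p)"
abbreviation "tensor_stalk k n d p \<equiv> tensor_module (ring_st k p) (sym_stalk k n p) (line_stalk k d p)"
abbreviation "bundle_class k n p P \<equiv> a_r_coset (form_stalk k n p) (taut_image k n (nonvan p)) P"

lemma coeff_tautological: "coeff (tautological_form k) j = (if j \<le> k then Fract (mvar j) 1 else 0)"
  by (simp add: tautological_form_def coeff_sum sum.delta')

lemma degree_tautological: "degree (tautological_form k) \<le> k"
  by (intro degree_le) (auto simp: coeff_tautological)

context denominators
begin

lemma coeff_tautological_fracs: "coeff (tautological_form k) j \<in> fracs k P 1"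
  by (auto simp: coeff_tautological intro!: fracsI[of _ _ 0 _ _ 1] one)

lemma taut_image_submodule:
  assumes "k \<le> n"
  shows "LinearCombinations.submodule (frac_ring k P) (taut_image k n P) (frac_poly_module k P n 0)"
proof -
  interpret M: Module.module "frac_ring k P" "frac_poly_module k P (n - k) (- 1)"
    by (rule frac_poly_module_is_module)
  let ?t = "tautological_form k"
  have in_carrier: "?t * p \<in> carrier (frac_poly_module k P n 0)"
    if "p \<in> carrier (frac_poly_module k P (n - k) (- 1))" for p
  proof -
    have p: "degree p \<le> n - k" "\<And>i. coeff p i \<in> fracs k P (- 1)"
      using that by (auto simp: frac_poly_module_def)
    have "degree (?t * p) \<le> k + (n - k)"
      using degree_mult_le[of ?t p] add_mono[OF degree_tautological[of k] p(1)] by (rule order_trans)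
    then have "degree (?t * p) \<le> n" using assms by simp
    moreover have "coeff (?t * p) i \<in> fracs k P 0" for i
      unfolding coeff_mult using fracs_mult[OF coeff_tautological_fracs p(2)]
      by (intro fracs_sum) simp
    ultimately show ?thesis by (simp add: frac_poly_module_def)
  qed
  show ?thesis
  proof (rule LinearCombinations.submodule.intro)
    show "Module.module (frac_ring k P) (frac_poly_module k P n 0)" by (rule frac_poly_module_is_module)
    show "taut_image k n P \<subseteq> carrier (frac_poly_module k P n 0)"
      using in_carrier by (auto simp: taut_image_def)
  next
    fix v w assume "v \<in> taut_image k n P" "w \<in> taut_image k n P"
    then obtain p q where pq: "v = ?t * p" "w = ?t * q"
      "p \<in> carrier (frac_poly_module k P (n - k) (- 1))" "q \<in> carrier (frac_poly_module k P (n - k) (- 1))"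
      by (auto simp: taut_image_def)
    have "?t * (p \<oplus>\<^bsub>frac_poly_module k P (n - k) (- 1)\<^esub> q) \<in> taut_image k n P"
      unfolding taut_image_def by (intro imageI M.a_closed pq)
    then show "v \<oplus>\<^bsub>frac_poly_module k P n 0\<^esub> w \<in> taut_image k n P"
      using pq by (simp add: frac_poly_module_def distrib_left)
  next
    have "?t * \<zero>\<^bsub>frac_poly_module k P (n - k) (- 1)\<^esub> \<in> taut_image k n P"
      unfolding taut_image_def by (intro imageI M.M.zero_closed)
    then show "\<zero>\<^bsub>frac_poly_module k P n 0\<^esub> \<in> taut_image k n P" by (simp add: frac_poly_module_def)
  next
    fix c v assume c: "c \<in> carrier (frac_ring k P)" and "v \<in> taut_image k n P"
    then obtain p where p: "v = ?t * p" "p \<in> carrier (frac_poly_module k P (n - k) (- 1))"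
      by (auto simp: taut_image_def)
    have "?t * (c \<odot>\<^bsub>frac_poly_module k P (n - k) (- 1)\<^esub> p) \<in> taut_image k n P"
      unfolding taut_image_def by (intro imageI M.smult_closed c p)
    then show "c \<odot>\<^bsub>frac_poly_module k P n 0\<^esub> v \<in> taut_image k n P"
      using p by (simp add: frac_poly_module_def)
  qed
qed

end

locale proj_point =
  fixes k n :: nat and d :: int and p :: "'a::alg_closed_field mpoly set"
  assumes kn: "k \<le> n" and p: "p \<in> proj_points k"
begin

lemma D: "denominators k (nonvan p)"
  by (rule denominators_point[OF p])

lemma E: "module_quotient (ring_st k p) (form_stalk k n p) (taut_image k n (nonvan p))"
  by (intro module_quotient.intro module_quotient_axioms.intro denominators.frac_poly_module_is_module
      denominators.taut_image_submodule kn D)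

lemma S: "sym_power (ring_st k p) (bundle_stalk k n p)"
  by (intro sym_power.intro module_quotient.quotient_is_module E)

lemma T: "tensor_product (ring_st k p) (sym_stalk k n p) (line_stalk k d p)"
  by (intro tensor_product.intro sym_power.sym_is_module S denominators.frac_module_is_module D)

end

section \<open>Evaluating the stalks at a closed point\<close>

text \<open>By linearity it suffices to multiply by a power of the variable. This shifts the
  coefficients of the form and yields one of the sums in \<open>apolar\<close>.\<close>

lemma apolar_kills_multiples:
  assumes ap: "apolar k n g \<phi>" and kn: "k \<le> n" and q: "degree q \<le> n - k"
  shows "(\<Sum>i\<le>n. \<phi> i * coeff ((\<Sum>j\<le>k. monom (g j) j) * q) i) = 0"
proof -
  define G where "G = (\<Sum>j\<le>k. monom (g j) j)"
  have G: "coeff G j = (if j \<le> k then g j else 0)" for j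
    by (simp add: G_def coeff_sum sum.delta')
  have mono: "(\<Sum>i\<le>n. \<phi> i * coeff (monom c l * G) i) = 0" if l: "l \<le> n - k" for c l
  proof -
    have "(\<Sum>i\<le>n. \<phi> i * coeff (monom c l * G) i) = (\<Sum>i\<in>{l..l+k}. \<phi> i * (c * g (i - l)))"
      using l kn by (intro sum.mono_neutral_cong_right) (auto simp: coeff_monom_mult G)
    also have "\<dots> = (\<Sum>j\<le>k. \<phi> (l + j) * (c * g j))"
      by (rule sum.reindex_bij_witness[of _ "\<lambda>j. l + j" "\<lambda>i. i - l"]) auto
    also have "\<dots> = c * (\<Sum>j\<le>k. g j * \<phi> (l + j))" by (simp add: sum_distrib_left mult_ac)
    also have "\<dots> = 0" using ap l by (simp add: apolar_def)
    finally show ?thesis .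
  qed
  have "q * G = (\<Sum>l\<le>n - k. monom (coeff q l) l) * G"
    by (simp only: poly_as_sum_of_monoms'[OF q])
  then have "coeff (G * q) i = (\<Sum>l\<le>n - k. coeff (monom (coeff q l) l * G) i)" for i
    by (simp only: mult.commute[of G q] sum_distrib_right coeff_sum)
  then have "(\<Sum>i\<le>n. \<phi> i * coeff (G * q) i) =
      (\<Sum>i\<le>n. \<Sum>l\<le>n - k. \<phi> i * coeff (monom (coeff q l) l * G) i)"
    by (simp only: sum_distrib_left)
  also have "\<dots> = (\<Sum>l\<le>n - k. \<Sum>i\<le>n. \<phi> i * coeff (monom (coeff q l) l * G) i)"
    by (rule sum.swap)
  also have "\<dots> = 0" using mono by (intro sum.neutral) auto
  finally show ?thesis unfolding G_def .
qed

text \<open>Evaluation at \<open>g\<close> turns the tautological form into \<open>g\<close> itself.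
  Together with \<open>apolar_kills_multiples\<close> this makes an apolar functional vanish on the
  image of the first map of the presentation.\<close>

lemma fev_coeff_tautological_mult:
  fixes q :: "'a::field mpoly fract poly"
  assumes q: "\<And>j. coeff q j \<in> regular_at g"
  shows "fev g (coeff (tautological_form k * q) i) =
    coeff ((\<Sum>j\<le>k. monom (g j) j) * map_poly (fev g) q) i"
proof -
  have G: "coeff (\<Sum>j\<le>k. monom (g j) j) j = (if j \<le> k then g j else 0)" for j
    by (simp add: coeff_sum sum.delta')
  have t: "fev g (coeff (tautological_form k) j) = coeff (\<Sum>j\<le>k. monom (g j) j) j" for j
    unfolding G coeff_tautological by (simp add: fev_Fract)
  have "Fract (mvar j) 1 \<in> regular_at g" for j
    unfolding regular_at_def by (intro CollectI exI[of _ "mvar j"] exI[of _ 1] conjI) auto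
  then have t_reg: "coeff (tautological_form k) j \<in> regular_at g" for j
    unfolding coeff_tautological by simp
  have "fev g (coeff (tautological_form k * q) i) =
      (\<Sum>j\<le>i. fev g (coeff (tautological_form k) j * coeff q (i - j)))"
    unfolding coeff_mult by (rule fev_sum[THEN conjunct2], rule regular_mult[OF t_reg q])
  also have "\<dots> = (\<Sum>j\<le>i. coeff (\<Sum>j\<le>k. monom (g j) j) j * coeff (map_poly (fev g) q) (i - j))"
    by (intro sum.cong refl) (simp only: fev_mult[OF t_reg q] t coeff_map_poly[where f = "fev g", OF fev_0_1(1)])
  finally show ?thesis unfolding coeff_mult .
qed

definition functional_value :: "nat \<Rightarrow> (nat \<Rightarrow> 'a::field) \<Rightarrow> (nat \<Rightarrow> 'a) \<Rightarrow> 'a mpoly fract poly \<Rightarrow> 'a" where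
  "functional_value n g \<phi> q = (\<Sum>i\<le>n. \<phi> i * fev g (coeff q i))"

text \<open>The functional \<phi> passes through the construction of the sheaf: to the cokernel
  because it kills multiples of \<open>g\<close>, to the symmetric power by taking products, to the
  twist by multiplying with the value of the fraction. \<open>hE\<close> and \<open>hS\<close> stay
  in the statement because \<open>hT\<close> is computed on generators through them.\<close>

lemma stalk_evaluation:
  fixes g :: "nat \<Rightarrow> 'a::alg_closed_field"
  assumes kn: "k \<le> n" and g: "nonzero_form k g" and ap: "apolar k n g \<phi>"
  shows "\<exists>hE hS hT. semilinear (ring_st k (pt k g)) (fev g) (sym_stalk k n (pt k g)) hS \<and>
      semilinear (ring_st k (pt k g)) (fev g) (tensor_stalk k n d (pt k g)) hT \<and>
      (\<forall>q\<in>carrier (form_stalk k n (pt k g)). hE (bundle_class k n (pt k g) q) = functional_value n g \<phi> q) \<and>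
      (\<forall>x\<in>tuples k (bundle_stalk k n (pt k g)).
        hS (sym_prod (ring_st k (pt k g)) k (bundle_stalk k n (pt k g)) x) = (\<Prod>i<k. hE (x i))) \<and>
      (\<forall>a\<in>carrier (sym_stalk k n (pt k g)). \<forall>b\<in>carrier (line_stalk k d (pt k g)).
        hT (tensor_prod (ring_st k (pt k g)) (sym_stalk k n (pt k g)) (line_stalk k d (pt k g)) a b) =
          hS a * fev g b)"
proof -
  let ?p = "pt k g"
  interpret proj_point k n d ?p using kn pt_in_proj_points[OF g] by unfold_locales
  have reg: "x \<in> regular_at g" if x: "x \<in> fracs k (nonvan ?p) e" for x e
  proof -
    obtain a f e1 where "x = Fract a f" "f \<in> homogeneous k e1" "f \<notin> ?p"
      using x unfolding fracs_def by blast
    then have "x = Fract a f" "meval g f \<noteq> 0" using homogeneous_in_pt[of f k e1 g] by auto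
    then show ?thesis unfolding regular_at_def by blast
  qed
  have ev: "eval_hom (ring_st k ?p) (fev g)"
    unfolding eval_hom_def frac_ring_def by (simp add: fev_add[OF reg reg] fev_mult[OF reg reg])
  let ?f = "functional_value n g \<phi>"
  have f: "semilinear (ring_st k ?p) (fev g) (form_stalk k n ?p) ?f"
    unfolding semilinear_def
  proof (intro conjI ballI)
    fix x y assume "x \<in> carrier (form_stalk k n ?p)" "y \<in> carrier (form_stalk k n ?p)"
    then have "coeff x i \<in> regular_at g" "coeff y i \<in> regular_at g" for i
      using reg by (auto simp: frac_poly_module_def)
    then show "?f (x \<oplus>\<^bsub>form_stalk k n ?p\<^esub> y) = ?f x + ?f y"
      by (simp add: functional_value_def frac_poly_module_def fev_add distrib_left sum.distrib)
  next
    fix r x assume "r \<in> carrier (ring_st k ?p)" "x \<in> carrier (form_stalk k n ?p)"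
    then have "r \<in> regular_at g" "coeff x i \<in> regular_at g" for i
      using reg by (auto simp: frac_poly_module_def frac_ring_def)
    then show "?f (r \<odot>\<^bsub>form_stalk k n ?p\<^esub> x) = fev g r * ?f x"
      by (simp add: functional_value_def frac_poly_module_def fev_mult sum_distrib_left mult_ac)
  qed
  have f0: "?f x = 0" if x: "x \<in> taut_image k n (nonvan ?p)" for x
  proof -
    obtain q where q: "degree q \<le> n - k" "\<And>i. coeff q i \<in> fracs k (nonvan ?p) (- 1)"
      "x = tautological_form k * q"
      using x by (auto simp: taut_image_def frac_poly_module_def)
    let ?q = "map_poly (fev g) q"
    have "fev g (coeff x i) = coeff ((\<Sum>j\<le>k. monom (g j) j) * ?q) i" for i
      unfolding q(3) by (rule fev_coeff_tautological_mult) (rule reg[OF q(2)])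
    moreover have "degree ?q \<le> n - k"
      using q(1) by (intro degree_le) (auto simp: coeff_map_poly coeff_eq_0)
    ultimately show ?thesis
      using apolar_kills_multiples[OF ap kn, of ?q] by (simp add: functional_value_def)
  qed
  have "\<exists>h. semilinear (ring_st k ?p) (fev g) (bundle_stalk k n ?p) h \<and>
      (\<forall>q\<in>carrier (form_stalk k n ?p). h (bundle_class k n ?p q) = ?f q)"
    by (rule module_quotient.semilinear_quotient[OF E f f0])
  then obtain hE where hE: "semilinear (ring_st k ?p) (fev g) (bundle_stalk k n ?p) hE"
    "\<forall>q\<in>carrier (form_stalk k n ?p). hE (bundle_class k n ?p q) = ?f q"
    by (elim exE conjE) (rule that)
  from sym_power.semilinear_sym[OF S hE(1) ev, where k = k]
  obtain hS where hS: "semilinear (ring_st k ?p) (fev g) (sym_stalk k n ?p) hS"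
    "\<forall>x\<in>tuples k (bundle_stalk k n ?p). hS (sym_prod (ring_st k ?p) k (bundle_stalk k n ?p) x) = (\<Prod>i<k. hE (x i))"
    by (elim exE conjE) (rule that)
  have line: "semilinear (ring_st k ?p) (fev g) (line_stalk k d ?p) (fev g)"
    by (auto simp: semilinear_def frac_module_def frac_ring_def fev_add fev_mult reg)
  from tensor_product.semilinear_tensor[OF T hS(1) line ev]
  obtain hT where hT: "semilinear (ring_st k ?p) (fev g) (tensor_stalk k n d ?p) hT"
    "\<forall>a\<in>carrier (sym_stalk k n ?p). \<forall>b\<in>carrier (line_stalk k d ?p).
      hT (tensor_prod (ring_st k ?p) (sym_stalk k n ?p) (line_stalk k d ?p) a b) = hS a * fev g b"
    by (elim exE conjE) (rule that)
  show ?thesis by (intro exI[of _ hE] exI[of _ hS] exI[of _ hT] conjI hE hS hT)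
qed

section \<open>Local generators\<close>

lemma const_fract_hom:
  "const_fract (a + b) = const_fract a + const_fract b"
  "const_fract (a * b) = const_fract a * const_fract b"
  "const_fract (0::'a::field) = 0" "const_fract (1::'a) = 1"
  by (simp_all add: const_fract_def single_add mult_single Zero_fract_def One_fract_def)

lemma const_fract_minus: "const_fract (- a) = - const_fract a" for a :: "'a::field"
  using const_fract_hom(1)[of a "- a"] by (simp add: const_fract_hom(3) eq_neg_iff_add_eq_0 add.commute)

lemma const_fract_diff: "const_fract (a - b) = const_fract a - const_fract b" for a b :: "'a::field"
  using const_fract_hom(1)[of a "- b"] by (simp add: const_fract_minus)

lemma const_fract_power: "const_fract (a ^ j) = const_fract a ^ j"
  by (induction j) (simp_all add: const_fract_hom)

text \<open>Such polynomials lie in the stalks of the middle term at all points, and the values of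
  their coefficients are the same everywhere. The frames and the Hankel entries are of this
  kind.\<close>

definition const_coeffs :: "'a::field mpoly fract poly \<Rightarrow> bool" where
  "const_coeffs q \<longleftrightarrow> (\<forall>i. coeff q i \<in> range const_fract)"

lemma range_const_add: "x \<in> range const_fract \<Longrightarrow> y \<in> range const_fract \<Longrightarrow> x + y \<in> range const_fract"
  by (auto simp flip: const_fract_hom(1))

lemma range_const_mult: "x \<in> range const_fract \<Longrightarrow> y \<in> range const_fract \<Longrightarrow> x * y \<in> range const_fract"
  by (auto simp flip: const_fract_hom(2))

lemma range_const_0: "0 \<in> range const_fract"
  unfolding const_fract_hom(3)[symmetric] by (rule rangeI)

lemma range_const_sum: "(\<And>i. i \<in> A \<Longrightarrow> f i \<in> range const_fract) \<Longrightarrow> sum f A \<in> range const_fract"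
  by (induction A rule: infinite_finite_induct) (simp_all add: range_const_0 range_const_add)

lemma const_coeffs_mult: "const_coeffs p \<Longrightarrow> const_coeffs q \<Longrightarrow> const_coeffs (p * q)"
  unfolding const_coeffs_def coeff_mult by (intro allI range_const_sum range_const_mult) auto

lemma const_coeffs_monom: "const_coeffs (monom 1 j)"
  unfolding const_coeffs_def by (auto simp: range_const_0 const_fract_hom(4)[symmetric] simp del: const_fract_hom)

lemma const_coeffs_power: "const_coeffs p \<Longrightarrow> const_coeffs (p ^ j)"
  by (induction j) (auto intro: const_coeffs_mult const_coeffs_monom[of 0, simplified])

lemma const_coeffs_linear: "const_coeffs [:- const_fract \<alpha>, 1:]"
  unfolding const_coeffs_def
proof
  fix i
  have "1 \<in> range (const_fract :: 'a \<Rightarrow> _)" unfolding const_fract_hom(4)[symmetric] by (rule rangeI)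
  then show "coeff [:- const_fract \<alpha>, 1:] i \<in> range const_fract"
    by (auto simp: coeff_pCons range_const_0 const_fract_minus[symmetric] split: nat.splits)
qed

abbreviation lin :: "'a::field \<Rightarrow> 'a mpoly fract poly" where
  "lin \<alpha> \<equiv> [:- const_fract \<alpha>, 1:]"

text \<open>A frame of the bundle where the tautological form is invertible at \<alpha>. A multiple
  of that form by a polynomial of degree at most n - k is divisible by the power n - k + 1 of the
  linear factor only if it is zero, and the ranks n - k + 1 and \<open>k\<close> add up to n +
  1.\<close>

definition ebas :: "nat \<Rightarrow> nat \<Rightarrow> 'a::field \<Rightarrow> nat \<Rightarrow> 'a mpoly fract poly" where
  "ebas k n \<alpha> i = lin \<alpha> ^ (n - k + 1) * monom 1 i"

lemma ebas_const_coeffs: "const_coeffs (ebas k n \<alpha> i)"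
  unfolding ebas_def by (intro const_coeffs_mult const_coeffs_power const_coeffs_linear const_coeffs_monom)

lemma degree_lin_power: "degree (lin \<alpha> ^ r) = r"
  by (simp add: degree_power_eq)

lemma degree_ebas: "k \<le> n \<Longrightarrow> i < k \<Longrightarrow> degree (ebas k n \<alpha> i) \<le> n"
  using degree_mult_le[of "lin \<alpha> ^ (n - k + 1)" "monom 1 i"] degree_lin_power[of \<alpha> "n - k + 1"]
    degree_monom_le[of "1 :: 'a mpoly fract" i] unfolding ebas_def by linarith

lemma poly_tautological:
  fixes \<alpha> :: "'a::field"
  shows "poly (tautological_form k) (const_fract \<alpha>) = Fract (ell k \<alpha>) 1"
proof -
  have F_add: "Fract (a + b) 1 = Fract a 1 + Fract b 1" for a b :: "'a mpoly" by simp
  have F: "Fract (sum f A) 1 = (\<Sum>x\<in>A. Fract (f x) 1)" if "finite A" for f :: "nat \<Rightarrow> 'a mpoly" and A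
    using that
  proof (induction A)
    case (insert a A)
    have "Fract (sum f (insert a A)) 1 = Fract (f a) 1 + Fract (sum f A) 1"
      unfolding F_add[symmetric] using insert by simp
    then show ?case using insert by simp
  qed (simp add: Zero_fract_def)
  have "poly (tautological_form k) (const_fract \<alpha>) = (\<Sum>j\<le>k. Fract (mvar j) 1 * const_fract \<alpha> ^ j)"
    by (simp add: tautological_form_def poly_sum poly_monom)
  also have "\<dots> = (\<Sum>j\<le>k. Fract (Poly_Mapping.single 0 (\<alpha> ^ j) * mvar j) 1)"
    unfolding const_fract_power[symmetric] unfolding const_fract_def mult_fract by (simp add: mult.commute)
  also have "\<dots> = Fract (ell k \<alpha>) 1" unfolding ell_def by (rule F[symmetric]) simp
  finally show ?thesis .
qed

section \<open>Reduction modulo the tautological form\<close>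

context denominators
begin

lemma const_coeffs_fracs: "const_coeffs q \<Longrightarrow> coeff q i \<in> fracs k P 0"
  unfolding const_coeffs_def using fracs_const by (auto dest: spec[of _ i])

text \<open>The divisor is monic, so the coefficients of the quotient are found from the top
  downwards by ring operations alone. The induction counts down from the index just above the
  degree, where the coefficient is 0.\<close>

lemma coeff_linear_quotient:
  assumes q: "\<And>i. coeff (lin \<alpha> * q) i \<in> fracs k P 0"
  shows "coeff q i \<in> fracs k P 0"
proof -
  have "coeff q (Suc (degree q) - j) \<in> fracs k P 0" for j
  proof (induction j)
    case 0
    show ?case by (simp add: coeff_eq_0)
  next
    case (Suc j)
    show ?case
    proof (cases "j \<le> degree q")
      case True
      let ?i = "degree q - j"
      have i: "Suc (degree q) - j = Suc ?i" using True by simp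
      have "coeff (lin \<alpha> * q) (Suc ?i) = coeff q ?i - const_fract \<alpha> * coeff q (Suc ?i)"
        by simp
      then have eq: "coeff q ?i = coeff (lin \<alpha> * q) (Suc ?i) + const_fract \<alpha> * coeff q (Suc ?i)"
        by (simp only: diff_add_cancel)
      have "const_fract \<alpha> * coeff q (Suc ?i) \<in> fracs k P 0"
        using fracs_mult[OF fracs_const[of \<alpha>] Suc.IH] unfolding i by simp
      from fracs_add[OF q[of "Suc ?i"] this] show ?thesis
        unfolding diff_Suc_Suc eq .
    next
      case False
      then show ?thesis using Suc.IH by simp
    qed
  qed
  from this[of "Suc (degree q) - i"] show ?thesis
    by (cases "i \<le> Suc (degree q)") (simp_all add: coeff_eq_0)
qed

text \<open>Where \<open>ell k \<alpha>\<close> is invertible, one factor \<open>x - \<alpha>\<close> after the other can be split off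
  modulo multiples of the tautological form.\<close>

lemma reduce_step:
  assumes kn: "k \<le> n" and l: "P (ell k \<alpha>)" and p: "degree p \<le> n" "\<And>i. coeff p i \<in> fracs k P 0"
    and r: "r \<le> n - k + 1"
  shows "\<exists>q s. p = lin \<alpha> ^ r * q + tautological_form k * s \<and> degree q \<le> n - r \<and>
    (\<forall>i. coeff q i \<in> fracs k P 0) \<and> degree s \<le> n - k \<and> (\<forall>i. coeff s i \<in> fracs k P (- 1))"
  using r
proof (induction r)
  case 0
  show ?case by (rule exI[of _ p], rule exI[of _ 0]) (simp add: p)
next
  case (Suc r)
  then obtain q s where qs: "p = lin \<alpha> ^ r * q + tautological_form k * s" "degree q \<le> n - r"
    "\<And>i. coeff q i \<in> fracs k P 0" "degree s \<le> n - k" "\<And>i. coeff s i \<in> fracs k P (- 1)"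
    by auto
  let ?L = "ell k \<alpha>"
  \<comment> \<open>Chosen so that subtracting \<open>c\<close> times the tautological form creates
    a root at \<alpha>; for this the value at \<alpha> has to be invertible.\<close>
  define c where "c = poly q (const_fract \<alpha>) * Fract 1 ?L"
  have "?L \<noteq> 0" using nonzero[OF l] .
  then have inv: "Fract 1 ?L * Fract ?L 1 = 1" by (simp add: One_fract_def eq_fract)
  have "poly q (const_fract \<alpha>) \<in> fracs k P 0"
    unfolding poly_altdef const_fract_power[symmetric]
    using fracs_mult[OF qs(3) fracs_const] by (intro fracs_sum) simp
  then have c: "c \<in> fracs k P (- 1)"
    using fracs_mult[of _ 0 "Fract 1 ?L" "- 1"] fracs_linear_power(1)[OF ell_homogeneous l, of 1]
    by (simp add: c_def)
  define q' where "q' = q - Polynomial.smult c (tautological_form k)"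
  have "poly q' (const_fract \<alpha>) = 0"
    by (simp add: q'_def c_def poly_tautological mult.assoc inv del: mult_fract)
  then have "lin \<alpha> dvd q'" by (simp add: poly_eq_0_iff_dvd)
  then obtain u where u: "q' = lin \<alpha> * u" by (elim dvdE)
  have "coeff q' i \<in> fracs k P 0" for i
  proof -
    have "coeff q' i = coeff q i + - (c * coeff (tautological_form k) i)" by (simp add: q'_def)
    moreover have "c * coeff (tautological_form k) i \<in> fracs k P 0"
      using fracs_mult[OF c coeff_tautological_fracs[of i]] by simp
    ultimately show ?thesis using fracs_add[OF qs(3) fracs_uminus] by simp
  qed
  then have u_coeff: "coeff u i \<in> fracs k P 0" for i
    unfolding u by (rule coeff_linear_quotient)
  have "degree q' \<le> n - r"
    unfolding q'_def
  proof (intro degree_diff_le order_trans[OF degree_smult_le])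
    have "k \<le> n - r" using Suc.prems kn by arith
    then show "degree (tautological_form k) \<le> n - r" using degree_tautological by (rule order_trans[rotated])
  qed (rule qs(2))
  then have u_deg: "degree u \<le> n - Suc r"
    unfolding u by (cases "u = 0") (simp_all add: degree_mult_eq del: mult_pCons_left)
  let ?s = "Polynomial.smult c (lin \<alpha> ^ r) + s"
  have "p = lin \<alpha> ^ r * (lin \<alpha> * u + Polynomial.smult c (tautological_form k)) + tautological_form k * s"
    unfolding u[symmetric] q'_def using qs(1) by simp
  also have "\<dots> = lin \<alpha> ^ Suc r * u + tautological_form k * ?s"
    by (simp only: distrib_left power_Suc mult_smult_right mult_smult_left mult_ac add.assoc)
  finally have eq: "p = lin \<alpha> ^ Suc r * u + tautological_form k * ?s" .
  have s_deg: "degree ?s \<le> n - k"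
    using qs(4) degree_lin_power[of \<alpha> r] Suc.prems
    by (intro degree_add_le order_trans[OF degree_smult_le]) linarith+
  have "coeff ?s i \<in> fracs k P (- 1)" for i
  proof -
    have "coeff (lin \<alpha> ^ r) i \<in> fracs k P 0"
      by (intro const_coeffs_fracs const_coeffs_power const_coeffs_linear)
    from fracs_mult[OF c this] show ?thesis
      unfolding coeff_add coeff_smult using qs(5)[of i] by (intro fracs_add) simp_all
  qed
  then show ?case
    by (intro exI[of _ u] exI[of _ ?s] conjI allI eq u_deg u_coeff s_deg)
qed

text \<open>After n - k + 1 linear factors have been split off, the remaining factor has degree at
  most k - 1, and its \<open>k\<close> coefficients are the coordinates with respect to
  \<open>ebas\<close>.\<close>

lemma reduce:
  assumes "k \<le> n" "k \<ge> 1" "P (ell k \<alpha>)" "degree p \<le> n" "\<And>i. coeff p i \<in> fracs k P 0"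
  shows "\<exists>q s. p = (\<Sum>i<k. Polynomial.smult (coeff q i) (ebas k n \<alpha> i)) + tautological_form k * s \<and>
    (\<forall>i. coeff q i \<in> fracs k P 0) \<and> degree s \<le> n - k \<and> (\<forall>i. coeff s i \<in> fracs k P (- 1))"
proof -
  obtain q s where qs: "p = lin \<alpha> ^ (n - k + 1) * q + tautological_form k * s" "degree q \<le> n - (n - k + 1)"
    "\<forall>i. coeff q i \<in> fracs k P 0" "degree s \<le> n - k" "\<forall>i. coeff s i \<in> fracs k P (- 1)"
    using reduce_step[OF assms(1,3,4,5) order_refl] by (elim exE conjE) (rule that)
  have "degree q \<le> k - 1" using qs(2) assms(1,2) by simp
  then have "q = (\<Sum>i\<le>k - 1. monom (coeff q i) i)" by (rule poly_as_sum_of_monoms'[symmetric])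
  also have "{..k - 1} = {..<k}" using assms(2) by auto
  finally have "lin \<alpha> ^ (n - k + 1) * q = lin \<alpha> ^ (n - k + 1) * (\<Sum>i<k. monom (coeff q i) i)"
    by (rule arg_cong)
  also have "\<dots> = (\<Sum>i<k. lin \<alpha> ^ (n - k + 1) * monom (coeff q i) i)"
    by (rule sum_distrib_left)
  also have "\<dots> = (\<Sum>i<k. Polynomial.smult (coeff q i) (ebas k n \<alpha> i))"
    unfolding ebas_def
  proof (intro sum.cong refl)
    fix i
    have "monom (coeff q i) i = Polynomial.smult (coeff q i) (monom 1 i)" by (simp add: smult_monom)
    then show "lin \<alpha> ^ (n - k + 1) * monom (coeff q i) i =
        Polynomial.smult (coeff q i) (lin \<alpha> ^ (n - k + 1) * monom 1 i)"
      by (simp only: mult_smult_right)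
  qed
  finally have "p = (\<Sum>i<k. Polynomial.smult (coeff q i) (ebas k n \<alpha> i)) + tautological_form k * s"
    unfolding qs(1) by (rule arg_cong)
  then show ?thesis using qs(3-5) by (intro exI conjI)
qed

end

section \<open>Normal forms on a chart\<close>

definition egen :: "nat \<Rightarrow> nat \<Rightarrow> 'a::field \<Rightarrow> 'a mpoly set \<Rightarrow> nat \<Rightarrow> 'a mpoly fract poly set" where
  "egen k n \<alpha> q i = bundle_class k n q (ebas k n \<alpha> i)"

abbreviation "spr k n q \<equiv> sym_prod (ring_st k q) k (bundle_stalk k n q)"
abbreviation "tpr k n d q \<equiv> tensor_prod (ring_st k q) (sym_stalk k n q) (line_stalk k d q)"
abbreviation words :: "nat \<Rightarrow> (nat \<Rightarrow> nat) set" where "words k \<equiv> {..<k} \<rightarrow>\<^sub>E {..<k}"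

definition sgen where
  "sgen k n \<alpha> q \<pi> = spr k n q (\<lambda>i\<in>{..<k}. egen k n \<alpha> q (\<pi> i))"

text \<open>The sum runs over all words, although words that differ by a permutation have the same
  \<open>sgen\<close>. The coefficients are therefore not unique, but letters need not be ordered
  and multiplicities need not be counted.\<close>

definition symNF where
  "symNF k n \<alpha> h q = (\<Oplus>\<^bsub>sym_stalk k n q\<^esub>\<pi>\<in>words k. h \<pi> \<odot>\<^bsub>sym_stalk k n q\<^esub> sgen k n \<alpha> q \<pi>)"

text \<open>The line bundle is trivialised by the inverse power of \<open>ell\<close>, so that all
  coefficients \<open>h \<pi>\<close> have degree 0.\<close>

definition NF where
  "NF k n N \<alpha> h q = tpr k n (- int N) q (symNF k n \<alpha> h q) (Fract 1 (ell k \<alpha> ^ N))"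

lemma finite_words: "finite (words k)"
  by (intro finite_PiE) auto

text \<open>On \<open>V\<close> the tautological form is invertible at \<alpha>; there the bundle
  has the frame \<open>egen\<close> and the line bundle has a generator. \<open>V\<close> is any set
  of points, as the statements concern families of germs with one presentation on all of
  \<open>V\<close>; openness is added where sections of the sheaves are constructed.\<close>

locale chart =
  fixes k n :: nat and \<alpha> :: "'a::alg_closed_field" and V :: "'a mpoly set set"
  assumes kn: "k \<le> n" and k1: "k \<ge> 1" and V: "V \<subseteq> proj_points k" "V \<noteq> {}"
    and ell_V: "\<And>q. q \<in> V \<Longrightarrow> ell k \<alpha> \<notin> q"

abbreviation (in chart) "OV \<equiv> fracs k (nonvan_on V)"

lemma (in chart) D: "denominators k (nonvan_on V)"
proof -
  obtain p where "p \<in> V" using V(2) by blast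
  then show ?thesis using V(1) ell_V by (intro denominators_basic) auto
qed

lemma (in chart) point: "q \<in> V \<Longrightarrow> proj_point k n q"
  using V(1) kn by (intro proj_point.intro) auto

lemma (in chart) OV_point:
  assumes "x \<in> OV d" "q \<in> V"
  shows "x \<in> fracs k (nonvan q) d"
proof -
  have "OV d \<subseteq> fracs k (nonvan q) d" by (rule fracs_mono) (use assms(2) in blast)
  then show ?thesis using assms(1) by (rule subsetD)
qed

lemma (in chart) ebas_carrier:
  assumes "q \<in> V" "i < k"
  shows "ebas k n \<alpha> i \<in> carrier (form_stalk k n q)"
  using degree_ebas[OF kn assms(2), of \<alpha>]
    denominators.const_coeffs_fracs[OF proj_point.D[OF point[OF assms(1)]] ebas_const_coeffs[of k n \<alpha> i]]
  by (simp add: frac_poly_module_def)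

lemma (in chart) egen_closed: "q \<in> V \<Longrightarrow> i < k \<Longrightarrow> egen k n \<alpha> q i \<in> carrier (bundle_stalk k n q)"
  unfolding egen_def by (intro module_quotient.quotient_cl[OF proj_point.E[OF point]] ebas_carrier)

text \<open>One polynomial represents the germ at every point of \<open>V\<close>. This is what a
  section of the bundle looks like on a small enough neighbourhood.\<close>

definition (in chart) famE :: "('a mpoly set \<Rightarrow> 'a mpoly fract poly set) \<Rightarrow> bool" where
  "famE v \<longleftrightarrow> (\<exists>p. degree p \<le> n \<and> (\<forall>i. coeff p i \<in> OV 0) \<and> (\<forall>q\<in>V. v q = bundle_class k n q p))"

definition (in chart) famS where
  "famS v \<longleftrightarrow> (\<exists>h. (\<forall>\<pi>\<in>words k. h \<pi> \<in> OV 0) \<and> (\<forall>q\<in>V. v q = symNF k n \<alpha> h q))"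

text \<open>\<open>reduce\<close> is applied once, over the fractions regular on \<open>V\<close>,
  and not at each point separately; so the same coefficients \<open>w\<close> serve all points of
  \<open>V\<close>.\<close>

lemma (in chart) famE_span:
  assumes "famE v"
  shows "\<exists>w. (\<forall>i. w i \<in> OV 0) \<and> (\<forall>q\<in>V. v q =
    (\<Oplus>\<^bsub>bundle_stalk k n q\<^esub>i\<in>{..<k}. w i \<odot>\<^bsub>bundle_stalk k n q\<^esub> egen k n \<alpha> q i))"
proof -
  obtain p where p: "degree p \<le> n" "\<And>i. coeff p i \<in> OV 0" "\<And>q. q \<in> V \<Longrightarrow> v q = bundle_class k n q p"
    using assms unfolding famE_def by auto
  have ell_all: "\<forall>q\<in>V. ell k \<alpha> \<notin> q" using ell_V by blast
  from denominators.reduce[OF D kn k1 ell_all p(1,2)]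
  obtain u s where us: "p = (\<Sum>i<k. Polynomial.smult (coeff u i) (ebas k n \<alpha> i)) + tautological_form k * s"
    "\<forall>i. coeff u i \<in> OV 0" "degree s \<le> n - k" "\<forall>i. coeff s i \<in> OV (- 1)"
    by (elim exE conjE) (rule that)
  have "v q = (\<Oplus>\<^bsub>bundle_stalk k n q\<^esub>i\<in>{..<k}. coeff u i \<odot>\<^bsub>bundle_stalk k n q\<^esub> egen k n \<alpha> q i)"
    if q: "q \<in> V" for q
  proof -
    let ?M = "form_stalk k n q"
    interpret module_quotient "ring_st k q" ?M "taut_image k n (nonvan q)"
      by (rule proj_point.E[OF point[OF q]])
    let ?t = "\<lambda>i. coeff u i \<odot>\<^bsub>?M\<^esub> ebas k n \<alpha> i"
    have u: "coeff u i \<in> carrier (ring_st k q)" for i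
      using OV_point[OF us(2)[rule_format] q] by (simp add: frac_ring_def)
    have t: "?t \<in> {..<k} \<rightarrow> carrier ?M" using u ebas_carrier[OF q] by auto
    have sumM: "finsum ?M f A = sum f A" if "finite A" "f \<in> A \<rightarrow> carrier ?M" for f and A :: "nat set"
      using that
    proof (induction A)
      case empty
      then show ?case unfolding M.finsum_empty by (simp add: frac_poly_module_def)
    next
      case (insert a A)
      then have "finsum ?M f (insert a A) = f a \<oplus>\<^bsub>?M\<^esub> finsum ?M f A" by (intro M.finsum_insert) auto
      then show ?case using insert by (simp add: frac_poly_module_def Pi_iff)
    qed
    have S: "finsum ?M ?t {..<k} = (\<Sum>i<k. Polynomial.smult (coeff u i) (ebas k n \<alpha> i))"
      using sumM[OF _ t] by (simp add: frac_poly_module_def)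
    have Sc: "finsum ?M ?t {..<k} \<in> carrier ?M" using t by (rule M.finsum_closed)
    have ps: "tautological_form k * s \<in> taut_image k n (nonvan q)"
      unfolding taut_image_def using us(3,4) OV_point[OF _ q] by (intro imageI) (simp add: frac_poly_module_def)
    have pc: "p \<in> carrier ?M" using p(1,2) OV_point[OF _ q] by (simp add: frac_poly_module_def)
    have tc: "tautological_form k * s \<in> carrier ?M" using ps N.a_subset by blast
    have "p = tautological_form k * s + finsum ?M ?t {..<k}"
      unfolding S us(1) by (rule add.commute)
    then have p_eq: "p = tautological_form k * s \<oplus>\<^bsub>?M\<^esub> finsum ?M ?t {..<k}"
      by (simp only: frac_poly_module_def monoid.simps ring.simps module.simps)
    have "p \<ominus>\<^bsub>?M\<^esub> finsum ?M ?t {..<k} = tautological_form k * s"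
      unfolding p_eq M.minus_eq using Sc tc by (simp only: M.a_assoc M.a_inv_closed M.r_neg M.r_zero)
    then have "v q = cl (finsum ?M ?t {..<k})"
      unfolding p(3)[OF q] using ps by (intro cl_eqI[OF pc Sc]) simp
    also have "\<dots> = finsum Q (\<lambda>i. cl (?t i)) {..<k}"
      using t by (intro quotient_finsum[symmetric]) auto
    also have "\<dots> = (\<Oplus>\<^bsub>Q\<^esub>i\<in>{..<k}. coeff u i \<odot>\<^bsub>Q\<^esub> egen k n \<alpha> q i)"
    proof -
      interpret Q: Module.module "ring_st k q" Q by (rule quotient_is_module)
      have e: "coeff u i \<odot>\<^bsub>Q\<^esub> egen k n \<alpha> q i = cl (?t i)" if "i < k" for i
        unfolding egen_def using quotient_smult[OF u ebas_carrier[OF q that]] .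
      show ?thesis
        using e u egen_closed[OF q] by (intro Q.finsum_cong') auto
    qed
    finally show ?thesis .
  qed
  then show ?thesis by (intro exI[of _ "coeff u"] conjI ballI us(2))
qed

lemma (in chart) S_module: "q \<in> V \<Longrightarrow> Module.module (ring_st k q) (sym_stalk k n q)"
  by (rule sym_power.sym_is_module[OF proj_point.S[OF point]])

lemma (in chart) T_module: "q \<in> V \<Longrightarrow> Module.module (ring_st k q) (tensor_stalk k n d q)"
  by (rule tensor_product.tensor_is_module[OF proj_point.T[OF point]])

lemma (in chart) OV_ring: "x \<in> OV 0 \<Longrightarrow> q \<in> V \<Longrightarrow> x \<in> carrier (ring_st k q)"
  using OV_point[of x 0 q] by (simp add: frac_ring_def)

lemma (in chart) egen_tuple:
  assumes "q \<in> V" "\<pi> \<in> words k"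
  shows "(\<lambda>i\<in>{..<k}. egen k n \<alpha> q (\<pi> i)) \<in> tuples k (bundle_stalk k n q)"
  unfolding tuples_def using assms egen_closed[OF assms(1)] by (intro restrict_PiE_iff[THEN iffD2]) auto

lemma (in chart) sgen_closed:
  assumes "q \<in> V" "\<pi> \<in> words k"
  shows "sgen k n \<alpha> q \<pi> \<in> carrier (sym_stalk k n q)"
  unfolding sgen_def by (rule sym_power.sp_closed[OF proj_point.S[OF point[OF assms(1)]] egen_tuple[OF assms]])

lemma (in chart) symNF_terms:
  assumes "q \<in> V" "\<And>\<pi>. \<pi> \<in> words k \<Longrightarrow> h \<pi> \<in> OV 0"
  shows "(\<lambda>\<pi>. h \<pi> \<odot>\<^bsub>sym_stalk k n q\<^esub> sgen k n \<alpha> q \<pi>) \<in> words k \<rightarrow> carrier (sym_stalk k n q)"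
proof
  fix \<pi> assume \<pi>: "\<pi> \<in> words k"
  show "h \<pi> \<odot>\<^bsub>sym_stalk k n q\<^esub> sgen k n \<alpha> q \<pi> \<in> carrier (sym_stalk k n q)"
    by (rule module.smult_closed[OF S_module[OF assms(1)] OV_ring[OF assms(2)[OF \<pi>] assms(1)]
          sgen_closed[OF assms(1) \<pi>]])
qed

lemma (in chart) symNF_closed:
  assumes "q \<in> V" "\<And>\<pi>. \<pi> \<in> words k \<Longrightarrow> h \<pi> \<in> OV 0"
  shows "symNF k n \<alpha> h q \<in> carrier (sym_stalk k n q)"
proof -
  interpret S: Module.module "ring_st k q" "sym_stalk k n q" by (rule S_module[OF assms(1)])
  show ?thesis unfolding symNF_def using symNF_terms[OF assms] by (rule S.finsum_closed)
qed

lemma (in chart) symNF_add: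
  assumes q: "q \<in> V" and h: "\<And>\<pi>. \<pi> \<in> words k \<Longrightarrow> h \<pi> \<in> OV 0" and h': "\<And>\<pi>. \<pi> \<in> words k \<Longrightarrow> h' \<pi> \<in> OV 0"
  shows "symNF k n \<alpha> h q \<oplus>\<^bsub>sym_stalk k n q\<^esub> symNF k n \<alpha> h' q = symNF k n \<alpha> (\<lambda>\<pi>. h \<pi> + h' \<pi>) q"
proof -
  interpret S: Module.module "ring_st k q" "sym_stalk k n q" by (rule S_module[OF q])
  have "symNF k n \<alpha> h q \<oplus>\<^bsub>sym_stalk k n q\<^esub> symNF k n \<alpha> h' q =
      (\<Oplus>\<^bsub>sym_stalk k n q\<^esub>\<pi>\<in>words k. h \<pi> \<odot>\<^bsub>sym_stalk k n q\<^esub> sgen k n \<alpha> q \<pi> \<oplus>\<^bsub>sym_stalk k n q\<^esub>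
        h' \<pi> \<odot>\<^bsub>sym_stalk k n q\<^esub> sgen k n \<alpha> q \<pi>)"
    unfolding symNF_def by (rule S.finsum_addf[symmetric]) (rule symNF_terms[OF q h] symNF_terms[OF q h']; assumption)+
  also have "\<dots> = symNF k n \<alpha> (\<lambda>\<pi>. h \<pi> + h' \<pi>) q"
    unfolding symNF_def
  proof (rule S.finsum_cong'[OF refl])
    show "(\<lambda>\<pi>. (h \<pi> + h' \<pi>) \<odot>\<^bsub>sym_stalk k n q\<^esub> sgen k n \<alpha> q \<pi>) \<in> words k \<rightarrow> carrier (sym_stalk k n q)"
      by (rule symNF_terms[OF q]) (intro denominators.fracs_add[OF D] h h')
    fix \<pi> assume \<pi>: "\<pi> \<in> words k"
    show "h \<pi> \<odot>\<^bsub>sym_stalk k n q\<^esub> sgen k n \<alpha> q \<pi> \<oplus>\<^bsub>sym_stalk k n q\<^esub> h' \<pi> \<odot>\<^bsub>sym_stalk k n q\<^esub> sgen k n \<alpha> q \<pi> =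
        (h \<pi> + h' \<pi>) \<odot>\<^bsub>sym_stalk k n q\<^esub> sgen k n \<alpha> q \<pi>"
      using S.smult_l_distr[OF OV_ring[OF h[OF \<pi>] q] OV_ring[OF h'[OF \<pi>] q] sgen_closed[OF q \<pi>]]
      by (simp add: frac_ring_def)
  qed
  finally show ?thesis .
qed

lemma (in chart) symNF_smult:
  assumes q: "q \<in> V" and r: "r \<in> OV 0" and h: "\<And>\<pi>. \<pi> \<in> words k \<Longrightarrow> h \<pi> \<in> OV 0"
  shows "r \<odot>\<^bsub>sym_stalk k n q\<^esub> symNF k n \<alpha> h q = symNF k n \<alpha> (\<lambda>\<pi>. r * h \<pi>) q"
proof -
  interpret S: Module.module "ring_st k q" "sym_stalk k n q" by (rule S_module[OF q])
  have "r \<odot>\<^bsub>sym_stalk k n q\<^esub> symNF k n \<alpha> h q =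
      (\<Oplus>\<^bsub>sym_stalk k n q\<^esub>\<pi>\<in>words k. r \<odot>\<^bsub>sym_stalk k n q\<^esub> (h \<pi> \<odot>\<^bsub>sym_stalk k n q\<^esub> sgen k n \<alpha> q \<pi>))"
    unfolding symNF_def
    by (rule S.finsum_smult_ldistr[OF finite_words OV_ring[OF r q] symNF_terms[OF q h]])
  also have "\<dots> = symNF k n \<alpha> (\<lambda>\<pi>. r * h \<pi>) q"
    unfolding symNF_def
  proof (rule S.finsum_cong'[OF refl])
    show "(\<lambda>\<pi>. (r * h \<pi>) \<odot>\<^bsub>sym_stalk k n q\<^esub> sgen k n \<alpha> q \<pi>) \<in> words k \<rightarrow> carrier (sym_stalk k n q)"
      by (rule symNF_terms[OF q]) (use denominators.fracs_mult[OF D r h] in simp)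
    fix \<pi> assume \<pi>: "\<pi> \<in> words k"
    show "r \<odot>\<^bsub>sym_stalk k n q\<^esub> (h \<pi> \<odot>\<^bsub>sym_stalk k n q\<^esub> sgen k n \<alpha> q \<pi>) =
        (r * h \<pi>) \<odot>\<^bsub>sym_stalk k n q\<^esub> sgen k n \<alpha> q \<pi>"
      using S.smult_assoc1[OF OV_ring[OF r q] OV_ring[OF h[OF \<pi>] q] sgen_closed[OF q \<pi>]]
      by (simp add: frac_ring_def)
  qed
  finally show ?thesis .
qed

lemma (in chart) symNF_single:
  assumes q: "q \<in> V" and \<pi>: "\<pi> \<in> words k"
  shows "symNF k n \<alpha> (\<lambda>\<rho>. if \<pi> = \<rho> then 1 else 0) q = sgen k n \<alpha> q \<pi>"
proof -
  interpret S: Module.module "ring_st k q" "sym_stalk k n q" by (rule S_module[OF q])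
  have c: "(\<lambda>\<rho>. sgen k n \<alpha> q \<rho>) \<in> words k \<rightarrow> carrier (sym_stalk k n q)" using sgen_closed[OF q] by blast
  have "symNF k n \<alpha> (\<lambda>\<rho>. if \<pi> = \<rho> then 1 else 0) q =
      (\<Oplus>\<^bsub>sym_stalk k n q\<^esub>\<rho>\<in>words k. if \<pi> = \<rho> then sgen k n \<alpha> q \<rho> else \<zero>\<^bsub>sym_stalk k n q\<^esub>)"
    unfolding symNF_def
  proof (rule S.finsum_cong'[OF refl])
    show "(\<lambda>\<rho>. if \<pi> = \<rho> then sgen k n \<alpha> q \<rho> else \<zero>\<^bsub>sym_stalk k n q\<^esub>) \<in> words k \<rightarrow> carrier (sym_stalk k n q)"
      using sgen_closed[OF q] S.M.zero_closed by (intro Pi_I) (simp split: if_split)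
    fix \<rho> assume \<rho>: "\<rho> \<in> words k"
    show "(if \<pi> = \<rho> then 1 else 0) \<odot>\<^bsub>sym_stalk k n q\<^esub> sgen k n \<alpha> q \<rho> =
        (if \<pi> = \<rho> then sgen k n \<alpha> q \<rho> else \<zero>\<^bsub>sym_stalk k n q\<^esub>)"
      using S.smult_one[OF sgen_closed[OF q \<rho>]] S.smult_l_null[OF sgen_closed[OF q \<rho>]]
      by (simp add: frac_ring_def)
  qed
  also have "\<dots> = sgen k n \<alpha> q \<pi>"
    by (rule S.add.finprod_singleton[OF \<pi> finite_words c])
  finally show ?thesis .
qed

lemma (in chart) famS_cong:
  assumes "famS v" "\<And>q. q \<in> V \<Longrightarrow> v q = v' q"
  shows "famS v'"
proof -
  obtain h where "\<forall>\<pi>\<in>words k. h \<pi> \<in> OV 0" "\<forall>q\<in>V. v q = symNF k n \<alpha> h q"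
    using assms(1) unfolding famS_def by (elim exE conjE) (rule that)
  then show ?thesis unfolding famS_def by (intro exI[of _ h]) (simp add: assms(2)[symmetric])
qed

lemma (in chart) famS_closed: "famS v \<Longrightarrow> q \<in> V \<Longrightarrow> v q \<in> carrier (sym_stalk k n q)"
  unfolding famS_def using symNF_closed by (elim exE conjE) simp

lemma (in chart) famS_add_smult:
  assumes v: "famS v" and v': "famS v'" and r: "r \<in> OV 0"
  shows "famS (\<lambda>q. r \<odot>\<^bsub>sym_stalk k n q\<^esub> v q \<oplus>\<^bsub>sym_stalk k n q\<^esub> v' q)"
proof -
  obtain h where "\<forall>\<pi>\<in>words k. h \<pi> \<in> OV 0" "\<forall>q\<in>V. v q = symNF k n \<alpha> h q"
    using v unfolding famS_def by (elim exE conjE) (rule that)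
  then have h: "\<And>\<pi>. \<pi> \<in> words k \<Longrightarrow> h \<pi> \<in> OV 0" "\<And>q. q \<in> V \<Longrightarrow> v q = symNF k n \<alpha> h q"
    by simp_all
  obtain h' where "\<forall>\<pi>\<in>words k. h' \<pi> \<in> OV 0" "\<forall>q\<in>V. v' q = symNF k n \<alpha> h' q"
    using v' unfolding famS_def by (elim exE conjE) (rule that)
  then have h': "\<And>\<pi>. \<pi> \<in> words k \<Longrightarrow> h' \<pi> \<in> OV 0" "\<And>q. q \<in> V \<Longrightarrow> v' q = symNF k n \<alpha> h' q"
    by simp_all
  have rh: "r * h \<pi> \<in> OV 0" if "\<pi> \<in> words k" for \<pi>
    using denominators.fracs_mult[OF D r h(1)[OF that]] by simp
  show ?thesis
    unfolding famS_def
  proof (intro exI[of _ "\<lambda>\<pi>. r * h \<pi> + h' \<pi>"] conjI ballI)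
    fix \<pi> assume "\<pi> \<in> words k"
    then show "r * h \<pi> + h' \<pi> \<in> OV 0" by (intro denominators.fracs_add[OF D] rh h'(1))
  next
    fix q assume q: "q \<in> V"
    have "r \<odot>\<^bsub>sym_stalk k n q\<^esub> symNF k n \<alpha> h q = symNF k n \<alpha> (\<lambda>\<pi>. r * h \<pi>) q"
      by (rule symNF_smult[OF q r h(1)])
    moreover have "symNF k n \<alpha> (\<lambda>\<pi>. r * h \<pi>) q \<oplus>\<^bsub>sym_stalk k n q\<^esub> symNF k n \<alpha> h' q =
        symNF k n \<alpha> (\<lambda>\<pi>. r * h \<pi> + h' \<pi>) q"
      by (rule symNF_add[OF q rh h'(1)])
    ultimately show "r \<odot>\<^bsub>sym_stalk k n q\<^esub> v q \<oplus>\<^bsub>sym_stalk k n q\<^esub> v' q = symNF k n \<alpha> (\<lambda>\<pi>. r * h \<pi> + h' \<pi>) q"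
      unfolding h(2)[OF q] h'(2)[OF q] by simp
  qed
qed

lemma (in chart) famS_zero: "famS (\<lambda>q. \<zero>\<^bsub>sym_stalk k n q\<^esub>)"
  unfolding famS_def
proof (intro exI[of _ "\<lambda>_. 0"] conjI ballI)
  show "0 \<in> OV 0" by (rule denominators.fracs_zero[OF D])
  fix q assume q: "q \<in> V"
  interpret S: Module.module "ring_st k q" "sym_stalk k n q" by (rule S_module[OF q])
  have "symNF k n \<alpha> (\<lambda>_. 0) q = (\<Oplus>\<^bsub>sym_stalk k n q\<^esub>\<pi>\<in>words k. \<zero>\<^bsub>sym_stalk k n q\<^esub>)"
    unfolding symNF_def
  proof (rule S.finsum_cong'[OF refl])
    fix \<pi> assume "\<pi> \<in> words k"
    then show "0 \<odot>\<^bsub>sym_stalk k n q\<^esub> sgen k n \<alpha> q \<pi> = \<zero>\<^bsub>sym_stalk k n q\<^esub>"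
      using S.smult_l_null[OF sgen_closed[OF q]] by (simp add: frac_ring_def)
  qed simp
  then show "\<zero>\<^bsub>sym_stalk k n q\<^esub> = symNF k n \<alpha> (\<lambda>_. 0) q" by simp
qed

lemma (in chart) famS_finsum:
  assumes "finite A" "\<And>j. j \<in> A \<Longrightarrow> famS (v j)" "\<And>j. j \<in> A \<Longrightarrow> r j \<in> OV 0"
  shows "famS (\<lambda>q. \<Oplus>\<^bsub>sym_stalk k n q\<^esub>j\<in>A. r j \<odot>\<^bsub>sym_stalk k n q\<^esub> v j q)"
  using assms
proof (induction A)
  case empty
  have "(\<Oplus>\<^bsub>sym_stalk k n q\<^esub>j\<in>{}. r j \<odot>\<^bsub>sym_stalk k n q\<^esub> v j q) = \<zero>\<^bsub>sym_stalk k n q\<^esub>" if "q \<in> V" for q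
  proof -
    interpret S: Module.module "ring_st k q" "sym_stalk k n q" by (rule S_module[OF that])
    show ?thesis by (rule S.finsum_empty)
  qed
  then show ?case by (intro famS_cong[OF famS_zero]) simp
next
  case (insert a A)
  have "famS (\<lambda>q. \<Oplus>\<^bsub>sym_stalk k n q\<^esub>j\<in>A. r j \<odot>\<^bsub>sym_stalk k n q\<^esub> v j q)"
    using insert.prems by (intro insert.IH) simp_all
  from famS_add_smult[OF insert.prems(1) this insert.prems(2), OF insertI1 insertI1]
  show ?case
  proof (rule famS_cong)
    fix q assume q: "q \<in> V"
    interpret S: Module.module "ring_st k q" "sym_stalk k n q" by (rule S_module[OF q])
    have c: "r j \<odot>\<^bsub>sym_stalk k n q\<^esub> v j q \<in> carrier (sym_stalk k n q)" if "j \<in> insert a A" for j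
      by (rule S.smult_closed[OF OV_ring[OF insert.prems(2)[OF that] q] famS_closed[OF insert.prems(1)[OF that] q]])
    show "r a \<odot>\<^bsub>sym_stalk k n q\<^esub> v a q \<oplus>\<^bsub>sym_stalk k n q\<^esub> (\<Oplus>\<^bsub>sym_stalk k n q\<^esub>j\<in>A. r j \<odot>\<^bsub>sym_stalk k n q\<^esub> v j q) =
        (\<Oplus>\<^bsub>sym_stalk k n q\<^esub>j\<in>insert a A. r j \<odot>\<^bsub>sym_stalk k n q\<^esub> v j q)"
      by (rule S.finsum_insert[symmetric]) (use insert.hyps c in auto)
  qed
qed

lemma (in chart) famE_closed:
  assumes "famE v" "q \<in> V"
  shows "v q \<in> carrier (bundle_stalk k n q)"
proof -
  obtain p where p: "degree p \<le> n" "\<forall>i. coeff p i \<in> OV 0" "\<forall>q\<in>V. v q = bundle_class k n q p"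
    using assms(1) unfolding famE_def by (elim exE conjE) (rule that)
  have "coeff p i \<in> fracs k (nonvan q) 0" for i
    using p(2) assms(2) by (intro OV_point) auto
  then have "p \<in> carrier (form_stalk k n q)" using p(1) by (simp add: frac_poly_module_def)
  then show ?thesis
    using module_quotient.quotient_cl[OF proj_point.E[OF point[OF assms(2)]]] p(3) assms(2) by simp
qed

text \<open>The symmetric product is expanded one factor at a time: \<open>j\<close> counts the factors that are
  not yet generators.\<close>

lemma (in chart) famS_sp_aux:
  assumes "j \<le> k" "\<And>i. i < j \<Longrightarrow> famE (x i)"
    "\<And>i. j \<le> i \<Longrightarrow> i < k \<Longrightarrow> \<exists>m<k. \<forall>q\<in>V. x i q = egen k n \<alpha> q m"
  shows "famS (\<lambda>q. spr k n q (\<lambda>i\<in>{..<k}. x i q))"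
  using assms
proof (induction j arbitrary: x)
  case 0
  have "\<forall>i. \<exists>m. i < k \<longrightarrow> m < k \<and> (\<forall>q\<in>V. x i q = egen k n \<alpha> q m)" using 0(3) by auto
  from choice[OF this] obtain \<pi> where "\<forall>i. i < k \<longrightarrow> \<pi> i < k \<and> (\<forall>q\<in>V. x i q = egen k n \<alpha> q (\<pi> i))"
    by (elim exE)
  then have \<pi>: "\<And>i. i < k \<Longrightarrow> \<pi> i < k" "\<And>i q. i < k \<Longrightarrow> q \<in> V \<Longrightarrow> x i q = egen k n \<alpha> q (\<pi> i)"
    by simp_all
  let ?\<pi> = "\<lambda>i\<in>{..<k}. \<pi> i"
  have w: "?\<pi> \<in> words k" using \<pi>(1) by auto
  show ?case
    unfolding famS_def
  proof (intro exI[of _ "\<lambda>\<rho>. if ?\<pi> = \<rho> then 1 else 0"] conjI ballI)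
    fix \<rho> :: "nat \<Rightarrow> nat"
    show "(if ?\<pi> = \<rho> then 1 else 0) \<in> OV 0"
      using denominators.fracs_zero[OF D] denominators.fracs_one[OF D] by simp
  next
    fix q assume q: "q \<in> V"
    have "(\<lambda>i\<in>{..<k}. x i q) = (\<lambda>i\<in>{..<k}. egen k n \<alpha> q (?\<pi> i))"
      using \<pi>(2)[OF _ q] by (intro restrict_ext) simp
    then show "spr k n q (\<lambda>i\<in>{..<k}. x i q) = symNF k n \<alpha> (\<lambda>\<rho>. if ?\<pi> = \<rho> then 1 else 0) q"
      unfolding symNF_single[OF q w] sgen_def by (rule arg_cong)
  qed
next
  case (Suc j)
  have jk: "j < k" using Suc.prems(1) by simp
  from famE_span[OF Suc.prems(2)[OF lessI]] obtain w where w0: "\<forall>i. w i \<in> OV 0" and xj0: "\<forall>q\<in>V. x j q =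
      (\<Oplus>\<^bsub>bundle_stalk k n q\<^esub>i\<in>{..<k}. w i \<odot>\<^bsub>bundle_stalk k n q\<^esub> egen k n \<alpha> q i)"
    by (elim exE conjE) (rule that)
  have w: "w i \<in> OV 0" for i using w0 by (rule spec)
  have xj: "x j q = (\<Oplus>\<^bsub>bundle_stalk k n q\<^esub>i\<in>{..<k}. w i \<odot>\<^bsub>bundle_stalk k n q\<^esub> egen k n \<alpha> q i)"
    if "q \<in> V" for q using xj0 that by (rule bspec)
  define x' where "x' m = x(j := (\<lambda>q. egen k n \<alpha> q m))" for m
  have fam: "famS (\<lambda>q. spr k n q (\<lambda>i\<in>{..<k}. x' m i q))" if m: "m \<in> {..<k}" for m
  proof (rule Suc.IH)
    show "j \<le> k" using jk by simp
    show "famE (x' m i)" if "i < j" for i using that Suc.prems(2)[of i] by (simp add: x'_def)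
    show "\<exists>m'<k. \<forall>q\<in>V. x' m i q = egen k n \<alpha> q m'" if "j \<le> i" "i < k" for i
    proof (cases "i = j")
      case True
      then show ?thesis using m by (intro exI[of _ m]) (simp add: x'_def)
    next
      case False
      then show ?thesis using Suc.prems(3)[of i] that by (simp add: x'_def)
    qed
  qed
  have "famS (\<lambda>q. \<Oplus>\<^bsub>sym_stalk k n q\<^esub>m\<in>{..<k}. w m \<odot>\<^bsub>sym_stalk k n q\<^esub> spr k n q (\<lambda>i\<in>{..<k}. x' m i q))"
    by (rule famS_finsum[OF _ fam w]) simp
  then show ?case
  proof (rule famS_cong)
    fix q assume q: "q \<in> V"
    let ?X = "\<lambda>i\<in>{..<k}. x i q"
    have "x i q \<in> carrier (bundle_stalk k n q)" if i: "i < k" for i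
    proof (cases "i < Suc j")
      case True
      then show ?thesis using famE_closed[OF Suc.prems(2) q] by simp
    next
      case False
      then obtain m where "m < k" "\<forall>q\<in>V. x i q = egen k n \<alpha> q m" using Suc.prems(3)[of i] i by auto
      then show ?thesis using egen_closed[OF q] q by simp
    qed
    then have X: "?X \<in> tuples k (bundle_stalk k n q)" unfolding tuples_def by auto
    have upd: "?X(j := egen k n \<alpha> q m) = (\<lambda>i\<in>{..<k}. x' m i q)" for m
      using jk by (auto simp: x'_def fun_eq_iff)
    have "?X = ?X(j := x j q)" using jk by (auto simp: fun_eq_iff)
    then have "spr k n q ?X = spr k n q (?X(j := \<Oplus>\<^bsub>bundle_stalk k n q\<^esub>i\<in>{..<k}. w i \<odot>\<^bsub>bundle_stalk k n q\<^esub> egen k n \<alpha> q i))"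
      unfolding xj[OF q] by (rule arg_cong)
    also have "\<dots> = (\<Oplus>\<^bsub>sym_stalk k n q\<^esub>m\<in>{..<k}. w m \<odot>\<^bsub>sym_stalk k n q\<^esub> spr k n q (?X(j := egen k n \<alpha> q m)))"
      by (rule sym_power.sp_finsum[OF proj_point.S[OF point[OF q]] X jk])
        (use OV_ring[OF w q] egen_closed[OF q] in auto)
    finally show "(\<Oplus>\<^bsub>sym_stalk k n q\<^esub>m\<in>{..<k}. w m \<odot>\<^bsub>sym_stalk k n q\<^esub> spr k n q (\<lambda>i\<in>{..<k}. x' m i q)) =
        spr k n q ?X"
      unfolding upd by (rule sym)
  qed
qed

lemma (in chart) famS_sp:
  "(\<And>i. i < k \<Longrightarrow> famE (x i)) \<Longrightarrow> famS (\<lambda>q. spr k n q (\<lambda>i\<in>{..<k}. x i q))"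
  by (rule famS_sp_aux[OF order_refl]) simp_all

definition (in chart) famT :: "nat \<Rightarrow> ('a mpoly set \<Rightarrow> _) \<Rightarrow> bool" where
  "famT N s \<longleftrightarrow> (\<exists>h. (\<forall>\<pi>\<in>words k. h \<pi> \<in> OV 0) \<and> (\<forall>q\<in>V. s q = NF k n N \<alpha> h q))"

lemma (in chart) line_powers:
  "Fract 1 (ell k \<alpha> ^ N) \<in> OV (- int N)" "Fract (ell k \<alpha> ^ N) 1 \<in> OV (int N)"
proof -
  have "\<forall>q\<in>V. ell k \<alpha> \<notin> q" using ell_V by blast
  then show "Fract 1 (ell k \<alpha> ^ N) \<in> OV (- int N)" "Fract (ell k \<alpha> ^ N) 1 \<in> OV (int N)"
    using denominators.fracs_linear_power[OF D ell_homogeneous, of \<alpha> N] by simp_all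
qed

text \<open>Each \<open>l j\<close> is a multiple of the fixed generator of the line bundle by a
  function \<open>c j\<close> of degree 0. Moved across the tensor sign, \<open>c j\<close> becomes
  a coefficient in the symmetric power, and the sum collapses to a single tensor.\<close>

lemma (in chart) famT_sum:
  fixes M :: nat
  assumes e: "\<And>j. j < M \<Longrightarrow> famS (e j)" and l: "\<And>j. j < M \<Longrightarrow> l j \<in> OV (- int N)"
  shows "famT N (\<lambda>q. \<Oplus>\<^bsub>tensor_stalk k n (- int N) q\<^esub>j\<in>{..<M}. tpr k n (- int N) q (e j q) (l j))"
proof -
  let ?L = "Fract (ell k \<alpha> ^ N) 1" and ?u = "Fract 1 (ell k \<alpha> ^ N)"
  have "ell k \<alpha> \<noteq> 0" using denominators.nonzero[OF D, of "ell k \<alpha>"] ell_V by blast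
  then have inv: "?L * ?u = 1" by (simp add: One_fract_def eq_fract)
  define c where "c j = l j * ?L" for j
  have c: "c j \<in> OV 0" if "j < M" for j
    using denominators.fracs_mult[OF D l[OF that] line_powers(2)[of N]] by (simp add: c_def)
  have lc: "l j = c j * ?u" for j unfolding c_def mult.assoc inv by simp
  have "famS (\<lambda>q. \<Oplus>\<^bsub>sym_stalk k n q\<^esub>j\<in>{..<M}. c j \<odot>\<^bsub>sym_stalk k n q\<^esub> e j q)"
    by (rule famS_finsum) (use e c in simp_all)
  then obtain h where h: "\<forall>\<pi>\<in>words k. h \<pi> \<in> OV 0"
    "\<forall>q\<in>V. (\<Oplus>\<^bsub>sym_stalk k n q\<^esub>j\<in>{..<M}. c j \<odot>\<^bsub>sym_stalk k n q\<^esub> e j q) = symNF k n \<alpha> h q"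
    unfolding famS_def by (elim exE conjE) (rule that)
  show ?thesis
    unfolding famT_def
  proof (intro exI[of _ h] conjI ballI)
    fix q assume q: "q \<in> V"
    let ?d = "- int N"
    interpret T: tensor_product "ring_st k q" "sym_stalk k n q" "line_stalk k ?d q"
      by (rule proj_point.T[OF point[OF q]])
    interpret TT: Module.module "ring_st k q" "tensor_stalk k n ?d q" by (rule T_module[OF q])
    have u: "?u \<in> carrier (line_stalk k ?d q)"
      using OV_point[OF line_powers(1) q] by (simp add: frac_module_def)
    have cc: "c j \<in> carrier (ring_st k q)" "e j q \<in> carrier (sym_stalk k n q)" if "j < M" for j
      using OV_ring[OF c[OF that] q] famS_closed[OF e[OF that] q] by auto
    have ce: "c j \<odot>\<^bsub>sym_stalk k n q\<^esub> e j q \<in> carrier (sym_stalk k n q)" if "j < M" for j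
      using cc[OF that] by (rule T.M.smult_closed)
    have step: "tpr k n ?d q (e j q) (l j) = tpr k n ?d q (c j \<odot>\<^bsub>sym_stalk k n q\<^esub> e j q) ?u" if j: "j < M" for j
    proof -
      have "l j = c j \<odot>\<^bsub>line_stalk k ?d q\<^esub> ?u" by (simp add: frac_module_def lc)
      then show ?thesis
        using T.tp_smult_right[OF cc(1)[OF j] cc(2)[OF j] u] T.tp_smult_left[OF cc(1)[OF j] cc(2)[OF j] u] by simp
    qed
    have "(\<Oplus>\<^bsub>tensor_stalk k n ?d q\<^esub>j\<in>{..<M}. tpr k n ?d q (e j q) (l j)) =
        (\<Oplus>\<^bsub>tensor_stalk k n ?d q\<^esub>j\<in>{..<M}. tpr k n ?d q (c j \<odot>\<^bsub>sym_stalk k n q\<^esub> e j q) ?u)"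
      by (rule TT.finsum_cong'[OF refl]) (use step T.tp_closed[OF ce u] in auto)
    also have "\<dots> = tpr k n ?d q (\<Oplus>\<^bsub>sym_stalk k n q\<^esub>j\<in>{..<M}. c j \<odot>\<^bsub>sym_stalk k n q\<^esub> e j q) ?u"
      by (rule T.tp_finsum_left[symmetric]) (use ce u in auto)
    finally show "(\<Oplus>\<^bsub>tensor_stalk k n ?d q\<^esub>j\<in>{..<M}. tpr k n ?d q (e j q) (l j)) = NF k n N \<alpha> h q"
      unfolding NF_def using h(2) q by simp
  qed (use h(1) in simp)
qed

section \<open>Sections near a point\<close>

text \<open>The property is asked of every smaller basic neighbourhood of \<open>p\<close> as well.
  In this form it passes to conjunctions, even when it is not visibly inherited by smaller
  sets.\<close>

definition near :: "nat \<Rightarrow> 'a::field mpoly set \<Rightarrow> ('a mpoly set set \<Rightarrow> bool) \<Rightarrow> bool" where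
  "near k p \<Phi> \<longleftrightarrow> (\<exists>b e. b \<in> homogeneous k e \<and> b \<notin> p \<and>
     (\<forall>b' e'. b' \<in> homogeneous k e' \<and> b' \<notin> p \<and> basic k b' \<subseteq> basic k b \<longrightarrow> \<Phi> (basic k b')))"

lemma basic_open: "b \<in> homogeneous k e \<Longrightarrow> basic k b \<in> proj_opens k"
  unfolding basic_def proj_opens_def by (intro CollectI exI[of _ "{b}"]) auto

lemma basic_subset: "basic k b \<subseteq> proj_points k"
  by (auto simp: basic_def)

lemma basic_mult:
  assumes "b \<in> mpoly_carrier k" "c \<in> mpoly_carrier k"
  shows "basic k (b * c) \<subseteq> basic k b \<inter> basic k c"
proof
  fix q assume "q \<in> basic k (b * c)"
  then have q: "q \<in> proj_points k" "b * c \<notin> q" by (auto simp: basic_def)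
  then have "b \<notin> q" "c \<notin> q"
    using proj_pointD(5)[OF q(1), of b c] proj_pointD(5)[OF q(1), of c b] assms by (auto simp: mult.commute)
  then show "q \<in> basic k b \<inter> basic k c" using q by (simp add: basic_def)
qed

lemma near_obtain:
  assumes "near k p \<Phi>"
  obtains b e where "b \<in> homogeneous k e" "b \<notin> p" "\<Phi> (basic k b)"
proof -
  obtain b e where b: "b \<in> homogeneous k e" "b \<notin> p"
    "\<forall>b' e'. b' \<in> homogeneous k e' \<and> b' \<notin> p \<and> basic k b' \<subseteq> basic k b \<longrightarrow> \<Phi> (basic k b')"
    using assms unfolding near_def by (elim exE conjE) (rule that)
  then have "\<Phi> (basic k b)" using b(1,2) by (intro b(3)[rule_format]) simp
  with b(1,2) show thesis by (rule that)
qed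

lemma near_mono:
  assumes "near k p \<Phi>" and p: "p \<in> proj_points k"
    and "\<And>V. p \<in> V \<Longrightarrow> V \<subseteq> proj_points k \<Longrightarrow> V \<in> proj_opens k \<Longrightarrow> \<Phi> V \<Longrightarrow> \<Psi> V"
  shows "near k p \<Psi>"
proof -
  obtain b e where b: "b \<in> homogeneous k e" "b \<notin> p"
    "\<forall>b' e'. b' \<in> homogeneous k e' \<and> b' \<notin> p \<and> basic k b' \<subseteq> basic k b \<longrightarrow> \<Phi> (basic k b')"
    using assms(1) unfolding near_def by (elim exE conjE) (rule that)
  show ?thesis
    unfolding near_def
  proof (intro exI[of _ b] exI[of _ e] conjI allI impI b(1,2))
    fix b' e' assume b': "b' \<in> homogeneous k e' \<and> b' \<notin> p \<and> basic k b' \<subseteq> basic k b"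
    show "\<Psi> (basic k b')"
    proof (rule assms(3))
      show "p \<in> basic k b'" using b' p by (simp add: basic_def)
      show "basic k b' \<in> proj_opens k" using b' basic_open by blast
      show "\<Phi> (basic k b')" using b(3) b' by blast
    qed (rule basic_subset)
  qed
qed

lemma near_conj:
  assumes p: "p \<in> proj_points k" and "near k p \<Phi>" "near k p \<Psi>"
  shows "near k p (\<lambda>V. \<Phi> V \<and> \<Psi> V)"
proof -
  obtain b e where b: "b \<in> homogeneous k e" "b \<notin> p"
    "\<forall>b' e'. b' \<in> homogeneous k e' \<and> b' \<notin> p \<and> basic k b' \<subseteq> basic k b \<longrightarrow> \<Phi> (basic k b')"
    using assms(2) unfolding near_def by (elim exE conjE) (rule that)
  obtain c u where c: "c \<in> homogeneous k u" "c \<notin> p"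
    "\<forall>b' e'. b' \<in> homogeneous k e' \<and> b' \<notin> p \<and> basic k b' \<subseteq> basic k c \<longrightarrow> \<Psi> (basic k b')"
    using assms(3) unfolding near_def by (elim exE conjE) (rule that)
  note carr = homogeneous_carrier[OF b(1)] homogeneous_carrier[OF c(1)]
  show ?thesis
    unfolding near_def
  proof (intro exI[of _ "b * c"] exI[of _ "e + u"] conjI allI impI)
    show "b * c \<in> homogeneous k (e + u)" using b(1) c(1) by (rule homogeneous_mult)
    show "b * c \<notin> p" using proj_pointD(6)[OF p carr] b(2) c(2) by blast
    fix b' e' assume b': "b' \<in> homogeneous k e' \<and> b' \<notin> p \<and> basic k b' \<subseteq> basic k (b * c)"
    then have "basic k b' \<subseteq> basic k b" "basic k b' \<subseteq> basic k c" using basic_mult[OF carr] by auto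
    then show "\<Phi> (basic k b')" "\<Psi> (basic k b')" using b(3) c(3) b' by blast+
  qed
qed

lemma near_True:
  assumes "p \<in> proj_points k"
  shows "near k p (\<lambda>V. True)"
  unfolding near_def using proj_pointD(3)[OF assms] by (intro exI[of _ 1] exI[of _ 0]) simp

lemma near_ball:
  assumes p: "p \<in> proj_points k" and "finite A" "\<And>a. a \<in> A \<Longrightarrow> near k p (\<Phi> a)"
  shows "near k p (\<lambda>V. \<forall>a\<in>A. \<Phi> a V)"
  using assms(2,3)
proof (induction A)
  case empty
  then show ?case using near_True[OF p] by simp
next
  case (insert a A)
  then show ?case using near_conj[OF p, of "\<Phi> a" "\<lambda>V. \<forall>a\<in>A. \<Phi> a V"] by simp
qed

lemma near_subset:
  assumes "W \<in> proj_opens k" "p \<in> W"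
  shows "near k p (\<lambda>V. V \<subseteq> W)"
proof -
  obtain T where T: "W = {p \<in> proj_points k. \<not> T \<subseteq> p}" "T \<subseteq> (\<Union>d. homogeneous k d)"
    using assms(1) unfolding proj_opens_def by blast
  then obtain b e where b: "b \<in> T" "b \<notin> p" "b \<in> homogeneous k e" using assms(2) by blast
  then have "basic k b \<subseteq> W" unfolding T(1) basic_def by blast
  then show ?thesis unfolding near_def using b by (intro exI[of _ b] exI[of _ e]) blast
qed

lemma near_ell:
  assumes "ell k \<alpha> \<notin> p"
  shows "near k p (\<lambda>V. \<forall>q\<in>V. ell k \<alpha> \<notin> q)"
  unfolding near_def
  by (intro exI[of _ "ell k \<alpha>"] exI[of _ 1] conjI allI impI ell_homogeneous assms) (auto simp: basic_def)

lemma proj_points_open: "proj_points k \<in> proj_opens k"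
  unfolding proj_opens_def
proof (intro CollectI exI[of _ "mvar ` {..k}"] conjI)
  show "proj_points k = {p \<in> proj_points k. \<not> mvar ` {..k} \<subseteq> p}"
    by (auto simp: proj_points_def)
  show "mvar ` {..k} \<subseteq> (\<Union>d. homogeneous k d)"
    using homogeneous_mvar by blast
qed

lemma Union_opens: "\<Union>(proj_opens k) = proj_points k"
proof
  show "\<Union>(proj_opens k) \<subseteq> proj_points k" by (auto simp: proj_opens_def)
  show "proj_points k \<subseteq> \<Union>(proj_opens k)" using proj_points_open by (rule Union_upper)
qed

section \<open>Sheafification\<close>

lemma sheafify_stalk [simp]: "stalk (sheafify Op st pre) = st"
  by (simp add: sheafify_def)

lemma sheafifyD:
  assumes "s \<in> sections (sheafify Op st pre) W" "p \<in> W"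
  shows "\<exists>W' t. W' \<in> Op \<and> p \<in> W' \<and> W' \<subseteq> W \<and> (\<forall>q\<in>W'. s q = t q) \<and> t \<in> pre W'"
proof -
  have "\<forall>p\<in>W. \<exists>W'\<in>Op. p \<in> W' \<and> W' \<subseteq> W \<and> (\<exists>t\<in>pre W'. \<forall>q\<in>W'. s q = t q)"
    using assms(1) unfolding sheafify_def by simp
  from bspec[OF this assms(2)] show ?thesis by blast
qed

lemma sheafify_closed: "s \<in> sections (sheafify Op st pre) W \<Longrightarrow> p \<in> W \<Longrightarrow> s p \<in> carrier (st p)"
  unfolding sheafify_def by auto

lemma sheafifyI:
  assumes "V \<in> Op" "t \<in> pre V" "\<And>q. q \<in> V \<Longrightarrow> s q = t q" "\<And>q. q \<in> V \<Longrightarrow> t q \<in> carrier (st q)"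
    "s \<in> extensional V"
  shows "s \<in> sections (sheafify Op st pre) V"
proof -
  have "s \<in> (\<Pi>\<^sub>E p\<in>V. carrier (st p))" using assms(3,4,5) by (simp add: PiE_iff)
  moreover have "\<forall>p\<in>V. \<exists>W\<in>Op. p \<in> W \<and> W \<subseteq> V \<and> (\<exists>t\<in>pre W. \<forall>q\<in>W. s q = t q)"
    using assms(1,2,3) by blast
  ultimately show ?thesis unfolding sheafify_def by simp
qed

lemma sheafify_glue:
  assumes "s \<in> (\<Pi>\<^sub>E p\<in>V. carrier (st p))"
    and "\<And>p. p \<in> V \<Longrightarrow> \<exists>W. p \<in> W \<and> W \<subseteq> V \<and> (\<exists>\<sigma>\<in>sections (sheafify Op st pre) W. \<forall>q\<in>W. s q = \<sigma> q)"
  shows "s \<in> sections (sheafify Op st pre) V"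
proof -
  have "\<exists>W\<in>Op. p \<in> W \<and> W \<subseteq> V \<and> (\<exists>t\<in>pre W. \<forall>q\<in>W. s q = t q)" if p: "p \<in> V" for p
  proof -
    obtain W \<sigma> where W: "p \<in> W" "W \<subseteq> V" "\<sigma> \<in> sections (sheafify Op st pre) W" "\<forall>q\<in>W. s q = \<sigma> q"
      using assms(2)[OF p] by auto
    from sheafifyD[OF W(3,1)]
    obtain W' t where W': "W' \<in> Op" "p \<in> W'" "W' \<subseteq> W" "\<forall>q\<in>W'. \<sigma> q = t q" "t \<in> pre W'"
      by (elim exE conjE) (rule that)
    have "\<forall>q\<in>W'. s q = t q" using W(4) W'(3,4) by auto
    then show ?thesis using W(2) W'(1,2,3,5) by (intro bexI[of _ W'] conjI bexI[of _ t]) auto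
  qed
  then show ?thesis using assms(1) unfolding sheafify_def by simp
qed

section \<open>The stalks, and the local shape of sections\<close>

lemma stalk_eqs:
  "ring_stalk (proj_space k) q = ring_st k q"
  "stalk (twist k d) q = line_stalk k d q"
  "stalk (form_sheaf k m d) q = frac_poly_module k (nonvan q) m d"
  by (simp_all add: proj_space_def frac_ring_def twist_def frac_module_def form_sheaf_def
      frac_poly_module_def twist_stalk_eq Let_def)

lemma proj_space_simps: "opens (proj_space k) = proj_opens k" "ring_sections (proj_space k) = sections (twist k 0)"
  by (simp_all add: proj_space_def)

lemma stalk_schwarzenberger:
  assumes "k \<le> n"
  shows "stalk (schwarzenberger k (n - k)) q = bundle_stalk k n q"
  using assms by (simp add: schwarzenberger_def cokernel_sheaf_def Let_def stalk_eqs taut_image_def)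

abbreviation "schw k n \<equiv> schwarzenberger k (n - k)"
abbreviation "symsh k n \<equiv> sym_sheaf (proj_space k) k (schw k n)"
abbreviation "tensh k n d \<equiv> tensor_sheaf (proj_space k) (symsh k n) (twist k d)"

lemma stalk_sym: "k \<le> n \<Longrightarrow> stalk (symsh k n) q = sym_stalk k n q"
  by (simp add: sym_sheaf_def Let_def stalk_eqs stalk_schwarzenberger)

lemma stalk_tensor: "k \<le> n \<Longrightarrow> stalk (tensh k n d) q = tensor_stalk k n d q"
  by (simp add: tensor_sheaf_def Let_def stalk_eqs stalk_sym)

text \<open>The stalks all lie in one field of fractions, and a section is locally a single
  fraction. So near \<open>p\<close> the function that represents it is constant.\<close>

lemma near_twist:
  assumes s: "s \<in> sections (twist k d) W" and p: "p \<in> W" "p \<in> proj_points k"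
  shows "near k p (\<lambda>V. \<exists>x\<in>fracs k (nonvan_on V) d. \<forall>q\<in>V. s q = x)"
proof -
  from sheafifyD[OF s[unfolded twist_def] p(1)]
  obtain W' t where W': "W' \<in> proj_opens k" "p \<in> W'" "\<forall>q\<in>W'. s q = t q"
    "t \<in> {(\<lambda>q. Fract a f) | a f e e'. f \<in> homogeneous k e \<and> (\<forall>q\<in>W'. f \<notin> q) \<and>
               a \<in> homogeneous k e' \<and> int e' = int e + d}"
    by (elim exE conjE) (rule that)
  then obtain a f e e' where t: "t = (\<lambda>q. Fract a f)" "f \<in> homogeneous k e" "\<forall>q\<in>W'. f \<notin> q"
    "a \<in> homogeneous k e'" "int e' = int e + d"
    by auto
  show ?thesis
  proof (rule near_mono[OF near_subset[OF W'(1,2)] p(2)])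
    fix V assume V: "V \<subseteq> W'"
    have "Fract a f \<in> fracs k (nonvan_on V) d"
      using t V by (intro fracsI[OF t(2) _ t(4,5)]) auto
    moreover have "\<forall>q\<in>V. s q = Fract a f" using W'(3) V t(1) by auto
    ultimately show "\<exists>x\<in>fracs k (nonvan_on V) d. \<forall>q\<in>V. s q = x" by (rule bexI[rotated])
  qed
qed

lemma near_form:
  assumes s: "s \<in> sections (form_sheaf k n d) W" and p: "p \<in> W" "p \<in> proj_points k" and W: "W \<in> proj_opens k"
  shows "near k p (\<lambda>V. \<exists>P. degree P \<le> n \<and> (\<forall>i. coeff P i \<in> fracs k (nonvan_on V) d) \<and> (\<forall>q\<in>V. s q = P))"
proof -
  have sec: "(\<lambda>p\<in>W. coeff (s p) i) \<in> sections (twist k d) W" for i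
    using s by (simp add: form_sheaf_def Let_def)
  have deg: "degree (s q) \<le> n" if "q \<in> W" for q
    using s that by (auto simp: form_sheaf_def Let_def PiE_iff)
  \<comment> \<open>The index \<open>Suc n\<close> is included for its coefficient 0: it puts 0 into
    \<open>fracs k (nonvan_on V) d\<close> and so covers all higher coefficients.\<close>
  have n: "near k p (\<lambda>V. \<forall>i\<in>{..Suc n}. \<exists>x\<in>fracs k (nonvan_on V) d. \<forall>q\<in>V. (\<lambda>p\<in>W. coeff (s p) i) q = x)"
    by (rule near_ball[OF p(2)]) (simp, rule near_twist[OF sec p])
  show ?thesis
  proof (rule near_mono[OF near_conj[OF p(2) near_subset[OF W p(1)] n] p(2)])
    fix V assume pV: "p \<in> V" and V: "V \<subseteq> W \<and> (\<forall>i\<in>{..Suc n}. \<exists>x\<in>fracs k (nonvan_on V) d. \<forall>q\<in>V. (\<lambda>p\<in>W. coeff (s p) i) q = x)"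
    have c: "coeff (s q) i = coeff (s p) i" "coeff (s p) i \<in> fracs k (nonvan_on V) d" if "i \<le> Suc n" "q \<in> V" for i q
    proof -
      obtain x where x: "x \<in> fracs k (nonvan_on V) d" "\<forall>q\<in>V. (\<lambda>p\<in>W. coeff (s p) i) q = x"
        using V \<open>i \<le> Suc n\<close> by (elim conjE ballE[of _ _ i] bexE) (rule that, assumption+, simp)
      have "q \<in> W" using V \<open>q \<in> V\<close> by blast
      then have "coeff (s q) i = x" "coeff (s p) i = x"
        using bspec[OF x(2) \<open>q \<in> V\<close>] bspec[OF x(2) pV] p(1) by simp_all
      then show "coeff (s q) i = coeff (s p) i" "coeff (s p) i \<in> fracs k (nonvan_on V) d" using x(1) by simp_all
    qed
    have dp: "degree (s p) \<le> n" by (rule deg[OF p(1)])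
    have "coeff (s p) i \<in> fracs k (nonvan_on V) d" for i
    proof (cases "i \<le> Suc n")
      case True
      then show ?thesis using c(2) pV by simp
    next
      case False
      then have "coeff (s p) i = coeff (s p) (Suc n)" using dp by (simp add: coeff_eq_0)
      then show ?thesis using c(2)[OF order_refl pV] by simp
    qed
    moreover have "s q = s p" if q: "q \<in> V" for q
    proof (rule poly_eqI)
      fix i
      show "coeff (s q) i = coeff (s p) i"
        using c(1)[of i q] q deg[of q] dp V by (cases "i \<le> Suc n") (auto simp: coeff_eq_0)
    qed
    ultimately show "\<exists>P. degree P \<le> n \<and> (\<forall>i. coeff P i \<in> fracs k (nonvan_on V) d) \<and> (\<forall>q\<in>V. s q = P)"
      using dp by (intro exI[of _ "s p"]) simp
  qed
qed

lemma near_schwarzenberger: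
  assumes kn: "k \<le> n" and s: "s \<in> sections (schw k n) W" and p: "p \<in> W" "p \<in> proj_points k"
  shows "near k p (\<lambda>V. \<exists>P. degree P \<le> n \<and> (\<forall>i. coeff P i \<in> fracs k (nonvan_on V) 0) \<and>
    (\<forall>q\<in>V. s q = bundle_class k n q P))"
proof -
  have nk: "n - k + k = n" using kn by simp
  from sheafifyD[OF s[unfolded schwarzenberger_def cokernel_sheaf_def Let_def stalk_eqs nk taut_image_def[symmetric]] p(1)]
  obtain W' t where W': "W' \<in> proj_opens k" "p \<in> W'" "\<forall>q\<in>W'. s q = t q"
    "t \<in> {(\<lambda>q. bundle_class k n q (t q)) | t. t \<in> sections (form_sheaf k n 0) W'}"
    by (elim exE conjE) (rule that)
  then obtain u where u: "t = (\<lambda>q. bundle_class k n q (u q))" "u \<in> sections (form_sheaf k n 0) W'"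
    by auto
  show ?thesis
  proof (rule near_mono[OF near_conj[OF p(2) near_subset[OF W'(1,2)] near_form[OF u(2) W'(2) p(2) W'(1)]] p(2)],
      elim conjE exE)
    fix V P assume *: "V \<subseteq> W'" "degree P \<le> n" "\<forall>i. coeff P i \<in> fracs k (nonvan_on V) 0" "\<forall>q\<in>V. u q = P"
    have "\<forall>q\<in>V. s q = bundle_class k n q P" using W'(3) u(1) *(1,4) by auto
    then show "\<exists>P. degree P \<le> n \<and> (\<forall>i. coeff P i \<in> fracs k (nonvan_on V) 0) \<and>
        (\<forall>q\<in>V. s q = bundle_class k n q P)"
      using *(2,3) by (intro exI[of _ P] conjI)
  qed
qed

text \<open>Near \<open>p\<close> the section is a finite sum of products of sections of the bundle.
  A smaller neighbourhood gives all factors polynomial representatives at once and keeps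
  \<open>ell k \<alpha>\<close> invertible; expansion in the frame yields the normal form.\<close>

lemma near_sym:
  fixes \<alpha> :: "'a::alg_closed_field"
  assumes kn: "k \<le> n" "k \<ge> 1" and s: "s \<in> sections (symsh k n) W" and p: "p \<in> W" "p \<in> proj_points k"
    and \<alpha>: "ell k \<alpha> \<notin> p"
  shows "near k p (\<lambda>V. \<exists>h. (\<forall>\<pi>\<in>words k. h \<pi> \<in> fracs k (nonvan_on V) 0) \<and>
    (\<forall>q\<in>V. s q = symNF k n \<alpha> h q))"
proof -
  from sheafifyD[OF s[unfolded sym_sheaf_def Let_def stalk_eqs stalk_schwarzenberger[OF kn(1)] proj_space_simps] p(1)]
  obtain W' t where W': "W' \<in> proj_opens k" "p \<in> W'" "\<forall>q\<in>W'. s q = t q"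
    "t \<in> {(\<lambda>q. \<Oplus>\<^bsub>sym_stalk k n q\<^esub>j\<in>{..<M}. r j q \<odot>\<^bsub>sym_stalk k n q\<^esub> spr k n q (\<lambda>i\<in>{..<k}. e j i q)) | (M::nat) r e.
       \<forall>j<M. r j \<in> sections (twist k 0) W' \<and> (\<forall>i<k. e j i \<in> sections (schw k n) W')}"
    by (elim exE conjE) (rule that)
  then obtain M :: nat and r e where t: "t = (\<lambda>q. \<Oplus>\<^bsub>sym_stalk k n q\<^esub>j\<in>{..<M}. r j q \<odot>\<^bsub>sym_stalk k n q\<^esub> spr k n q (\<lambda>i\<in>{..<k}. e j i q))"
    and re: "\<forall>j<M. r j \<in> sections (twist k 0) W' \<and> (\<forall>i<k. e j i \<in> sections (schw k n) W')"
    by (elim CollectE exE conjE) (rule that)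
  have nr: "near k p (\<lambda>V. \<forall>j\<in>{..<M}. \<exists>x\<in>fracs k (nonvan_on V) 0. \<forall>q\<in>V. r j q = x)"
    by (rule near_ball[OF p(2)]) (simp, rule near_twist[OF _ W'(2) p(2)], use re in simp)
  have ne: "near k p (\<lambda>V. \<forall>j\<in>{..<M}. \<forall>i\<in>{..<k}. \<exists>P. degree P \<le> n \<and>
      (\<forall>l. coeff P l \<in> fracs k (nonvan_on V) 0) \<and> (\<forall>q\<in>V. e j i q = bundle_class k n q P))"
    by (rule near_ball[OF p(2)], simp, rule near_ball[OF p(2)], simp,
        rule near_schwarzenberger[OF kn(1) _ W'(2) p(2)], use re in simp)
  show ?thesis
  proof (rule near_mono[OF near_conj[OF p(2) near_conj[OF p(2) near_subset[OF W'(1,2)] near_ell[OF \<alpha>]]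
          near_conj[OF p(2) nr ne]] p(2)], elim conjE)
    fix V assume VV: "p \<in> V" "V \<subseteq> proj_points k" "V \<subseteq> W'" "\<forall>q\<in>V. ell k \<alpha> \<notin> q"
      and vr: "\<forall>j\<in>{..<M}. \<exists>x\<in>fracs k (nonvan_on V) 0. \<forall>q\<in>V. r j q = x"
      and ve: "\<forall>j\<in>{..<M}. \<forall>i\<in>{..<k}. \<exists>P. degree P \<le> n \<and>
        (\<forall>l. coeff P l \<in> fracs k (nonvan_on V) 0) \<and> (\<forall>q\<in>V. e j i q = bundle_class k n q P)"
    interpret chart k n \<alpha> V using kn VV by (intro chart.intro) auto
    obtain x where x: "\<forall>j\<in>{..<M}. x j \<in> fracs k (nonvan_on V) 0 \<and> (\<forall>q\<in>V. r j q = x j)"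
      using bchoice[OF vr[unfolded Bex_def]] by (elim exE)
    have "famS (\<lambda>q. \<Oplus>\<^bsub>sym_stalk k n q\<^esub>j\<in>{..<M}. x j \<odot>\<^bsub>sym_stalk k n q\<^esub> spr k n q (\<lambda>i\<in>{..<k}. e j i q))"
    proof (rule famS_finsum)
      show "famS (\<lambda>q. spr k n q (\<lambda>i\<in>{..<k}. e j i q))" if "j \<in> {..<M}" for j
        by (rule famS_sp) (use ve that in \<open>simp add: famE_def\<close>)
    qed (use x in simp_all)
    then have "famS s"
    proof (rule famS_cong)
      fix q assume q: "q \<in> V"
      interpret S: Module.module "ring_st k q" "sym_stalk k n q" by (rule S_module[OF q])
      have c: "e j i q \<in> carrier (bundle_stalk k n q)" if "j < M" "i < k" for j i
        by (rule famE_closed[OF _ q]) (use ve that in \<open>simp add: famE_def\<close>)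
      have "x j \<odot>\<^bsub>sym_stalk k n q\<^esub> spr k n q (\<lambda>i\<in>{..<k}. e j i q) \<in> carrier (sym_stalk k n q)" if j: "j < M" for j
        by (rule S.smult_closed[OF OV_ring[OF _ q] sym_power.sp_closed[OF proj_point.S[OF point[OF q]]]])
          (use x j c[OF j] in \<open>auto simp: tuples_def\<close>)
      then have "(\<Oplus>\<^bsub>sym_stalk k n q\<^esub>j\<in>{..<M}. r j q \<odot>\<^bsub>sym_stalk k n q\<^esub> spr k n q (\<lambda>i\<in>{..<k}. e j i q)) =
          (\<Oplus>\<^bsub>sym_stalk k n q\<^esub>j\<in>{..<M}. x j \<odot>\<^bsub>sym_stalk k n q\<^esub> spr k n q (\<lambda>i\<in>{..<k}. e j i q))"
        using x q by (intro S.finsum_cong'[OF refl]) auto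
      then show "(\<Oplus>\<^bsub>sym_stalk k n q\<^esub>j\<in>{..<M}. x j \<odot>\<^bsub>sym_stalk k n q\<^esub> spr k n q (\<lambda>i\<in>{..<k}. e j i q)) = s q"
        using W'(3) t VV(3) q by auto
    qed
    then show "\<exists>h. (\<forall>\<pi>\<in>words k. h \<pi> \<in> fracs k (nonvan_on V) 0) \<and> (\<forall>q\<in>V. s q = symNF k n \<alpha> h q)"
      unfolding famS_def .
  qed
qed

lemma near_tensor:
  fixes \<alpha> :: "'a::alg_closed_field"
  assumes kn: "k \<le> n" "k \<ge> 1" and s: "s \<in> sections (tensh k n (- int N)) W" and p: "p \<in> W" "p \<in> proj_points k"
    and \<alpha>: "ell k \<alpha> \<notin> p"
  shows "near k p (\<lambda>V. \<exists>h. (\<forall>\<pi>\<in>words k. h \<pi> \<in> fracs k (nonvan_on V) 0) \<and>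
    (\<forall>q\<in>V. s q = NF k n N \<alpha> h q))"
proof -
  let ?d = "- int N"
  from sheafifyD[OF s[unfolded tensor_sheaf_def Let_def stalk_eqs stalk_sym[OF kn(1)] proj_space_simps] p(1)]
  obtain W' t where W': "W' \<in> proj_opens k" "p \<in> W'" "\<forall>q\<in>W'. s q = t q"
    "t \<in> {(\<lambda>q. \<Oplus>\<^bsub>tensor_stalk k n ?d q\<^esub>j\<in>{..<M}. tpr k n ?d q (e j q) (l j q)) | (M::nat) e l.
       \<forall>j<M. e j \<in> sections (symsh k n) W' \<and> l j \<in> sections (twist k ?d) W'}"
    by (elim exE conjE) (rule that)
  then obtain M :: nat and e l where t: "t = (\<lambda>q. \<Oplus>\<^bsub>tensor_stalk k n ?d q\<^esub>j\<in>{..<M}. tpr k n ?d q (e j q) (l j q))"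
    and el: "\<forall>j<M. e j \<in> sections (symsh k n) W' \<and> l j \<in> sections (twist k ?d) W'"
    by (elim CollectE exE conjE) (rule that)
  have nl: "near k p (\<lambda>V. \<forall>j\<in>{..<M}. \<exists>x\<in>fracs k (nonvan_on V) ?d. \<forall>q\<in>V. l j q = x)"
    by (rule near_ball[OF p(2)]) (simp, rule near_twist[OF _ W'(2) p(2)], use el in simp)
  have ne: "near k p (\<lambda>V. \<forall>j\<in>{..<M}. \<exists>h. (\<forall>\<pi>\<in>words k. h \<pi> \<in> fracs k (nonvan_on V) 0) \<and>
    (\<forall>q\<in>V. e j q = symNF k n \<alpha> h q))"
    by (rule near_ball[OF p(2)]) (simp, rule near_sym[OF kn _ W'(2) p(2) \<alpha>], use el in simp)
  show ?thesis
  proof (rule near_mono[OF near_conj[OF p(2) near_conj[OF p(2) near_subset[OF W'(1,2)] near_ell[OF \<alpha>]]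
          near_conj[OF p(2) nl ne]] p(2)], elim conjE)
    fix V assume VV: "p \<in> V" "V \<subseteq> proj_points k" "V \<subseteq> W'" "\<forall>q\<in>V. ell k \<alpha> \<notin> q"
      and vl: "\<forall>j\<in>{..<M}. \<exists>x\<in>fracs k (nonvan_on V) ?d. \<forall>q\<in>V. l j q = x"
      and ve: "\<forall>j\<in>{..<M}. \<exists>h. (\<forall>\<pi>\<in>words k. h \<pi> \<in> fracs k (nonvan_on V) 0) \<and>
        (\<forall>q\<in>V. e j q = symNF k n \<alpha> h q)"
    interpret chart k n \<alpha> V using kn VV by (intro chart.intro) auto
    obtain x where x: "\<forall>j\<in>{..<M}. x j \<in> fracs k (nonvan_on V) ?d \<and> (\<forall>q\<in>V. l j q = x j)"
      using bchoice[OF vl[unfolded Bex_def]] by (elim exE)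
    have fe: "famS (e j)" if "j < M" for j using ve that by (simp add: famS_def)
    have "famT N (\<lambda>q. \<Oplus>\<^bsub>tensor_stalk k n ?d q\<^esub>j\<in>{..<M}. tpr k n ?d q (e j q) (x j))"
      by (rule famT_sum[OF fe]) (use x in simp_all)
    then obtain h where h: "\<forall>\<pi>\<in>words k. h \<pi> \<in> fracs k (nonvan_on V) 0"
      "\<forall>q\<in>V. (\<Oplus>\<^bsub>tensor_stalk k n ?d q\<^esub>j\<in>{..<M}. tpr k n ?d q (e j q) (x j)) = NF k n N \<alpha> h q"
      unfolding famT_def by (elim exE conjE) (rule that)
    have "s q = NF k n N \<alpha> h q" if q: "q \<in> V" for q
    proof -
      interpret T: Module.module "ring_st k q" "tensor_stalk k n ?d q" by (rule T_module[OF q])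
      have "x j \<in> carrier (line_stalk k ?d q)" if "j < M" for j
        using OV_point[OF _ q, of "x j" ?d] x that by (simp add: frac_module_def)
      then have "tpr k n ?d q (e j q) (x j) \<in> carrier (tensor_stalk k n ?d q)" if "j < M" for j
        using that famS_closed[OF fe q] by (intro tensor_product.tp_closed[OF proj_point.T[OF point[OF q]]])
      then have "(\<Oplus>\<^bsub>tensor_stalk k n ?d q\<^esub>j\<in>{..<M}. tpr k n ?d q (e j q) (l j q)) =
          (\<Oplus>\<^bsub>tensor_stalk k n ?d q\<^esub>j\<in>{..<M}. tpr k n ?d q (e j q) (x j))"
        using x q by (intro T.finsum_cong'[OF refl]) auto
      then show ?thesis using W'(3) t VV(3) q h(2) by auto
    qed
    then show "\<exists>h. (\<forall>\<pi>\<in>words k. h \<pi> \<in> fracs k (nonvan_on V) 0) \<and> (\<forall>q\<in>V. s q = NF k n N \<alpha> h q)"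
      using h(1) by (intro exI[of _ h]) simp
  qed
qed

section \<open>Sections built from local data\<close>

lemma twist_section:
  assumes V: "V \<in> proj_opens k" and x: "x \<in> fracs k (nonvan_on V) d"
  shows "(\<lambda>q\<in>V. x) \<in> sections (twist k d) V"
proof -
  obtain a f e e' where *: "x = Fract a f" "f \<in> homogeneous k e" "\<forall>q\<in>V. f \<notin> q"
    "a \<in> homogeneous k e'" "int e' = int e + d"
    using x unfolding fracs_def by blast
  show ?thesis
    unfolding twist_def
  proof (rule sheafifyI[OF V, where t = "\<lambda>q. Fract a f"])
    show "(\<lambda>q. Fract a f) \<in> {(\<lambda>q. Fract a f) | a f e e'. f \<in> homogeneous k e \<and> (\<forall>q\<in>V. f \<notin> q) \<and>
               a \<in> homogeneous k e' \<and> int e' = int e + d}"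
      using *(2-5) by blast
    fix q assume q: "q \<in> V"
    have "Fract a f \<in> twist_stalk k d q" using * q unfolding twist_stalk_def by blast
    then show "Fract a f \<in> carrier \<lparr>carrier = twist_stalk k d q, monoid.mult = undefined, one = undefined,
             zero = 0, add = (+), smult = (*)\<rparr>" by simp
  qed (simp_all add: *(1))
qed

lemma form_section:
  assumes V: "V \<in> proj_opens k" and P: "degree P \<le> n" "\<And>i. coeff P i \<in> fracs k (nonvan_on V) d"
  shows "(\<lambda>q\<in>V. P) \<in> sections (form_sheaf k n d) V"
proof -
  have "coeff P i \<in> twist_stalk k d q" if "q \<in> V" for i q
    using fracs_mono[of "nonvan_on V" "nonvan q" k d] P(2)[of i] that unfolding twist_stalk_eq by blast
  moreover have "(\<lambda>p\<in>V. coeff ((\<lambda>q\<in>V. P) p) i) \<in> sections (twist k d) V" for i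
    using twist_section[OF V P(2)[of i]] by (simp cong: restrict_cong)
  ultimately show ?thesis using P(1) unfolding form_sheaf_def Let_def by auto
qed

lemma (in chart) schwarzenberger_section:
  assumes V: "V \<in> proj_opens k" and P: "degree P \<le> n" "\<And>i. coeff P i \<in> OV 0"
  shows "(\<lambda>q\<in>V. bundle_class k n q P) \<in> sections (schw k n) V"
proof -
  have nk: "n - k + k = n" using kn by simp
  show ?thesis
    unfolding schwarzenberger_def cokernel_sheaf_def Let_def stalk_eqs nk taut_image_def[symmetric]
  proof (rule sheafifyI[OF V, where t = "\<lambda>q. bundle_class k n q ((\<lambda>q\<in>V. P) q)"])
    show "(\<lambda>q. bundle_class k n q ((\<lambda>q\<in>V. P) q)) \<in>
        {(\<lambda>q. bundle_class k n q (t q)) | t. t \<in> sections (form_sheaf k n 0) V}"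
      using form_section[OF V P] by blast
    fix q assume q: "q \<in> V"
    have "P \<in> carrier (form_stalk k n q)" using P OV_point[OF P(2) q] by (simp add: frac_poly_module_def)
    then show "bundle_class k n q ((\<lambda>q\<in>V. P) q) \<in> carrier (bundle_stalk k n q)"
      using module_quotient.quotient_cl[OF proj_point.E[OF point[OF q]]] q by simp
  qed simp_all
qed

text \<open>The presheaf numbers its summands by an initial segment of the naturals, whereas the
  sums at hand run over words or permutations; they are transported along an enumeration of
  \<open>A\<close>.\<close>

lemma (in chart) sym_section:
  fixes A :: "'b set"
  assumes V: "V \<in> proj_opens k" and A: "finite A" and r: "\<And>a. a \<in> A \<Longrightarrow> r a \<in> OV 0"
    and P: "\<And>a i. a \<in> A \<Longrightarrow> i < k \<Longrightarrow> degree (P a i) \<le> n" "\<And>a i j. a \<in> A \<Longrightarrow> i < k \<Longrightarrow> coeff (P a i) j \<in> OV 0"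
  shows "(\<lambda>q\<in>V. \<Oplus>\<^bsub>sym_stalk k n q\<^esub>a\<in>A. r a \<odot>\<^bsub>sym_stalk k n q\<^esub>
      spr k n q (\<lambda>i\<in>{..<k}. bundle_class k n q (P a i))) \<in> sections (symsh k n) V"
proof -
  obtain f where f: "bij_betw f {..<card A} A"
    using ex_bij_betw_nat_finite[OF A] by (auto simp: atLeast0LessThan)
  then have fA: "f j \<in> A" if "j < card A" for j using that by (auto simp: bij_betw_def)
  let ?r = "\<lambda>j. \<lambda>q\<in>V. r (f j)" and ?e = "\<lambda>j i. \<lambda>q\<in>V. bundle_class k n q (P (f j) i)"
  have term_closed: "r a \<odot>\<^bsub>sym_stalk k n q\<^esub> spr k n q (\<lambda>i\<in>{..<k}. bundle_class k n q (P a i)) \<in> carrier (sym_stalk k n q)"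
    if a: "a \<in> A" and q: "q \<in> V" for a q
  proof -
    have "P a i \<in> carrier (form_stalk k n q)" if "i < k" for i
      using P(1)[OF a that] OV_point[OF P(2)[OF a that] q] by (simp add: frac_poly_module_def)
    then have "(\<lambda>i\<in>{..<k}. bundle_class k n q (P a i)) \<in> tuples k (bundle_stalk k n q)"
      using module_quotient.quotient_cl[OF proj_point.E[OF point[OF q]]] by (auto simp: tuples_def)
    then show ?thesis
      by (intro module.smult_closed[OF S_module[OF q]] OV_ring[OF r[OF a] q]
          sym_power.sp_closed[OF proj_point.S[OF point[OF q]]])
  qed
  have reindex: "(\<Oplus>\<^bsub>sym_stalk k n q\<^esub>a\<in>A. r a \<odot>\<^bsub>sym_stalk k n q\<^esub> spr k n q (\<lambda>i\<in>{..<k}. bundle_class k n q (P a i))) =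
      (\<Oplus>\<^bsub>sym_stalk k n q\<^esub>j\<in>{..<card A}. ?r j q \<odot>\<^bsub>sym_stalk k n q\<^esub> spr k n q (\<lambda>i\<in>{..<k}. ?e j i q))"
    if q: "q \<in> V" for q
  proof -
    interpret S: Module.module "ring_st k q" "sym_stalk k n q" by (rule S_module[OF q])
    let ?t = "\<lambda>a. r a \<odot>\<^bsub>sym_stalk k n q\<^esub> spr k n q (\<lambda>i\<in>{..<k}. bundle_class k n q (P a i))"
    have img: "f ` {..<card A} = A" and inj: "inj_on f {..<card A}" using f by (auto simp: bij_betw_def)
    have "finsum (sym_stalk k n q) ?t (f ` {..<card A}) = finsum (sym_stalk k n q) (\<lambda>j. ?t (f j)) {..<card A}"
      by (rule S.finsum_reindex[OF _ inj]) (use term_closed[OF _ q] img in auto)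
    also have "\<dots> = (\<Oplus>\<^bsub>sym_stalk k n q\<^esub>j\<in>{..<card A}. ?r j q \<odot>\<^bsub>sym_stalk k n q\<^esub> spr k n q (\<lambda>i\<in>{..<k}. ?e j i q))"
      using q by simp
    finally show ?thesis unfolding img .
  qed
  show ?thesis
    unfolding sym_sheaf_def Let_def stalk_eqs stalk_schwarzenberger[OF kn] proj_space_simps
  proof (rule sheafifyI[OF V, where t = "\<lambda>q. \<Oplus>\<^bsub>sym_stalk k n q\<^esub>j\<in>{..<card A}. ?r j q \<odot>\<^bsub>sym_stalk k n q\<^esub> spr k n q (\<lambda>i\<in>{..<k}. ?e j i q)"])
    have "\<forall>j<card A. ?r j \<in> sections (twist k 0) V \<and> (\<forall>i<k. ?e j i \<in> sections (schw k n) V)"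
      using twist_section[OF V r[OF fA]] schwarzenberger_section[OF V P(1)[OF fA] P(2)[OF fA]] by simp
    then show "(\<lambda>q. \<Oplus>\<^bsub>sym_stalk k n q\<^esub>j\<in>{..<card A}. ?r j q \<odot>\<^bsub>sym_stalk k n q\<^esub> spr k n q (\<lambda>i\<in>{..<k}. ?e j i q)) \<in>
      {(\<lambda>q. \<Oplus>\<^bsub>sym_stalk k n q\<^esub>j\<in>{..<M}. r j q \<odot>\<^bsub>sym_stalk k n q\<^esub> spr k n q (\<lambda>i\<in>{..<k}. e j i q)) | (M::nat) r e.
       \<forall>j<M. r j \<in> sections (twist k 0) V \<and> (\<forall>i<k. e j i \<in> sections (schw k n) V)}"
      by (intro CollectI exI[of _ "card A"] exI[of _ ?r] exI[of _ ?e] conjI refl)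
    fix q assume q: "q \<in> V"
    interpret S: Module.module "ring_st k q" "sym_stalk k n q" by (rule S_module[OF q])
    show "(\<Oplus>\<^bsub>sym_stalk k n q\<^esub>j\<in>{..<card A}. ?r j q \<odot>\<^bsub>sym_stalk k n q\<^esub> spr k n q (\<lambda>i\<in>{..<k}. ?e j i q)) \<in> carrier (sym_stalk k n q)"
      unfolding reindex[OF q, symmetric] by (rule S.finsum_closed) (use term_closed[OF _ q] in simp)
    show "(\<lambda>q\<in>V. \<Oplus>\<^bsub>sym_stalk k n q\<^esub>a\<in>A. r a \<odot>\<^bsub>sym_stalk k n q\<^esub>
        spr k n q (\<lambda>i\<in>{..<k}. bundle_class k n q (P a i))) q =
      (\<Oplus>\<^bsub>sym_stalk k n q\<^esub>j\<in>{..<card A}. ?r j q \<odot>\<^bsub>sym_stalk k n q\<^esub> spr k n q (\<lambda>i\<in>{..<k}. ?e j i q))"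
      unfolding reindex[OF q, symmetric] using q by simp
  qed simp
qed

lemma (in chart) tensor_section:
  assumes V: "V \<in> proj_opens k" and e: "e \<in> sections (symsh k n) V" and l: "l \<in> sections (twist k d) V"
  shows "(\<lambda>q\<in>V. tpr k n d q (e q) (l q)) \<in> sections (tensh k n d) V"
proof -
  have closed: "tpr k n d q (e q) (l q) \<in> carrier (tensor_stalk k n d q)" if q: "q \<in> V" for q
  proof (rule tensor_product.tp_closed[OF proj_point.T[OF point[OF q]]])
    show "e q \<in> carrier (sym_stalk k n q)"
      using sheafify_closed[OF e[unfolded sym_sheaf_def Let_def stalk_eqs stalk_schwarzenberger[OF kn] proj_space_simps] q] .
    show "l q \<in> carrier (line_stalk k d q)"
      using sheafify_closed[OF l[unfolded twist_def] q] by (simp add: frac_module_def twist_stalk_eq)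
  qed
  have single: "(\<Oplus>\<^bsub>tensor_stalk k n d q\<^esub>j\<in>{..<1::nat}. tpr k n d q (e q) (l q)) = tpr k n d q (e q) (l q)"
    if q: "q \<in> V" for q
  proof -
    interpret T: Module.module "ring_st k q" "tensor_stalk k n d q" by (rule T_module[OF q])
    have "{..<1::nat} = insert 0 {}" by auto
    then show ?thesis using closed[OF q] T.finsum_insert[of "{}" "0::nat" "\<lambda>_. tpr k n d q (e q) (l q)"] by simp
  qed
  show ?thesis
    unfolding tensor_sheaf_def Let_def stalk_eqs stalk_sym[OF kn] proj_space_simps
  proof (rule sheafifyI[OF V, where t = "\<lambda>q. \<Oplus>\<^bsub>tensor_stalk k n d q\<^esub>j\<in>{..<1::nat}. tpr k n d q (e q) (l q)"])
    show "(\<lambda>q. \<Oplus>\<^bsub>tensor_stalk k n d q\<^esub>j\<in>{..<1::nat}. tpr k n d q (e q) (l q)) \<in>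
      {(\<lambda>q. \<Oplus>\<^bsub>tensor_stalk k n d q\<^esub>j\<in>{..<M}. tpr k n d q (e j q) (l j q)) | (M::nat) e l.
       \<forall>j<M. e j \<in> sections (symsh k n) V \<and> l j \<in> sections (twist k d) V}"
      using e l by (intro CollectI exI[of _ 1] exI[of _ "\<lambda>_. e"] exI[of _ "\<lambda>_. l"] conjI refl) simp
  qed (simp_all only: single closed restrict_apply' restrict_extensional)
qed

lemma (in chart) NF_section:
  assumes V: "V \<in> proj_opens k" and h: "\<And>\<pi>. \<pi> \<in> words k \<Longrightarrow> h \<pi> \<in> OV 0"
  shows "(\<lambda>q\<in>V. NF k n N \<alpha> h q) \<in> sections (tensh k n (- int N)) V"
proof -
  have w: "\<pi> i < k" if "\<pi> \<in> words k" "i < k" for \<pi> i using that by auto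
  have e: "(\<lambda>q\<in>V. symNF k n \<alpha> h q) \<in> sections (symsh k n) V"
    unfolding symNF_def sgen_def egen_def
  proof (rule sym_section[OF V finite_words])
    show "h \<pi> \<in> OV 0" if "\<pi> \<in> words k" for \<pi> by (rule h[OF that])
    show "degree (ebas k n \<alpha> (\<pi> i)) \<le> n" if "\<pi> \<in> words k" "i < k" for \<pi> i
      by (rule degree_ebas[OF kn w[OF that]])
    show "coeff (ebas k n \<alpha> (\<pi> i)) j \<in> OV 0" for \<pi> i j
      by (rule denominators.const_coeffs_fracs[OF D ebas_const_coeffs])
  qed
  have l: "(\<lambda>q\<in>V. Fract 1 (ell k \<alpha> ^ N)) \<in> sections (twist k (- int N)) V"
    by (rule twist_section[OF V line_powers(1)])
  have "(\<lambda>q\<in>V. NF k n N \<alpha> h q) =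
      (\<lambda>q\<in>V. tpr k n (- int N) q ((\<lambda>q\<in>V. symNF k n \<alpha> h q) q) ((\<lambda>q\<in>V. Fract 1 (ell k \<alpha> ^ N)) q))"
    by (rule restrict_ext) (simp add: NF_def)
  then show ?thesis using tensor_section[OF V e l] by simp
qed

lemma (in chart) NF_closed:
  assumes q: "q \<in> V" and h: "\<And>\<pi>. \<pi> \<in> words k \<Longrightarrow> h \<pi> \<in> OV 0"
  shows "NF k n N \<alpha> h q \<in> carrier (tensor_stalk k n (- int N) q)"
  unfolding NF_def
proof (rule tensor_product.tp_closed[OF proj_point.T[OF point[OF q]]])
  show "symNF k n \<alpha> h q \<in> carrier (sym_stalk k n q)" by (rule symNF_closed[OF q h])
  show "Fract 1 (ell k \<alpha> ^ N) \<in> carrier (line_stalk k (- int N) q)"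
    using OV_point[OF line_powers(1) q] by (simp add: frac_module_def)
qed

lemma (in chart) NF_add_smult:
  assumes q: "q \<in> V" and c: "c \<in> OV 0"
    and h: "\<And>\<pi>. \<pi> \<in> words k \<Longrightarrow> h \<pi> \<in> OV 0" and h': "\<And>\<pi>. \<pi> \<in> words k \<Longrightarrow> h' \<pi> \<in> OV 0"
  shows "c \<odot>\<^bsub>tensor_stalk k n (- int N) q\<^esub> NF k n N \<alpha> h q \<oplus>\<^bsub>tensor_stalk k n (- int N) q\<^esub> NF k n N \<alpha> h' q =
    NF k n N \<alpha> (\<lambda>\<pi>. c * h \<pi> + h' \<pi>) q"
proof -
  interpret T: tensor_product "ring_st k q" "sym_stalk k n q" "line_stalk k (- int N) q"
    by (rule proj_point.T[OF point[OF q]])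
  have u: "Fract 1 (ell k \<alpha> ^ N) \<in> carrier (line_stalk k (- int N) q)"
    using OV_point[OF line_powers(1) q] by (simp add: frac_module_def)
  have ch: "c * h \<pi> \<in> OV 0" if "\<pi> \<in> words k" for \<pi>
    using denominators.fracs_mult[OF D c h[OF that]] by simp
  note cl = symNF_closed[OF q h] symNF_closed[OF q h'] symNF_closed[OF q ch]
  have 1: "symNF k n \<alpha> (\<lambda>\<pi>. c * h \<pi>) q = c \<odot>\<^bsub>sym_stalk k n q\<^esub> symNF k n \<alpha> h q"
    by (rule symNF_smult[OF q c h, symmetric])
  have 2: "symNF k n \<alpha> (\<lambda>\<pi>. c * h \<pi> + h' \<pi>) q =
      symNF k n \<alpha> (\<lambda>\<pi>. c * h \<pi>) q \<oplus>\<^bsub>sym_stalk k n q\<^esub> symNF k n \<alpha> h' q"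
    by (rule symNF_add[OF q ch h', symmetric])
  have 3: "NF k n N \<alpha> (\<lambda>\<pi>. c * h \<pi> + h' \<pi>) q =
      tpr k n (- int N) q (symNF k n \<alpha> (\<lambda>\<pi>. c * h \<pi>) q) (Fract 1 (ell k \<alpha> ^ N))
      \<oplus>\<^bsub>tensor_stalk k n (- int N) q\<^esub> NF k n N \<alpha> h' q"
    unfolding NF_def 2 by (rule T.tp_add_left[OF cl(3,2) u])
  have 4: "tpr k n (- int N) q (symNF k n \<alpha> (\<lambda>\<pi>. c * h \<pi>) q) (Fract 1 (ell k \<alpha> ^ N)) =
      c \<odot>\<^bsub>tensor_stalk k n (- int N) q\<^esub> NF k n N \<alpha> h q"
    unfolding NF_def 1 by (rule T.tp_smult_left[OF OV_ring[OF c q] cl(1) u])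
  show ?thesis unfolding 3 4 ..
qed

definition "locally_NF k n N \<alpha> s V \<longleftrightarrow> (\<exists>h. (\<forall>\<pi>\<in>words k. h \<pi> \<in> fracs k (nonvan_on V) 0) \<and>
    (\<forall>q\<in>V. s q = NF k n N \<alpha> h q))"

text \<open>A normal form on a basic open set is a section there, so a family that is locally a
  normal form glues. The parameter \<alpha> may change from point to point. With this converse of
  \<open>near_tensor\<close>, closure under linear combinations becomes a computation with
  coefficients.\<close>

lemma global_sectionsI:
  assumes kn: "k \<le> n" "k \<ge> 1"
    and s: "s \<in> (\<Pi>\<^sub>E q\<in>proj_points k. carrier (tensor_stalk k n (- int N) q))"
    and loc: "\<And>p. p \<in> proj_points k \<Longrightarrow> \<exists>\<alpha>. ell k \<alpha> \<notin> p \<and> near k p (locally_NF k n N (\<alpha> :: 'a::alg_closed_field) s)"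
  shows "s \<in> sections (tensh k n (- int N)) (proj_points k)"
  unfolding tensor_sheaf_def Let_def stalk_eqs stalk_sym[OF kn(1)] proj_space_simps
proof (rule sheafify_glue)
  show "s \<in> (\<Pi>\<^sub>E q\<in>proj_points k. carrier (tensor_stalk k n (- int N) q))" by (rule s)
  fix p :: "'a mpoly set" assume p: "p \<in> proj_points k"
  obtain \<alpha> where \<alpha>: "ell k \<alpha> \<notin> p" "near k p (locally_NF k n N \<alpha> s)"
    using loc[OF p] by (elim exE conjE) (rule that)
  obtain b e where b: "b \<in> homogeneous k e" "b \<notin> p"
    "(\<forall>q\<in>basic k b. ell k \<alpha> \<notin> q) \<and> locally_NF k n N \<alpha> s (basic k b)"
    by (rule near_obtain[OF near_conj[OF p near_ell[OF \<alpha>(1)] \<alpha>(2)]])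
  let ?V = "basic k b"
  obtain h where h: "\<forall>\<pi>\<in>words k. h \<pi> \<in> fracs k (nonvan_on ?V) 0" "\<forall>q\<in>?V. s q = NF k n N \<alpha> h q"
    using b(3) unfolding locally_NF_def by (elim conjE exE) (rule that)
  have pV: "p \<in> ?V" using p b(2) by (simp add: basic_def)
  interpret chart k n \<alpha> ?V
    using kn basic_subset[of k b] pV b(3) by (intro chart.intro) auto
  have "(\<lambda>q\<in>?V. NF k n N \<alpha> h q) \<in> sections (tensh k n (- int N)) ?V"
    using h(1) by (intro NF_section basic_open[OF b(1)]) auto
  note sec = this[unfolded tensor_sheaf_def Let_def stalk_eqs stalk_sym[OF kn(1)] proj_space_simps]
  show "\<exists>W. p \<in> W \<and> W \<subseteq> proj_points k \<and> (\<exists>\<sigma>\<in>sections (sheafify (proj_opens k) (tensor_stalk k n (- int N))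
      (\<lambda>W. {(\<lambda>q. \<Oplus>\<^bsub>tensor_stalk k n (- int N) q\<^esub>j\<in>{..<M}. tpr k n (- int N) q (e j q) (l j q)) | (M::nat) e l.
       \<forall>j<M. e j \<in> sections (symsh k n) W \<and> l j \<in> sections (twist k (- int N)) W})) W. \<forall>q\<in>W. s q = \<sigma> q)"
    by (intro exI[of _ ?V] conjI pV basic_subset bexI[OF _ sec]) (use h(2) in simp)
qed

lemma global_sectionsD:
  assumes kn: "k \<le> n" "k \<ge> 1" and s: "s \<in> sections (tensh k n (- int N)) W"
    and p: "p \<in> W" "p \<in> proj_points k" and \<alpha>: "ell k (\<alpha> :: 'a::alg_closed_field) \<notin> p"
  shows "near k p (locally_NF k n N \<alpha> s)"
  using near_tensor[OF kn s p \<alpha>] unfolding locally_NF_def .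

lemma section_closed:
  assumes kn: "k \<le> n" and s: "s \<in> sections (tensh k n d) W" and p: "p \<in> W"
  shows "s p \<in> carrier (tensor_stalk k n d p)"
  using sheafify_closed[OF s[unfolded tensor_sheaf_def Let_def stalk_eqs stalk_sym[OF kn] proj_space_simps] p] .

lemma global_sections_add_smult:
  fixes s s' :: "'a::alg_closed_field mpoly set \<Rightarrow> _"
  assumes kn: "k \<le> n" "k \<ge> 1" and s: "s \<in> sections (tensh k n (- int N)) (proj_points k)"
    and s': "s' \<in> sections (tensh k n (- int N)) (proj_points k)"
  shows "(\<lambda>p\<in>proj_points k. const_fract c \<odot>\<^bsub>tensor_stalk k n (- int N) p\<^esub> s p \<oplus>\<^bsub>tensor_stalk k n (- int N) p\<^esub> s' p)
    \<in> sections (tensh k n (- int N)) (proj_points k)" (is "?s \<in> _")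
proof (rule global_sectionsI[OF kn])
  show "?s \<in> (\<Pi>\<^sub>E q\<in>proj_points k. carrier (tensor_stalk k n (- int N) q))"
  proof (rule restrict_PiE_iff[THEN iffD2], rule ballI)
    fix q :: "'a mpoly set" assume q: "q \<in> proj_points k"
    have pp: "proj_point k n q" using kn q by (intro proj_point.intro)
    interpret T: Module.module "ring_st k q" "tensor_stalk k n (- int N) q"
      by (rule tensor_product.tensor_is_module[OF proj_point.T[OF pp]])
    have "const_fract c \<in> carrier (ring_st k q)"
      using denominators.fracs_const[OF proj_point.D[OF pp], of c] by (simp add: frac_ring_def)
    then show "const_fract c \<odot>\<^bsub>tensor_stalk k n (- int N) q\<^esub> s q \<oplus>\<^bsub>tensor_stalk k n (- int N) q\<^esub> s' q
        \<in> carrier (tensor_stalk k n (- int N) q)"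
      by (intro T.a_closed T.smult_closed section_closed[OF kn(1) s q] section_closed[OF kn(1) s' q])
  qed
  fix p :: "'a mpoly set" assume p: "p \<in> proj_points k"
  obtain \<alpha> where \<alpha>: "ell k \<alpha> \<notin> p" using ell_avoids[OF p] by (elim exE)
  have "near k p (locally_NF k n N \<alpha> ?s)"
  proof (rule near_mono[OF near_conj[OF p near_ell[OF \<alpha>] near_conj[OF p global_sectionsD[OF kn s p p \<alpha>]
            global_sectionsD[OF kn s' p p \<alpha>]]] p], elim conjE)
    fix V assume VV: "p \<in> V" "V \<subseteq> proj_points k" "\<forall>q\<in>V. ell k \<alpha> \<notin> q"
      and nf: "locally_NF k n N \<alpha> s V" "locally_NF k n N \<alpha> s' V"
    obtain h where h: "\<forall>\<pi>\<in>words k. h \<pi> \<in> fracs k (nonvan_on V) 0" "\<forall>q\<in>V. s q = NF k n N \<alpha> h q"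
      using nf(1) unfolding locally_NF_def by (elim conjE exE) (rule that)
    obtain h' where h': "\<forall>\<pi>\<in>words k. h' \<pi> \<in> fracs k (nonvan_on V) 0" "\<forall>q\<in>V. s' q = NF k n N \<alpha> h' q"
      using nf(2) unfolding locally_NF_def by (elim conjE exE) (rule that)
    interpret chart k n \<alpha> V using kn VV by (intro chart.intro) auto
    have c: "const_fract c \<in> OV 0" by (rule denominators.fracs_const[OF D])
    show "locally_NF k n N \<alpha> ?s V"
      unfolding locally_NF_def
    proof (intro exI[of _ "\<lambda>\<pi>. const_fract c * h \<pi> + h' \<pi>"] conjI ballI)
      fix \<pi> assume \<pi>: "\<pi> \<in> words k"
      have "const_fract c * h \<pi> \<in> OV 0"
        using denominators.fracs_mult[OF D c bspec[OF h(1) \<pi>]] by simp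
      then show "const_fract c * h \<pi> + h' \<pi> \<in> OV 0"
        by (rule denominators.fracs_add[OF D _ bspec[OF h'(1) \<pi>]])
    next
      fix q assume q: "q \<in> V"
      then have "q \<in> proj_points k" using VV(2) by blast
      then show "?s q = NF k n N \<alpha> (\<lambda>\<pi>. const_fract c * h \<pi> + h' \<pi>) q"
        using NF_add_smult[OF q c bspec[OF h(1)] bspec[OF h'(1)], where N = N] bspec[OF h(2) q] bspec[OF h'(2) q] by simp
    qed
  qed
  then show "\<exists>\<alpha>. ell k \<alpha> \<notin> p \<and> near k p (locally_NF k n N \<alpha> ?s)" using \<alpha> by (intro exI conjI)
qed

section \<open>The function defined by a global section\<close>

text \<open>A choice, because \<open>stalk_evaluation\<close> asserts existence. The functional
  enters as the map \<open>F\<close> on polynomials and not as \<phi>: since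
  \<open>functional_value\<close> reads only the indices up to \<open>n\<close>, truncating \<phi>
  leaves the choice itself unchanged.\<close>

definition tev :: "nat \<Rightarrow> nat \<Rightarrow> int \<Rightarrow> (nat \<Rightarrow> 'a::alg_closed_field) \<Rightarrow> ('a mpoly fract poly \<Rightarrow> 'a) \<Rightarrow> _ \<Rightarrow> 'a" where
  "tev k n d g F = (SOME hT. \<exists>hE hS. semilinear (ring_st k (pt k g)) (fev g) (sym_stalk k n (pt k g)) hS \<and>
      semilinear (ring_st k (pt k g)) (fev g) (tensor_stalk k n d (pt k g)) hT \<and>
      (\<forall>q\<in>carrier (form_stalk k n (pt k g)). hE (bundle_class k n (pt k g) q) = F q) \<and>
      (\<forall>x\<in>tuples k (bundle_stalk k n (pt k g)).
        hS (sym_prod (ring_st k (pt k g)) k (bundle_stalk k n (pt k g)) x) = (\<Prod>i<k. hE (x i))) \<and>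
      (\<forall>a\<in>carrier (sym_stalk k n (pt k g)). \<forall>b\<in>carrier (line_stalk k d (pt k g)).
        hT (tensor_prod (ring_st k (pt k g)) (sym_stalk k n (pt k g)) (line_stalk k d (pt k g)) a b) =
          hS a * fev g b))"

text \<open>The coefficients of \<open>ebas\<close> are constants, so that they can be evaluated anywhere.\<close>

definition bval :: "nat \<Rightarrow> nat \<Rightarrow> 'a::field \<Rightarrow> (nat \<Rightarrow> 'a) \<Rightarrow> nat \<Rightarrow> 'a" where
  "bval k n \<alpha> \<phi> i = (\<Sum>m\<le>n. \<phi> m * fev (\<lambda>_. 0) (coeff (ebas k n \<alpha> i) m))"

lemma functional_value_ebas: "functional_value n g \<phi> (ebas k n \<alpha> i) = bval k n \<alpha> \<phi> i"
proof -
  have "fev g (coeff (ebas k n \<alpha> i) m) = fev (\<lambda>_. 0) (coeff (ebas k n \<alpha> i) m)" for m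
  proof -
    have "coeff (ebas k n \<alpha> i) m \<in> range const_fract"
      using ebas_const_coeffs[of k n \<alpha> i] unfolding const_coeffs_def by (rule spec)
    then obtain c where "coeff (ebas k n \<alpha> i) m = const_fract c" by (elim rangeE)
    then show ?thesis by simp
  qed
  then show ?thesis unfolding functional_value_def bval_def by simp
qed

text \<open>The number that a normal form yields when its coefficients and the generator of the line
  bundle are evaluated at \<open>g\<close> and the frame is evaluated by \<phi>. Here the dependence
  on \<open>g\<close> and \<phi> is explicit, while \<open>tev\<close> hides it.\<close>

definition NFval :: "nat \<Rightarrow> nat \<Rightarrow> nat \<Rightarrow> 'a::field \<Rightarrow> ((nat \<Rightarrow> nat) \<Rightarrow> 'a mpoly fract) \<Rightarrow> (nat \<Rightarrow> 'a) \<Rightarrow> (nat \<Rightarrow> 'a) \<Rightarrow> 'a" where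
  "NFval k n N \<alpha> h g \<phi> = (\<Sum>\<pi>\<in>words k. fev g (h \<pi>) * (\<Prod>i<k. bval k n \<alpha> \<phi> (\<pi> i))) / meval g (ell k \<alpha>) ^ N"

lemma tev_props:
  fixes g :: "nat \<Rightarrow> 'a::alg_closed_field"
  assumes kn: "k \<le> n" and g: "nonzero_form k g" and ap: "apolar k n g \<phi>"
  shows "\<exists>hE hS. semilinear (ring_st k (pt k g)) (fev g) (sym_stalk k n (pt k g)) hS \<and>
      semilinear (ring_st k (pt k g)) (fev g) (tensor_stalk k n d (pt k g)) (tev k n d g (functional_value n g \<phi>)) \<and>
      (\<forall>q\<in>carrier (form_stalk k n (pt k g)). hE (bundle_class k n (pt k g) q) = functional_value n g \<phi> q) \<and>
      (\<forall>x\<in>tuples k (bundle_stalk k n (pt k g)). hS (spr k n (pt k g) x) = (\<Prod>i<k. hE (x i))) \<and>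
      (\<forall>a\<in>carrier (sym_stalk k n (pt k g)). \<forall>b\<in>carrier (line_stalk k d (pt k g)).
        tev k n d g (functional_value n g \<phi>) (tpr k n d (pt k g) a b) = hS a * fev g b)"
proof -
  from stalk_evaluation[OF kn g ap, of d] have "\<exists>hT hE hS. semilinear (ring_st k (pt k g)) (fev g) (sym_stalk k n (pt k g)) hS \<and>
      semilinear (ring_st k (pt k g)) (fev g) (tensor_stalk k n d (pt k g)) hT \<and>
      (\<forall>q\<in>carrier (form_stalk k n (pt k g)). hE (bundle_class k n (pt k g) q) = functional_value n g \<phi> q) \<and>
      (\<forall>x\<in>tuples k (bundle_stalk k n (pt k g)). hS (spr k n (pt k g) x) = (\<Prod>i<k. hE (x i))) \<and>
      (\<forall>a\<in>carrier (sym_stalk k n (pt k g)). \<forall>b\<in>carrier (line_stalk k d (pt k g)).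
        hT (tpr k n d (pt k g) a b) = hS a * fev g b)"
    by (elim exE) (intro exI, assumption)
  from someI_ex[OF this] show ?thesis unfolding tev_def .
qed

lemma (in chart) tev_NF:
  assumes g: "nonzero_form k g" and ap: "apolar k n g \<phi>" and gV: "pt k g \<in> V"
    and h: "\<And>\<pi>. \<pi> \<in> words k \<Longrightarrow> h \<pi> \<in> OV 0"
  shows "tev k n (- int N) g (functional_value n g \<phi>) (NF k n N \<alpha> h (pt k g)) = NFval k n N \<alpha> h g \<phi>"
proof -
  let ?p = "pt k g" and ?d = "- int N"
  let ?hT = "tev k n ?d g (functional_value n g \<phi>)"
  from tev_props[OF kn g ap, of ?d] obtain hE hS
    where hS: "semilinear (ring_st k ?p) (fev g) (sym_stalk k n ?p) hS"
      and hE: "\<forall>q\<in>carrier (form_stalk k n ?p). hE (bundle_class k n ?p q) = functional_value n g \<phi> q"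
      and sp: "\<forall>x\<in>tuples k (bundle_stalk k n ?p). hS (spr k n ?p x) = (\<Prod>i<k. hE (x i))"
      and tp: "\<forall>a\<in>carrier (sym_stalk k n ?p). \<forall>b\<in>carrier (line_stalk k ?d ?p). ?hT (tpr k n ?d ?p a b) = hS a * fev g b"
    by (elim exE conjE) (rule that)
  have ell: "meval g (ell k \<alpha>) \<noteq> 0"
    using ell_V[OF gV] homogeneous_in_pt[OF ell_homogeneous, of k \<alpha> g] by simp
  have u: "Fract 1 (ell k \<alpha> ^ N) \<in> carrier (line_stalk k ?d ?p)"
    using OV_point[OF line_powers(1) gV] by (simp add: frac_module_def)
  have "fev g (Fract 1 (ell k \<alpha> ^ N)) = 1 / meval g (ell k \<alpha>) ^ N"
    using ell by (subst fev_Fract) (simp_all add: meval_power)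
  then have "?hT (NF k n N \<alpha> h ?p) = hS (symNF k n \<alpha> h ?p) / meval g (ell k \<alpha>) ^ N"
    unfolding NF_def using bspec[OF bspec[OF tp symNF_closed[OF gV h]] u] by simp
  moreover have "hS (symNF k n \<alpha> h ?p) = (\<Sum>\<pi>\<in>words k. hS (h \<pi> \<odot>\<^bsub>sym_stalk k n ?p\<^esub> sgen k n \<alpha> ?p \<pi>))"
  proof -
    interpret S: Module.module "ring_st k ?p" "sym_stalk k n ?p" by (rule S_module[OF gV])
    show ?thesis
      unfolding symNF_def by (rule semilinear_finsum[OF hS S.abelian_group_axioms finite_words symNF_terms[OF gV h]])
  qed
  moreover have "hS (h \<pi> \<odot>\<^bsub>sym_stalk k n ?p\<^esub> sgen k n \<alpha> ?p \<pi>) = fev g (h \<pi>) * (\<Prod>i<k. bval k n \<alpha> \<phi> (\<pi> i))"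
    if \<pi>: "\<pi> \<in> words k" for \<pi>
  proof -
    have "hS (sgen k n \<alpha> ?p \<pi>) = (\<Prod>i<k. hE ((\<lambda>i\<in>{..<k}. egen k n \<alpha> ?p (\<pi> i)) i))"
      unfolding sgen_def by (rule bspec[OF sp egen_tuple[OF gV \<pi>]])
    also have "\<dots> = (\<Prod>i<k. bval k n \<alpha> \<phi> (\<pi> i))"
    proof (rule prod.cong[OF refl])
      fix i assume i: "i \<in> {..<k}"
      then have "\<pi> i < k" using \<pi> by auto
      then show "hE ((\<lambda>i\<in>{..<k}. egen k n \<alpha> ?p (\<pi> i)) i) = bval k n \<alpha> \<phi> (\<pi> i)"
        using i bspec[OF hE ebas_carrier[OF gV, of "\<pi> i"]] by (simp add: egen_def functional_value_ebas)
    qed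
    finally show ?thesis
      using semilinear_smult[OF hS OV_ring[OF h[OF \<pi>] gV] sgen_closed[OF gV \<pi>]] by simp
  qed
  ultimately show ?thesis unfolding NFval_def by simp
qed

definition "Phi k n N s g \<phi> = tev k n (- int N) g (functional_value n g \<phi>) (s (pt k g))"

lemma Phi_locally_NF:
  fixes g :: "nat \<Rightarrow> 'a::alg_closed_field"
  assumes kn: "k \<le> n" "k \<ge> 1" and VV: "V \<subseteq> proj_points k" "\<forall>q\<in>V. ell k \<alpha> \<notin> q" "pt k g \<in> V"
    and h: "\<forall>\<pi>\<in>words k. h \<pi> \<in> fracs k (nonvan_on V) 0" "\<forall>q\<in>V. s q = NF k n N \<alpha> h q"
    and g: "nonzero_form k g" "apolar k n g \<phi>"
  shows "Phi k n N s g \<phi> = NFval k n N \<alpha> h g \<phi>"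
proof -
  interpret chart k n \<alpha> V using kn VV by (intro chart.intro) auto
  show ?thesis
    unfolding Phi_def bspec[OF h(2) VV(3)] by (rule tev_NF[OF g VV(3) bspec[OF h(1)]])
qed

lemma pt_in_basic: "nonzero_form k g \<Longrightarrow> b \<in> homogeneous k e \<Longrightarrow> meval g b \<noteq> 0 \<Longrightarrow> pt k g \<in> basic k b"
  for g :: "nat \<Rightarrow> 'a::alg_closed_field"
  using pt_in_proj_points[of k g] homogeneous_in_pt[of b k e g] by (simp add: basic_def)

lemma section_near:
  fixes p :: "'a::alg_closed_field mpoly set"
  assumes kn: "k \<le> n" "k \<ge> 1" and s: "s \<in> sections (tensh k n (- int N)) W" and p: "p \<in> W" "p \<in> proj_points k"
  obtains \<alpha> b e h where "b \<in> homogeneous k e" "p \<in> basic k b" "\<forall>q\<in>basic k b. ell k \<alpha> \<notin> q"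
    "\<forall>\<pi>\<in>words k. h \<pi> \<in> fracs k (nonvan_on (basic k b)) 0" "\<forall>q\<in>basic k b. s q = NF k n N \<alpha> h q"
proof -
  obtain \<alpha> where \<alpha>: "ell k \<alpha> \<notin> p" using ell_avoids[OF p(2)] by (elim exE)
  obtain b e where b: "b \<in> homogeneous k e" "b \<notin> p"
    "(\<forall>q\<in>basic k b. ell k \<alpha> \<notin> q) \<and> locally_NF k n N \<alpha> s (basic k b)"
    by (rule near_obtain[OF near_conj[OF p(2) near_ell[OF \<alpha>] global_sectionsD[OF kn s p \<alpha>]]])
  obtain h where h: "\<forall>\<pi>\<in>words k. h \<pi> \<in> fracs k (nonvan_on (basic k b)) 0" "\<forall>q\<in>basic k b. s q = NF k n N \<alpha> h q"
    using conjunct2[OF b(3)] unfolding locally_NF_def by (elim exE conjE) (rule that)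
  have "p \<in> basic k b" using p(2) b(2) by (simp add: basic_def)
  then show thesis by (rule that[OF b(1) _ conjunct1[OF b(3)] h])
qed

section \<open>Locally rational functions of one variable\<close>

text \<open>The set where \<open>B\<close> is nonzero plays the part of a neighbourhood of
  \<open>x\<close>; multiplying numerator and denominator by a further factor shrinks it, which is
  how two local descriptions are combined.\<close>

definition rat_at :: "'a::field \<Rightarrow> ('a \<Rightarrow> 'a) \<Rightarrow> bool" where
  "rat_at x f \<longleftrightarrow> (\<exists>A B. poly B x \<noteq> 0 \<and> (\<forall>T. poly B T \<noteq> 0 \<longrightarrow> f T = poly A T / poly B T))"

lemma rat_atI: "poly B x \<noteq> 0 \<Longrightarrow> (\<And>T. poly B T \<noteq> 0 \<Longrightarrow> f T = poly A T / poly B T) \<Longrightarrow> rat_at x f"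
  unfolding rat_at_def by (intro exI[of _ A] exI[of _ B]) simp

lemma rat_atE:
  assumes "rat_at x f"
  obtains A B where "poly B x \<noteq> 0" "\<forall>T. poly B T \<noteq> 0 \<longrightarrow> f T = poly A T / poly B T"
  using assms unfolding rat_at_def by (elim exE conjE) (rule that)

lemma rat_at_poly: "rat_at x (poly r)"
  by (rule rat_atI[of 1]) simp_all

lemma rat_at_const: "rat_at x (\<lambda>_. c)"
  by (rule rat_atI[of 1 _ _ "[:c:]"]) simp_all

lemma rat_at_add:
  assumes "rat_at x f" "rat_at x g"
  shows "rat_at x (\<lambda>T. f T + g T)"
proof -
  obtain A B where 1: "poly B x \<noteq> 0" "\<forall>T. poly B T \<noteq> 0 \<longrightarrow> f T = poly A T / poly B T"
    by (rule rat_atE[OF assms(1)])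
  obtain A' B' where 2: "poly B' x \<noteq> 0" "\<forall>T. poly B' T \<noteq> 0 \<longrightarrow> g T = poly A' T / poly B' T"
    by (rule rat_atE[OF assms(2)])
  show ?thesis
    by (rule rat_atI[of "B * B'" _ _ "A * B' + A' * B"]) (use 1 2 in \<open>simp_all add: add_frac_eq\<close>)
qed

lemma rat_at_mult:
  assumes "rat_at x f" "rat_at x g"
  shows "rat_at x (\<lambda>T. f T * g T)"
proof -
  obtain A B where 1: "poly B x \<noteq> 0" "\<forall>T. poly B T \<noteq> 0 \<longrightarrow> f T = poly A T / poly B T"
    by (rule rat_atE[OF assms(1)])
  obtain A' B' where 2: "poly B' x \<noteq> 0" "\<forall>T. poly B' T \<noteq> 0 \<longrightarrow> g T = poly A' T / poly B' T"
    by (rule rat_atE[OF assms(2)])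
  show ?thesis
    by (rule rat_atI[of "B * B'" _ _ "A * A'"]) (use 1 2 in simp_all)
qed

lemma rat_at_sum: "(\<And>i. i \<in> I \<Longrightarrow> rat_at x (f i)) \<Longrightarrow> rat_at x (\<lambda>T. \<Sum>i\<in>I. f i T)"
proof (induction I rule: infinite_finite_induct)
  case (insert i I)
  then show ?case using rat_at_add[of x "f i" "\<lambda>T. \<Sum>i\<in>I. f i T"] by simp
qed (simp_all add: rat_at_const)

lemma rat_at_prod: "(\<And>i. i \<in> I \<Longrightarrow> rat_at x (f i)) \<Longrightarrow> rat_at x (\<lambda>T. \<Prod>i\<in>I. f i T)"
proof (induction I rule: infinite_finite_induct)
  case (insert i I)
  then show ?case using rat_at_mult[of x "f i" "\<lambda>T. \<Prod>i\<in>I. f i T"] by simp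
qed (simp_all add: rat_at_const)

lemma rat_at_cong:
  assumes "rat_at x f" "poly b x \<noteq> 0" "\<And>T. poly b T \<noteq> 0 \<Longrightarrow> g T = f T"
  shows "rat_at x g"
proof -
  obtain A B where 1: "poly B x \<noteq> 0" "\<forall>T. poly B T \<noteq> 0 \<longrightarrow> f T = poly A T / poly B T"
    by (rule rat_atE[OF assms(1)])
  show ?thesis
    by (rule rat_atI[of "B * b" _ _ "A * b"]) (use 1 assms in simp_all)
qed

lemma rat_at_divide:
  assumes "rat_at x f" "poly b x \<noteq> 0"
  shows "rat_at x (\<lambda>T. f T / poly b T)"
proof -
  have "rat_at x (\<lambda>T. 1 / poly b T)" by (rule rat_atI[of b _ _ 1]) (use assms(2) in simp_all)
  from rat_at_mult[OF assms(1) this] show ?thesis by simp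
qed

text \<open>Induction on the degree of the denominator. At a root \<open>x\<close> of
  \<open>B\<close> the function also has a description with denominator nonzero at \<open>x\<close>;
  comparing the two shows that \<open>A\<close> vanishes at \<open>x\<close> as well, and the common
  factor cancels.\<close>

lemma locally_rational_imp_poly_cofinite:
  fixes f :: "'a::alg_closed_field \<Rightarrow> 'a"
  assumes loc: "\<And>x. rat_at x f"
    and "B \<noteq> 0" "finite E" "\<And>T. T \<notin> E \<Longrightarrow> f T * poly B T = poly A T"
  shows "\<exists>r E. finite E \<and> (\<forall>T. T \<notin> E \<longrightarrow> f T = poly r T)"
  using assms(2-4)
proof (induction "degree B" arbitrary: A B E rule: less_induct)
  case less
  show ?case
  proof (cases "degree B = 0")
    case True
    then obtain c where c: "B = [:c:]" by (elim degree_eq_zeroE)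
    then have "f T = poly (Polynomial.smult (1 / c) A) T" if "T \<notin> E" for T
      using less.prems(1) less.prems(3)[OF that] by (simp add: field_simps)
    then show ?thesis using less.prems(2) by (intro exI[of _ "Polynomial.smult (1 / c) A"] exI[of _ E]) simp
  next
    case False
    then obtain x where x: "poly B x = 0" using alg_closed_imp_poly_has_root[of B] by auto
    obtain A' B' where *: "poly B' x \<noteq> 0" "\<forall>T. poly B' T \<noteq> 0 \<longrightarrow> f T = poly A' T / poly B' T"
      by (rule rat_atE[OF loc])
    have "B' \<noteq> 0" using *(1) by auto
    then have fin: "finite (E \<union> {T. poly B' T = 0})" using less.prems(2) by (simp add: poly_roots_finite)
    have "A' * B = A * B'"
    proof (rule poly_eqI_cofinite[OF fin])
      fix T assume "T \<notin> E \<union> {T. poly B' T = 0}"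
      then have T: "T \<notin> E" "poly B' T \<noteq> 0" by auto
      have "poly A' T = f T * poly B' T" using *(2) T(2) by simp
      then show "poly (A' * B) T = poly (A * B') T" using less.prems(3)[OF T(1)] by (simp add: mult_ac)
    qed
    then have "poly A x * poly B' x = 0" using x by (metis mult_zero_right poly_mult)
    then have "poly A x = 0" using *(1) by simp
    then obtain A1 where A1: "A = [:- x, 1:] * A1" unfolding poly_eq_0_iff_dvd by (elim dvdE)
    obtain B1 where B1: "B = [:- x, 1:] * B1" using x unfolding poly_eq_0_iff_dvd by (elim dvdE)
    have B10: "B1 \<noteq> 0" using B1 less.prems(1) by auto
    show ?thesis
    proof (rule less.hyps[of B1 "insert x E" A1])
      show "degree B1 < degree B" unfolding B1 using B10 by (subst degree_mult_eq) simp_all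
      show "f T * poly B1 T = poly A1 T" if "T \<notin> insert x E" for T
      proof -
        have "(T - x) * (f T * poly B1 T) = (T - x) * poly A1 T"
          using less.prems(3)[of T] that unfolding A1 B1 by (simp add: algebra_simps)
        then show ?thesis using that by simp
      qed
    qed (use B10 less.prems(2) in simp_all)
  qed
qed

text \<open>The global denominator disappears off a finite set. At each exceptional point the local
  description is the same rational function, so it gives the value of the polynomial there
  too.\<close>

lemma locally_rational_imp_poly:
  fixes f :: "'a::alg_closed_field \<Rightarrow> 'a"
  assumes loc: "\<And>x. rat_at x f"
  shows "\<exists>r. \<forall>T. f T = poly r T"
proof -
  obtain A B where AB: "poly B 0 \<noteq> 0" "\<forall>T. poly B T \<noteq> 0 \<longrightarrow> f T = poly A T / poly B T"
    by (rule rat_atE[OF loc])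
  then have B: "B \<noteq> 0" by auto
  then have B': "finite {T. poly B T = 0}" by (rule poly_roots_finite)
  have "f T * poly B T = poly A T" if "T \<notin> {T. poly B T = 0}" for T
    using AB(2)[rule_format, of T] that by simp
  then have "\<exists>r E. finite E \<and> (\<forall>T. T \<notin> E \<longrightarrow> f T = poly r T)"
    by (rule locally_rational_imp_poly_cofinite[OF loc B B'])
  then obtain r E where r: "finite E" "\<forall>T. T \<notin> E \<longrightarrow> f T = poly r T"
    by (elim exE conjE) (rule that)
  have "f x = poly r x" for x
  proof -
    obtain A' B' where *: "poly B' x \<noteq> 0" "\<forall>T. poly B' T \<noteq> 0 \<longrightarrow> f T = poly A' T / poly B' T"
      by (rule rat_atE[OF loc])
    have "B' \<noteq> 0" using *(1) by auto
    then have fin: "finite (E \<union> {T. poly B' T = 0})" using r(1) by (simp add: poly_roots_finite)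
    have "A' = r * B'"
    proof (rule poly_eqI_cofinite[OF fin])
      fix T assume "T \<notin> E \<union> {T. poly B' T = 0}"
      then have T: "T \<notin> E" "poly B' T \<noteq> 0" by auto
      then show "poly A' T = poly (r * B') T"
        using *(2)[rule_format, OF T(2)] r(2)[rule_format, OF T(1)] by (simp add: field_simps)
    qed
    then show ?thesis using * by simp
  qed
  then show ?thesis by (intro exI[of _ r] allI)
qed

lemma bval_curve: "\<exists>r. \<forall>T. poly r T = bval k n \<alpha> (\<lambda>m. poly (P m) T) i"
  by (rule exI[of _ "\<Sum>m\<le>n. Polynomial.smult (fev (\<lambda>_. 0) (coeff (ebas k n \<alpha> i) m)) (P m)"])
    (simp add: bval_def poly_sum mult.commute)

lemma rat_at_fev:
  fixes G :: "nat \<Rightarrow> 'a::field poly"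
  assumes "meval (\<lambda>j. poly (G j) x) f \<noteq> 0"
  shows "rat_at x (\<lambda>T. fev (\<lambda>j. poly (G j) T) (Fract a f))"
proof -
  obtain A where A: "\<forall>T. poly A T = meval (\<lambda>j. poly (G j) T) a" using meval_curve[of G a] by (elim exE)
  obtain B where B: "\<forall>T. poly B T = meval (\<lambda>j. poly (G j) T) f" using meval_curve[of G f] by (elim exE)
  show ?thesis
    by (rule rat_atI[of B _ _ A]) (use assms A B in \<open>simp_all add: fev_Fract\<close>)
qed

section \<open>Regularity of the function\<close>

text \<open>Apart from truncation, each property is read off one normal form near the point in
  question: fractions of degree 0 in \<open>g\<close>, times products of \<open>k\<close> values
  linear in \<phi>, over the \<open>N\<close>-th power of a linear form in \<open>g\<close>. Along a
  curve the local descriptions make \<Phi> rational at every parameter, hence polynomial.\<close>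

lemma Phi_apolar_function:
  fixes s :: "'a::alg_closed_field mpoly set \<Rightarrow> _"
  assumes kn: "k \<ge> 1" "N \<ge> 1" "n + 2 = N + 2 * k"
    and s: "s \<in> sections (tensh k n (- int N)) (proj_points k)"
  shows "apolar_function k n N (Phi k n N s)"
proof -
  have kn': "k \<le> n" using kn by linarith
  note near = section_near[OF kn' kn(1) s]
  show ?thesis
  proof
    show "n + 2 = N + 2 * k" "1 \<le> N" "1 \<le> k" using kn by simp_all
  next
    fix \<phi> \<phi>' g :: "nat \<Rightarrow> 'a"
    assume eq: "\<And>m. m \<le> n \<Longrightarrow> \<phi> m = \<phi>' m"
    have "functional_value n g \<phi> = functional_value n g \<phi>'"
      unfolding functional_value_def fun_eq_iff using eq by simp
    then show "Phi k n N s g \<phi> = Phi k n N s g \<phi>'" unfolding Phi_def by simp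
  next
    fix G P :: "nat \<Rightarrow> 'a poly"
    assume g: "\<And>T. nonzero_form k (\<lambda>j. poly (G j) T)"
      and ap: "\<And>T. apolar k n (\<lambda>j. poly (G j) T) (\<lambda>m. poly (P m) T)"
    let ?g = "\<lambda>T j. poly (G j) T" and ?\<phi> = "\<lambda>T m. poly (P m) T"
    have "rat_at x (\<lambda>T. Phi k n N s (?g T) (?\<phi> T))" for x
    proof -
      obtain \<alpha> b e h where b: "b \<in> homogeneous k e" "pt k (?g x) \<in> basic k b" "\<forall>q\<in>basic k b. ell k \<alpha> \<notin> q"
        "\<forall>\<pi>\<in>words k. h \<pi> \<in> fracs k (nonvan_on (basic k b)) 0" "\<forall>q\<in>basic k b. s q = NF k n N \<alpha> h q"
        by (rule near[OF pt_in_proj_points[OF g] pt_in_proj_points[OF g]])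
      obtain B where B: "\<forall>T. poly B T = meval (?g T) b" using meval_curve[of G b] by (elim exE)
      obtain L where L: "\<forall>T. poly L T = meval (?g T) (ell k \<alpha>)" using meval_curve[of G "ell k \<alpha>"] by (elim exE)
      have Lx: "poly L x \<noteq> 0"
        using L b(2,3) homogeneous_in_pt[OF ell_homogeneous, of k \<alpha> "?g x"] by simp
      have Bx: "poly B x \<noteq> 0" using B b(2) homogeneous_in_pt[OF b(1), of "?g x"] by (simp add: basic_def)
      have r1: "rat_at x (\<lambda>T. fev (?g T) (h \<pi>))" if \<pi>: "\<pi> \<in> words k" for \<pi>
      proof -
        obtain a f u where f: "h \<pi> = Fract a f" "f \<in> homogeneous k u" "\<forall>q\<in>basic k b. f \<notin> q"
          using bspec[OF b(4) \<pi>] unfolding fracs_def by (elim CollectE exE conjE) (rule that)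
        have "meval (?g x) f \<noteq> 0" using homogeneous_in_pt[OF f(2), of "?g x"] bspec[OF f(3) b(2)] by simp
        then show ?thesis unfolding f(1) by (rule rat_at_fev)
      qed
      have r2: "rat_at x (\<lambda>T. bval k n \<alpha> (?\<phi> T) i)" for i
      proof -
        obtain r where "\<forall>T. poly r T = bval k n \<alpha> (?\<phi> T) i" using bval_curve[of k n \<alpha> P i] by (elim exE)
        then have "(\<lambda>T. bval k n \<alpha> (?\<phi> T) i) = poly r" by (simp add: fun_eq_iff)
        then show ?thesis using rat_at_poly by simp
      qed
      have "rat_at x (\<lambda>T. (\<Sum>\<pi>\<in>words k. fev (?g T) (h \<pi>) * (\<Prod>i<k. bval k n \<alpha> (?\<phi> T) (\<pi> i))) / poly (L ^ N) T)"
        by (intro rat_at_divide rat_at_sum rat_at_mult rat_at_prod r1 r2) (use Lx in simp_all)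
      moreover have "(\<lambda>T. (\<Sum>\<pi>\<in>words k. fev (?g T) (h \<pi>) * (\<Prod>i<k. bval k n \<alpha> (?\<phi> T) (\<pi> i))) / poly (L ^ N) T) =
          (\<lambda>T. NFval k n N \<alpha> h (?g T) (?\<phi> T))"
        unfolding NFval_def using L by (simp add: fun_eq_iff)
      ultimately have "rat_at x (\<lambda>T. NFval k n N \<alpha> h (?g T) (?\<phi> T))" by simp
      then show ?thesis
      proof (rule rat_at_cong[OF _ Bx])
        fix T assume "poly B T \<noteq> 0"
        then have "meval (?g T) b \<noteq> 0" using B by simp
        then show "Phi k n N s (?g T) (?\<phi> T) = NFval k n N \<alpha> h (?g T) (?\<phi> T)"
          by (intro Phi_locally_NF[OF kn' kn(1) basic_subset b(3) _ b(4,5) g ap] pt_in_basic[OF g b(1)])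
      qed
    qed
    then show "\<exists>r. \<forall>T. Phi k n N s (?g T) (?\<phi> T) = poly r T" by (rule locally_rational_imp_poly)
  next
    fix c :: 'a and g \<phi> :: "nat \<Rightarrow> 'a"
    assume c: "c \<noteq> 0" and g: "nonzero_form k g" and ap: "apolar k n g \<phi>"
    let ?g = "\<lambda>j. c * g j"
    have g': "nonzero_form k ?g" using c g unfolding nonzero_form_def by simp
    have ap': "apolar k n ?g \<phi>"
      using ap unfolding apolar_def by (simp add: mult.assoc flip: sum_distrib_left)
    obtain \<alpha> b e h where b: "b \<in> homogeneous k e" "pt k g \<in> basic k b" "\<forall>q\<in>basic k b. ell k \<alpha> \<notin> q"
        "\<forall>\<pi>\<in>words k. h \<pi> \<in> fracs k (nonvan_on (basic k b)) 0" "\<forall>q\<in>basic k b. s q = NF k n N \<alpha> h q"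
      by (rule near[OF pt_in_proj_points[OF g] pt_in_proj_points[OF g]])
    have "meval g b \<noteq> 0" using b(2) homogeneous_in_pt[OF b(1), of g] by (simp add: basic_def)
    then have "meval ?g b \<noteq> 0" using c by (simp add: meval_homogeneous[OF b(1)])
    then have pt': "pt k ?g \<in> basic k b" by (rule pt_in_basic[OF g' b(1)])
    have fev: "fev ?g (h \<pi>) = fev g (h \<pi>)" if \<pi>: "\<pi> \<in> words k" for \<pi>
    proof -
      obtain a f u u' where f: "h \<pi> = Fract a f" "f \<in> homogeneous k u" "\<forall>q\<in>basic k b. f \<notin> q"
          "a \<in> homogeneous k u'" "int u' = int u + 0"
        using bspec[OF b(4) \<pi>] unfolding fracs_def by (elim CollectE exE conjE) (rule that)
      have "meval g f \<noteq> 0" using homogeneous_in_pt[OF f(2), of g] bspec[OF f(3) b(2)] by simp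
      then show ?thesis
        using c f(5) unfolding f(1)
        by (simp add: fev_Fract meval_homogeneous[OF f(2)] meval_homogeneous[OF f(4)])
    qed
    have ell: "meval ?g (ell k \<alpha>) = c * meval g (ell k \<alpha>)"
      using meval_homogeneous[OF ell_homogeneous, of c g k \<alpha>] by simp
    have "Phi k n N s ?g \<phi> = NFval k n N \<alpha> h ?g \<phi>"
      by (rule Phi_locally_NF[OF kn' kn(1) basic_subset b(3) pt' b(4,5) g' ap'])
    \<comment> \<open>The coefficients have degree 0 and do not see \<open>c\<close>; the value of
      the form at \<alpha> is multiplied by \<open>c\<close>, and its power in the denominator
      accounts for the exponent \<open>N\<close>.\<close>
    also have "\<dots> * c ^ N = NFval k n N \<alpha> h g \<phi>"
      unfolding NFval_def ell using fev c by (simp add: power_mult_distrib)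
    also have "\<dots> = Phi k n N s g \<phi>"
      by (rule Phi_locally_NF[OF kn' kn(1) basic_subset b(3) b(2) b(4,5) g ap, symmetric])
    finally show "Phi k n N s ?g \<phi> * c ^ N = Phi k n N s g \<phi>" .
  next
    fix g :: "nat \<Rightarrow> 'a" and \<psi> :: "nat \<Rightarrow> nat \<Rightarrow> 'a"
    assume g: "nonzero_form k g" and ap: "\<And>l. l < k \<Longrightarrow> apolar k n g (\<psi> l)"
    obtain \<alpha> b e h where b: "b \<in> homogeneous k e" "pt k g \<in> basic k b" "\<forall>q\<in>basic k b. ell k \<alpha> \<notin> q"
        "\<forall>\<pi>\<in>words k. h \<pi> \<in> fracs k (nonvan_on (basic k b)) 0" "\<forall>q\<in>basic k b. s q = NF k n N \<alpha> h q"
      by (rule near[OF pt_in_proj_points[OF g] pt_in_proj_points[OF g]])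
    let ?\<phi> = "\<lambda>c m. \<Sum>l<k. c l * \<psi> l m"
    have ap': "apolar k n g (?\<phi> c)" for c
      unfolding apolar_def
    proof (intro allI impI)
      fix r assume r: "r \<le> n - k"
      have "(\<Sum>j\<le>k. g j * (\<Sum>l<k. c l * \<psi> l (r + j))) = (\<Sum>j\<le>k. \<Sum>l<k. c l * (g j * \<psi> l (r + j)))"
        by (simp add: sum_distrib_left mult_ac)
      also have "\<dots> = (\<Sum>l<k. \<Sum>j\<le>k. c l * (g j * \<psi> l (r + j)))" by (rule sum.swap)
      also have "\<dots> = (\<Sum>l<k. c l * (\<Sum>j\<le>k. g j * \<psi> l (r + j)))" by (simp add: sum_distrib_left)
      also have "\<dots> = 0" using ap r unfolding apolar_def by simp
      finally show "(\<Sum>j\<le>k. g j * (\<Sum>l<k. c l * \<psi> l (r + j))) = 0" .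
    qed
    have bval: "bval k n \<alpha> (?\<phi> c) i = (\<Sum>l<k. c l * bval k n \<alpha> (\<psi> l) i)" for c i
    proof -
      have "bval k n \<alpha> (?\<phi> c) i = (\<Sum>m\<le>n. \<Sum>l<k. c l * (\<psi> l m * fev (\<lambda>_. 0) (coeff (ebas k n \<alpha> i) m)))"
        by (simp add: bval_def sum_distrib_right mult.assoc)
      also have "\<dots> = (\<Sum>l<k. \<Sum>m\<le>n. c l * (\<psi> l m * fev (\<lambda>_. 0) (coeff (ebas k n \<alpha> i) m)))" by (rule sum.swap)
      finally show ?thesis by (simp add: bval_def sum_distrib_left)
    qed
    define L where "L = meval g (ell k \<alpha>) ^ N"
    let ?C = "\<lambda>\<sigma>. (\<Sum>\<pi>\<in>words k. fev g (h \<pi>) * (\<Prod>i<k. bval k n \<alpha> (\<psi> (\<sigma> i)) (\<pi> i))) / L"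
    have "Phi k n N s g (?\<phi> c) = (\<Sum>\<sigma>\<in>words k. ?C \<sigma> * (\<Prod>i<k. c (\<sigma> i)))" for c
    proof -
      have "Phi k n N s g (?\<phi> c) = NFval k n N \<alpha> h g (?\<phi> c)"
        by (rule Phi_locally_NF[OF kn' kn(1) basic_subset b(3) b(2) b(4,5) g ap'])
      also have "\<dots> = (\<Sum>\<pi>\<in>words k. fev g (h \<pi>) * (\<Prod>i<k. \<Sum>l<k. c l * bval k n \<alpha> (\<psi> l) (\<pi> i))) / L"
        unfolding NFval_def L_def bval ..
      \<comment> \<open>Expanding a product of \<open>k\<close> linear forms in \<open>c\<close>
        gives one term for each word \<sigma>.\<close>
      also have "\<dots> = (\<Sum>\<pi>\<in>words k. \<Sum>\<sigma>\<in>words k.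
          fev g (h \<pi>) * (\<Prod>i<k. bval k n \<alpha> (\<psi> (\<sigma> i)) (\<pi> i)) / L * (\<Prod>i<k. c (\<sigma> i)))"
        by (simp add: prod_sum_PiE prod.distrib sum_distrib_left sum_divide_distrib mult_ac)
      also have "\<dots> = (\<Sum>\<sigma>\<in>words k. \<Sum>\<pi>\<in>words k.
          fev g (h \<pi>) * (\<Prod>i<k. bval k n \<alpha> (\<psi> (\<sigma> i)) (\<pi> i)) / L * (\<Prod>i<k. c (\<sigma> i)))"
        by (rule sum.swap)
      also have "\<dots> = (\<Sum>\<sigma>\<in>words k. ?C \<sigma> * (\<Prod>i<k. c (\<sigma> i)))"
        by (simp only: sum_distrib_right sum_divide_distrib)
      finally show ?thesis .
    qed
    then show "\<exists>C. \<forall>c. Phi k n N s g (?\<phi> c) = (\<Sum>\<sigma>\<in>words k. C \<sigma> * (\<Prod>i<k. c (\<sigma> i)))"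
      by (intro exI[of _ ?C] allI)
  qed
qed

section \<open>Vanishing of a section\<close>

text \<open>The multiset of letters of a word, encoded as a monomial; it identifies the words that
  differ by a permutation.\<close>

definition word_monomial :: "nat \<Rightarrow> (nat \<Rightarrow> nat) \<Rightarrow> (nat \<Rightarrow>\<^sub>0 nat)" where
  "word_monomial k \<pi> = (\<Sum>i<k. Poly_Mapping.single (\<pi> i) 1)"

lemma mon_val_word: "mon_val Y (word_monomial k \<pi>) = (\<Prod>i<k. Y (\<pi> i))"
  by (simp add: word_monomial_def mon_val_sum)

text \<open>A polynomial that vanishes at all \<open>Y\<close> is zero, and these sums are its
  coefficients once equal monomials are collected. The single \<open>C \<pi>\<close> may well be
  nonzero.\<close>

lemma word_polynomial_zero:
  fixes C :: "(nat \<Rightarrow> nat) \<Rightarrow> 'a::alg_closed_field"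
  assumes "\<And>Y. (\<Sum>\<pi>\<in>words k. C \<pi> * (\<Prod>i<k. Y (\<pi> i))) = 0"
  shows "(\<Sum>\<pi>\<in>{\<pi>\<in>words k. word_monomial k \<pi> = \<mu>}. C \<pi>) = 0"
proof -
  define f where "f = (\<Sum>\<pi>\<in>words k. Poly_Mapping.single (word_monomial k \<pi>) (C \<pi>))"
  have "meval Y f = 0" for Y
    unfolding f_def meval_sum meval_single mon_val_word by (rule assms)
  then have "f = 0" by (rule meval_eq_0_imp_eq_0)
  then have "(\<Sum>\<pi>\<in>words k. if word_monomial k \<pi> = \<mu> then C \<pi> else 0) = 0"
    using arg_cong[of f 0 "\<lambda>f. Poly_Mapping.lookup f \<mu>"]
    unfolding f_def lookup_sum lookup_single when_def by simp
  then show ?thesis using sum.inter_filter[OF finite_words, of C k "\<lambda>\<pi>. word_monomial k \<pi> = \<mu>"] by simp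
qed

text \<open>The exponents count how often each letter occurs, so the two words have the same
  multiset of letters.\<close>

lemma word_monomial_eq_imp_permuted:
  assumes "word_monomial k \<pi> = word_monomial k \<pi>'"
  shows "\<exists>\<sigma>. \<sigma> permutes {..<k} \<and> (\<forall>i\<in>{..<k}. \<pi> i = \<pi>' (\<sigma> i))"
proof -
  have count: "Poly_Mapping.lookup (\<Sum>x\<in>#M. Poly_Mapping.single x (1::nat)) y = count M y" for M :: "nat multiset" and y
    by (induction M) (simp_all add: lookup_add lookup_single when_def)
  have wm: "word_monomial k \<pi> = (\<Sum>x\<in>#image_mset \<pi> (mset_set {..<k}). Poly_Mapping.single x 1)" for \<pi>
    unfolding word_monomial_def sum_unfold_sum_mset by (simp add: image_mset.compositionality o_def)
  have eq: "image_mset \<pi> (mset_set {..<k}) = image_mset \<pi>' (mset_set {..<k})"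
    using assms unfolding wm by (intro multiset_eqI) (metis count)
  obtain \<sigma> where "\<sigma> permutes {..<k}" "\<forall>i\<in>{..<k}. \<pi> i = \<pi>' (\<sigma> i)"
    by (rule image_mset_eq_implies_permutes[OF finite_lessThan eq])
  then show ?thesis by (intro exI conjI)
qed

lemma (in chart) sgen_permuted:
  assumes q: "q \<in> V" and \<pi>: "\<pi> \<in> words k" "\<pi>' \<in> words k" and eq: "word_monomial k \<pi> = word_monomial k \<pi>'"
  shows "sgen k n \<alpha> q \<pi> = sgen k n \<alpha> q \<pi>'"
proof -
  obtain \<sigma> where \<sigma>: "\<sigma> permutes {..<k}" "\<forall>i\<in>{..<k}. \<pi> i = \<pi>' (\<sigma> i)"
    using word_monomial_eq_imp_permuted[OF eq] by (elim exE conjE) (rule that)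
  have "(\<lambda>i\<in>{..<k}. egen k n \<alpha> q (\<pi> i)) = (\<lambda>i\<in>{..<k}. egen k n \<alpha> q (\<pi>' i)) \<circ> \<sigma>"
  proof
    fix i
    show "(\<lambda>i\<in>{..<k}. egen k n \<alpha> q (\<pi> i)) i = ((\<lambda>i\<in>{..<k}. egen k n \<alpha> q (\<pi>' i)) \<circ> \<sigma>) i"
      using \<sigma>(2) permutes_in_image[OF \<sigma>(1), of i] by (simp add: restrict_def)
  qed
  then show ?thesis
    unfolding sgen_def using sym_power.sp_permute[OF proj_point.S[OF point[OF q]] egen_tuple[OF q \<pi>(2)] \<sigma>(1)] by simp
qed

lemma (in Module.module) finsum_smult_const:
  assumes "finite A" "\<And>a. a \<in> A \<Longrightarrow> h a \<in> carrier R" "v \<in> carrier M"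
  shows "(\<Oplus>\<^bsub>M\<^esub>a\<in>A. h a \<odot>\<^bsub>M\<^esub> v) = finsum R h A \<odot>\<^bsub>M\<^esub> v"
  using assms(1,2)
proof (induction A)
  case (insert a A)
  have h: "h a \<in> carrier R" "h \<in> A \<rightarrow> carrier R" using insert.prems by auto
  have "(\<Oplus>\<^bsub>M\<^esub>a\<in>insert a A. h a \<odot>\<^bsub>M\<^esub> v) = h a \<odot>\<^bsub>M\<^esub> v \<oplus>\<^bsub>M\<^esub> (\<Oplus>\<^bsub>M\<^esub>a\<in>A. h a \<odot>\<^bsub>M\<^esub> v)"
    using insert.hyps h assms(3) by (intro M.finsum_insert) auto
  also have "\<dots> = (h a \<oplus>\<^bsub>R\<^esub> finsum R h A) \<odot>\<^bsub>M\<^esub> v"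
    using insert h assms(3) by (simp add: smult_l_distr R.finsum_closed)
  also have "h a \<oplus>\<^bsub>R\<^esub> finsum R h A = finsum R h (insert a A)"
    using insert.hyps h by (intro R.finsum_insert[symmetric]) auto
  finally show ?case .
qed (simp add: assms(3))

lemma (in chart) finsum_ring_st:
  assumes "finite A" "\<And>a. a \<in> A \<Longrightarrow> h a \<in> OV 0" "q \<in> V"
  shows "finsum (ring_st k q) h A = sum h A"
proof -
  interpret R: cring "ring_st k q" by (rule denominators.frac_ring_cring[OF proj_point.D[OF point[OF assms(3)]]])
  show ?thesis using assms(1,2)
  proof (induction A)
    case empty
    show ?case unfolding R.finsum_empty by (simp add: frac_ring_def)
  next
    case (insert a A)
    have "finsum (ring_st k q) h (insert a A) = h a \<oplus>\<^bsub>ring_st k q\<^esub> finsum (ring_st k q) h A"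
      using insert.hyps OV_ring[OF insert.prems assms(3)] by (intro R.finsum_insert) auto
    then show ?case using insert by (simp add: frac_ring_def)
  qed
qed

lemma Union_fibres: "(\<Union>y\<in>f ` A. {x\<in>A. f x = y}) = A"
  by auto

lemma disjnt_fibres: "pairwise (\<lambda>y z. disjnt {x\<in>A. f x = y} {x\<in>A. f x = z}) I"
  by (auto simp: pairwise_def disjnt_def)

text \<open>Words with the same monomial have the same symmetric product; after grouping, each
  product carries the sum of its coefficients.\<close>

lemma (in chart) symNF_zero:
  assumes h: "\<And>\<pi>. \<pi> \<in> words k \<Longrightarrow> h \<pi> \<in> OV 0"
    and zero: "\<And>\<mu>. (\<Sum>\<pi>\<in>{\<pi>\<in>words k. word_monomial k \<pi> = \<mu>}. h \<pi>) = 0" and q: "q \<in> V"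
  shows "symNF k n \<alpha> h q = \<zero>\<^bsub>sym_stalk k n q\<^esub>"
proof -
  interpret S: Module.module "ring_st k q" "sym_stalk k n q" by (rule S_module[OF q])
  let ?I = "word_monomial k ` words k" and ?A = "\<lambda>\<mu>. {\<pi>\<in>words k. word_monomial k \<pi> = \<mu>}"
  let ?t = "\<lambda>\<pi>. h \<pi> \<odot>\<^bsub>sym_stalk k n q\<^esub> sgen k n \<alpha> q \<pi>"
  have fin: "finite (?A \<mu>)" for \<mu> using finite_words[of k] by simp
  have t: "?t \<in> words k \<rightarrow> carrier (sym_stalk k n q)" by (rule symNF_terms[OF q h])
  have "finsum (sym_stalk k n q) ?t (?A \<mu>) = \<zero>\<^bsub>sym_stalk k n q\<^esub>" if \<mu>: "\<mu> \<in> ?I" for \<mu>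
  proof -
    obtain \<rho> where \<rho>: "\<rho> \<in> words k" "\<mu> = word_monomial k \<rho>" using \<mu> by (elim imageE)
    note v = sgen_closed[OF q \<rho>(1)]
    have hA: "h \<pi> \<in> OV 0" if "\<pi> \<in> ?A \<mu>" for \<pi> using that by (intro h) simp
    have "finsum (sym_stalk k n q) ?t (?A \<mu>) =
        (\<Oplus>\<^bsub>sym_stalk k n q\<^esub>\<pi>\<in>?A \<mu>. h \<pi> \<odot>\<^bsub>sym_stalk k n q\<^esub> sgen k n \<alpha> q \<rho>)"
    proof (rule S.finsum_cong'[OF refl])
      show "(\<lambda>\<pi>. h \<pi> \<odot>\<^bsub>sym_stalk k n q\<^esub> sgen k n \<alpha> q \<rho>) \<in> ?A \<mu> \<rightarrow> carrier (sym_stalk k n q)"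
        using OV_ring[OF hA q] v by (intro Pi_I S.smult_closed)
      fix \<pi> assume "\<pi> \<in> ?A \<mu>"
      then have "sgen k n \<alpha> q \<pi> = sgen k n \<alpha> q \<rho>" using \<rho> by (intro sgen_permuted[OF q]) simp_all
      then show "?t \<pi> = h \<pi> \<odot>\<^bsub>sym_stalk k n q\<^esub> sgen k n \<alpha> q \<rho>" by simp
    qed
    also have "\<dots> = finsum (ring_st k q) h (?A \<mu>) \<odot>\<^bsub>sym_stalk k n q\<^esub> sgen k n \<alpha> q \<rho>"
      by (rule S.finsum_smult_const[OF fin OV_ring[OF hA q] v])
    also have "finsum (ring_st k q) h (?A \<mu>) = sum h (?A \<mu>)"
      by (rule finsum_ring_st[OF fin hA q])
    also have "sum h (?A \<mu>) = 0" by (rule zero)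
    also have "0 = \<zero>\<^bsub>ring_st k q\<^esub>" by (simp add: frac_ring_def)
    finally show ?thesis using S.smult_l_null[OF v] by simp
  qed
  note fibre = this
  have "(\<Union>\<mu>\<in>?I. ?A \<mu>) = words k" by (rule Union_fibres)
  then have "symNF k n \<alpha> h q = finsum (sym_stalk k n q) ?t (\<Union>\<mu>\<in>?I. ?A \<mu>)"
    unfolding symNF_def by simp
  also have "\<dots> = (\<Oplus>\<^bsub>sym_stalk k n q\<^esub>\<mu>\<in>?I. finsum (sym_stalk k n q) ?t (?A \<mu>))"
  proof (rule S.add.finprod_UN_disjoint)
    show "finite ?I" using finite_words by simp
    show "pairwise (\<lambda>i j. disjnt (?A i) (?A j)) ?I" by (rule disjnt_fibres)
    show "?t x \<in> carrier (sym_stalk k n q)" if "i \<in> ?I" "x \<in> ?A i" for i x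
      using t that by (simp add: Pi_iff)
  qed (rule fin)
  also have "\<dots> = (\<Oplus>\<^bsub>sym_stalk k n q\<^esub>\<mu>\<in>?I. \<zero>\<^bsub>sym_stalk k n q\<^esub>)"
    using fibre by (intro S.finsum_cong'[OF refl]) auto
  finally show ?thesis by simp
qed

section \<open>Testing normal forms at forms with distinct roots\<close>

lemma fev_const_coeffs:
  fixes t :: "'a::field"
  assumes "const_coeffs q" "degree q \<le> n"
  shows "(\<Sum>m\<le>n. t ^ m * fev (\<lambda>_. 0) (coeff q m)) = fev (\<lambda>_. 0) (poly q (const_fract t))"
proof -
  have c: "coeff q m \<in> regular_at (\<lambda>_. 0)" for m
  proof -
    have "coeff q m \<in> range const_fract" using assms(1) unfolding const_coeffs_def by (rule spec)
    then show ?thesis by (elim rangeE) simp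
  qed
  have r: "coeff q m * const_fract (t ^ m) \<in> regular_at (\<lambda>_. 0)" for m
    by (intro regular_mult c regular_const)
  have "fev (\<lambda>_. 0) (poly q (const_fract t)) = fev (\<lambda>_. 0) (\<Sum>m\<le>n. coeff q m * const_fract (t ^ m))"
    unfolding poly_bounded_sum[OF assms(2)] const_fract_power ..
  also have "\<dots> = (\<Sum>m\<le>n. fev (\<lambda>_. 0) (coeff q m * const_fract (t ^ m)))"
    by (rule fev_sum[THEN conjunct2]) (rule r)
  finally show ?thesis by (simp add: fev_mult[OF c regular_const] mult.commute)
qed

lemma poly_ebas: "poly (ebas k n \<alpha> i) (const_fract t) = const_fract ((t - \<alpha>) ^ (n - k + 1) * t ^ i)"
  for t \<alpha> :: "'a::field"
proof -
  have "poly (ebas k n \<alpha> i) (const_fract t) = (const_fract t - const_fract \<alpha>) ^ (n - k + 1) * const_fract t ^ i"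
    unfolding ebas_def poly_mult poly_power poly_monom by simp
  then show ?thesis by (simp only: const_fract_hom const_fract_power const_fract_diff)
qed

text \<open>For distinct roots different from \<alpha> the powers of \<open>t l - \<alpha>\<close>
  are nonzero and the rest is a Vandermonde system, so suitable weights give the functional any
  prescribed values on the frame.\<close>

lemma bval_root_functional:
  fixes t :: "nat \<Rightarrow> 'a::field"
  assumes "k \<le> n" "i < k"
  shows "bval k n \<alpha> (root_functional k t c) i = (\<Sum>l<k. c l * ((t l - \<alpha>) ^ (n - k + 1) * t l ^ i))"
proof -
  let ?\<epsilon> = "\<lambda>m. fev (\<lambda>_. 0) (coeff (ebas k n \<alpha> i) m)"
  have "bval k n \<alpha> (root_functional k t c) i = (\<Sum>m\<le>n. \<Sum>l<k. c l * (t l ^ m * ?\<epsilon> m))"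
    by (simp add: bval_def root_functional_def sum_distrib_right mult.assoc)
  also have "\<dots> = (\<Sum>l<k. \<Sum>m\<le>n. c l * (t l ^ m * ?\<epsilon> m))" by (rule sum.swap)
  also have "\<dots> = (\<Sum>l<k. c l * (\<Sum>m\<le>n. t l ^ m * ?\<epsilon> m))" by (simp only: sum_distrib_left)
  finally show ?thesis
    unfolding fev_const_coeffs[OF ebas_const_coeffs degree_ebas[OF assms]] poly_ebas fev_const_fract .
qed

lemma meval_root_form_ell:
  fixes t :: "nat \<Rightarrow> 'a::field"
  shows "meval (root_form k t) (ell k \<alpha>) = (\<Prod>i<k. \<alpha> - t i)"
proof -
  let ?p = "\<Prod>i<k. [:- t i, 1:]"
  have "degree ?p \<le> k" by (simp add: degree_prod_eq_sum_degree)
  then have "poly ?p \<alpha> = (\<Sum>j\<le>k. coeff ?p j * \<alpha> ^ j)" by (rule poly_bounded_sum)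
  then show ?thesis unfolding meval_ell root_form_def by (simp add: poly_prod mult.commute)
qed

text \<open>Were some collected coefficient nonzero, its numerator would be nonzero at a form with
  distinct roots. There the values of \<phi> on the frame can be prescribed by the weights, and a
  polynomial that vanishes for all these values has zero coefficients.\<close>

lemma (in chart) NF_zero:
  assumes b: "b \<in> homogeneous k e" "V = basic k b" and h: "\<And>\<pi>. \<pi> \<in> words k \<Longrightarrow> h \<pi> \<in> OV 0"
    and zero: "\<And>t c. inj_on t {..<k} \<Longrightarrow> meval (root_form k t) b \<noteq> 0 \<Longrightarrow>
      NFval k n N \<alpha> h (root_form k t) (root_functional k t c) = 0"
    and q: "q \<in> V"
  shows "NF k n N \<alpha> h q = \<zero>\<^bsub>tensor_stalk k n (- int N) q\<^esub>"
proof -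
  have b0: "b \<noteq> 0" using q b(2) proj_pointD(2)[of q k] by (auto simp: basic_def)
  have fibre_sum: "(\<Sum>\<pi>\<in>{\<pi>\<in>words k. word_monomial k \<pi> = \<mu>}. h \<pi>) = 0" for \<mu>
  proof (rule ccontr)
    let ?A = "{\<pi>\<in>words k. word_monomial k \<pi> = \<mu>}"
    assume nz: "sum h ?A \<noteq> 0"
    have "sum h ?A \<in> OV 0" using h by (intro denominators.fracs_sum[OF D]) simp
    then obtain a f u u' where af: "sum h ?A = Fract a f" "f \<in> homogeneous k u" "\<forall>q\<in>V. f \<notin> q"
        "a \<in> homogeneous k u'"
      unfolding fracs_def by (elim CollectE exE conjE) (rule that)
    have "a \<noteq> 0" using nz af(1) by (auto simp: fract_collapse)
    \<comment> \<open>Including \<open>b\<close> keeps the form to be chosen inside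
      \<open>V\<close>.\<close>
    then have "a * b \<noteq> 0" using b0 by simp
    from meval_root_form_nonzero[OF homogeneous_mult[OF af(4) b(1)] this]
    obtain t where t: "inj_on t {..<k}" "meval (root_form k t) (a * b) \<noteq> 0" by (elim exE conjE) (rule that)
    let ?g = "root_form k t"
    have ag: "meval ?g a \<noteq> 0" and bg: "meval ?g b \<noteq> 0" using t(2) by (auto simp: meval_mult)
    have pV: "pt k ?g \<in> V" unfolding b(2) by (rule pt_in_basic[OF root_form_nonzero b(1) bg])
    have reg: "h \<pi> \<in> regular_at ?g" if \<pi>: "\<pi> \<in> words k" for \<pi>
    proof -
      obtain a' f' v where "h \<pi> = Fract a' f'" "f' \<in> homogeneous k v" "\<forall>q\<in>V. f' \<notin> q"
        using h[OF \<pi>] unfolding fracs_def by (elim CollectE exE conjE) (rule that)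
      then show ?thesis
        using homogeneous_in_pt[of f' k v ?g] pV unfolding regular_at_def by blast
    qed
    have ellg: "meval ?g (ell k \<alpha>) \<noteq> 0"
      using ell_V[OF pV] homogeneous_in_pt[OF ell_homogeneous, of k \<alpha> ?g] by simp
    then have t\<alpha>: "t l \<noteq> \<alpha>" if "l < k" for l using that unfolding meval_root_form_ell by (auto simp: prod_zero_iff)
    from lagrange_coefficients[OF t(1)] obtain L
      where L: "\<forall>j<k. \<forall>m<k. (\<Sum>l<k. L l j * t l ^ m) = (if j = m then 1 else 0)" by (elim exE)
    have "(\<Sum>\<pi>\<in>words k. fev ?g (h \<pi>) * (\<Prod>i<k. Y (\<pi> i))) = 0" for Y
    proof -
      \<comment> \<open>These weights solve the Vandermonde system for the prescribed values
        \<open>Y\<close>; the division undoes the power of \<open>t l - \<alpha>\<close> that the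
        frame brings in.\<close>
      define c where "c l = (\<Sum>j<k. Y j * L l j) / (t l - \<alpha>) ^ (n - k + 1)" for l
      have c: "bval k n \<alpha> (root_functional k t c) i = Y i" if i: "i < k" for i
      proof -
        have "bval k n \<alpha> (root_functional k t c) i = (\<Sum>l<k. (\<Sum>j<k. Y j * L l j) * t l ^ i)"
          unfolding bval_root_functional[OF kn i] c_def using t\<alpha> by (intro sum.cong refl) simp
        also have "\<dots> = (\<Sum>l<k. \<Sum>j<k. Y j * (L l j * t l ^ i))" by (simp add: sum_distrib_right mult.assoc)
        also have "\<dots> = (\<Sum>j<k. \<Sum>l<k. Y j * (L l j * t l ^ i))" by (rule sum.swap)
        also have "\<dots> = (\<Sum>j<k. Y j * (\<Sum>l<k. L l j * t l ^ i))" by (simp only: sum_distrib_left)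
        also have "\<dots> = (\<Sum>j<k. if j = i then Y j else 0)" using L i by (intro sum.cong refl) simp
        finally show ?thesis using i by simp
      qed
      have "(\<Prod>i<k. bval k n \<alpha> (root_functional k t c) (\<pi> i)) = (\<Prod>i<k. Y (\<pi> i))" if "\<pi> \<in> words k" for \<pi>
        using that c by (intro prod.cong refl) auto
      then have "(\<Sum>\<pi>\<in>words k. fev ?g (h \<pi>) * (\<Prod>i<k. Y (\<pi> i))) / meval ?g (ell k \<alpha>) ^ N = 0"
        using zero[OF t(1) bg, of c] unfolding NFval_def by simp
      then show ?thesis using ellg by simp
    qed
    then have "(\<Sum>\<pi>\<in>?A. fev ?g (h \<pi>)) = 0" by (rule word_polynomial_zero)
    moreover have "fev ?g (sum h ?A) = (\<Sum>\<pi>\<in>?A. fev ?g (h \<pi>))"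
      using reg by (intro fev_sum[THEN conjunct2]) simp
    moreover have "meval ?g f \<noteq> 0" using homogeneous_in_pt[OF af(2), of ?g] bspec[OF af(3) pV] by simp
    ultimately show False using ag af(1) by (simp add: fev_Fract)
  qed
  have S0: "symNF k n \<alpha> h q = \<zero>\<^bsub>sym_stalk k n q\<^esub>" by (rule symNF_zero[OF h fibre_sum q])
  interpret T: tensor_product "ring_st k q" "sym_stalk k n q" "line_stalk k (- int N) q"
    by (rule proj_point.T[OF point[OF q]])
  interpret TT: Module.module "ring_st k q" "tensor_stalk k n (- int N) q" by (rule T_module[OF q])
  have u: "Fract 1 (ell k \<alpha> ^ N) \<in> carrier (line_stalk k (- int N) q)"
    using OV_point[OF line_powers(1) q] by (simp add: frac_module_def)
  \<comment> \<open>The zero of the symmetric power is presented as an empty sum, so that additivity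
    on the left makes the tensor zero.\<close>
  have "tpr k n (- int N) q (finsum (sym_stalk k n q) (\<lambda>_. \<zero>\<^bsub>sym_stalk k n q\<^esub>) ({}::nat set)) (Fract 1 (ell k \<alpha> ^ N))
      = \<zero>\<^bsub>tensor_stalk k n (- int N) q\<^esub>"
    using T.tp_finsum_left[of "{}::nat set" "\<lambda>_. \<zero>\<^bsub>sym_stalk k n q\<^esub>", OF _ _ u] by simp
  then show ?thesis unfolding NF_def S0 by simp
qed

text \<open>As the coefficients of a normal form are not unique, two normal forms are compared by
  their values; their difference falls under \<open>NF_zero\<close>.\<close>

lemma (in chart) NF_eqI:
  assumes b: "b \<in> homogeneous k e" "V = basic k b" and h: "\<And>\<pi>. \<pi> \<in> words k \<Longrightarrow> h \<pi> \<in> OV 0"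
    and h': "\<And>\<pi>. \<pi> \<in> words k \<Longrightarrow> h' \<pi> \<in> OV 0"
    and eq: "\<And>t c. inj_on t {..<k} \<Longrightarrow> meval (root_form k t) b \<noteq> 0 \<Longrightarrow>
      NFval k n N \<alpha> h (root_form k t) (root_functional k t c) =
      NFval k n N \<alpha> h' (root_form k t) (root_functional k t c)"
    and q: "q \<in> V"
  shows "NF k n N \<alpha> h q = NF k n N \<alpha> h' q"
proof -
  let ?d = "\<lambda>\<pi>. h \<pi> + - h' \<pi>"
  have d: "?d \<pi> \<in> OV 0" if "\<pi> \<in> words k" for \<pi>
    by (intro denominators.fracs_add[OF D] denominators.fracs_uminus[OF D] h h' that)
  have "NF k n N \<alpha> ?d q = \<zero>\<^bsub>tensor_stalk k n (- int N) q\<^esub>"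
  proof (rule NF_zero[OF b d _ q])
    fix t :: "nat \<Rightarrow> 'a" and c assume t: "inj_on t {..<k}" "meval (root_form k t) b \<noteq> 0"
    let ?g = "root_form k t"
    have pV: "pt k ?g \<in> V" unfolding b(2) by (rule pt_in_basic[OF root_form_nonzero b(1) t(2)])
    have reg: "x \<in> regular_at ?g" if x: "x \<in> OV 0" for x
    proof -
      obtain a' f' v where "x = Fract a' f'" "f' \<in> homogeneous k v" "\<forall>q\<in>V. f' \<notin> q"
        using x unfolding fracs_def by (elim CollectE exE conjE) (rule that)
      then show ?thesis
        using homogeneous_in_pt[of f' k v ?g] pV unfolding regular_at_def by blast
    qed
    have fd: "fev ?g (?d \<pi>) + fev ?g (h' \<pi>) = fev ?g (h \<pi>)" if "\<pi> \<in> words k" for \<pi>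
      using fev_add[OF reg[OF d[OF that]] reg[OF h'[OF that]]] by simp
    have "NFval k n N \<alpha> ?d ?g (root_functional k t c) + NFval k n N \<alpha> h' ?g (root_functional k t c) =
        NFval k n N \<alpha> h ?g (root_functional k t c)"
      unfolding NFval_def add_divide_distrib[symmetric] sum.distrib[symmetric] distrib_right[symmetric]
      using fd by simp
    then show "NFval k n N \<alpha> ?d ?g (root_functional k t c) = 0" using eq[OF t, of c] by simp
  qed simp
  moreover have "1 \<odot>\<^bsub>tensor_stalk k n (- int N) q\<^esub> NF k n N \<alpha> ?d q \<oplus>\<^bsub>tensor_stalk k n (- int N) q\<^esub> NF k n N \<alpha> h' q =
      NF k n N \<alpha> (\<lambda>\<pi>. 1 * ?d \<pi> + h' \<pi>) q"
    by (rule NF_add_smult[OF q denominators.fracs_one[OF D] d h'])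
  moreover have "1 \<odot>\<^bsub>tensor_stalk k n (- int N) q\<^esub> \<zero>\<^bsub>tensor_stalk k n (- int N) q\<^esub> \<oplus>\<^bsub>tensor_stalk k n (- int N) q\<^esub>
      NF k n N \<alpha> h' q = NF k n N \<alpha> h' q"
  proof -
    interpret TT: Module.module "ring_st k q" "tensor_stalk k n (- int N) q" by (rule T_module[OF q])
    have "NF k n N \<alpha> h' q \<in> carrier (tensor_stalk k n (- int N) q)" by (rule NF_closed[OF q h'])
    moreover have "1 \<odot>\<^bsub>tensor_stalk k n (- int N) q\<^esub> \<zero>\<^bsub>tensor_stalk k n (- int N) q\<^esub> =
        \<zero>\<^bsub>tensor_stalk k n (- int N) q\<^esub>"
      by (rule TT.smult_r_null[OF OV_ring[OF denominators.fracs_one[OF D] q]])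
    ultimately show ?thesis by simp
  qed
  ultimately show ?thesis by simp
qed

text \<open>The values at nearby forms with distinct roots decide whether a normal form is zero,
  also at points \<open>p\<close> that are not closed.\<close>

lemma section_zero:
  fixes s :: "'a::alg_closed_field mpoly set \<Rightarrow> _"
  assumes kn0: "k \<le> n" "k \<ge> 1" and s: "s \<in> sections (tensh k n (- int N)) (proj_points k)"
    and zero: "\<And>t c. inj_on t {..<k} \<Longrightarrow> Phi k n N s (root_form k t) (root_functional k t c) = 0"
    and p: "p \<in> proj_points k"
  shows "s p = \<zero>\<^bsub>tensor_stalk k n (- int N) p\<^esub>"
proof -
  obtain \<alpha> b e h where b: "b \<in> homogeneous k e" "p \<in> basic k b" "\<forall>q\<in>basic k b. ell k \<alpha> \<notin> q"
        "\<forall>\<pi>\<in>words k. h \<pi> \<in> fracs k (nonvan_on (basic k b)) 0" "\<forall>q\<in>basic k b. s q = NF k n N \<alpha> h q"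
    by (rule section_near[OF kn0 s p p])
  interpret chart k n \<alpha> "basic k b" using kn0 b(2,3) basic_subset[of k b] by (intro chart.intro) auto
  have "NF k n N \<alpha> h p = \<zero>\<^bsub>tensor_stalk k n (- int N) p\<^esub>"
  proof (rule NF_zero[OF b(1) refl bspec[OF b(4)] _ b(2)])
    fix t :: "nat \<Rightarrow> 'a" and c assume t: "inj_on t {..<k}" "meval (root_form k t) b \<noteq> 0"
    have "Phi k n N s (root_form k t) (root_functional k t c) = NFval k n N \<alpha> h (root_form k t) (root_functional k t c)"
      by (rule Phi_locally_NF[OF kn0 basic_subset b(3) pt_in_basic[OF root_form_nonzero b(1) t(2)] b(4,5)
            root_form_nonzero root_form_apolar])
    then show "NFval k n N \<alpha> h (root_form k t) (root_functional k t c) = 0" using zero[OF t(1)] by simp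
  qed
  then show ?thesis using bspec[OF b(5,2)] by simp
qed

section \<open>The Hankel determinant\<close>

text \<open>The exponent will be \<open>N\<close>, not the n - k + 1 of \<open>ebas\<close>: the
  index \<open>i + \<sigma> i\<close> in the determinant runs up to 2k - 2, and N + (2k - 2) =
  n.\<close>

definition hform :: "nat \<Rightarrow> 'a::field \<Rightarrow> nat \<Rightarrow> 'a mpoly fract poly" where
  "hform N \<alpha> i = lin \<alpha> ^ N * monom 1 i"

lemma hform_const_coeffs: "const_coeffs (hform N \<alpha> i)"
  unfolding hform_def by (intro const_coeffs_mult const_coeffs_power const_coeffs_linear const_coeffs_monom)

lemma degree_hform: "degree (hform N \<alpha> i) \<le> N + i"
  using degree_mult_le[of "lin \<alpha> ^ N" "monom 1 i"] degree_lin_power[of \<alpha> N]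
    degree_monom_le[of "1 :: 'a mpoly fract" i] unfolding hform_def by linarith

lemma poly_hform: "poly (hform N \<alpha> i) (const_fract t) = const_fract ((t - \<alpha>) ^ N * t ^ i)"
  for t \<alpha> :: "'a::field"
proof -
  have "poly (hform N \<alpha> i) (const_fract t) = (const_fract t - const_fract \<alpha>) ^ N * const_fract t ^ i"
    unfolding hform_def poly_mult poly_power poly_monom by simp
  then show ?thesis by (simp only: const_fract_hom const_fract_power const_fract_diff)
qed

lemma functional_value_root:
  fixes t :: "nat \<Rightarrow> 'a::field"
  assumes q: "const_coeffs q" "degree q \<le> n"
  shows "functional_value n g (root_functional k t c) q = (\<Sum>l<k. c l * fev (\<lambda>_. 0) (poly q (const_fract (t l))))"
proof -
  have c: "fev g (coeff q m) = fev (\<lambda>_. 0) (coeff q m)" for m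
  proof -
    have "coeff q m \<in> range const_fract" using q(1) unfolding const_coeffs_def by (rule spec)
    then show ?thesis by (elim rangeE) simp
  qed
  have "functional_value n g (root_functional k t c) q = (\<Sum>m\<le>n. \<Sum>l<k. c l * (t l ^ m * fev (\<lambda>_. 0) (coeff q m)))"
    by (simp add: functional_value_def root_functional_def c sum_distrib_right mult.assoc)
  also have "\<dots> = (\<Sum>l<k. \<Sum>m\<le>n. c l * (t l ^ m * fev (\<lambda>_. 0) (coeff q m)))" by (rule sum.swap)
  also have "\<dots> = (\<Sum>l<k. c l * (\<Sum>m\<le>n. t l ^ m * fev (\<lambda>_. 0) (coeff q m)))" by (simp only: sum_distrib_left)
  finally show ?thesis unfolding fev_const_coeffs[OF q] .
qed

definition vander :: "nat \<Rightarrow> (nat \<Rightarrow> 'a::field) \<Rightarrow> 'a mat" where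
  "vander k t = mat k k (\<lambda>(l, j). t l ^ j)"

lemma vander_carrier [simp]: "vander k t \<in> carrier_mat k k"
  by (simp add: vander_def)

text \<open>The Lagrange coefficients form an inverse matrix.\<close>

lemma det_vander_nonzero:
  fixes t :: "nat \<Rightarrow> 'a::field"
  assumes "inj_on t {..<k}"
  shows "det (vander k t) \<noteq> 0"
proof -
  from lagrange_coefficients[OF assms] obtain L
    where L: "\<forall>j<k. \<forall>m<k. (\<Sum>l<k. L l j * t l ^ m) = (if j = m then 1 else 0)" by (elim exE)
  let ?L = "mat k k (\<lambda>(j, l). L l j)"
  have "?L * vander k t = 1\<^sub>m k"
  proof (rule eq_matI)
    fix j m assume "j < dim_row (1\<^sub>m k :: 'a mat)" "m < dim_col (1\<^sub>m k :: 'a mat)"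
    then have jm: "j < k" "m < k" by auto
    have "(?L * vander k t) $$ (j, m) = (\<Sum>l<k. L l j * t l ^ m)"
      using jm by (simp add: vander_def scalar_prod_def atLeast0LessThan)
    then show "(?L * vander k t) $$ (j, m) = 1\<^sub>m k $$ (j, m)" using L jm by simp
  qed (simp_all add: vander_def)
  then have "det ?L * det (vander k t) = 1"
    using det_mult[of ?L k "vander k t"] by simp
  then show ?thesis by auto
qed

text \<open>The left side is the Leibniz formula for the Hankel matrix of weighted power sums. This
  matrix is the product of the transposed Vandermonde matrix, the diagonal matrix of the weights and
  the Vandermonde matrix.\<close>

lemma hankel_leibniz:
  fixes t w :: "nat \<Rightarrow> 'a::field"
  shows "(\<Sum>\<sigma>\<in>{\<sigma>. \<sigma> permutes {..<k}}. signof \<sigma> * (\<Prod>i<k. \<Sum>l<k. w l * t l ^ (i + \<sigma> i))) =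
    (\<Prod>l<k. w l) * det (vander k t) ^ 2"
proof -
  let ?W = "mat k k (\<lambda>(l, j). if l = j then w l else 0)"
  let ?H = "mat k k (\<lambda>(i, j). \<Sum>l<k. w l * t l ^ (i + j))"
  have VW: "transpose_mat (vander k t) * ?W = mat k k (\<lambda>(i, l). t l ^ i * w l)"
  proof (rule eq_matI)
    fix i l assume "i < dim_row (mat k k (\<lambda>(i, l). t l ^ i * w l))" "l < dim_col (mat k k (\<lambda>(i, l). t l ^ i * w l))"
    then have il: "i < k" "l < k" by auto
    have "(transpose_mat (vander k t) * ?W) $$ (i, l) = (\<Sum>j<k. t j ^ i * (if j = l then w j else 0))"
      using il by (simp add: vander_def scalar_prod_def atLeast0LessThan)
    also have "\<dots> = (\<Sum>j<k. if j = l then t j ^ i * w j else 0)" by (intro sum.cong) auto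
    finally show "(transpose_mat (vander k t) * ?W) $$ (i, l) = mat k k (\<lambda>(i, l). t l ^ i * w l) $$ (i, l)"
      using il by simp
  qed (simp_all add: vander_def)
  have "transpose_mat (vander k t) * ?W * vander k t = ?H"
    unfolding VW
  proof (rule eq_matI)
    fix i j assume "i < dim_row ?H" "j < dim_col ?H"
    then have ij: "i < k" "j < k" by auto
    have "(mat k k (\<lambda>(i, l). t l ^ i * w l) * vander k t) $$ (i, j) = (\<Sum>l<k. t l ^ i * w l * t l ^ j)"
      using ij by (simp add: vander_def scalar_prod_def atLeast0LessThan)
    also have "\<dots> = (\<Sum>l<k. w l * t l ^ (i + j))" by (simp add: power_add mult_ac)
    finally show "(mat k k (\<lambda>(i, l). t l ^ i * w l) * vander k t) $$ (i, j) = ?H $$ (i, j)" using ij by simp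
  qed (simp_all add: vander_def)
  then have "det ?H = det (transpose_mat (vander k t) * ?W * vander k t)" by simp
  also have "\<dots> = det (transpose_mat (vander k t)) * det ?W * det (vander k t)"
  proof -
    have V': "transpose_mat (vander k t) \<in> carrier_mat k k" and W: "?W \<in> carrier_mat k k" by simp_all
    show ?thesis unfolding det_mult[OF mult_carrier_mat[OF V' W] vander_carrier] det_mult[OF V' W] by (rule refl)
  qed
  also have "det (transpose_mat (vander k t)) = det (vander k t)" by (rule det_transpose[OF vander_carrier])
  also have "det ?W = (\<Prod>l<k. w l)"
  proof -
    have "upper_triangular ?W" by (auto simp: upper_triangular_def)
    then have "det ?W = prod_list (diag_mat ?W)" by (rule det_upper_triangular[of _ k]) simp
    also have "\<dots> = (\<Prod>l<k. w l)"
      by (simp add: prod_list_diag_prod atLeast0LessThan)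
    finally show ?thesis .
  qed
  finally have "det ?H = (\<Prod>l<k. w l) * det (vander k t) ^ 2" by (simp add: power2_eq_square mult_ac)
  moreover have "det ?H = (\<Sum>\<sigma>\<in>{\<sigma>. \<sigma> permutes {..<k}}. signof \<sigma> * (\<Prod>i<k. \<Sum>l<k. w l * t l ^ (i + \<sigma> i)))"
  proof -
    have "(\<Prod>i<k. ?H $$ (i, \<sigma> i)) = (\<Prod>i<k. \<Sum>l<k. w l * t l ^ (i + \<sigma> i))" if "\<sigma> permutes {..<k}" for \<sigma>
    proof (rule prod.cong[OF refl])
      fix i assume "i \<in> {..<k}"
      then have "i < k" "\<sigma> i < k" using permutes_in_image[OF that, of i] by auto
      then show "?H $$ (i, \<sigma> i) = (\<Sum>l<k. w l * t l ^ (i + \<sigma> i))" by simp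
    qed
    then show ?thesis
      by (subst det_def'[of _ k]) (simp_all add: atLeast0LessThan)
  qed
  ultimately show ?thesis by simp
qed

text \<open>The \<open>k \<times> k\<close> Hankel determinant of the functional, restricted to the multiples of
  \<open>(x - \<alpha>)\<^sup>N\<close> and divided by the \<open>N\<close>-th power of the value at \<open>\<alpha>\<close> of the tautological form.\<close>

definition hankel where
  "hankel k n N \<alpha> q = (\<Oplus>\<^bsub>sym_stalk k n q\<^esub>\<sigma>\<in>{\<sigma>. \<sigma> permutes {..<k}}. const_fract (signof \<sigma>) \<odot>\<^bsub>sym_stalk k n q\<^esub>
    spr k n q (\<lambda>i\<in>{..<k}. bundle_class k n q (hform N \<alpha> (i + \<sigma> i))))"

definition hsec where
  "hsec k n N \<alpha> q = tpr k n (- int N) q (hankel k n N \<alpha> q) (Fract 1 (ell k \<alpha> ^ N))"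

text \<open>The sign comes from exchanging \<open>t l - \<alpha>\<close> and
  \<open>\<alpha> - t l\<close> in the \<open>N\<close>-th power of each of the \<open>k\<close>
  factors.\<close>

definition hval :: "nat \<Rightarrow> nat \<Rightarrow> (nat \<Rightarrow> 'a::field) \<Rightarrow> (nat \<Rightarrow> 'a) \<Rightarrow> 'a" where
  "hval k N t c = (-1) ^ (k * N) * (\<Prod>l<k. c l) * det (vander k t) ^ 2"

lemma (in chart) hform_degree:
  assumes nk: "n + 2 = N + 2 * k" and "\<sigma> permutes {..<k}" "i < k"
  shows "degree (hform N \<alpha> (i + \<sigma> i)) \<le> n"
proof -
  have "\<sigma> i < k" using permutes_in_image[OF assms(2), of i] assms(3) by simp
  then have "N + (i + \<sigma> i) \<le> n" using nk assms(3) by linarith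
  then show ?thesis using degree_hform[of N \<alpha> "i + \<sigma> i"] by linarith
qed

lemma (in chart) hsec_section:
  assumes nk: "n + 2 = N + 2 * k" and Vo: "V \<in> proj_opens k"
  shows "(\<lambda>q\<in>V. hsec k n N \<alpha> q) \<in> sections (tensh k n (- int N)) V"
proof -
  have fin: "finite {\<sigma>. \<sigma> permutes {..<k}}" by (rule finite_permutations) simp
  have e: "(\<lambda>q\<in>V. hankel k n N \<alpha> q) \<in> sections (symsh k n) V"
    unfolding hankel_def
  proof (rule sym_section[OF Vo fin])
    show "const_fract (signof \<sigma>) \<in> OV 0" for \<sigma> by (rule denominators.fracs_const[OF D])
    show "degree (hform N \<alpha> (i + \<sigma> i)) \<le> n" if "\<sigma> \<in> {\<sigma>. \<sigma> permutes {..<k}}" "i < k" for \<sigma> i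
      using that by (intro hform_degree[OF nk]) simp_all
    show "coeff (hform N \<alpha> (i + \<sigma> i)) j \<in> OV 0" for \<sigma> i j
      by (rule denominators.const_coeffs_fracs[OF D hform_const_coeffs])
  qed
  have l: "(\<lambda>q\<in>V. Fract 1 (ell k \<alpha> ^ N)) \<in> sections (twist k (- int N)) V"
    by (rule twist_section[OF Vo line_powers(1)])
  have "(\<lambda>q\<in>V. hsec k n N \<alpha> q) =
      (\<lambda>q\<in>V. tpr k n (- int N) q ((\<lambda>q\<in>V. hankel k n N \<alpha> q) q) ((\<lambda>q\<in>V. Fract 1 (ell k \<alpha> ^ N)) q))"
    by (rule restrict_ext) (simp add: hsec_def)
  then show ?thesis using tensor_section[OF Vo e l] by simp
qed

text \<open>The entries become power sums with weights \<open>c l * (t l - \<alpha>) ^ N\<close>.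
  The product of the \<open>t l - \<alpha>\<close> is, up to sign, the value of the form at
  \<alpha>, so its \<open>N\<close>-th power cancels the denominator and \<alpha>
  disappears.\<close>

lemma (in chart) tev_hsec:
  assumes nk: "n + 2 = N + 2 * k" and gV: "pt k (root_form k t) \<in> V"
  shows "tev k n (- int N) (root_form k t) (functional_value n (root_form k t) (root_functional k t c))
    (hsec k n N \<alpha> (pt k (root_form k t))) = hval k N t c"
proof -
  let ?g = "root_form k t" and ?\<phi> = "root_functional k t c"
  let ?p = "pt k ?g" and ?d = "- int N"
  let ?hT = "tev k n ?d ?g (functional_value n ?g ?\<phi>)"
  from tev_props[OF kn root_form_nonzero[of k t] root_form_apolar[of k n t c], of ?d] obtain hE hS
    where hS: "semilinear (ring_st k ?p) (fev ?g) (sym_stalk k n ?p) hS"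
      and hE: "\<forall>q\<in>carrier (form_stalk k n ?p). hE (bundle_class k n ?p q) = functional_value n ?g ?\<phi> q"
      and sp: "\<forall>x\<in>tuples k (bundle_stalk k n ?p). hS (spr k n ?p x) = (\<Prod>i<k. hE (x i))"
      and tp: "\<forall>a\<in>carrier (sym_stalk k n ?p). \<forall>b\<in>carrier (line_stalk k ?d ?p). ?hT (tpr k n ?d ?p a b) = hS a * fev ?g b"
    by (elim exE conjE) (rule that)
  let ?P = "{\<sigma>. \<sigma> permutes {..<k}}"
  have fin: "finite ?P" by (rule finite_permutations) simp
  have hc: "hform N \<alpha> (i + \<sigma> i) \<in> carrier (form_stalk k n ?p)" if "\<sigma> permutes {..<k}" "i < k" for \<sigma> i
    using hform_degree[OF nk that] denominators.const_coeffs_fracs[OF proj_point.D[OF point[OF gV]] hform_const_coeffs]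
    by (simp add: frac_poly_module_def)
  have tup: "(\<lambda>i\<in>{..<k}. bundle_class k n ?p (hform N \<alpha> (i + \<sigma> i))) \<in> tuples k (bundle_stalk k n ?p)"
    if "\<sigma> permutes {..<k}" for \<sigma>
    using module_quotient.quotient_cl[OF proj_point.E[OF point[OF gV]] hc[OF that]] by (auto simp: tuples_def)
  note spc = sym_power.sp_closed[OF proj_point.S[OF point[OF gV]] tup]
  have sg: "const_fract (signof \<sigma>) \<in> carrier (ring_st k ?p)" for \<sigma> :: "nat \<Rightarrow> nat"
    by (rule OV_ring[OF denominators.fracs_const[OF D] gV])
  interpret S: Module.module "ring_st k ?p" "sym_stalk k n ?p" by (rule S_module[OF gV])
  have terms: "(\<lambda>\<sigma>. const_fract (signof \<sigma>) \<odot>\<^bsub>sym_stalk k n ?p\<^esub>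
      spr k n ?p (\<lambda>i\<in>{..<k}. bundle_class k n ?p (hform N \<alpha> (i + \<sigma> i)))) \<in> ?P \<rightarrow> carrier (sym_stalk k n ?p)"
    using S.smult_closed[OF sg spc] by simp
  have hank_c: "hankel k n N \<alpha> ?p \<in> carrier (sym_stalk k n ?p)"
    unfolding hankel_def by (rule S.finsum_closed[OF terms])
  have ell: "meval ?g (ell k \<alpha>) \<noteq> 0"
    using ell_V[OF gV] homogeneous_in_pt[OF ell_homogeneous, of k \<alpha> ?g] by simp
  have u: "Fract 1 (ell k \<alpha> ^ N) \<in> carrier (line_stalk k ?d ?p)"
    using OV_point[OF line_powers(1) gV] by (simp add: frac_module_def)
  have "fev ?g (Fract 1 (ell k \<alpha> ^ N)) = 1 / meval ?g (ell k \<alpha>) ^ N"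
    using ell by (subst fev_Fract) (simp_all add: meval_power)
  then have 1: "?hT (hsec k n N \<alpha> ?p) = hS (hankel k n N \<alpha> ?p) / meval ?g (ell k \<alpha>) ^ N"
    unfolding hsec_def using bspec[OF bspec[OF tp hank_c] u] by simp
  let ?w = "\<lambda>l. c l * (t l - \<alpha>) ^ N"
  have term_val: "hS (const_fract (signof \<sigma>) \<odot>\<^bsub>sym_stalk k n ?p\<^esub>
      spr k n ?p (\<lambda>i\<in>{..<k}. bundle_class k n ?p (hform N \<alpha> (i + \<sigma> i)))) =
      signof \<sigma> * (\<Prod>i<k. \<Sum>l<k. ?w l * t l ^ (i + \<sigma> i))" if \<sigma>: "\<sigma> permutes {..<k}" for \<sigma>
  proof -
    have "hS (spr k n ?p (\<lambda>i\<in>{..<k}. bundle_class k n ?p (hform N \<alpha> (i + \<sigma> i)))) =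
        (\<Prod>i<k. hE ((\<lambda>i\<in>{..<k}. bundle_class k n ?p (hform N \<alpha> (i + \<sigma> i))) i))"
      by (rule bspec[OF sp tup[OF \<sigma>]])
    also have "\<dots> = (\<Prod>i<k. \<Sum>l<k. ?w l * t l ^ (i + \<sigma> i))"
    proof (rule prod.cong[OF refl])
      fix i assume "i \<in> {..<k}"
      then have i: "i < k" by simp
      have "hE ((\<lambda>i\<in>{..<k}. bundle_class k n ?p (hform N \<alpha> (i + \<sigma> i))) i) =
          functional_value n ?g ?\<phi> (hform N \<alpha> (i + \<sigma> i))"
        using bspec[OF hE hc[OF \<sigma> i]] i by simp
      also have "\<dots> = (\<Sum>l<k. ?w l * t l ^ (i + \<sigma> i))"
        unfolding functional_value_root[OF hform_const_coeffs hform_degree[OF nk \<sigma> i]] poly_hform fev_const_fract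
        by (simp add: mult.assoc)
      finally show "hE ((\<lambda>i\<in>{..<k}. bundle_class k n ?p (hform N \<alpha> (i + \<sigma> i))) i) =
          (\<Sum>l<k. ?w l * t l ^ (i + \<sigma> i))" .
    qed
    finally show ?thesis unfolding semilinear_smult[OF hS sg spc[OF \<sigma>]] by simp
  qed
  have "hS (hankel k n N \<alpha> ?p) = (\<Sum>\<sigma>\<in>?P. hS (const_fract (signof \<sigma>) \<odot>\<^bsub>sym_stalk k n ?p\<^esub>
      spr k n ?p (\<lambda>i\<in>{..<k}. bundle_class k n ?p (hform N \<alpha> (i + \<sigma> i)))))"
    unfolding hankel_def by (rule semilinear_finsum[OF hS S.abelian_group_axioms fin terms])
  also have "\<dots> = (\<Sum>\<sigma>\<in>?P. signof \<sigma> * (\<Prod>i<k. \<Sum>l<k. ?w l * t l ^ (i + \<sigma> i)))"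
    by (rule sum.cong[OF refl]) (simp only: mem_Collect_eq term_val)
  also have "\<dots> = (\<Prod>l<k. ?w l) * det (vander k t) ^ 2" by (rule hankel_leibniz)
  finally have 2: "hS (hankel k n N \<alpha> ?p) = (\<Prod>l<k. ?w l) * det (vander k t) ^ 2" .
  have 3: "(\<Prod>l<k. ?w l) = (\<Prod>l<k. c l) * ((-1) ^ (k * N) * meval ?g (ell k \<alpha>) ^ N)"
  proof -
    have "(\<Prod>l<k. t l - \<alpha>) = (\<Prod>l<k. (-1) * (\<alpha> - t l))" by (intro prod.cong) auto
    also have "\<dots> = (-1) ^ k * (\<Prod>l<k. \<alpha> - t l)" by (simp only: prod.distrib prod_constant card_lessThan)
    finally have "(\<Prod>l<k. t l - \<alpha>) ^ N = (-1) ^ (k * N) * meval ?g (ell k \<alpha>) ^ N"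
      unfolding meval_root_form_ell by (simp add: power_mult_distrib power_mult)
    then show ?thesis by (simp add: prod.distrib prod_power_distrib)
  qed
  show ?thesis unfolding 1 2 3 hval_def using ell by simp
qed

section \<open>Gluing the Hankel determinants\<close>

text \<open>At every form with distinct roots near \<open>p\<close> both determinants have the value
  \<open>hval\<close>, in which the parameter does not occur, and a normal form is determined by
  these values.\<close>

lemma hsec_independent:
  fixes p :: "'a::alg_closed_field mpoly set"
  assumes kn: "k \<ge> 1" "N \<ge> 1" "n + 2 = N + 2 * k" and p: "p \<in> proj_points k"
    and \<alpha>: "ell k \<alpha> \<notin> p" and \<beta>: "ell k \<beta> \<notin> p"
  shows "hsec k n N \<alpha> p = hsec k n N \<beta> p"
proof -
  have kn': "k \<le> n" using kn by linarith
  have sec: "(\<lambda>q\<in>basic k (ell k \<gamma>). hsec k n N \<gamma> q) \<in> sections (tensh k n (- int N)) (basic k (ell k \<gamma>))"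
    and chart: "chart k n \<gamma> (basic k (ell k \<gamma>))" and pV: "p \<in> basic k (ell k \<gamma>)"
    if "ell k \<gamma> \<notin> p" for \<gamma>
  proof -
    show pV: "p \<in> basic k (ell k \<gamma>)" using p that by (simp add: basic_def)
    then show chart: "chart k n \<gamma> (basic k (ell k \<gamma>))"
      using kn kn' basic_subset by (intro chart.intro) (auto simp: basic_def)
    show "(\<lambda>q\<in>basic k (ell k \<gamma>). hsec k n N \<gamma> q) \<in> sections (tensh k n (- int N)) (basic k (ell k \<gamma>))"
      by (rule chart.hsec_section[OF chart kn(3) basic_open[OF ell_homogeneous]])
  qed
  let ?s = "\<lambda>\<gamma>. \<lambda>q\<in>basic k (ell k \<gamma>). hsec k n N \<gamma> q"
  \<comment> \<open>The determinants for \<alpha> and for \<beta> are both put into normal form in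
    the one frame at \<alpha>; otherwise \<open>NF_eqI\<close> could not compare them.\<close>
  have nr: "near k p (\<lambda>V. V \<subseteq> basic k (ell k \<gamma>) \<and> locally_NF k n N \<alpha> (?s \<gamma>) V)" if "ell k \<gamma> \<notin> p" for \<gamma>
    by (intro near_conj[OF p] near_subset[OF basic_open[OF ell_homogeneous] pV[OF that]]
        global_sectionsD[OF kn' kn(1) sec[OF that] pV[OF that] p \<alpha>])
  obtain b e where b: "b \<in> homogeneous k e" "b \<notin> p"
    "(\<forall>q\<in>basic k b. ell k \<alpha> \<notin> q) \<and> (basic k b \<subseteq> basic k (ell k \<alpha>) \<and> locally_NF k n N \<alpha> (?s \<alpha>) (basic k b)) \<and>
     (basic k b \<subseteq> basic k (ell k \<beta>) \<and> locally_NF k n N \<alpha> (?s \<beta>) (basic k b))"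
    by (rule near_obtain[OF near_conj[OF p near_ell[OF \<alpha>] near_conj[OF p nr[OF \<alpha>] nr[OF \<beta>]]]])
  have pb: "p \<in> basic k b" using p b(2) by (simp add: basic_def)
  have b\<alpha>: "\<forall>q\<in>basic k b. ell k \<alpha> \<notin> q" and sub: "basic k b \<subseteq> basic k (ell k \<alpha>)" "basic k b \<subseteq> basic k (ell k \<beta>)"
    and loc: "locally_NF k n N \<alpha> (?s \<alpha>) (basic k b)" "locally_NF k n N \<alpha> (?s \<beta>) (basic k b)"
    using b(3) by auto
  obtain h where h: "\<forall>\<pi>\<in>words k. h \<pi> \<in> fracs k (nonvan_on (basic k b)) 0" "\<forall>q\<in>basic k b. ?s \<alpha> q = NF k n N \<alpha> h q"
    using loc(1) unfolding locally_NF_def by (elim exE conjE) (rule that)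
  obtain h' where h': "\<forall>\<pi>\<in>words k. h' \<pi> \<in> fracs k (nonvan_on (basic k b)) 0" "\<forall>q\<in>basic k b. ?s \<beta> q = NF k n N \<alpha> h' q"
    using loc(2) unfolding locally_NF_def by (elim exE conjE) (rule that)
  have val: "NFval k n N \<alpha> h'' (root_form k t) (root_functional k t c) = hval k N t c"
    if \<gamma>: "ell k \<gamma> \<notin> p" "basic k b \<subseteq> basic k (ell k \<gamma>)"
      and h'': "\<forall>\<pi>\<in>words k. h'' \<pi> \<in> fracs k (nonvan_on (basic k b)) 0" "\<forall>q\<in>basic k b. ?s \<gamma> q = NF k n N \<alpha> h'' q"
      and t: "meval (root_form k t) b \<noteq> 0" for \<gamma> h'' t c
  proof -
    have pg: "pt k (root_form k t) \<in> basic k b" by (rule pt_in_basic[OF root_form_nonzero b(1) t])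
    then have pg': "pt k (root_form k t) \<in> basic k (ell k \<gamma>)" using \<gamma>(2) by blast
    have "NFval k n N \<alpha> h'' (root_form k t) (root_functional k t c) = Phi k n N (?s \<gamma>) (root_form k t) (root_functional k t c)"
      by (rule Phi_locally_NF[OF kn' kn(1) basic_subset b\<alpha> pg h'' root_form_nonzero root_form_apolar, symmetric])
    also have "\<dots> = hval k N t c"
      unfolding Phi_def using chart.tev_hsec[OF chart[OF \<gamma>(1)] kn(3) pg', of c] pg' by simp
    finally show ?thesis .
  qed
  interpret chart k n \<alpha> "basic k b" using kn kn' basic_subset[of k b] pb b\<alpha> by (intro chart.intro) auto
  have "NF k n N \<alpha> h p = NF k n N \<alpha> h' p"
  proof (rule NF_eqI[OF b(1) refl bspec[OF h(1)] bspec[OF h'(1)] _ pb])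
    fix t c :: "nat \<Rightarrow> 'a" assume t: "meval (root_form k t) b \<noteq> 0"
    show "NFval k n N \<alpha> h (root_form k t) (root_functional k t c) =
        NFval k n N \<alpha> h' (root_form k t) (root_functional k t c)"
      unfolding val[OF \<alpha> sub(1) h t, of c] val[OF \<beta> sub(2) h' t, of c] by (rule refl)
  qed
  then show ?thesis using bspec[OF h(2) pb] bspec[OF h'(2) pb] subsetD[OF sub(1) pb] subsetD[OF sub(2) pb] by simp
qed

text \<open>The parameter is chosen anew at each point. The germ does not depend on it, and near
  each point one choice can be kept, which makes the family a section.\<close>

definition hankel_section where
  "hankel_section k n N = (\<lambda>p\<in>proj_points k. hsec k n N (SOME \<alpha>. ell k \<alpha> \<notin> p) p)"

lemma hankel_section_eq:
  fixes p :: "'a::alg_closed_field mpoly set"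
  assumes kn: "k \<ge> 1" "N \<ge> 1" "n + 2 = N + 2 * k" and p: "p \<in> proj_points k" and \<alpha>: "ell k \<alpha> \<notin> p"
  shows "hankel_section k n N p = hsec k n N \<alpha> p"
proof -
  have "ell k (SOME \<alpha>. ell k \<alpha> \<notin> p) \<notin> p" by (rule someI[of "\<lambda>\<alpha>. ell k \<alpha> \<notin> p", OF \<alpha>])
  then show ?thesis unfolding hankel_section_def using hsec_independent[OF kn p _ \<alpha>] p by simp
qed

lemma hankel_section_global:
  assumes kn: "k \<ge> 1" "N \<ge> 1" "n + 2 = N + 2 * k"
  shows "(hankel_section k n N :: 'a::alg_closed_field mpoly set \<Rightarrow> _) \<in> sections (tensh k n (- int N)) (proj_points k)"
proof -
  have kn': "k \<le> n" using kn by linarith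
  have local: "\<exists>\<alpha>. p \<in> basic k (ell k \<alpha>) \<and>
      (\<lambda>q\<in>basic k (ell k \<alpha>). hsec k n N \<alpha> q) \<in> sections (tensh k n (- int N)) (basic k (ell k \<alpha>)) \<and>
      (\<forall>q\<in>basic k (ell k \<alpha>). hankel_section k n N q = (\<lambda>q\<in>basic k (ell k \<alpha>). hsec k n N \<alpha> q) q)"
    if p: "p \<in> proj_points k" for p :: "'a mpoly set"
  proof -
    obtain \<alpha> where \<alpha>: "ell k \<alpha> \<notin> p" using ell_avoids[OF p] by (elim exE)
    have pV: "p \<in> basic k (ell k \<alpha>)" using p \<alpha> by (simp add: basic_def)
    then have chart: "chart k n \<alpha> (basic k (ell k \<alpha>))"
      using kn kn' basic_subset by (intro chart.intro) (auto simp: basic_def)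
    have "hankel_section k n N q = (\<lambda>q\<in>basic k (ell k \<alpha>). hsec k n N \<alpha> q) q" if "q \<in> basic k (ell k \<alpha>)" for q
      using hankel_section_eq[OF kn, of q \<alpha>] that by (simp add: basic_def)
    then show ?thesis
      using pV chart.hsec_section[OF chart kn(3) basic_open[OF ell_homogeneous]] by (intro exI[of _ \<alpha>] conjI ballI)
  qed
  have "hankel_section k n N p \<in> carrier (tensor_stalk k n (- int N) p)" if p: "p \<in> proj_points k" for p :: "'a mpoly set"
  proof -
    obtain \<alpha> where \<alpha>: "p \<in> basic k (ell k \<alpha>)"
      "(\<lambda>q\<in>basic k (ell k \<alpha>). hsec k n N \<alpha> q) \<in> sections (tensh k n (- int N)) (basic k (ell k \<alpha>))"
      "\<forall>q\<in>basic k (ell k \<alpha>). hankel_section k n N q = (\<lambda>q\<in>basic k (ell k \<alpha>). hsec k n N \<alpha> q) q"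
      using local[OF p] by (elim exE conjE) (rule that)
    show ?thesis using section_closed[OF kn' \<alpha>(2,1)] bspec[OF \<alpha>(3,1)] by simp
  qed
  then have ext: "(hankel_section k n N :: 'a mpoly set \<Rightarrow> _) \<in> (\<Pi>\<^sub>E p\<in>proj_points k. carrier (tensor_stalk k n (- int N) p))"
    unfolding PiE_iff by (simp add: hankel_section_def)
  show ?thesis
    unfolding tensor_sheaf_def Let_def stalk_eqs stalk_sym[OF kn'] proj_space_simps
  proof (rule sheafify_glue[OF ext])
    fix p :: "'a mpoly set" assume p: "p \<in> proj_points k"
    obtain \<alpha> where \<alpha>: "p \<in> basic k (ell k \<alpha>)"
      "(\<lambda>q\<in>basic k (ell k \<alpha>). hsec k n N \<alpha> q) \<in> sections (tensh k n (- int N)) (basic k (ell k \<alpha>))"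
      "\<forall>q\<in>basic k (ell k \<alpha>). hankel_section k n N q = (\<lambda>q\<in>basic k (ell k \<alpha>). hsec k n N \<alpha> q) q"
      using local[OF p] by (elim exE conjE) (rule that)
    note sec = \<alpha>(2)[unfolded tensor_sheaf_def Let_def stalk_eqs stalk_sym[OF kn'] proj_space_simps]
    show "\<exists>W. p \<in> W \<and> W \<subseteq> proj_points k \<and> (\<exists>\<sigma>\<in>sections (sheafify (proj_opens k) (tensor_stalk k n (- int N))
      (\<lambda>W. {(\<lambda>q. \<Oplus>\<^bsub>tensor_stalk k n (- int N) q\<^esub>j\<in>{..<M}. tpr k n (- int N) q (e j q) (l j q)) | (M::nat) e l.
       \<forall>j<M. e j \<in> sections (symsh k n) W \<and> l j \<in> sections (twist k (- int N)) W})) W. \<forall>q\<in>W. hankel_section k n N q = \<sigma> q)"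
      by (intro exI[of _ "basic k (ell k \<alpha>)"] conjI \<alpha>(1) basic_subset bexI[OF _ sec] \<alpha>(3))
  qed
qed

lemma Phi_hankel_section:
  fixes t c :: "nat \<Rightarrow> 'a::alg_closed_field"
  assumes kn: "k \<ge> 1" "N \<ge> 1" "n + 2 = N + 2 * k"
  shows "Phi k n N (hankel_section k n N) (root_form k t) (root_functional k t c) = hval k N t c"
proof -
  have kn': "k \<le> n" using kn by linarith
  let ?p = "pt k (root_form k t)"
  have p: "?p \<in> proj_points k" by (rule pt_in_proj_points[OF root_form_nonzero])
  obtain \<alpha> where \<alpha>: "ell k \<alpha> \<notin> ?p" using ell_avoids[OF p] by (elim exE)
  have pV: "?p \<in> basic k (ell k \<alpha>)" using p \<alpha> by (simp add: basic_def)
  then have chart: "chart k n \<alpha> (basic k (ell k \<alpha>))"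
    using kn kn' basic_subset by (intro chart.intro) (auto simp: basic_def)
  show ?thesis
    unfolding Phi_def hankel_section_eq[OF kn p \<alpha>] by (rule chart.tev_hsec[OF chart kn(3) pV])
qed

section \<open>The space of global sections\<close>

text \<open>The operations are pointwise, so the identities hold stalk by stalk. Only closure
  concerns \<open>C\<close>, and closure under c s + t supplies everything: zero as (-1) s + s, and
  from it sums and multiples.\<close>

lemma pointwise_vectorspace:
  fixes \<iota> :: "'a::field \<Rightarrow> 'r" and R :: "'p \<Rightarrow> 'r ring" and M :: "'p \<Rightarrow> ('r, 'm) module"
  assumes mod: "\<And>p. p \<in> P \<Longrightarrow> Module.module (R p) (M p)"
    and \<iota>: "\<And>p a. p \<in> P \<Longrightarrow> \<iota> a \<in> carrier (R p)"
      "\<And>p a b. p \<in> P \<Longrightarrow> \<iota> (a + b) = \<iota> a \<oplus>\<^bsub>R p\<^esub> \<iota> b"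
      "\<And>p a b. p \<in> P \<Longrightarrow> \<iota> (a * b) = \<iota> a \<otimes>\<^bsub>R p\<^esub> \<iota> b"
      "\<And>p. p \<in> P \<Longrightarrow> \<iota> 1 = \<one>\<^bsub>R p\<^esub>"
    and C: "C \<subseteq> (\<Pi>\<^sub>E p\<in>P. carrier (M p))" "C \<noteq> {}"
    and lin: "\<And>c s t. s \<in> C \<Longrightarrow> t \<in> C \<Longrightarrow> (\<lambda>p\<in>P. \<iota> c \<odot>\<^bsub>M p\<^esub> s p \<oplus>\<^bsub>M p\<^esub> t p) \<in> C"
  shows "vectorspace (class_ring :: 'a ring)
    \<lparr>carrier = C, monoid.mult = undefined, one = undefined, zero = (\<lambda>p\<in>P. \<zero>\<^bsub>M p\<^esub>),
     add = (\<lambda>s t. \<lambda>p\<in>P. s p \<oplus>\<^bsub>M p\<^esub> t p), smult = (\<lambda>c s. \<lambda>p\<in>P. \<iota> c \<odot>\<^bsub>M p\<^esub> s p)\<rparr>"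
    (is "vectorspace _ ?H")
proof -
  have Cc: "s p \<in> carrier (M p)" if "s \<in> C" "p \<in> P" for s p
    by (rule PiE_mem[OF subsetD[OF C(1) that(1)] that(2)])
  have ext: "(\<lambda>p\<in>P. s p) = s" if "s \<in> C" for s
    using subsetD[OF C(1) that] by (simp add: PiE_iff extensional_restrict)
  have grp: "abelian_group (M p)" if "p \<in> P" for p
    by (rule Module.module.axioms(2)[OF mod[OF that]])
  have sc: "\<iota> c \<odot>\<^bsub>M p\<^esub> s p \<in> carrier (M p)" if "s \<in> C" "p \<in> P" for c s p
    by (rule Module.module.smult_closed[OF mod[OF that(2)] \<iota>(1)[OF that(2)] Cc[OF that]])
  have one: "\<iota> 1 \<odot>\<^bsub>M p\<^esub> s p = s p" if "s \<in> C" "p \<in> P" for s p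
    unfolding \<iota>(4)[OF that(2)] by (rule Module.module.smult_one[OF mod[OF that(2)] Cc[OF that]])
  have \<iota>0: "\<iota> 0 = \<zero>\<^bsub>R p\<^esub>" if "p \<in> P" for p
  proof -
    interpret m: Module.module "R p" "M p" by (rule mod[OF that])
    have "\<iota> 0 \<oplus>\<^bsub>R p\<^esub> \<iota> 0 = \<iota> 0" using \<iota>(2)[OF that, of 0 0] by simp
    then show ?thesis using m.R.add.r_cancel_one[OF \<iota>(1) \<iota>(1)] that by simp
  qed
  have neg: "\<iota> (- 1) \<odot>\<^bsub>M p\<^esub> s p \<oplus>\<^bsub>M p\<^esub> s p = \<zero>\<^bsub>M p\<^esub>" if "s \<in> C" "p \<in> P" for s p
  proof -
    interpret m: Module.module "R p" "M p" by (rule mod[OF that(2)])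
    have "\<iota> (- 1) \<odot>\<^bsub>M p\<^esub> s p \<oplus>\<^bsub>M p\<^esub> \<iota> 1 \<odot>\<^bsub>M p\<^esub> s p = \<zero>\<^bsub>M p\<^esub>"
      unfolding m.smult_l_distr[OF \<iota>(1)[OF that(2)] \<iota>(1)[OF that(2)] Cc[OF that], symmetric]
        \<iota>(2)[OF that(2), symmetric]
      using m.smult_l_null[OF Cc[OF that]] \<iota>0[OF that(2)] by simp
    then show ?thesis unfolding one[OF that] .
  qed
  obtain s0 where s0: "s0 \<in> C" using C(2) by auto
  have zero: "(\<lambda>p\<in>P. \<zero>\<^bsub>M p\<^esub>) \<in> C"
    using lin[OF s0 s0, of "- 1"] neg[OF s0] by (simp cong: restrict_cong)
  have add: "(\<lambda>p\<in>P. s p \<oplus>\<^bsub>M p\<^esub> t p) \<in> C" if "s \<in> C" "t \<in> C" for s t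
    using lin[OF that, of 1] one[OF that(1)] by (simp cong: restrict_cong)
  have smult: "(\<lambda>p\<in>P. \<iota> c \<odot>\<^bsub>M p\<^esub> s p) \<in> C" if "s \<in> C" for c s
    using lin[OF that zero, of c] abelian_monoid.r_zero[OF abelian_group.axioms(1)[OF grp] sc[OF that]]
    by (simp cong: restrict_cong)
  have "abelian_group ?H"
  proof (rule abelian_groupI)
    fix x y z assume "x \<in> carrier ?H" "y \<in> carrier ?H" "z \<in> carrier ?H"
    then have xyz: "x \<in> C" "y \<in> C" "z \<in> C" by simp_all
    show "x \<oplus>\<^bsub>?H\<^esub> y \<oplus>\<^bsub>?H\<^esub> z = x \<oplus>\<^bsub>?H\<^esub> (y \<oplus>\<^bsub>?H\<^esub> z)"
      using abelian_monoid.a_assoc[OF abelian_group.axioms(1)[OF grp] Cc[OF xyz(1)] Cc[OF xyz(2)] Cc[OF xyz(3)]]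
      by (simp cong: restrict_cong)
  next
    fix x y assume "x \<in> carrier ?H" "y \<in> carrier ?H"
    then have xy: "x \<in> C" "y \<in> C" by simp_all
    show "x \<oplus>\<^bsub>?H\<^esub> y \<in> carrier ?H" using add[OF xy] by simp
    show "x \<oplus>\<^bsub>?H\<^esub> y = y \<oplus>\<^bsub>?H\<^esub> x"
      using abelian_monoid.a_comm[OF abelian_group.axioms(1)[OF grp] Cc[OF xy(1)] Cc[OF xy(2)]]
      by (simp cong: restrict_cong)
  next
    fix x assume "x \<in> carrier ?H"
    then have x: "x \<in> C" by simp
    show "\<zero>\<^bsub>?H\<^esub> \<oplus>\<^bsub>?H\<^esub> x = x"
      using abelian_monoid.l_zero[OF abelian_group.axioms(1)[OF grp] Cc[OF x]] ext[OF x]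
      by (simp cong: restrict_cong)
    show "\<exists>y\<in>carrier ?H. y \<oplus>\<^bsub>?H\<^esub> x = \<zero>\<^bsub>?H\<^esub>"
      using smult[OF x, of "- 1"] neg[OF x] by (intro bexI[of _ "\<lambda>p\<in>P. \<iota> (- 1) \<odot>\<^bsub>M p\<^esub> x p"]) (simp_all cong: restrict_cong)
  next
    show "\<zero>\<^bsub>?H\<^esub> \<in> carrier ?H" using zero by simp
  qed
  then have "Module.module (class_ring :: 'a ring) ?H"
  proof (rule moduleI[OF class_cring.cring_axioms])
    fix a b :: 'a and x y assume "x \<in> carrier ?H" "y \<in> carrier ?H"
    then have xy: "x \<in> C" "y \<in> C" by simp_all
    show "a \<odot>\<^bsub>?H\<^esub> (x \<oplus>\<^bsub>?H\<^esub> y) = a \<odot>\<^bsub>?H\<^esub> x \<oplus>\<^bsub>?H\<^esub> a \<odot>\<^bsub>?H\<^esub> y"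
      using Module.module.smult_r_distr[OF mod \<iota>(1) Cc[OF xy(1)] Cc[OF xy(2)]] by (simp cong: restrict_cong)
  next
    fix a b :: 'a and x assume "x \<in> carrier ?H"
    then have x: "x \<in> C" by simp
    show "a \<odot>\<^bsub>?H\<^esub> x \<in> carrier ?H" using smult[OF x] by simp
    show "(a \<oplus>\<^bsub>class_ring\<^esub> b) \<odot>\<^bsub>?H\<^esub> x = a \<odot>\<^bsub>?H\<^esub> x \<oplus>\<^bsub>?H\<^esub> b \<odot>\<^bsub>?H\<^esub> x"
      using Module.module.smult_l_distr[OF mod \<iota>(1) \<iota>(1) Cc[OF x]] by (simp add: \<iota>(2) cong: restrict_cong)
    show "(a \<otimes>\<^bsub>class_ring\<^esub> b) \<odot>\<^bsub>?H\<^esub> x = a \<odot>\<^bsub>?H\<^esub> (b \<odot>\<^bsub>?H\<^esub> x)"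
      using Module.module.smult_assoc1[OF mod \<iota>(1) \<iota>(1) Cc[OF x]] by (simp add: \<iota>(3) cong: restrict_cong)
    show "\<one>\<^bsub>class_ring\<^esub> \<odot>\<^bsub>?H\<^esub> x = x"
      using one[OF x] ext[OF x] by (simp cong: restrict_cong)
  qed
  then show ?thesis by (rule vectorspace.intro) (rule class_field.field_axioms)
qed

text \<open>The empty set spans only zero, so no generating set is smaller than
  \<open>{v}\<close>.\<close>

lemma (in vectorspace) dim_one:
  assumes v: "v \<in> carrier V" "v \<noteq> \<zero>\<^bsub>V\<^esub>" and gen: "\<And>w. w \<in> carrier V \<Longrightarrow> \<exists>c\<in>carrier K. w = c \<odot>\<^bsub>V\<^esub> v"
  shows "fin_dim \<and> dim = 1"
proof -
  have sub: "{v} \<subseteq> carrier V" using v(1) by simp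
  have "carrier V \<subseteq> span {v}"
  proof
    fix w assume "w \<in> carrier V"
    from gen[OF this] obtain c where c: "c \<in> carrier K" "w = c \<odot>\<^bsub>V\<^esub> v" by (elim bexE)
    have "v \<in> span {v}" using in_own_span[OF sub] by simp
    then show "w \<in> span {v}"
      unfolding c(2) by (rule submodule.smult_closed[OF span_is_submodule[OF sub] c(1)])
  qed
  then have g: "gen_set {v}" using span_is_subset2[OF sub] by (rule equalityI[rotated])
  then have "fin_dim" unfolding fin_dim_def using sub by (intro exI[of _ "{v}"]) simp
  moreover have "dim = 1"
    unfolding dim_def
  proof (rule Least_equality)
    show "\<exists>A. finite A \<and> card A = 1 \<and> A \<subseteq> carrier V \<and> gen_set A"
      using g sub by (intro exI[of _ "{v}"]) simp
    fix m assume "\<exists>A. finite A \<and> card A = m \<and> A \<subseteq> carrier V \<and> gen_set A"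
    then obtain A where A: "finite A" "card A = m" "gen_set A" by (elim exE conjE) (rule that)
    have "A \<noteq> {}"
    proof
      assume "A = {}"
      then have "carrier V = {\<zero>\<^bsub>V\<^esub>}" using A(3) span_empty by simp
      then show False using v by simp
    qed
    then show "1 \<le> m" using A(1,2) card_gt_0_iff[of A] by linarith
  qed
  ultimately show ?thesis ..
qed

section \<open>Every global section is a multiple of the Hankel section\<close>

lemma section_extensional:
  assumes "k \<le> n" "s \<in> sections (tensh k n d) W"
  shows "s \<in> (\<Pi>\<^sub>E p\<in>W. carrier (tensor_stalk k n d p))"
  using assms(2) unfolding tensor_sheaf_def Let_def stalk_eqs stalk_sym[OF assms(1)] proj_space_simps
  by (simp add: sheafify_def)

lemma Phi_semilinear:
  fixes s s' :: "'a::alg_closed_field mpoly set \<Rightarrow> _"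
  assumes kn: "k \<le> n" and g: "nonzero_form k g" and ap: "apolar k n g \<phi>"
    and s: "s \<in> sections (tensh k n (- int N)) (proj_points k)"
    and s': "s' \<in> sections (tensh k n (- int N)) (proj_points k)"
  shows "Phi k n N (\<lambda>p\<in>proj_points k. const_fract c \<odot>\<^bsub>tensor_stalk k n (- int N) p\<^esub> s p \<oplus>\<^bsub>tensor_stalk k n (- int N) p\<^esub> s' p) g \<phi> =
    c * Phi k n N s g \<phi> + Phi k n N s' g \<phi>"
    and "Phi k n N (\<lambda>p\<in>proj_points k. \<zero>\<^bsub>tensor_stalk k n (- int N) p\<^esub>) g \<phi> = 0"
proof -
  let ?q = "pt k g"
  let ?T = "tensor_stalk k n (- int N) ?q"
  from tev_props[OF kn g ap, of "- int N"]
  have T: "semilinear (ring_st k ?q) (fev g) ?T (tev k n (- int N) g (functional_value n g \<phi>))"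
    by (elim exE conjE)
  have q: "?q \<in> proj_points k" by (rule pt_in_proj_points[OF g])
  have pp: "proj_point k n ?q" using kn q by (rule proj_point.intro)
  interpret T: Module.module "ring_st k ?q" ?T
    by (rule tensor_product.tensor_is_module[OF proj_point.T[OF pp]])
  have c: "const_fract c \<in> carrier (ring_st k ?q)"
    using denominators.fracs_const[OF proj_point.D[OF pp], of c] by (simp add: frac_ring_def)
  note cl = section_closed[OF kn s q] section_closed[OF kn s' q]
  show "Phi k n N (\<lambda>p\<in>proj_points k. const_fract c \<odot>\<^bsub>tensor_stalk k n (- int N) p\<^esub> s p \<oplus>\<^bsub>tensor_stalk k n (- int N) p\<^esub> s' p) g \<phi> =
    c * Phi k n N s g \<phi> + Phi k n N s' g \<phi>"
    unfolding Phi_def using q semilinear_add[OF T T.smult_closed[OF c cl(1)] cl(2)] semilinear_smult[OF T c cl(1)] by simp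
  show "Phi k n N (\<lambda>p\<in>proj_points k. \<zero>\<^bsub>tensor_stalk k n (- int N) p\<^esub>) g \<phi> = 0"
    unfolding Phi_def using q semilinear_zero[OF T T.abelian_group_axioms] by simp
qed

text \<open>Subtract the multiple of the Hankel section that agrees with \<open>s\<close> at one
  tuple of distinct roots, where the Hankel section is nonzero. The difference vanishes there, hence
  at all forms with distinct roots, hence everywhere.\<close>

lemma section_multiple:
  fixes s :: "'a::alg_closed_field mpoly set \<Rightarrow> _"
  assumes kn: "k \<ge> 1" "N \<ge> 1" "n + 2 = N + 2 * k"
    and s: "s \<in> sections (tensh k n (- int N)) (proj_points k)"
  shows "\<exists>c. s = (\<lambda>p\<in>proj_points k. const_fract c \<odot>\<^bsub>tensor_stalk k n (- int N) p\<^esub> hankel_section k n N p)"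
proof -
  have kn': "k \<le> n" using kn by linarith
  let ?\<Lambda> = "hankel_section k n N :: 'a mpoly set \<Rightarrow> _"
  let ?T = "tensor_stalk k n (- int N)"
  obtain t :: "nat \<Rightarrow> 'a" where t: "inj_on t {..<k}" by (rule exE[OF inj_exists])
  let ?\<phi> = "root_functional k t (\<lambda>_. 1)"
  have L: "?\<Lambda> \<in> sections (tensh k n (- int N)) (proj_points k)" by (rule hankel_section_global[OF kn])
  have nz: "Phi k n N ?\<Lambda> (root_form k t) ?\<phi> \<noteq> 0"
    unfolding Phi_hankel_section[OF kn] hval_def using det_vander_nonzero[OF t] by simp
  define c where "c = Phi k n N s (root_form k t) ?\<phi> / Phi k n N ?\<Lambda> (root_form k t) ?\<phi>"
  let ?s = "\<lambda>p\<in>proj_points k. const_fract (- c) \<odot>\<^bsub>?T p\<^esub> ?\<Lambda> p \<oplus>\<^bsub>?T p\<^esub> s p"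
  have s': "?s \<in> sections (tensh k n (- int N)) (proj_points k)"
    by (rule global_sections_add_smult[OF kn' kn(1) L s])
  have "Phi k n N ?s (root_form k t) ?\<phi> = 0"
    unfolding Phi_semilinear(1)[OF kn' root_form_nonzero root_form_apolar L s] c_def using nz by simp
  then have zero: "Phi k n N ?s (root_form k t') (root_functional k t' c') = 0" if "inj_on t' {..<k}" for t' c'
    by (rule apolar_function.vanishes_everywhere[OF Phi_apolar_function[OF kn s'] t _ that])
  have "s p = const_fract c \<odot>\<^bsub>?T p\<^esub> ?\<Lambda> p" if p: "p \<in> proj_points k" for p
  proof -
    have pp: "proj_point k n p" using kn' p by (rule proj_point.intro)
    interpret T: Module.module "ring_st k p" "?T p"
      by (rule tensor_product.tensor_is_module[OF proj_point.T[OF pp]])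
    have c: "const_fract a \<in> carrier (ring_st k p)" for a :: 'a
      using denominators.fracs_const[OF proj_point.D[OF pp], of a] by (simp add: frac_ring_def)
    note cl = section_closed[OF kn' L p] section_closed[OF kn' s p]
    have "const_fract (- c) \<odot>\<^bsub>?T p\<^esub> ?\<Lambda> p \<oplus>\<^bsub>?T p\<^esub> s p = \<zero>\<^bsub>?T p\<^esub>"
      using section_zero[OF kn' kn(1) s' zero p] p by simp
    moreover have "const_fract (- c) \<odot>\<^bsub>?T p\<^esub> ?\<Lambda> p \<oplus>\<^bsub>?T p\<^esub> const_fract c \<odot>\<^bsub>?T p\<^esub> ?\<Lambda> p = \<zero>\<^bsub>?T p\<^esub>"
    proof -
      have "const_fract (- c) \<oplus>\<^bsub>ring_st k p\<^esub> const_fract c = \<zero>\<^bsub>ring_st k p\<^esub>"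
        by (simp add: frac_ring_def const_fract_minus)
      then show ?thesis using T.smult_l_distr[OF c c cl(1), of "- c" c] T.smult_l_null[OF cl(1)] by simp
    qed
    ultimately have "const_fract (- c) \<odot>\<^bsub>?T p\<^esub> ?\<Lambda> p \<oplus>\<^bsub>?T p\<^esub> s p =
        const_fract (- c) \<odot>\<^bsub>?T p\<^esub> ?\<Lambda> p \<oplus>\<^bsub>?T p\<^esub> const_fract c \<odot>\<^bsub>?T p\<^esub> ?\<Lambda> p" by simp
    then show ?thesis
      using T.smult_closed[OF c cl(1)] cl(2) by simp
  qed
  moreover have "s = (\<lambda>p\<in>proj_points k. s p)"
    using section_extensional[OF kn' s] by (simp add: PiE_iff extensional_restrict)
  ultimately have "s = (\<lambda>p\<in>proj_points k. const_fract c \<odot>\<^bsub>?T p\<^esub> ?\<Lambda> p)"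
    by (metis (no_types, lifting) restrict_ext)
  then show ?thesis by (rule exI)
qed

theorem proposition5p2:
  fixes k n :: nat
  assumes "k \<ge> 1" and "int n \<ge> 2 * int k - 1"
  shows "let H = (H0 (proj_space k) const_fract
               (tensor_sheaf (proj_space k)
                 (sym_sheaf (proj_space k) k (schwarzenberger k (n - k)))
                 (twist k (- int n + 2 * int k - 2))) :: ('a::alg_closed_field, _) module)
         in vectorspace class_ring H \<and> vectorspace.fin_dim class_ring H \<and>
            vectorspace.dim class_ring H = 1"
proof -
  \<comment> \<open>The twist is \<open>- N\<close>; the assumption on \<open>n\<close> says exactly
    that \<open>N \<ge> 1\<close>, so the subtraction is a true one.\<close>
  define N where "N = n + 2 - 2 * k"
  have kn: "k \<ge> 1" "N \<ge> 1" "n + 2 = N + 2 * k" and d: "- int n + 2 * int k - 2 = - int N"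
    using assms unfolding N_def by linarith+
  have kn': "k \<le> n" using kn by linarith
  let ?T = "tensor_stalk k n (- int N) :: 'a mpoly set \<Rightarrow> _"
  let ?C = "sections (tensh k n (- int N)) (proj_points k) :: ('a mpoly set \<Rightarrow> _) set"
  let ?H = "\<lparr>carrier = ?C, monoid.mult = undefined, one = undefined,
     zero = (\<lambda>p\<in>proj_points k. \<zero>\<^bsub>?T p\<^esub>), add = (\<lambda>s t. \<lambda>p\<in>proj_points k. s p \<oplus>\<^bsub>?T p\<^esub> t p),
     smult = (\<lambda>c s. \<lambda>p\<in>proj_points k. const_fract c \<odot>\<^bsub>?T p\<^esub> s p)\<rparr>"
  let ?\<Lambda> = "hankel_section k n N :: 'a mpoly set \<Rightarrow> _"
  have L: "?\<Lambda> \<in> ?C" by (rule hankel_section_global[OF kn])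
  have vs: "vectorspace (class_ring :: 'a ring) ?H"
  proof (rule pointwise_vectorspace)
    fix p :: "'a mpoly set" and a b :: 'a assume p: "p \<in> proj_points k"
    have pp: "proj_point k n p" using kn' p by (rule proj_point.intro)
    show "Module.module (ring_st k p) (?T p)"
      by (rule tensor_product.tensor_is_module[OF proj_point.T[OF pp]])
    show "const_fract a \<in> carrier (ring_st k p)"
      using denominators.fracs_const[OF proj_point.D[OF pp], of a] by (simp add: frac_ring_def)
    show "const_fract (a + b) = const_fract a \<oplus>\<^bsub>ring_st k p\<^esub> const_fract b"
      "const_fract (a * b) = const_fract a \<otimes>\<^bsub>ring_st k p\<^esub> const_fract b"
      "const_fract 1 = \<one>\<^bsub>ring_st k p\<^esub>" by (simp_all add: frac_ring_def const_fract_hom)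
  next
    show "?C \<subseteq> (\<Pi>\<^sub>E p\<in>proj_points k. carrier (?T p))" by (rule subsetI) (rule section_extensional[OF kn'])
    show "?C \<noteq> {}" using L by auto
  next
    fix c and s t assume "s \<in> ?C" "t \<in> ?C"
    then show "(\<lambda>p\<in>proj_points k. const_fract c \<odot>\<^bsub>?T p\<^esub> s p \<oplus>\<^bsub>?T p\<^esub> t p) \<in> ?C"
      by (rule global_sections_add_smult[OF kn' kn(1)])
  qed
  obtain t :: "nat \<Rightarrow> 'a" where t: "inj_on t {..<k}" by (rule exE[OF inj_exists])
  have "Phi k n N ?\<Lambda> (root_form k t) (root_functional k t (\<lambda>_. 1)) \<noteq> 0"
    unfolding Phi_hankel_section[OF kn] hval_def using det_vander_nonzero[OF t] by simp
  then have nz: "?\<Lambda> \<noteq> (\<lambda>p\<in>proj_points k. \<zero>\<^bsub>?T p\<^esub>)"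
    using Phi_semilinear(2)[OF kn' root_form_nonzero root_form_apolar L L] by force
  have "vectorspace.fin_dim class_ring ?H \<and> vectorspace.dim class_ring ?H = 1"
  proof (rule vectorspace.dim_one[OF vs])
    show "?\<Lambda> \<in> carrier ?H" using L by simp
    show "?\<Lambda> \<noteq> \<zero>\<^bsub>?H\<^esub>" using nz by simp
    fix s assume "s \<in> carrier ?H"
    then have "s \<in> ?C" by simp
    from section_multiple[OF kn this] show "\<exists>c\<in>carrier class_ring. s = c \<odot>\<^bsub>?H\<^esub> ?\<Lambda>" by simp
  qed
  moreover have "H0 (proj_space k) const_fract (tensh k n (- int N)) = ?H"
    unfolding H0_def Let_def proj_space_simps Union_opens stalk_tensor[OF kn'] by (rule refl)
  ultimately show ?thesis unfolding Let_def d using vs by simp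
qed

end
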